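(* Let $\alpha,\beta\in\mathbb{C}$ and consider the differential equation $$\textrm{P}_{\textrm{III}}^{(\textrm{i})}:\qquad \frac{d^{2}u}{dx^{2}}=\frac{1}{u}\left(\frac{du}{dx}\right)^{2}-\frac{1}{x}\frac{du}{dx}+\frac{1}{x}\left(\alpha u^{2}+\beta\right)+u^{3}-\frac{1}{u}.$$ For $m\in\{0,1,2,3\}$ let $a_0^{(m)}=e^{\frac{m\pi i}{2}}$, $A_0^{(m)}=-(a_0^{(m)})^2$, and let $a_{n+1}^{(m)},A_{n+1}^{(m)}$ ($n\ge 0$) be determined by the recurrence relation $$\begin{cases} 2a_{0}^{(m)}A_{0}^{(m)}a_{n+1}^{(m)}=(\beta-1-n)a_{n}^{(m)}-A_{0}^{(m)}\sum\limits_{l=1}^{n}a_{l}^{(m)}a_{n+1-l}^{(m)}-\sum\limits_{k=1}^{n+1}A_k^{(m)}\sum\limits_{l=0}^{n+1-k}a_{l}^{(m)}a_{n+1-k-l}^{(m)},\\ 2a_{0}^{(m)}A_{0}^{(m)}A_{n+1}^{(m)}=\alpha\delta_{n,0}+(n+\beta-2)A_{n}^{(m)}-a_{0}^{(m)}\sum\limits_{l=1}^{n}A_{l}^{(m)}A_{n+1-l}^{(m)}-\sum\limits_{k=1}^{n}a_{k}^{(m)}\sum\limits_{l=0}^{n+1-k}A_{l}^{(m)}A_{n+1-k-l}^{(m)}, \end{cases}$$ where $\delta_{0,0}=1$ and $\delta_{n,0}=0$ for $n>0$. Then for $m\in\{0,1,2,3\}$, $k\in\{0,1\}$ and $x_0\neq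 0$ the following two statements hold. 1. There exists a one-parameter family of solutions of $\textrm{P}_{\textrm{III}}^{(\textrm{i})}$ in the sector $$S^{(m)}_k=\begin{cases}\{x\in\mathbb{C} : |x|>|x_0|,\ -\frac{\pi}{2}+k\pi<\arg x<\frac{\pi}{2}+k\pi\}, & m=0,2,\\ \{x\in\mathbb{C} : |x|>|x_0|,\ k\pi<\arg x<(k+1)\pi\}, & m=1,3,\end{cases}$$ with the asymptotic expansion $$u(x)\sim\sum_{n=0}^{\infty}a_n^{(m)}x^{-n}\qquad\text{as } |x|\to\infty. \qquad ( * )$$ 2. There exists a unique solution of $\textrm{P}_{\textrm{III}}^{(\textrm{i})}$ in the sector $$\Omega^{(m)}_k=\begin{cases}\{x\in\mathbb{C} : |x|>|x_0|,\ -\frac{\pi}{2}+k\pi<\arg x<\frac{3\pi}{2}+k\pi\}, & m=0,2,\\ \{x\in\mathbb{C} : |x|>|x_0|,\ k\pi<\arg x<(k+2)\pi\}, & m=1,3,\end{cases}$$ with the asymptotic expansion $( * )$.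
   Context: All movable singularities of solutions of the Painlevé equations are poles; a solution with the stated expansion is only asserted to be pole-free for large $|x|$, and $x_0$ is a nonzero constant (only the behaviour for large $|x|$ matters). An asymptotic expansion in an open sector is understood to hold as $|x|\to\infty$ in every proper subsector. "One-parameter family" means that the solutions depend on one free parameter (which appears in exponentially small terms and does not affect the expansion). The coefficients $A_n^{(m)}$ are auxiliary. *)

theory Defs
  imports "HOL-Complex_Analysis.Complex_Analysis" "HOL-Library.Landau_Symbols"
begin

text \<open>
  Angles are given by a real interval rather than by \<^const>\<open>Arg\<close>, so that they need not be
  normalised. For \<open>R \<ge> 0\<close> and opening \<open>\<theta>\<^sub>2 - \<theta>\<^sub>1 \<le> 2\<pi>\<close> every point of the sector has exactly one
  argument in the interval, so the subset of the plane loses nothing against the Riemann surface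
  of the logarithm.
\<close>

definition sector :: "real \<Rightarrow> real \<Rightarrow> real \<Rightarrow> complex set" where
  "sector R \<theta>\<^sub>1 \<theta>\<^sub>2 = {rcis r \<theta> | r \<theta>. R < r \<and> \<theta>\<^sub>1 < \<theta> \<and> \<theta> < \<theta>\<^sub>2}"

definition at_infinity_in_sector :: "real \<Rightarrow> real \<Rightarrow> complex filter" where
  "at_infinity_in_sector \<phi>\<^sub>1 \<phi>\<^sub>2 = inf at_infinity (principal (sector 0 \<phi>\<^sub>1 \<phi>\<^sub>2))"

text \<open>The Poincare expansion, required in every proper subsector.\<close>

definition has_asymp_expansion_in_sector ::
    "(complex \<Rightarrow> complex) \<Rightarrow> (nat \<Rightarrow> complex) \<Rightarrow> real \<Rightarrow> real \<Rightarrow> bool" where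
  "has_asymp_expansion_in_sector u a \<theta>\<^sub>1 \<theta>\<^sub>2 \<longleftrightarrow>
     (\<forall>\<phi>\<^sub>1 \<phi>\<^sub>2. \<theta>\<^sub>1 < \<phi>\<^sub>1 \<and> \<phi>\<^sub>1 < \<phi>\<^sub>2 \<and> \<phi>\<^sub>2 < \<theta>\<^sub>2 \<longrightarrow>
       (\<forall>N. (\<lambda>x. u x - (\<Sum>n\<le>N. a n / x ^ n))
              \<in> o[at_infinity_in_sector \<phi>\<^sub>1 \<phi>\<^sub>2](\<lambda>x. 1 / x ^ N)))"

text \<open>
  Solutions are meromorphic functions; \<^const>\<open>nicely_meromorphic_on\<close> normalises the junk values
  at poles and removable singularities, so that a solution is determined as a function on the
  domain. The equation is imposed where both sides make sense, that is, away from the poles and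
  zeros of \<open>u\<close>. The zero function, which would satisfy it vacuously, is excluded.
\<close>

definition painleve3_solution_on ::
    "complex \<Rightarrow> complex \<Rightarrow> complex set \<Rightarrow> (complex \<Rightarrow> complex) \<Rightarrow> bool" where
  "painleve3_solution_on \<alpha> \<beta> D u \<longleftrightarrow>
     u nicely_meromorphic_on D \<and> (\<exists>x\<in>D. u x \<noteq> 0) \<and>
     (\<forall>x\<in>D. \<not> is_pole u x \<and> u x \<noteq> 0 \<longrightarrow>
        deriv (deriv u) x =
          1 / u x * (deriv u x)\<^sup>2 - 1 / x * deriv u x
            + 1 / x * (\<alpha> * (u x)\<^sup>2 + \<beta>) + (u x) ^ 3 - 1 / u x)"

text \<open>
  A family depending on one free complex parameter which enters only through exponentially small
  terms: distinct parameters give distinct functions on the sector and, in every proper subsector,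
  the values for large \<open>\<bar>x\<bar>\<close> depend holomorphically on the parameter and any two members differ
  by an exponentially small quantity. How far out one has to go may depend on the subsector and,
  locally uniformly, on the parameter, because the poles move with the parameter.
\<close>

definition one_parameter_family_in_sector ::
    "(complex \<Rightarrow> complex \<Rightarrow> complex) \<Rightarrow> real \<Rightarrow> real \<Rightarrow> real \<Rightarrow> bool" where
  "one_parameter_family_in_sector U R \<theta>\<^sub>1 \<theta>\<^sub>2 \<longleftrightarrow>
     (\<forall>c c'. c \<noteq> c' \<longrightarrow> (\<exists>x\<in>sector R \<theta>\<^sub>1 \<theta>\<^sub>2. U c x \<noteq> U c' x)) \<and>
     (\<forall>\<phi>\<^sub>1 \<phi>\<^sub>2. \<theta>\<^sub>1 < \<phi>\<^sub>1 \<and> \<phi>\<^sub>1 < \<phi>\<^sub>2 \<and> \<phi>\<^sub>2 < \<theta>\<^sub>2 \<longrightarrow>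
        (\<forall>c\<^sub>0. \<exists>\<delta>>0. \<forall>\<^sub>F x in at_infinity_in_sector \<phi>\<^sub>1 \<phi>\<^sub>2.
            (\<lambda>c. U c x) holomorphic_on ball c\<^sub>0 \<delta>) \<and>
        (\<forall>c c'. \<exists>\<kappa>>0. (\<lambda>x. U c x - U c' x)
            \<in> O[at_infinity_in_sector \<phi>\<^sub>1 \<phi>\<^sub>2](\<lambda>x. of_real (exp (- \<kappa> * norm x)))))"

definition sector_start :: "nat \<Rightarrow> nat \<Rightarrow> real" where
  "sector_start m k = (if m \<in> {0, 2} then - pi / 2 + real k * pi else real k * pi)"

definition S_end :: "nat \<Rightarrow> nat \<Rightarrow> real" where
  "S_end m k = (if m \<in> {0, 2} then pi / 2 + real k * pi else (real k + 1) * pi)"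

definition Omega_end :: "nat \<Rightarrow> nat \<Rightarrow> real" where
  "Omega_end m k = (if m \<in> {0, 2} then 3 * pi / 2 + real k * pi else (real k + 2) * pi)"

end

theory Submission
 imports Defs
begin

text \<open>
  The coefficient \<open>a 0\<close> is a fourth root of unity. Let \<open>z\<close> be the direction of the middle of the sector
  of opening \<open>\<pi>\<close>; then \<open>(a 0)\<^sup>2 = z\<^sup>2\<close>, and writing \<open>u x = a 0 * v (x / z)\<close> turns the equation into one of the
  same kind for \<open>v\<close>, with \<open>v\<close> tending to 1 and with the sectors of arguments \<open>(- \<pi> / 2, \<pi> / 2)\<close>
  and \<open>(- \<pi> / 2, 3 * \<pi> / 2)\<close>. The transfer between the two is \<open>pull_solves\<close> and \<open>log_phase_solves\<close>.

  Far out everything is a perturbation problem for \<open>\<phi> = ln v\<close>, which satisfies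
  \<open>\<phi>'' + \<phi>' / x = 2 * sinh (2 * \<phi>) + O (1 / x)\<close>. The linear part has solutions that behave like
  \<open>exp (2 * x)\<close> and \<open>exp (- 2 * x)\<close>. It factors up to \<open>O (1 / x\<^sup>2)\<close> into two first-order operators, and each
  factor is inverted by an integral that comes in from infinity along a ray on which the corresponding
  exponential grows in the right direction. In the sector of opening \<open>2 * \<pi>\<close> the two rays point to
  different sides, both exponentials are excluded, and the contraction principle gives exactly one small
  \<open>\<phi>\<close> (\<open>small_solution_exists\<close>, \<open>small_solution_unique\<close>). In the sector of opening \<open>\<pi>\<close> the solution
  \<open>exp (- 2 * x)\<close> is small, so an arbitrary multiple \<open>c\<close> of it may be added; the contraction
  principle, now for the difference to the first solution and with the exponential as weight, gives one
  solution for each \<open>c\<close>, depending holomorphically on \<open>c\<close> (\<open>fixed_point_family\<close>).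

  These solutions are defined only for large \<open>x\<close> in subregions of the sectors. That they extend to
  meromorphic functions on the whole sector is the Painleve property. In the variable \<open>t = ln x\<close> every local
  solution extends to the whole plane (\<open>log_solution_extend_entire\<close>): a nonholomorphic energy
  satisfies a linear differential inequality along segments that avoid zeros and poles, so it is bounded
  on bounded sets; a bounded energy bounds the coordinates of a chart in which the equation is
  regular; and in such a chart solutions exist on discs of a radius bounded from below. The sectors have
  opening at most \<open>2 * \<pi>\<close>, so the logarithm brings the solution back to \<open>x\<close>. The identity theorem
  shows that the solutions found in different subregions have the same extension.

  Finally, \<open>u - a 0 = O (1 / x)\<close> in all proper subsectors already implies the complete expansion
  (\<open>expansion_from_leading_term\<close>). The recurrence for \<open>a\<close> and \<open>A\<close> is the formal solution of a
  system for \<open>u\<close> and a Riccati partner; derivatives gain a power of \<open>1 / x\<close> by Cauchy's estimate, and the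
  algebraic part of the system, linearised at the leading terms, is triangular with nonzero diagonal, so each
  passage through the system improves the remainder by one power.
\<close>

section \<open>Fixed points in weighted classes of holomorphic functions\<close>

text \<open>
  The weight is bounded on compact sets, so the convergence is locally uniform.
\<close>

lemma holomorphic_weighted_limit:
 fixes F :: "nat => complex => complex"
 assumes "open G" and hol: "!!n. F n holomorphic_on G"
  and w: "continuous_on G w"
  and bd: "!!n x. x \<in> G ==> norm (F n x - f x) <= (1/2)^n * w x"
 shows "f holomorphic_on G"
proof (rule holomorphic_uniform_sequence[OF \<open>open G\<close> hol])
 fix x assume "x \<in> G"
 then obtain d where d: "d > 0" "cball x d <= G"
  using \<open>open G\<close> open_contains_cball by blast
 have "compact (w ` cball x d)"
  by (intro compact_continuous_image continuous_on_subset[OF w] d) auto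
 then obtain B where B: "!!y. y \<in> cball x d ==> norm (w y) <= B"
  by (meson bounded_iff compact_imp_bounded imageI)
 have "uniform_limit (cball x d) F f sequentially"
 proof (rule uniform_limitI)
  fix e :: real assume "e > 0"
  have "(%n. (1/2::real)^n * (\<bar>B\<bar> + 1)) \<longlonglongrightarrow> 0 * (\<bar>B\<bar> + 1)"
   by (intro tendsto_intros LIMSEQ_realpow_zero) auto
  then have "\<forall>\<^sub>F n in sequentially. (1/2::real)^n * (\<bar>B\<bar> + 1) < e"
   using \<open>e > 0\<close> by (intro order_tendstoD(2)[where y=0]) auto
  then show "\<forall>\<^sub>F n in sequentially. \<forall>y\<in>cball x d. dist (F n y) (f y) < e"
  proof eventually_elim
   case (elim n)
   show ?case
   proof
    fix y assume y: "y \<in> cball x d"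
    have "norm (F n y - f y) <= (1/2)^n * w y" using bd d y by blast
    also have "... <= (1/2)^n * (\<bar>B\<bar> + 1)"
     by (rule mult_left_mono) (use B[OF y] in auto)
    finally show "dist (F n y) (f y) < e" using elim by (simp add: dist_norm)
   qed
  qed
 qed
 then show "\<exists>d>0. cball x d <= G & uniform_limit (cball x d) F f sequentially"
  using d by blast
qed

text \<open>
  The contraction principle with a weight in place of a norm. Iterates from any element of the class
  converge geometrically relative to the weight, so no function space has to be set up; the class must
  be closed under limits at exactly this rate.
\<close>

lemma weighted_contraction_fixed_point:
 fixes M :: "('p => complex) set" and w :: "'p => real"
 assumes ne: "init \<in> M"
  and maps: "!!f. f \<in> M ==> T f \<in> M"
  and diam: "!!f g p. f \<in> M ==> g \<in> M ==> p \<in> P ==> norm (f p - g p) <= w p"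
  and contr: "!!f g d p. f \<in> M ==> g \<in> M ==> 0 <= d ==>
    (!!p. p \<in> P ==> norm (f p - g p) <= d * w p) ==> p \<in> P ==>
    norm (T f p - T g p) <= d / 2 * w p"
  and closed: "!!F f. (!!n. F n \<in> M) ==>
    (!!n p. p \<in> P ==> norm (F n p - f p) <= (1/2)^n * (2 * w p)) ==> f \<in> M"
 shows "\<exists>f\<in>M. \<forall>p\<in>P. T f p = f p"
proof -
 define F where "F n = (T ^^ n) init" for n
 have FM: "F n \<in> M" for n
  by (induction n) (auto simp: F_def ne maps)
 have wp: "0 <= w p" if "p \<in> P" for p
  using diam[OF ne ne that] by simp
 have step: "norm (F (Suc n) p - F n p) <= (1/2)^n * w p" if "p \<in> P" for n p
  using that
 proof (induction n arbitrary: p)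
  case 0 then show ?case using diam[OF FM[of 1] FM[of 0]] by simp
 next
  case (Suc n)
  have "norm (T (F (Suc n)) p - T (F n) p) <= (1/2)^n / 2 * w p"
   by (rule contr[OF FM FM _ Suc.IH Suc.prems]) auto
  then show ?case by (simp add: F_def)
 qed
 have dist: "norm (F (n + m) p - F n p) <= (1/2)^n * (2 * w p) - (1/2)^(n+m) * (2 * w p)"
  if "p \<in> P" for n m p
 proof (induction m)
  case (Suc m)
  have "norm (F (n + Suc m) p - F n p)
    <= norm (F (Suc (n + m)) p - F (n + m) p) + norm (F (n + m) p - F n p)"
   using norm_triangle_ineq[of "F (Suc (n + m)) p - F (n + m) p" "F (n + m) p - F n p"] by simp
  then show ?case using Suc step[OF that, of "n + m"] by simp
 qed auto
 define f where "f p = lim (%n. F n p)" for p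
 have lim: "norm (F n p - f p) <= (1/2)^n * (2 * w p)" if "p \<in> P" for n p
 proof -
  have "Cauchy (%n. F n p)"
  proof (rule metric_CauchyI)
   fix e :: real assume "e > 0"
   have "(%n. (1/2::real)^n * (2 * w p)) \<longlonglongrightarrow> 0 * (2 * w p)"
    by (intro tendsto_intros LIMSEQ_realpow_zero) auto
   then have "\<forall>\<^sub>F n in sequentially. (1/2::real)^n * (2 * w p) < e / 2"
    using \<open>e > 0\<close> by (intro order_tendstoD(2)[where y=0]) auto
   then obtain N where N: "(1/2::real)^N * (2 * w p) < e / 2"
    by (auto simp: eventually_sequentially)
   have *: "dist (F n p) (F N p) < e / 2" if "n >= N" for n
   proof -
    have "norm (F (N + (n - N)) p - F N p) <= (1/2)^N * (2 * w p)"
     using dist[OF \<open>p \<in> P\<close>, of N "n - N"] wp[OF \<open>p \<in> P\<close>]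
     by (smt (verit) divide_nonneg_nonneg mult_nonneg_nonneg zero_le_power)
    then show ?thesis using that N by (simp add: dist_norm)
   qed
   show "\<exists>M. \<forall>m\<ge>M. \<forall>n\<ge>M. dist (F m p) (F n p) < e"
    using * dist_triangle_half_l by (metis dist_commute)
  qed
  then have L: "(%n. F n p) \<longlonglongrightarrow> f p"
   unfolding f_def by (simp add: Cauchy_convergent_iff convergent_LIMSEQ_iff)
  have "(%m. norm (F (m + n) p - F n p)) \<longlonglongrightarrow> norm (f p - F n p)"
   by (intro tendsto_intros LIMSEQ_ignore_initial_segment L)
  moreover have "norm (F (m + n) p - F n p) <= (1/2)^n * (2 * w p)" for m
   using dist[OF that, of n m] wp[OF that]
   by (smt (verit) add.commute divide_nonneg_nonneg mult_nonneg_nonneg zero_le_power)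
  ultimately have "norm (f p - F n p) <= (1/2)^n * (2 * w p)"
   by (intro LIMSEQ_le_const2[where X = "%m. norm (F (m + n) p - F n p)"]) auto
  then show ?thesis by (simp add: norm_minus_commute)
 qed
 have fM: "f \<in> M" by (rule closed[OF FM lim])
 have "T f p = f p" if p: "p \<in> P" for p
 proof -
  have "norm (T f p - f p) <= (1/2)^n * (2 * w p)" for n
  proof -
   have "norm (T (F n) p - T f p) <= ((1/2)^n * 2) / 2 * w p"
    by (rule contr[OF FM fM _ _ p]) (use lim in \<open>auto simp: mult.assoc\<close>)
   moreover have "norm (F (Suc n) p - f p) <= (1/2)^Suc n * (2 * w p)" by (rule lim[OF p])
   moreover have "T (F n) p = F (Suc n) p" by (simp add: F_def)
   ultimately show ?thesis
    using norm_triangle_ineq4[of "T (F n) p - f p" "T (F n) p - T f p"]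
    by (simp add: algebra_simps)
  qed
  moreover have "(%n. (1/2::real)^n * (2 * w p)) \<longlonglongrightarrow> 0 * (2 * w p)"
   by (intro tendsto_intros LIMSEQ_realpow_zero) auto
  ultimately have "norm (T f p - f p) <= 0"
   by (intro LIMSEQ_le_const[where X = "%n. (1/2::real)^n * (2 * w p)"]) auto
  then show ?thesis by simp
 qed
 with fM show ?thesis by blast
qed

section \<open>The regular charts of the equation in logarithmic time\<close>

definition line_primitive :: "complex => (complex => complex) => complex => complex" where
 "line_primitive t0 f t = contour_integral (linepath t0 t) f"

lemma line_primitive:
 assumes f: "f holomorphic_on ball t0 r" and t: "t \<in> ball t0 r"
 shows "(line_primitive t0 f has_field_derivative f t) (at t)"
  and "(!!s. s \<in> ball t0 r ==> norm (f s) <= B) ==> norm (line_primitive t0 f t) <= B * r"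
proof -
 obtain g where g: "!!x. x \<in> ball t0 r ==> (g has_field_derivative f x) (at x within ball t0 r)"
  using holomorphic_convex_primitive'[OF convex_ball open_ball f] by blast
 have eq: "(f has_contour_integral g s - g t0) (linepath t0 s)" if "s \<in> ball t0 r" for s
  using contour_integral_primitive[OF g, of "linepath t0 s"] that
   closed_segment_subset[OF _ that convex_ball, of t0]
  by (simp add: path_image_linepath del: mem_ball) (metis centre_in_ball ball_empty empty_iff linorder_not_le)
 have lp: "g s - g t0 = line_primitive t0 f s" if "s \<in> ball t0 r" for s
  unfolding line_primitive_def using contour_integral_unique[OF eq[OF that]] by simp
 have "((%s. g s - g t0) has_field_derivative f t) (at t)"
  using g[OF t] t at_within_open[OF t open_ball] by (auto intro!: derivative_eq_intros)
 then show "(line_primitive t0 f has_field_derivative f t) (at t)"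
  by (rule has_field_derivative_transform_within_open[OF _ open_ball t lp])
 assume B: "!!s. s \<in> ball t0 r ==> norm (f s) <= B"
 have r0: "0 < r" using t by (auto intro: le_less_trans[OF zero_le_dist])
 have "norm (f t0) <= B" using B r0 by simp
 then have B0: "0 <= B" using norm_ge_zero order_trans by blast
 have "norm (g t - g t0) <= B * norm (t - t0)"
  by (rule has_contour_integral_bound_linepath[OF eq[OF t] B0])
   (use B closed_segment_subset[OF _ t convex_ball, of t0] r0 in auto)
 also have "... <= B * r" using t B0 by (intro mult_left_mono) (auto simp: dist_norm norm_minus_commute)
 finally show "norm (line_primitive t0 f t) <= B * r"
  unfolding line_primitive_def using contour_integral_unique[OF eq[OF t]] by simp
qed

lemma line_primitive_refl [simp]: "line_primitive t0 f t0 = 0"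
 by (simp add: line_primitive_def)

text \<open>
  With \<open>chart_B\<close> this is the equation in \<open>t = ln x\<close> as a polynomial system, so zeros of \<open>y\<close> are
  ordinary points. At such a zero the derivative of \<open>y\<close> is \<open>exp t\<close>; zeros with derivative
  \<open>- exp t\<close> are zeros of this kind for \<open>- y\<close>, and poles are zeros of \<open>1 / y\<close>, so four charts
  suffice.
\<close>

definition chart_y :: "complex => complex => complex => complex => complex" where
 "chart_y be t y B = exp t + B * y^2 + (1 - be) * y"

definition chart_B :: "complex => complex => complex => complex => complex => complex" where
 "chart_B al be t y B = y * (exp (2 * t) - B^2) + al * exp t + (be - 1) * B"

definition chart_solution :: "complex => complex => complex set => (complex => complex) => (complex => complex) => bool" where
 "chart_solution al be D y B \<longleftrightarrow>
   (\<forall>t\<in>D. (y has_field_derivative chart_y be t (y t) (B t)) (at t) &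
      (B has_field_derivative chart_B al be t (y t) (B t)) (at t))"

lemma chart_lipschitz:
 assumes e: "norm (exp (2 * t)) <= E" "norm be <= c"
  and m: "norm y <= m" "norm B <= m" "norm y' <= m" "norm B' <= m"
  and d: "norm (y - y') <= d" "norm (B - B') <= d"
 shows "norm (chart_y be t y B - chart_y be t y' B') <= (3 * m^2 + 1 + c + E) * d"
  and "norm (chart_B al be t y B - chart_B al be t y' B') <= (3 * m^2 + 1 + c + E) * d"
proof -
 have m0: "0 <= m" and d0: "0 <= d" and E0: "0 <= E" and c0: "0 <= c"
  using m d e norm_ge_zero order_trans by blast+
 have b1: "norm (1 - be) <= 1 + c" "norm (be - 1) <= 1 + c"
  using norm_triangle_ineq4[of 1 be] norm_triangle_ineq4[of be 1] e(2) by auto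
 have "chart_y be t y B - chart_y be t y' B' = (B - B') * y^2 + B' * (y + y') * (y - y') + (1 - be) * (y - y')"
  by (simp add: chart_y_def algebra_simps power2_eq_square)
 also have "norm ... <= d * m^2 + m * (m + m) * d + (1 + c) * d"
  by (intro norm_triangle_le add_mono order_trans[OF norm_mult_ineq] mult_mono
    order_trans[OF norm_power_ineq] power_mono m d b1)
   (use m0 d0 c0 in auto)
 also have "... <= (3 * m^2 + 1 + c + E) * d"
  using E0 d0 by (simp add: algebra_simps power2_eq_square)
 finally show "norm (chart_y be t y B - chart_y be t y' B') <= (3 * m^2 + 1 + c + E) * d" .
 have "chart_B al be t y B - chart_B al be t y' B'
   = (y - y') * exp (2 * t) + - ((y - y') * B^2) + - (y' * (B + B') * (B - B')) + (be - 1) * (B - B')"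
  by (simp add: chart_B_def algebra_simps power2_eq_square)
 also have "norm ... <= d * E + d * m^2 + m * (m + m) * d + (1 + c) * d"
  by (intro norm_triangle_le add_mono order_trans[OF norm_mult_ineq] mult_mono
    order_trans[OF norm_power_ineq] power_mono m d b1 e order_trans[OF eq_refl[OF norm_minus_cancel]])
   (use m0 d0 c0 in auto)
 also have "... = (3 * m^2 + 1 + c + E) * d"
  by (simp add: algebra_simps power2_eq_square)
 finally show "norm (chart_B al be t y B - chart_B al be t y' B') <= (3 * m^2 + 1 + c + E) * d" .
qed

lemma chart_bound:
 assumes e: "norm (exp t) <= E" "norm (exp (2 * t)) <= E" "norm be <= c" "norm al <= c"
  and m: "norm y <= m" "norm B <= m"
 shows "norm (chart_y be t y B) <= E + m^3 + (1 + c) * m + m * (E + m^2) + c * E"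
  and "norm (chart_B al be t y B) <= E + m^3 + (1 + c) * m + m * (E + m^2) + c * E"
proof -
 have m0: "0 <= m" and E0: "0 <= E" and c0: "0 <= c"
  using m e norm_ge_zero order_trans by blast+
 have b1: "norm (1 - be) <= 1 + c" "norm (be - 1) <= 1 + c"
  using norm_triangle_ineq4[of 1 be] norm_triangle_ineq4[of be 1] e by auto
 have "norm (chart_y be t y B) <= E + m * m^2 + (1 + c) * m"
  unfolding chart_y_def
  by (intro norm_triangle_le add_mono order_trans[OF norm_mult_ineq] mult_mono
    order_trans[OF norm_power_ineq] power_mono m e b1) (use m0 c0 in auto)
 also have "... <= E + m^3 + (1 + c) * m + m * (E + m^2) + c * E"
  using m0 E0 c0 by (simp add: power3_eq_cube power2_eq_square)
 finally show "norm (chart_y be t y B) <= E + m^3 + (1 + c) * m + m * (E + m^2) + c * E" .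
 have "norm (chart_B al be t y B) <= m * (E + m^2) + c * E + (1 + c) * m"
  unfolding chart_B_def
  by (intro norm_triangle_le add_mono order_trans[OF norm_mult_ineq] mult_mono
    order_trans[OF norm_triangle_ineq4] order_trans[OF norm_power_ineq] power_mono m e b1) (use m0 c0 E0 in auto)
 also have "... <= E + m^3 + (1 + c) * m + m * (E + m^2) + c * E"
  using m0 E0 c0 by simp
 finally show "norm (chart_B al be t y B) <= E + m^3 + (1 + c) * m + m * (E + m^2) + c * E" .
qed

text \<open>
  Picard iteration on a disc. The radius depends only on bounds for the base point and for the initial
  values, and this uniformity is what makes continuation over arbitrary distances possible.
\<close>

lemma chart_solution_exists:
 fixes R M :: real and al be :: complex
 obtains r where "r > 0"
  "!!t0 y0 B0. norm t0 <= R ==> norm y0 <= M ==> norm B0 <= M ==>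
   \<exists>y B. chart_solution al be (ball t0 r) y B & y t0 = y0 & B t0 = B0"
proof -
 define c where "c = norm al + norm be"
 define E where "E = exp (2 * (\<bar>R\<bar> + 1))"
 define m where "m = \<bar>M\<bar> + 1"
 define L where "L = 3 * m^2 + 1 + c + E"
 define Q where "Q = E + m^3 + (1 + c) * m + m * (E + m^2) + c * E"
 have pos: "m > 0" "c >= 0" "E > 0" by (auto simp: m_def c_def E_def)
 then have L: "L > 0" by (auto simp: L_def intro!: add_nonneg_pos)
 have Q: "Q > 0" using pos by (simp add: Q_def add_pos_nonneg)
 define r where "r = min 1 (min (1 / (2 * L)) (1 / Q))"
 have r: "r > 0" "r <= 1" "L * r <= 1/2" "Q * r <= 1"
  using L Q by (auto simp: r_def min_def field_simps)
 have "\<exists>y B. chart_solution al be (ball t0 r) y B & y t0 = y0 & B t0 = B0"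
  if t0: "norm t0 <= R" and y0: "norm y0 <= M" and B0: "norm B0 <= M" for t0 y0 B0
 proof -
  have E: "norm (exp t) <= E" "norm (exp (2 * t)) <= E" if "t \<in> ball t0 r" for t
  proof -
   have "norm t <= norm t0 + dist t0 t" using norm_triangle_ineq2[of t t0] by (simp add: dist_norm norm_minus_commute)
   then have "norm t <= \<bar>R\<bar> + 1" using that r t0 by auto
   then have "Re t <= \<bar>R\<bar> + 1" using complex_Re_le_cmod order_trans by blast
   then show "norm (exp t) <= E" "norm (exp (2 * t)) <= E" by (auto simp: E_def)
  qed
  define Mset where "Mset = {f :: bool \<times> complex => complex.
    (%t. f (True, t)) holomorphic_on ball t0 r & (%t. f (False, t)) holomorphic_on ball t0 r &
    (\<forall>b. \<forall>t\<in>ball t0 r. norm (f (b, t)) <= m)}"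
  define G where "G f b t = (if b then chart_y be t (f (True, t)) (f (False, t))
    else chart_B al be t (f (True, t)) (f (False, t)))" for f :: "bool \<times> complex => complex" and b t
  define T where "T f p = (if fst p then y0 else B0) + line_primitive t0 (G f (fst p)) (snd p)"
   for f and p :: "bool \<times> complex"
  have Ghol: "G f b holomorphic_on ball t0 r" if "f \<in> Mset" for f b
   using that unfolding G_def Mset_def chart_y_def chart_B_def
   by (cases b) (auto intro!: holomorphic_intros)
  have Gb: "norm (G f b t) <= Q" if "f \<in> Mset" "t \<in> ball t0 r" for f b t
   using that chart_bound[OF E[OF that(2)], of be c al "f (True, t)" m "f (False, t)"]
   unfolding G_def Mset_def Q_def by (auto simp: c_def)
  have der: "((%t. T f (b, t)) has_field_derivative G f b t) (at t)" if "f \<in> Mset" "t \<in> ball t0 r" for f b t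
   unfolding T_def by (auto intro!: derivative_eq_intros line_primitive(1)[OF Ghol[OF that(1)] that(2)])
  have "\<exists>f\<in>Mset. \<forall>p\<in>UNIV \<times> ball t0 r. T f p = f p"
  proof (rule weighted_contraction_fixed_point[where M = Mset and init = "%_. 0" and T = T
     and w = "%_. 2 * m" and P = "UNIV \<times> ball t0 r"])
   show "(%_. 0) \<in> Mset" using pos by (auto simp: Mset_def)
  next
   fix f assume f: "f \<in> Mset"
   have "(%t. T f (b, t)) holomorphic_on ball t0 r" for b
    by (rule holomorphic_onI) (use der[OF f] in \<open>auto simp: field_differentiable_def intro: DERIV_subset\<close>)
   moreover have "norm (T f (b, t)) <= m" if "t \<in> ball t0 r" for b t
   proof -
    have "norm (line_primitive t0 (G f b) t) <= Q * r"
     by (rule line_primitive(2)[OF Ghol[OF f] that Gb[OF f]])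
    moreover have "norm (if b then y0 else B0) <= M" using y0 B0 by simp
    moreover have "norm (T f (b, t)) <= norm (if b then y0 else B0) + norm (line_primitive t0 (G f b) t)"
     unfolding T_def fst_conv snd_conv by (rule norm_triangle_ineq)
    ultimately show ?thesis using r(4) unfolding m_def by linarith
   qed
   ultimately show "T f \<in> Mset" by (auto simp: Mset_def)
  next
   fix f g p assume "f \<in> Mset" "g \<in> Mset" "p \<in> (UNIV :: bool set) \<times> ball t0 r"
   then have "norm (f p) <= m" "norm (g p) <= m" by (auto simp: Mset_def)
   then show "norm (f p - g p) <= 2 * m" by (intro norm_triangle_le_diff) auto
  next
   fix f g d p assume f: "f \<in> Mset" and g: "g \<in> Mset" and d: "0 <= d"
    and le: "!!p. p \<in> UNIV \<times> ball t0 r ==> norm (f p - g p) <= d * (2 * m)"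
    and p: "p \<in> (UNIV :: bool set) \<times> ball t0 r"
   obtain b t where bt: "p = (b, t)" "t \<in> ball t0 r" using p by auto
   have Gd: "norm (G f b s - G g b s) <= L * (d * (2 * m))" if s: "s \<in> ball t0 r" for s
    using f g s chart_lipschitz[OF E(2)[OF s], of be c "f (True, s)" m "f (False, s)" "g (True, s)" "g (False, s)" "d * (2 * m)"]
     le[of "(True, s)"] le[of "(False, s)"]
    unfolding G_def Mset_def L_def by (auto simp: c_def)
   have "T f p - T g p = line_primitive t0 (%s. G f b s - G g b s) t"
   proof -
    have "closed_segment t0 t <= ball t0 r"
     using closed_segment_subset[OF _ bt(2) convex_ball, of t0] r(1) by simp
    then have "G h b contour_integrable_on linepath t0 t" if "h \<in> Mset" for h
     by (intro contour_integrable_continuous_linepath holomorphic_on_imp_continuous_on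
       holomorphic_on_subset[OF Ghol[OF that]])
    from this[OF f] this[OF g] show ?thesis by (simp add: T_def bt line_primitive_def contour_integral_diff)
   qed
   also have "norm ... <= L * (d * (2 * m)) * r"
    by (rule line_primitive(2)[OF _ bt(2) Gd]) (auto intro!: holomorphic_intros Ghol f g)
   also have "... = (L * r) * (d * (2 * m))" by simp
   also have "... <= 1/2 * (d * (2 * m))" by (rule mult_right_mono[OF r(3)]) (use d pos in auto)
   finally show "norm (T f p - T g p) <= d / 2 * (2 * m)" by simp
  next
   fix F :: "nat => bool \<times> complex => complex" and f
   assume F: "!!n. F n \<in> Mset"
    and lim: "!!n p. p \<in> UNIV \<times> ball t0 r ==> norm (F n p - f p) <= (1/2)^n * (2 * (2 * m))"
   have "(%t. f (b, t)) holomorphic_on ball t0 r" for b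
    by (rule holomorphic_weighted_limit[where F = "%n t. F n (b, t)" and w = "%_. 2 * (2 * m)"])
     (use F lim in \<open>cases b; auto simp: Mset_def\<close>)+
   moreover have "norm (f (b, t)) <= m" if "t \<in> ball t0 r" for b t
   proof -
    have "norm (f (b, t)) <= m + (1/2)^n * (2 * (2 * m))" for n
    proof -
     have "norm (F n (b, t)) <= m" using F that by (auto simp: Mset_def)
     moreover have "norm (F n (b, t) - f (b, t)) <= (1/2)^n * (2 * (2 * m))" using lim that by auto
     ultimately show ?thesis
      using norm_triangle_ineq2[of "f (b, t)" "F n (b, t)"] by (simp add: norm_minus_commute)
    qed
    moreover have "(%n. m + (1/2::real)^n * (2 * (2 * m))) \<longlonglongrightarrow> m + 0 * (2 * (2 * m))"
     by (intro tendsto_intros LIMSEQ_realpow_zero) auto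
    ultimately show ?thesis
     by (intro LIMSEQ_le_const[where X = "%n. m + (1/2::real)^n * (2 * (2 * m))"]) auto
   qed
   ultimately show "f \<in> Mset" by (auto simp: Mset_def)
  qed
  then obtain f where f: "f \<in> Mset" and fixp: "!!p. p \<in> UNIV \<times> ball t0 r ==> T f p = f p"
   by blast
  have "((%t. f (b, t)) has_field_derivative G f b t) (at t)" if t: "t \<in> ball t0 r" for b t
   by (rule has_field_derivative_transform_within_open[OF der[OF f t] open_ball t]) (use fixp in auto)
  from this[of _ True] this[of _ False]
  have "chart_solution al be (ball t0 r) (%t. f (True, t)) (%t. f (False, t))"
   by (simp add: chart_solution_def G_def)
  moreover have "f (True, t0) = y0" "f (False, t0) = B0"
   using fixp[of "(True, t0)"] fixp[of "(False, t0)"] r by (auto simp: T_def)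
  ultimately show ?thesis by blast
 qed
 then show thesis using that[OF r(1)] by blast
qed

lemma chart_solution_unique:
 assumes s1: "chart_solution al be (ball t0 s) y B" and s2: "chart_solution al be (ball t0 s) y' B'"
  and init: "y t0 = y' t0" "B t0 = B' t0" and "s > 0"
 shows "\<forall>\<^sub>F t in nhds t0. y t = y' t & B t = B' t"
proof -
 define K where "K = cball t0 (s/2)"
 have K: "compact K" "K <= ball t0 s" using \<open>s > 0\<close> by (auto simp: K_def)
 have der: "(y has_field_derivative chart_y be t (y t) (B t)) (at t)"
  "(B has_field_derivative chart_B al be t (y t) (B t)) (at t)"
  "(y' has_field_derivative chart_y be t (y' t) (B' t)) (at t)"
  "(B' has_field_derivative chart_B al be t (y' t) (B' t)) (at t)" if "t \<in> ball t0 s" for t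
  using s1 s2 that by (auto simp: chart_solution_def)
 have cont: "continuous_on K y" "continuous_on K B" "continuous_on K y'" "continuous_on K B'"
  by (rule continuous_at_imp_continuous_on; use der K DERIV_isCont in blast)+
 have "bounded (y ` K \<union> B ` K \<union> y' ` K \<union> B' ` K)"
  using cont K by (auto intro!: compact_imp_bounded compact_continuous_image)
 then obtain m where m0: "!!z. z \<in> y ` K \<union> B ` K \<union> y' ` K \<union> B' ` K ==> norm z <= m"
  unfolding bounded_iff by metis
 have m: "norm (y t) <= m & norm (B t) <= m & norm (y' t) <= m & norm (B' t) <= m" if "t \<in> K" for t
  by (intro conjI m0) (use that in auto)
 have ce: "continuous_on K (%t. exp (2 * t))" by (intro continuous_intros)
 have "bounded ((%t. exp (2 * t)) ` K)"
  using compact_imp_bounded[OF compact_continuous_image[OF ce K(1)]] .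
 then obtain E where E: "!!t. t \<in> K ==> norm (exp (2 * t)) <= E" unfolding bounded_iff by blast
 define L where "L = 3 * m^2 + 1 + norm be + E"
 have "norm (exp (2 * t0)) <= E" using \<open>s > 0\<close> by (intro E) (simp add: K_def)
 then have "0 <= E" using norm_ge_zero order_trans by blast
 then have L: "L > 0" using zero_le_power2[of m] norm_ge_zero[of be] unfolding L_def by linarith
 define r where "r = min (s/2) (1 / (2 * L))"
 have "r <= s/2" by (simp add: r_def)
 then have "cball t0 r <= K" by (auto simp: K_def)
 moreover have "r > 0" "L * r <= 1/2"
  using L \<open>s > 0\<close> by (auto simp: r_def min_def field_simps)
 ultimately have r: "r > 0" "L * r <= 1/2" "cball t0 r <= K" by auto
 define h where "h t = max (norm (y t - y' t)) (norm (B t - B' t))" for t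
 have "continuous_on (cball t0 r) h"
  unfolding h_def by (intro continuous_intros continuous_on_max continuous_on_subset[OF _ r(3)] cont)
 then obtain tm where tm: "tm \<in> cball t0 r" "!!t. t \<in> cball t0 r ==> h t <= h tm"
  using continuous_attains_sup[of "cball t0 r" h] r(1) by auto
 have lip: "norm (chart_y be t (y t) (B t) - chart_y be t (y' t) (B' t)) <= L * h tm"
  "norm (chart_B al be t (y t) (B t) - chart_B al be t (y' t) (B' t)) <= L * h tm"
  if t: "t \<in> cball t0 r" for t
  using chart_lipschitz[OF E, of t be "norm be" "y t" m "B t" "y' t" "B' t" "h tm"] m[of t] r(3) t tm(2)[OF t]
  unfolding L_def h_def by auto
 have seg: "closed_segment t0 t <= cball t0 r" if "t \<in> cball t0 r" for t
  by (rule closed_segment_subset) (use that r(1) in auto)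
 have hm: "h t <= h tm / 2" if t: "t \<in> cball t0 r" for t
 proof -
  have nt: "norm (t - t0) <= r" using t by (simp add: dist_norm norm_minus_commute)
  have h0: "0 <= h tm" by (simp add: h_def le_max_iff_disj)
  have le: "L * h tm * norm (t - t0) <= h tm / 2"
  proof -
   have "L * h tm * norm (t - t0) <= L * h tm * r" using nt L h0 by (intro mult_left_mono) auto
   also have "... = L * r * h tm" by simp
   also have "... <= 1/2 * h tm" by (rule mult_right_mono[OF r(2) h0])
   finally show ?thesis by simp
  qed
  have "norm ((%t. y t - y' t) t - (%t. y t - y' t) t0) <= L * h tm * norm (t - t0)"
  proof (rule field_differentiable_bound[OF convex_cball[of t0 r]])
   fix z assume z: "z \<in> cball t0 r"
   then have "z \<in> ball t0 s" using r(3) K by blast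
   then show "((%t. y t - y' t) has_field_derivative (chart_y be z (y z) (B z) - chart_y be z (y' z) (B' z))) (at z within cball t0 r)"
    by (intro DERIV_subset[OF DERIV_diff[OF der(1) der(3)]]) auto
  qed (use lip t r(1) in auto)
  moreover have "norm ((%t. B t - B' t) t - (%t. B t - B' t) t0) <= L * h tm * norm (t - t0)"
  proof (rule field_differentiable_bound[OF convex_cball[of t0 r]])
   fix z assume z: "z \<in> cball t0 r"
   then have "z \<in> ball t0 s" using r(3) K by blast
   then show "((%t. B t - B' t) has_field_derivative (chart_B al be z (y z) (B z) - chart_B al be z (y' z) (B' z))) (at z within cball t0 r)"
    by (intro DERIV_subset[OF DERIV_diff[OF der(2) der(4)]]) auto
  qed (use lip t r(1) in auto)
  ultimately show ?thesis using init le by (auto simp: h_def)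
 qed
 have "h tm <= 0" using hm[OF tm(1)] by simp
 then have "h t <= 0" if "t \<in> cball t0 r" for t using tm(2)[OF that] by simp
 then have "y t = y' t & B t = B' t" if "t \<in> ball t0 r" for t
  using that by (auto simp: h_def dest!: meta_spec[of _ t])
 then show ?thesis
  using r(1) by (auto simp: eventually_nhds_metric dist_commute intro!: exI[of _ r])
qed

section \<open>Logarithmic solutions and their symmetries\<close>

text \<open>
  The Painleve equation for \<open>U t = u (exp t)\<close>, multiplied by \<open>x\<^sup>2 * U\<close>.
\<close>

definition log_P3 :: "complex => complex => (complex => complex) => complex => bool" where
 "log_P3 al be U t \<longleftrightarrow> U t * deriv (deriv U) t =
   (deriv U t)^2 + exp t * (al * U t ^ 3 + be * U t) + exp (2 * t) * (U t ^ 4 - 1)"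

text \<open>
  A nicely meromorphic function is 0 at its poles, so \<open>U t \<noteq> 0\<close> excludes zeros and poles at once
  and no separate condition on poles is required.
\<close>

definition log_solution :: "complex => complex => complex set => (complex => complex) => bool" where
 "log_solution al be D U \<longleftrightarrow> U nicely_meromorphic_on D & (\<exists>t\<in>D. U t ~= 0) &
   (\<forall>t\<in>D. U t ~= 0 --> log_P3 al be U t)"

lemma nicely_meromorphic_nonzero_ball:
 assumes "U nicely_meromorphic_on D" "open D" "t \<in> D" "U t ~= 0"
 obtains r where "r > 0" "ball t r <= D" "U holomorphic_on ball t r" "!!s. s \<in> ball t r ==> U s ~= 0"
proof -
 have "~ is_pole U t" using is_pole_zero_at_nicely_mero[OF assms(1)] assms by blast
 then have "U analytic_on {t}" using nicely_meromorphic_on_imp_analytic_at assms by blast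
 then obtain e where e: "e > 0" "U holomorphic_on ball t e" by (auto simp: analytic_on_def)
 have "isCont U t" using e by (metis centre_in_ball continuous_on_eq_continuous_at holomorphic_on_imp_continuous_on open_ball)
 then obtain d where d: "d > 0" "!!s. dist t s < d ==> U s ~= 0"
  using continuous_at_avoid[of t U 0] assms(4) by auto
 obtain f where f: "f > 0" "ball t f <= D" using assms open_contains_ball by blast
 show thesis
  by (rule that[of "min e (min d f)"]) (use e d f in \<open>auto intro: holomorphic_on_subset\<close>)
qed

lemma log_P3_cong:
 assumes "\<forall>\<^sub>F s in nhds t. U s = V s"
 shows "log_P3 al be U t \<longleftrightarrow> log_P3 al be V t"
proof -
 have "U t = V t" using assms by (rule eventually_nhds_x_imp_x)
 moreover have "deriv U t = deriv V t" using assms by (rule deriv_cong_ev) simp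
 moreover have "\<forall>\<^sub>F s in nhds t. deriv U s = deriv V s"
  using eventually_eventually[of "%s. U s = V s" t] assms
  by (auto elim!: eventually_mono intro: deriv_cong_ev)
 then have "deriv (deriv U) t = deriv (deriv V) t" by (rule deriv_cong_ev) simp
 ultimately show ?thesis by (simp add: log_P3_def)
qed

lemma second_derivative_eqI:
 assumes "open S" "t \<in> S" "!!s. s \<in> S ==> (f has_field_derivative g s) (at s)"
  "(g has_field_derivative g') (at t)"
 shows "deriv (deriv f) t = g'" "deriv f t = g t"
proof -
 have "\<forall>\<^sub>F s in nhds t. deriv f s = g s"
  using eventually_nhds_in_open[OF assms(1,2)] by eventually_elim (use assms DERIV_imp_deriv in blast)
 then have "deriv (deriv f) t = deriv g t" by (rule deriv_cong_ev) simp
 then show "deriv (deriv f) t = g'" using assms DERIV_imp_deriv by metis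
 show "deriv f t = g t" using assms DERIV_imp_deriv by metis
qed

lemma log_P3_uminus:
 assumes "U holomorphic_on S" "open S" "t \<in> S" "log_P3 al be U t"
 shows "log_P3 (-al) (-be) (%s. - U s) t"
proof -
 have d: "((%s. - U s) has_field_derivative - deriv U s) (at s)" if "s \<in> S" for s
  using holomorphic_derivI[OF assms(1,2) that] by (rule DERIV_minus)
 have d2: "((%s. - deriv U s) has_field_derivative - deriv (deriv U) t) (at t)"
  using holomorphic_derivI[OF holomorphic_deriv[OF assms(1,2)] assms(2,3)] by (rule DERIV_minus)
 show ?thesis
  using assms(4) second_derivative_eqI[OF assms(2,3) d d2] by (simp add: log_P3_def)
qed

text \<open>
  Inversion is a symmetry that exchanges zeros and poles, so that poles need no separate analysis.
\<close>

lemma log_P3_inverse: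
 assumes "U holomorphic_on S" "open S" "t \<in> S" "log_P3 al be U t" "!!s. s \<in> S ==> U s ~= 0"
 shows "log_P3 (-be) (-al) (%s. inverse (U s)) t"
proof -
 have dU: "(U has_field_derivative deriv U s) (at s)" if "s \<in> S" for s
  by (rule holomorphic_derivI[OF assms(1,2) that])
 have dU2: "(deriv U has_field_derivative deriv (deriv U) t) (at t)"
  by (rule holomorphic_derivI[OF holomorphic_deriv[OF assms(1,2)] assms(2,3)])
 have d: "((%s. inverse (U s)) has_field_derivative - deriv U s / U s ^ 2) (at s)" if "s \<in> S" for s
  using dU[OF that] assms(5)[OF that]
  by (auto intro!: derivative_eq_intros simp: field_simps power2_eq_square)
 have nz: "U t ~= 0" using assms by blast
 have d2: "((%s. - deriv U s / U s ^ 2) has_field_derivative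
   (- deriv (deriv U) t * U t + 2 * (deriv U t)^2) / U t ^ 3) (at t)"
  using dU[OF assms(3)] dU2 nz
  by (auto intro!: derivative_eq_intros simp: field_simps power2_eq_square power3_eq_cube)
 define u v w where "u = U t" and "v = deriv U t" and "w = deriv (deriv U) t"
 have eq: "u * w = v^2 + exp t * (al * u ^ 3 + be * u) + exp (2 * t) * (u ^ 4 - 1)"
  using assms(4) by (simp add: log_P3_def u_def v_def w_def)
 have "inverse u * ((- w * u + 2 * v^2) / u^3) = (- (u * w) + 2 * v^2) / u^4"
  using nz by (simp add: u_def field_simps eval_nat_numeral)
 also have "... = (- v / u^2)^2 + exp t * (- be * inverse u ^ 3 + - al * inverse u) + exp (2 * t) * (inverse u ^ 4 - 1)"
  unfolding eq using nz by (simp add: u_def field_simps eval_nat_numeral)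
 finally show ?thesis
  using second_derivative_eqI[OF assms(2,3) d d2] by (simp add: log_P3_def u_def v_def w_def)
qed

lemma log_solution_uminus:
 assumes "log_solution al be D U" "open D"
 shows "log_solution (-al) (-be) D (%t. - U t)"
 using assms unfolding log_solution_def
proof (intro conjI ballI impI)
 fix t assume *: "U nicely_meromorphic_on D & (\<exists>t\<in>D. U t ~= 0) & (\<forall>t\<in>D. U t ~= 0 --> log_P3 al be U t)"
  and t: "t \<in> D" "- U t ~= 0"
 obtain r where "r > 0" "U holomorphic_on ball t r"
  by (rule nicely_meromorphic_nonzero_ball[of U D t]) (use * t assms(2) in auto)
 then show "log_P3 (-al) (-be) (%t. - U t) t"
  using log_P3_uminus[of U "ball t r" t] * t by auto
qed auto

lemma log_solution_inverse:
 assumes "log_solution al be D U" "open D"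
 shows "log_solution (-be) (-al) D (%t. inverse (U t))"
 using assms unfolding log_solution_def
proof (intro conjI ballI impI)
 fix t assume *: "U nicely_meromorphic_on D & (\<exists>t\<in>D. U t ~= 0) & (\<forall>t\<in>D. U t ~= 0 --> log_P3 al be U t)"
  and t: "t \<in> D" "inverse (U t) ~= 0"
 obtain r where "r > 0" "U holomorphic_on ball t r" "!!s. s \<in> ball t r ==> U s ~= 0"
  by (rule nicely_meromorphic_nonzero_ball[of U D t]) (use * t assms(2) in auto)
 then show "log_P3 (-be) (-al) (%t. inverse (U t)) t"
  using log_P3_inverse[of U "ball t r" t] * t by auto
qed (auto intro: nicely_meromorphic_on_inverse)

text \<open>
  Eliminating \<open>B\<close> from the chart gives back the equation of second order.
\<close>

lemma chart_solution_imp_log_solution: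
 assumes c: "chart_solution al be S y B" and S: "open S" "S ~= {}"
 shows "log_solution al be S y"
proof -
 have dy: "(y has_field_derivative chart_y be t (y t) (B t)) (at t)"
  and dB: "(B has_field_derivative chart_B al be t (y t) (B t)) (at t)" if "t \<in> S" for t
  using c that by (auto simp: chart_solution_def)
 have hol: "y holomorphic_on S" using dy S by (auto simp: holomorphic_on_open)
 then have "y nicely_meromorphic_on S"
  using S analytic_on_open analytic_on_imp_nicely_meromorphic_on by blast
 moreover have "\<exists>t\<in>S. y t ~= 0"
 proof (rule ccontr)
  assume "~ ?thesis"
  then have z: "y t = 0" if "t \<in> S" for t using that by blast
  obtain t where t: "t \<in> S" using S by blast
  have "(y has_field_derivative 0) (at t)"
   using has_field_derivative_transform_within_open[OF DERIV_const S(1) t, of 0 y] z by auto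
  then have "exp t = 0" using DERIV_unique[OF dy[OF t]] z[OF t] by (simp add: chart_y_def)
  then show False by simp
 qed
 moreover have "log_P3 al be y t" if t: "t \<in> S" for t
 proof -
  have d2: "((%s. chart_y be s (y s) (B s)) has_field_derivative
    exp t + (chart_B al be t (y t) (B t) * y t ^ 2 + B t * (2 * y t * chart_y be t (y t) (B t)))
     + (1 - be) * chart_y be t (y t) (B t)) (at t)"
   unfolding chart_y_def
   by (rule derivative_eq_intros dy[OF t, unfolded chart_y_def] dB[OF t] refl)+
    (simp add: chart_y_def algebra_simps)
  define u b where "u = y t" and "b = B t"
  have "u * (exp t + (chart_B al be t u b * u ^ 2 + b * (2 * u * chart_y be t u b)) + (1 - be) * chart_y be t u b)
    = (chart_y be t u b)^2 + exp t * (al * u ^ 3 + be * u) + exp (2 * t) * (u ^ 4 - 1)"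
   unfolding chart_y_def chart_B_def exp_double by algebra
  then show ?thesis
   using second_derivative_eqI[OF S(1) t dy d2] by (simp add: log_P3_def u_def b_def)
 qed
 ultimately show ?thesis by (auto simp: log_solution_def)
qed

definition chart_coord :: "complex => complex => complex => complex => complex" where
 "chart_coord be x u v = (v - x - (1 - be) * u) / u^2"

lemma log_P3_imp_chart_solution:
 assumes hol: "y holomorphic_on S" and S: "open S"
  and nz: "!!t. t \<in> S ==> y t ~= 0" and eq: "!!t. t \<in> S ==> log_P3 al be y t"
 shows "chart_solution al be S y (%t. chart_coord be (exp t) (y t) (deriv y t))"
 unfolding chart_solution_def
proof (intro ballI conjI)
 fix t assume t: "t \<in> S"
 have d: "(y has_field_derivative deriv y t) (at t)"
  by (rule holomorphic_derivI[OF hol S t])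
 have d2: "(deriv y has_field_derivative deriv (deriv y) t) (at t)"
  by (rule holomorphic_derivI[OF holomorphic_deriv[OF hol S] S t])
 define u v w where "u = y t" and "v = deriv y t" and "w = deriv (deriv y) t"
 have u: "u ~= 0" using nz t by (simp add: u_def)
 show "(y has_field_derivative chart_y be t (y t) (chart_coord be (exp t) (y t) (deriv y t))) (at t)"
  using d u by (simp add: chart_y_def chart_coord_def u_def)
 have e: "u * w = v^2 + exp t * (al * u ^ 3 + be * u) + exp t ^ 2 * (u ^ 4 - 1)"
  using eq[OF t] by (simp add: log_P3_def u_def v_def w_def exp_double)
 have "((%t. chart_coord be (exp t) (y t) (deriv y t)) has_field_derivative
   ((w - exp t - (1 - be) * v) * u - 2 * v * (v - exp t - (1 - be) * u)) / u^3) (at t)"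
  unfolding chart_coord_def
  by (rule derivative_eq_intros d d2 refl)+
   (use u in \<open>auto simp: u_def v_def w_def field_simps eval_nat_numeral\<close>)
 also have "((w - exp t - (1 - be) * v) * u - 2 * v * (v - exp t - (1 - be) * u))
   = u * w - (exp t + (1 - be) * v) * u - 2 * v * (v - exp t - (1 - be) * u)" by (simp add: algebra_simps)
 also have "... / u^3 = chart_B al be t u (chart_coord be (exp t) u v)"
  unfolding e chart_B_def exp_double using u by (simp add: chart_coord_def field_simps eval_nat_numeral)
 finally show "((%t. chart_coord be (exp t) (y t) (deriv y t)) has_field_derivative
   chart_B al be t (y t) (chart_coord be (exp t) (y t) (deriv y t))) (at t)"
  by (simp add: u_def v_def)
qed

text \<open>
  Chart coordinates bounded at one point give a solution on a disc of controlled radius around this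
  point, and uniqueness in the chart makes it a continuation.
\<close>

lemma log_solution_local_extension:
 fixes R M :: real
 obtains r where "r > 0"
  "!!D U t0. open D ==> log_solution al be D U ==> t0 \<in> D ==> U t0 ~= 0 ==> norm t0 <= R ==>
   norm (U t0) <= M ==> norm (chart_coord be (exp t0) (U t0) (deriv U t0)) <= M ==>
   \<exists>V. log_solution al be (ball t0 r) V & (\<forall>\<^sub>F t in nhds t0. V t = U t)"
proof -
 obtain r where r: "r > 0" and ex: "!!t0 y0 B0. norm t0 <= R ==> norm y0 <= M ==> norm B0 <= M ==>
   \<exists>y B. chart_solution al be (ball t0 r) y B & y t0 = y0 & B t0 = B0"
  using chart_solution_exists by blast
 have "\<exists>V. log_solution al be (ball t0 r) V & (\<forall>\<^sub>F t in nhds t0. V t = U t)"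
  if D: "open D" "log_solution al be D U" "t0 \<in> D" "U t0 ~= 0" "norm t0 <= R" "norm (U t0) <= M"
   "norm (chart_coord be (exp t0) (U t0) (deriv U t0)) <= M" for D U t0
 proof -
  have nm: "U nicely_meromorphic_on D" using D by (simp add: log_solution_def)
  obtain e where e: "e > 0" "ball t0 e <= D" "U holomorphic_on ball t0 e" "!!s. s \<in> ball t0 e ==> U s ~= 0"
   using nicely_meromorphic_nonzero_ball[OF nm D(1,3,4)] by blast
  have "log_P3 al be U t" if "t \<in> ball t0 e" for t
   using D(2) e that by (auto simp: log_solution_def)
  then have c1: "chart_solution al be (ball t0 e) U (%t. chart_coord be (exp t) (U t) (deriv U t))"
   by (intro log_P3_imp_chart_solution e) auto
  obtain y B where c2: "chart_solution al be (ball t0 r) y B" and i: "y t0 = U t0"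
   "B t0 = chart_coord be (exp t0) (U t0) (deriv U t0)" using ex[OF D(5,6,7)] by blast
  have "\<forall>\<^sub>F t in nhds t0. y t = U t & B t = chart_coord be (exp t) (U t) (deriv U t)"
   by (rule chart_solution_unique[where s = "min e r" and al = al and be = be])
    (use c1 c2 i e r in \<open>auto simp: chart_solution_def\<close>)
  moreover have "log_solution al be (ball t0 r) y"
   by (rule chart_solution_imp_log_solution[OF c2]) (use r in auto)
  ultimately show ?thesis by (intro exI[of _ y]) (auto elim: eventually_mono)
 qed
 then show thesis using that[OF r] by blast
qed

section \<open>An energy that is bounded at zeros and poles\<close>

text \<open>
  A weight that is near \<open>- 1\<close> at zeros and near 1 at poles of \<open>u\<close>. It is not holomorphic, but
  only its values along real segments matter.
\<close>

definition blend :: "complex => real" where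
 "blend u = ((norm u)^2 - 1) / ((norm u)^2 + 1)"

text \<open>
  Here \<open>p\<close> is the logarithmic derivative of \<open>u\<close> with respect to \<open>ln x\<close>. Without the last term this is the
  energy of the equation for \<open>ln u\<close>; its rate of change contains \<open>x\<^sup>2 * (u\<^sup>2 + 1 / u\<^sup>2)\<close>, which the energy does
  not control. The last term cancels the large part of it both at zeros and at poles.
\<close>

definition aux_energy :: "complex => complex => complex => complex => complex => complex" where
 "aux_energy al be x u p =
   p^2 - x^2 * (u^2 + 1 / u^2) - 2 * x * (al * u - be / u) + 2 * of_real (blend u) * p"

lemma blend_simps:
 "1 - blend u = 2 / (1 + (norm u)^2)" "1 + blend u = 2 * (norm u)^2 / (1 + (norm u)^2)"
 "\<bar>blend u\<bar> <= 1"
proof -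
 have pos: "0 < 1 + (norm u)^2" by (simp add: add_pos_nonneg)
 show "1 - blend u = 2 / (1 + (norm u)^2)" "1 + blend u = 2 * (norm u)^2 / (1 + (norm u)^2)"
  using pos by (auto simp: blend_def field_simps)
 show "\<bar>blend u\<bar> <= 1" using pos by (auto simp: blend_def field_simps abs_le_iff)
qed

lemma aux_energy_inverse:
 assumes "u ~= 0"
 shows "aux_energy (-be) (-al) x (inverse u) (-p) = aux_energy al be x u p"
proof -
 have "blend (inverse u) = - blend u"
 proof -
  define n where "n = (norm u)^2"
  have n: "0 < n" "(norm (inverse u))^2 = 1 / n"
   using assms by (simp_all add: n_def norm_inverse norm_divide inverse_eq_divide power_divide)
  have "(1 / n - 1) / (1 / n + 1) = - ((n - 1) / (n + 1))"
   using n(1) by (simp add: divide_simps)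
  then show ?thesis unfolding blend_def n(2) n_def[symmetric] by simp
 qed
 then show ?thesis using assms by (simp add: aux_energy_def field_simps)
qed

text \<open>
  Let \<open>q = p * u\<close>. For small \<open>u\<close> the energy times \<open>u\<^sup>2\<close> is, up to \<open>O (u\<^sup>2)\<close>, the product of
  \<open>q - x - (1 - be) * u\<close> and \<open>q + x - (1 + be) * u\<close>. These factors differ by \<open>2 * x + O (u)\<close>, so when the
  product is \<open>O (u\<^sup>2)\<close> one of them is \<open>O (u\<^sup>2)\<close> by itself. Divided by \<open>u\<^sup>2\<close> they are, up to sign, the
  coordinates of the charts for \<open>u\<close> and for \<open>- u\<close>.
\<close>

lemma aux_energy_bounds_chart:
 fixes al be :: complex and X0 X1 K :: real
 assumes "0 < X0"
 obtains M where "!!x u p. X0 <= norm x ==> norm x <= X1 ==> u ~= 0 ==> norm u <= 1 ==>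
   norm (aux_energy al be x u p) <= K ==>
   norm (chart_coord be x u (p * u)) <= M \<or> norm (chart_coord (-be) x (-u) (- (p * u))) <= M"
proof -
 define a b where "a = norm al" and "b = norm be"
 define c where "c = \<bar>K\<bar> + 2 * X1^2 + 2 * \<bar>X1\<bar> * (a + b)"
 define C where "C = \<bar>K\<bar> + X1^2 + 2 * \<bar>X1\<bar> * a + 4 * (c + 2) + 1 + b^2"
 define M where "M = max (2 * C / X0) ((c + 3 + X1 + b) * (4 * b^2 / X0^2))"
 have ab: "0 <= a" "0 <= b" by (auto simp: a_def b_def)
 have c0: "0 <= c" unfolding c_def using ab by auto
 have C0: "0 <= C" unfolding C_def using ab c0 by auto
 have "norm (chart_coord be x u (p * u)) <= M \<or> norm (chart_coord (-be) x (-u) (- (p * u))) <= M"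
  if x: "X0 <= norm x" "norm x <= X1" and u: "u ~= 0" "norm u <= 1"
   and W: "norm (aux_energy al be x u p) <= K" for x u p
 proof -
  define W q g where "W = aux_energy al be x u p" and "q = p * u" and "g = complex_of_real (blend u)"
  have X1: "0 < X1" "\<bar>X1\<bar> = X1" using x assms by auto
  have K: "norm W <= K" "\<bar>K\<bar> = K" using W norm_ge_zero[of W] unfolding W_def by linarith+
  have g: "norm g <= 1" "norm (1 + g) <= 2 * (norm u)^2"
  proof -
   show "norm g <= 1" using blend_simps(3)[of u] by (simp add: g_def)
   have "norm (1 + g) = \<bar>1 + blend u\<bar>" unfolding g_def by (metis norm_of_real of_real_1 of_real_add)
   also have "... = 2 * (norm u)^2 / (1 + (norm u)^2)" unfolding blend_simps by simp
   also have "... <= 2 * (norm u)^2 / 1" by (rule divide_left_mono) (auto simp: add_pos_nonneg)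
   finally show "norm (1 + g) <= 2 * (norm u)^2" by simp
  qed
  have n1: "norm u ^ k <= 1" for k using u by (simp add: power_le_one)
  have q2: "q^2 = u^2 * W + x^2 * (u^4 + 1) + 2 * x * (al * u^3 - be * u) - 2 * g * q * u"
   using u unfolding W_def q_def g_def aux_energy_def by (simp add: field_simps eval_nat_numeral)
  have nq: "norm q <= c + 2"
  proof (rule ccontr)
   assume "~ norm q <= c + 2"
   then have n: "norm q > c + 2" by simp
   have "norm (q^2) <= 1 * K + X1^2 * (1 + 1) + 2 * X1 * (a * 1 + b * 1) + 2 * 1 * norm q * 1"
   proof -
    have "norm (u^2 * W) <= 1 * K"
     unfolding norm_mult norm_power using K n1[of 2] by (intro mult_mono) auto
    moreover have "norm (x^2 * (u^4 + 1)) <= X1^2 * (1 + 1)"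
     unfolding norm_mult norm_power using n1[of 4] x
     by (intro mult_mono power_mono order_trans[OF norm_triangle_ineq]) (auto simp: norm_power)
    moreover have "norm (2 * x * (al * u^3 - be * u)) <= 2 * X1 * (a * 1 + b * 1)"
    proof -
     have "norm (al * u^3) <= a * 1" "norm (be * u) <= b * 1"
      unfolding norm_mult norm_power a_def b_def using n1[of 3] u by (intro mult_left_mono; simp)+
     then have "norm (al * u^3 - be * u) <= a * 1 + b * 1"
      by (intro order_trans[OF norm_triangle_ineq4]) simp
     then show ?thesis unfolding norm_mult[of "2 * x"] using x X1 by (intro mult_mono) auto
    qed
    moreover have "norm (2 * g * q * u) <= 2 * 1 * norm q * 1"
     unfolding norm_mult using g u by (intro mult_mono) auto
    ultimately show ?thesis
     unfolding q2
     by (intro order_trans[OF norm_triangle_ineq4] order_trans[OF norm_triangle_ineq] add_mono)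
   qed
   also have "... = c + 2 * norm q" using K X1 by (simp add: c_def)
   finally have "norm q * norm q <= c + 2 * norm q" by (simp add: power2_eq_square norm_mult)
   moreover have "(c + 2) * norm q < norm q * norm q" using n c0 by (intro mult_strict_right_mono) auto
   moreover have "c * 1 <= c * norm q" using n c0 by (intro mult_left_mono) auto
   ultimately show False by (simp add: algebra_simps)
  qed
  define F1 F2 where "F1 = q - x - (1 - be) * u" and "F2 = q + x - (1 + be) * u"
  have "F1 * F2 = q^2 - 2 * q * u + u^2 - x^2 + 2 * be * x * u - be^2 * u^2"
   by (simp add: F1_def F2_def algebra_simps power2_eq_square)
  also have "... = u^2 * W + x^2 * u^4 + 2 * x * (al * u^3) - 2 * (1 + g) * q * u + u^2 - be^2 * u^2"
   unfolding q2 by (simp add: algebra_simps)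
  finally have FF: "F1 * F2 = ..." .
  have "norm (F1 * F2) <= (norm u)^2 * K + X1^2 * ((norm u)^2 * 1) + 2 * X1 * (a * ((norm u)^2 * 1))
     + 2 * (2 * (norm u)^2) * (c + 2) * 1 + (norm u)^2 + b^2 * (norm u)^2"
  proof -
   have p4: "norm u ^ 4 <= (norm u)^2 * 1" "norm u ^ 3 <= (norm u)^2 * 1"
    using u by (auto intro: power_decreasing)
   have "norm (u^2 * W) <= (norm u)^2 * K" using K by (simp add: norm_mult norm_power mult_left_mono)
   moreover have "norm (x^2 * u^4) <= X1^2 * ((norm u)^2 * 1)"
    unfolding norm_mult norm_power by (intro mult_mono power_mono p4 x) auto
   moreover have "norm (2 * x * (al * u^3)) <= 2 * X1 * (a * ((norm u)^2 * 1))"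
    unfolding norm_mult norm_power a_def using X1 by (intro mult_mono p4 x) auto
   moreover have "norm (2 * (1 + g) * q * u) <= 2 * (2 * (norm u)^2) * (c + 2) * 1"
    unfolding norm_mult using nq g u c0 by (intro mult_mono) auto
   ultimately show ?thesis
    unfolding FF
    by (intro order_trans[OF norm_triangle_ineq4] order_trans[OF norm_triangle_ineq] add_mono)
     (auto simp: norm_mult norm_power b_def)
  qed
  also have "... = (norm u)^2 * (K + X1^2 + 2 * X1 * a + 4 * (c + 2) + 1 + b^2)" by algebra
  also have "K + X1^2 + 2 * X1 * a + 4 * (c + 2) + 1 + b^2 = C" by (simp only: C_def K(2) X1(2))
  finally have P: "norm F1 * norm F2 <= C * (norm u)^2" by (simp add: norm_mult mult.commute)
  have coord: "norm (chart_coord be x u (p * u)) = norm F1 / (norm u)^2"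
   "norm (chart_coord (-be) x (-u) (- (p * u))) = norm F2 / (norm u)^2"
  proof -
   show "norm (chart_coord be x u (p * u)) = norm F1 / (norm u)^2"
    by (simp add: chart_coord_def F1_def q_def norm_divide norm_power)
   have "chart_coord (-be) x (-u) (- (p * u)) = - F2 / u^2"
    by (simp add: chart_coord_def F2_def q_def algebra_simps)
   then show "norm (chart_coord (-be) x (-u) (- (p * u))) = norm F2 / (norm u)^2"
    by (simp add: norm_divide norm_power)
  qed
  have un: "0 < (norm u)^2" using u by simp
  show ?thesis
  proof (cases "b * norm u <= X0 / 2")
   case True
   have "2 * x = (F2 - F1) + 2 * (be * u)" by (simp add: F1_def F2_def algebra_simps)
   then have "norm (2 * x) <= norm (F2 - F1) + norm (2 * (be * u))" by (metis norm_triangle_ineq)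
   moreover have "norm (F2 - F1) <= norm F2 + norm F1" by (rule norm_triangle_ineq4)
   moreover have "norm (2 * (be * u)) = 2 * (b * norm u)" "norm (2 * x) = 2 * norm x"
    by (simp_all add: norm_mult b_def)
   ultimately have "X0 <= norm F1 + norm F2" using True x by linarith
   then consider "norm F1 >= X0 / 2" | "norm F2 >= X0 / 2" by linarith
   then show ?thesis
   proof cases
    case 1
    have "X0 / 2 * norm F2 <= norm F1 * norm F2" using 1 by (rule mult_right_mono) simp
    then have "norm F2 / (norm u)^2 <= 2 * C / X0" using P un assms by (simp add: field_simps)
    then show ?thesis unfolding coord M_def le_max_iff_disj by blast
   next
    case 2
    have "norm F1 * (X0 / 2) <= norm F1 * norm F2" using 2 by (rule mult_left_mono) simp
    then have "norm F1 / (norm u)^2 <= 2 * C / X0" using P un assms by (simp add: field_simps)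
    then show ?thesis unfolding coord M_def le_max_iff_disj by blast
   qed
  next
   case False
   then have bu: "X0 < 2 * (b * norm u)" by simp
   have "norm F1 <= c + 3 + X1 + b"
   proof -
    have "norm F1 <= norm q + norm x + norm ((1 - be) * u)"
     unfolding F1_def by (intro order_trans[OF norm_triangle_ineq4] add_mono order_refl)
    moreover have "norm ((1 - be) * u) <= (1 + b) * 1"
     unfolding norm_mult b_def using norm_triangle_ineq4[of 1 be] u by (intro mult_mono) auto
    ultimately show ?thesis using nq x by simp
   qed
   moreover have "1 / (norm u)^2 <= 4 * b^2 / X0^2"
   proof -
    have "X0^2 <= (2 * (b * norm u))^2" using bu assms by (intro power_mono) auto
    then show ?thesis using un assms by (simp add: field_simps power2_eq_square)
   qed
   ultimately have "norm F1 * (1 / (norm u)^2) <= (c + 3 + X1 + b) * (4 * b^2 / X0^2)"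
    using c0 X1 ab un by (intro mult_mono) auto
   then have "norm F1 / (norm u)^2 <= (c + 3 + X1 + b) * (4 * b^2 / X0^2)" by simp
   then show ?thesis unfolding coord M_def le_max_iff_disj by blast
  qed
 qed
 then show thesis by (rule that)
qed

text \<open>
  The derivative of the energy along a segment with direction \<open>d\<close>, after the equation has been used.
\<close>

definition aux_rate :: "complex => complex => complex => complex => complex => complex => complex" where
 "aux_rate al be d x u p =
   d * (- 2 * x^2 * (u^2 + 1 / u^2) - 2 * x * (al * u - be / u))
   + 2 * of_real (blend u) * d * (x * (al * u + be / u) + x^2 * (u^2 - 1 / u^2))
   + 2 * of_real (4 * (norm u)^2 * Re (d * p) / (1 + (norm u)^2)^2) * p"

text \<open>
  In the rate, \<open>u\<^sup>2\<close> appears with the factor \<open>1 - blend u\<close> and \<open>1 / u\<^sup>2\<close> with the factor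
  \<open>1 + blend u\<close>; these decay like \<open>1 / \<bar>u\<bar>\<^sup>2\<close> and \<open>\<bar>u\<bar>\<^sup>2\<close>, so both products stay bounded. What is left is
  at most linear in \<open>p\<close> or has a bounded coefficient of \<open>p\<^sup>2\<close>, and the energy controls \<open>p\<^sup>2\<close> up to such terms.
\<close>

lemma aux_rate_bound:
 assumes u: "u ~= 0" and x: "norm x <= X1"
 shows "norm (aux_rate al be d x u p) \<le>
   norm d * (48 + 24 * X1^2 + 34 * X1 * (norm al + norm be)) * (1 + norm (aux_energy al be x u p))"
proof -
 define r n m W where "r = norm u" and "n = (norm u)^2" and "m = n / (1 + n)^2" and "W = aux_energy al be x u p"
 define a b where "a = norm al" and "b = norm be"
 define g where "g = complex_of_real (blend u)"
 have r: "r > 0" "n = r^2" "n > 0" using u by (auto simp: r_def n_def)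
 have ab: "0 <= a" "0 <= b" "0 <= X1" using order_trans[OF norm_ge_zero x] by (auto simp: a_def b_def)
 have rn: "2 * r <= 1 + n" using zero_le_power2[of "r - 1"] by (simp add: r power2_eq_square algebra_simps)
 have g1: "norm (1 - g) = 2 / (1 + n)" "norm (1 + g) = 2 * n / (1 + n)" "norm g <= 1"
 proof -
  have "norm (1 - g) = \<bar>1 - blend u\<bar>" "norm (1 + g) = \<bar>1 + blend u\<bar>"
   unfolding g_def by (metis norm_of_real of_real_1 of_real_diff, metis norm_of_real of_real_1 of_real_add)
  then show "norm (1 - g) = 2 / (1 + n)" "norm (1 + g) = 2 * n / (1 + n)"
   unfolding blend_simps using r by (auto simp: n_def)
  show "norm g <= 1" using blend_simps(3)[of u] by (simp add: g_def)
 qed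
 have decomp: "aux_rate al be d x u p =
   d * (x^2 * (- 2 * (u^2 * (1 - g)) - 2 * ((1 + g) / u^2))) +
   d * (x * (- 2 * (al * (u * (1 - g))) + 2 * (be * ((1 + g) / u)))) +
   2 * of_real (4 * m * Re (d * p)) * p"
 proof -
  have "4 * (norm u)^2 * Re (d * p) / (1 + (norm u)^2)^2 = 4 * m * Re (d * p)"
   by (simp add: m_def n_def)
  then show ?thesis
   unfolding aux_rate_def g_def[symmetric] by (simp only: divide_inverse) (simp add: algebra_simps)
 qed
 have t1: "norm (u^2 * (1 - g)) <= 2" "norm ((1 + g) / u^2) <= 2" "norm (u * (1 - g)) <= 1" "norm ((1 + g) / u) <= 1"
 proof -
  have "norm (u^2 * (1 - g)) = n * (2 / (1 + n))" by (simp add: norm_mult norm_power g1 n_def)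
  also have "... <= 2" using r(3) by (simp add: divide_simps)
  finally show "norm (u^2 * (1 - g)) <= 2" .
  have "norm ((1 + g) / u^2) = 2 * n / (1 + n) / n" by (simp add: norm_divide norm_power g1 n_def)
  also have "... <= 2" using r(3) by (simp add: divide_simps)
  finally show "norm ((1 + g) / u^2) <= 2" .
  have "norm (u * (1 - g)) = r * (2 / (1 + n))" by (simp add: norm_mult g1 r_def)
  also have "... <= 1" using r(3) rn by (simp add: divide_simps)
  finally show "norm (u * (1 - g)) <= 1" .
  have "norm ((1 + g) / u) = 2 * n / (1 + n) / r" by (simp add: norm_divide g1 r_def)
  also have "... = 2 * r / (1 + n)" using r(1) unfolding r(2) by (simp add: power2_eq_square)
  also have "... <= 1" using r(3) rn by (simp add: divide_simps)
  finally show "norm ((1 + g) / u) <= 1" .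
 qed
 have s1: "norm (x^2 * (- 2 * (u^2 * (1 - g)) - 2 * ((1 + g) / u^2))) <= X1^2 * 8"
 proof -
  have "norm (- 2 * (u^2 * (1 - g)) - 2 * ((1 + g) / u^2)) <= norm (- 2 * (u^2 * (1 - g))) + norm (2 * ((1 + g) / u^2))"
   by (rule norm_triangle_ineq4)
  also have "... = 2 * norm (u^2 * (1 - g)) + 2 * norm ((1 + g) / u^2)"
   unfolding norm_mult[of "- 2"] norm_mult[of 2] by simp
  finally have "norm (- 2 * (u^2 * (1 - g)) - 2 * ((1 + g) / u^2)) <= 8" using t1 by linarith
  then show ?thesis
   unfolding norm_mult[of "x^2"] norm_power by (intro mult_mono power_mono x) auto
 qed
 have s2: "norm (x * (- 2 * (al * (u * (1 - g))) + 2 * (be * ((1 + g) / u)))) <= X1 * (2 * a + 2 * b)"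
 proof -
  have "norm (al * (u * (1 - g))) <= a * 1" "norm (be * ((1 + g) / u)) <= b * 1"
   unfolding norm_mult[of al] norm_mult[of be] a_def b_def by (intro mult_left_mono t1; simp)+
  then have "norm (- 2 * (al * (u * (1 - g))) + 2 * (be * ((1 + g) / u))) <= 2 * a + 2 * b"
   using norm_triangle_ineq[of "- 2 * (al * (u * (1 - g)))" "2 * (be * ((1 + g) / u))"]
   unfolding norm_mult[of 2] norm_mult[of "- 2"] by simp
  then show ?thesis unfolding norm_mult[of x] using x ab by (intro mult_mono) auto
 qed
 have m: "0 <= m" "m <= 1" "m * (n + 1 / n) <= 1" "m * r <= 1" "m * (1 / r) <= 1"
 proof -
  have n2: "0 < (1 + n)^2" using r(3) by simp
  show "0 <= m" "m <= 1" using r(3) n2 by (auto simp: m_def divide_simps power2_eq_square algebra_simps)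
  show "m * (n + 1 / n) <= 1"
   using r(3) n2 by (simp add: m_def field_simps) (simp add: power2_eq_square algebra_simps)
  have "r * n <= (1 + n) * (1 + n)" using rn r by (intro mult_mono) auto
  then show "m * r <= 1" using n2 by (simp add: m_def field_simps power2_eq_square)
  have "m * (1 / r) = r / (1 + n)^2" using r by (simp add: m_def power2_eq_square)
  also have "r <= (1 + n)^2"
  proof -
   have "r <= 1 + n" using rn r by simp
   also have "... <= (1 + n)^2" using r by (simp add: power2_eq_square algebra_simps)
   finally show ?thesis .
  qed
  then have "r / (1 + n)^2 <= 1" using n2 by simp
  finally show "m * (1 / r) <= 1" by simp
 qed
 have mp: "m * (norm p)^2 <= 2 * norm W + 2 * X1^2 + 4 * X1 * (a + b) + 4"
 proof -
  have p2: "p^2 = W + x^2 * (u^2 + 1 / u^2) + 2 * x * (al * u - be / u) - 2 * g * p"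
   by (simp add: W_def aux_energy_def g_def)
  have "norm (A + B + C - D) <= norm A + norm B + norm C + norm D" for A B C D :: complex
   using norm_triangle_ineq4[of "A + B + C" D] norm_triangle_ineq[of "A + B" C] norm_triangle_ineq[of A B] by linarith
  then have "norm (p^2) <= norm W + norm (x^2 * (u^2 + 1 / u^2)) + norm (2 * x * (al * u - be / u)) + norm (2 * g * p)"
   unfolding p2 .
  moreover have "norm (x^2 * (u^2 + 1 / u^2)) <= X1^2 * (n + 1 / n)"
   unfolding norm_mult norm_power
   by (intro mult_mono power_mono x order_trans[OF norm_triangle_ineq])
    (use r in \<open>auto simp: norm_divide norm_power n_def\<close>)
  moreover have "norm (2 * x * (al * u - be / u)) <= 2 * X1 * (a * r + b * (1 / r))"
   unfolding norm_mult[of "2 * x"]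
   by (intro mult_mono order_trans[OF norm_triangle_ineq4])
    (use x ab r in \<open>auto simp: norm_mult norm_divide a_def b_def r_def\<close>)
  moreover have "norm (2 * g * p) <= 2 * norm p" using g1(3) by (simp add: norm_mult mult_left_le_one_le)
  moreover have "2 * norm p <= (norm p)^2 / 2 + 2"
   using zero_le_power2[of "norm p - 2"] by (simp add: power2_eq_square algebra_simps)
  ultimately have "(norm p)^2 <= 2 * norm W + 2 * X1^2 * (n + 1 / n) + 4 * X1 * (a * r + b * (1 / r)) + 4"
   unfolding norm_power by argo
  then have "m * (norm p)^2 <= m * (2 * norm W + 2 * X1^2 * (n + 1 / n) + 4 * X1 * (a * r + b * (1 / r)) + 4)"
   by (rule mult_left_mono[OF _ m(1)])
  also have "... = 2 * (m * norm W) + 2 * X1^2 * (m * (n + 1 / n)) + 4 * X1 * (a * (m * r) + b * (m * (1 / r))) + 4 * m"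
   by (simp add: algebra_simps)
  also have "... <= 2 * (1 * norm W) + 2 * X1^2 * 1 + 4 * X1 * (a * 1 + b * 1) + 4 * 1"
   using m ab by (intro add_mono mult_left_mono mult_right_mono) auto
  finally show ?thesis by simp
 qed
 have s3: "norm (2 * of_real (4 * m * Re (d * p)) * p) <= norm d * (8 * (m * (norm p)^2))"
 proof -
  have "\<bar>Re (d * p)\<bar> <= norm d * norm p" using abs_Re_le_cmod[of "d * p"] by (simp add: norm_mult)
  then have "8 * m * \<bar>Re (d * p)\<bar> * norm p <= 8 * m * (norm d * norm p) * norm p"
   using m by (intro mult_left_mono mult_right_mono) auto
  moreover have "norm (2 * complex_of_real (4 * m * Re (d * p)) * p) = 8 * m * \<bar>Re (d * p)\<bar> * norm p"
   unfolding norm_mult norm_of_real abs_mult using m(1) by simp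
  ultimately show ?thesis by (simp only: power2_eq_square mult_ac)
 qed
 have "norm (aux_rate al be d x u p) <= norm d * (X1^2 * 8) + norm d * (X1 * (2 * a + 2 * b)) + norm d * (8 * (m * (norm p)^2))"
  unfolding decomp
  by (intro order_trans[OF norm_triangle_ineq] add_mono s3)
   (unfold norm_mult[of d], (intro mult_left_mono s1 s2 norm_ge_zero)+)
 also have "... <= norm d * (X1^2 * 8 + X1 * (2 * a + 2 * b) + 8 * (2 * norm W + 2 * X1^2 + 4 * X1 * (a + b) + 4))"
  using mult_left_mono[OF mp, of "8 * norm d"] by (simp add: algebra_simps)
 also have "... <= norm d * ((48 + 24 * X1^2 + 34 * X1 * (a + b)) * (1 + norm W))"
 proof (rule mult_left_mono)
  have "0 <= (24 * X1^2 + 34 * X1 * (a + b)) * norm W" using ab by auto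
  then show "X1^2 * 8 + X1 * (2 * a + 2 * b) + 8 * (2 * norm W + 2 * X1^2 + 4 * X1 * (a + b) + 4)
    <= (48 + 24 * X1^2 + 34 * X1 * (a + b)) * (1 + norm W)"
   using norm_ge_zero[of W] by (simp add: algebra_simps)
 qed simp
 finally show ?thesis by (simp add: W_def a_def b_def mult.assoc)
qed

text \<open>
  The logarithm of \<open>1 + \<bar>w\<bar>\<^sup>2\<close> is differentiable also where \<open>w\<close> vanishes, which the norm is not.
\<close>

lemma square_gronwall:
 fixes w w' :: "real => complex"
 assumes d: "!!s. s \<in> {0..1} ==> (w has_vector_derivative w' s) (at s)"
  and b: "!!s. s \<in> {0..1} ==> norm (w' s) <= C * (1 + norm (w s))" and "0 <= C"
 shows "1 + (norm (w 1))^2 <= (1 + (norm (w 0))^2) * exp (4 * C)"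
proof -
 define f where "f s = ln (1 + w s \<bullet> w s)" for s
 have pos: "0 < 1 + w s \<bullet> w s" for s by (simp add: add_pos_nonneg)
 have der: "(f has_real_derivative 2 * (w s \<bullet> w' s) / (1 + w s \<bullet> w s)) (at s)" if s: "s \<in> {0..1}" for s
 proof -
  have "((%s. w s \<bullet> w s) has_vector_derivative w s \<bullet> w' s + w' s \<bullet> w s) (at s)"
   by (rule bounded_bilinear.has_vector_derivative[OF bounded_bilinear_inner d[OF s] d[OF s]])
  then have "((%s. w s \<bullet> w s) has_real_derivative 2 * (w s \<bullet> w' s)) (at s)"
   by (simp add: has_real_derivative_iff_has_vector_derivative inner_commute)
  then show ?thesis unfolding f_def using pos[of s]
   by (auto intro!: derivative_eq_intros simp: field_simps)
 qed
 have bd: "2 * (w s \<bullet> w' s) / (1 + w s \<bullet> w s) <= 4 * C" if s: "s \<in> {0..1}" for s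
 proof -
  define z where "z = norm (w s)"
  have "w s \<bullet> w' s <= z * norm (w' s)" unfolding z_def by (rule norm_cauchy_schwarz)
  also have "... <= z * (C * (1 + z))" using b[OF s] by (intro mult_left_mono) (auto simp: z_def)
  also have "... = C * (z + z^2)" by (simp add: algebra_simps power2_eq_square)
  also have "... <= C * (2 * (1 + z^2))"
  proof (rule mult_left_mono[OF _ \<open>0 <= C\<close>])
   have "0 <= (z - 1)^2 + z^2" by simp
   then show "z + z^2 <= 2 * (1 + z^2)" by (simp add: power2_eq_square algebra_simps)
  qed
  finally have "2 * (w s \<bullet> w' s) <= 4 * C * (1 + w s \<bullet> w s)"
   by (simp add: z_def power2_norm_eq_inner algebra_simps)
  then show ?thesis using pos[of s] by (simp add: divide_le_eq)
 qed
 obtain z where z: "0 < z" "z < 1" "f 1 - f 0 = (1 - 0) * (2 * (w z \<bullet> w' z) / (1 + w z \<bullet> w z))"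
 proof -
  have "\<exists>z>0. z < 1 & f 1 - f 0 = (1 - 0) * (2 * (w z \<bullet> w' z) / (1 + w z \<bullet> w z))"
   by (rule MVT2) (use der in auto)
  then show thesis using that by blast
 qed
 have "f 1 <= f 0 + 4 * C" using z bd[of z] by simp
 then have "exp (f 1) <= exp (f 0) * exp (4 * C)" by (simp flip: exp_add)
 then show ?thesis using pos by (simp add: f_def power2_norm_eq_inner)
qed

text \<open>
  The bound depends on the segment only through its length and the size of \<open>exp\<close> on it, and on the
  solution only through its initial energy.
\<close>

lemma aux_energy_growth:
 assumes sol: "log_solution al be D U" and D: "open D"
  and seg: "closed_segment c t <= D" and nz: "!!s. s \<in> closed_segment c t ==> U s ~= 0"
  and X: "!!s. s \<in> closed_segment c t ==> norm (exp s) <= X1"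
 defines "W \<equiv> %s. aux_energy al be (exp s) (U s) (deriv U s / U s)"
 shows "1 + (norm (W t))^2 <= (1 + (norm (W c))^2) *
   exp (4 * (norm (t - c) * (48 + 24 * X1^2 + 34 * X1 * (norm al + norm be))))"
proof -
 define d where "d = t - c"
 define \<gamma> where "\<gamma> s = c + of_real s * d" for s :: real
 have g: "\<gamma> s \<in> closed_segment c t" if "s \<in> {0..1}" for s
  using that unfolding in_segment \<gamma>_def d_def
  by (intro exI[of _ s]) (auto simp: algebra_simps scaleR_conv_of_real)
 have nm: "U nicely_meromorphic_on D" using sol by (simp add: log_solution_def)
 have "norm (exp c) <= X1" by (rule X) simp
 then have X0: "0 <= X1" using norm_ge_zero order_trans by blast
 have main: "((%s. W (\<gamma> s)) has_vector_derivative
   aux_rate al be d (exp (\<gamma> s)) (U (\<gamma> s)) (deriv U (\<gamma> s) / U (\<gamma> s))) (at s)" if s: "s \<in> {0..1}" for s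
 proof -
  have gD: "\<gamma> s \<in> D" "U (\<gamma> s) ~= 0" using g[OF s] seg nz by auto
  obtain r where r: "r > 0" "ball (\<gamma> s) r <= D" "U holomorphic_on ball (\<gamma> s) r"
   by (rule nicely_meromorphic_nonzero_ball[OF nm D gD])
  define u v w x p where "u = U (\<gamma> s)" and "v = deriv U (\<gamma> s)" and "w = deriv (deriv U) (\<gamma> s)"
   and "x = exp (\<gamma> s)" and "p = v / u"
  have u: "u ~= 0" using gD by (simp add: u_def)
  have eq: "u * w = v^2 + x * (al * u ^ 3 + be * u) + x^2 * (u ^ 4 - 1)"
   using sol gD by (auto simp: log_solution_def log_P3_def u_def v_def w_def x_def exp_double)
  have dg: "(\<gamma> has_vector_derivative d) (at s)"
   unfolding \<gamma>_def by (auto intro!: derivative_eq_intros)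
  have dU: "(U has_field_derivative v) (at (\<gamma> s))"
   unfolding v_def by (rule holomorphic_derivI[OF r(3) open_ball]) (use r in simp)
  have dV: "(deriv U has_field_derivative w) (at (\<gamma> s))"
   unfolding w_def by (rule holomorphic_derivI[OF holomorphic_deriv[OF r(3) open_ball] open_ball]) (use r in simp)
  have dP: "((%z. deriv U z / U z) has_field_derivative x * (al * u + be / u) + x^2 * (u^2 - 1 / u^2)) (at (\<gamma> s))"
  proof -
   have "((%z. deriv U z / U z) has_field_derivative (w * u - v * v) / (u * u)) (at (\<gamma> s))"
    using DERIV_divide[OF dV dU] u by (simp add: u_def v_def)
   moreover have "(w * u - v * v) / (u * u) = x * (al * u + be / u) + x^2 * (u^2 - 1 / u^2)"
   proof -
    have "w * u - v * v = x * (al * u ^ 3 + be * u) + x^2 * (u ^ 4 - 1)"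
     using eq by (simp add: power2_eq_square algebra_simps)
    moreover have "x * (al * u + be / u) + x^2 * (u^2 - 1 / u^2) = (x * (al * u ^ 3 + be * u) + x^2 * (u ^ 4 - 1)) / (u * u)"
     using u by (simp add: field_simps eval_nat_numeral)
    ultimately show ?thesis by simp
   qed
   ultimately show ?thesis by simp
  qed
  \<comment> \<open>the holomorphic part of the auxiliary function\<close>
  have dE: "((%z. (deriv U z / U z)^2 - exp z^2 * (U z^2 + 1 / U z^2) - 2 * exp z * (al * U z - be / U z))
    has_field_derivative - 2 * x^2 * (u^2 + 1 / u^2) - 2 * x * (al * u - be / u)) (at (\<gamma> s))"
  proof -
   have dQ: "((%z. inverse (U z)) has_field_derivative - (v / u^2)) (at (\<gamma> s))"
    using DERIV_inverse'[OF dU] u by (simp add: u_def power2_eq_square divide_inverse mult_ac)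
   have dX: "(exp has_field_derivative x) (at (\<gamma> s))" unfolding x_def by (rule DERIV_exp)
   have "((%z. (deriv U z / U z)^2 - exp z^2 * (U z^2 + inverse (U z)^2) - 2 * exp z * (al * U z - be * inverse (U z)))
    has_field_derivative 2 * p * (x * (al * u + be / u) + x^2 * (u^2 - 1 / u^2))
     - (2 * x * x * (u^2 + inverse u ^ 2) + x^2 * (2 * u * v + 2 * inverse u * - (v / u^2)))
     - (2 * x * (al * u - be * inverse u) + 2 * x * (al * v - be * - (v / u^2)))) (at (\<gamma> s))"
    by (rule DERIV_cong, (rule derivative_intros dP dU dQ dX)+)
     (simp add: u_def[symmetric] v_def[symmetric] x_def[symmetric] p_def[symmetric] algebra_simps)
   moreover have "2 * p * (x * (al * u + be / u) + x^2 * (u^2 - 1 / u^2))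
     - (2 * x * x * (u^2 + inverse u ^ 2) + x^2 * (2 * u * v + 2 * inverse u * - (v / u^2)))
     - (2 * x * (al * u - be * inverse u) + 2 * x * (al * v - be * - (v / u^2)))
     = - 2 * x^2 * (u^2 + 1 / u^2) - 2 * x * (al * u - be / u)"
    unfolding p_def using u by (simp add: field_simps eval_nat_numeral)
   ultimately have "((%z. (deriv U z / U z)^2 - exp z^2 * (U z^2 + inverse (U z)^2) - 2 * exp z * (al * U z - be * inverse (U z)))
    has_field_derivative - 2 * x^2 * (u^2 + 1 / u^2) - 2 * x * (al * u - be / u)) (at (\<gamma> s))"
    by (rule DERIV_cong)
   then show ?thesis by (simp add: inverse_eq_divide power_divide)
  qed
  have dEs: "((%s. (deriv U (\<gamma> s) / U (\<gamma> s))^2 - exp (\<gamma> s)^2 * (U (\<gamma> s)^2 + 1 / U (\<gamma> s)^2)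
     - 2 * exp (\<gamma> s) * (al * U (\<gamma> s) - be / U (\<gamma> s)))
    has_vector_derivative d * (- 2 * x^2 * (u^2 + 1 / u^2) - 2 * x * (al * u - be / u))) (at s)"
   using field_vector_diff_chain_at[OF dg dE] by (simp add: o_def)
  have dPs: "((%s. deriv U (\<gamma> s) / U (\<gamma> s)) has_vector_derivative
    d * (x * (al * u + be / u) + x^2 * (u^2 - 1 / u^2))) (at s)"
   using field_vector_diff_chain_at[OF dg dP] by (simp add: o_def)
  have dUs: "((%s. U (\<gamma> s)) has_vector_derivative d * v) (at s)"
   using field_vector_diff_chain_at[OF dg dU] by (simp add: o_def)
  have dn: "((%s. (norm (U (\<gamma> s)))^2) has_real_derivative 2 * (norm u)^2 * Re (d * p)) (at s)"
  proof -
   have "((%s. U (\<gamma> s) \<bullet> U (\<gamma> s)) has_vector_derivative u \<bullet> (d * v) + (d * v) \<bullet> u) (at s)"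
    unfolding u_def by (rule bounded_bilinear.has_vector_derivative[OF bounded_bilinear_inner dUs dUs])
   moreover have "u \<bullet> (d * v) + (d * v) \<bullet> u = 2 * (norm u)^2 * Re (d * p)"
   proof -
    have "d * v = (d * p) * u" using u by (simp add: p_def)
    moreover have "u \<bullet> (q * u) = Re q * (norm u)^2" for q
     unfolding cmod_power2 inner_complex_def by (simp add: algebra_simps power2_eq_square)
    ultimately have "u \<bullet> (d * v) = Re (d * p) * (norm u)^2" by metis
    then show ?thesis by (simp add: inner_commute)
   qed
   ultimately show ?thesis
    by (simp add: has_real_derivative_iff_has_vector_derivative power2_norm_eq_inner)
  qed
  have nn: "1 + (norm u)^2 ~= 0" by (metis add_pos_nonneg less_irrefl zero_le_power2 zero_less_one)
  have db: "((%s. blend (U (\<gamma> s))) has_real_derivative 4 * (norm u)^2 * Re (d * p) / (1 + (norm u)^2)^2) (at s)"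
  proof -
   define k where "k = 2 * (norm u)^2 * Re (d * p)"
   have "((%s. ((norm (U (\<gamma> s)))^2 - 1) / ((norm (U (\<gamma> s)))^2 + 1)) has_real_derivative
     ((k - 0) * ((norm (U (\<gamma> s)))^2 + 1) - ((norm (U (\<gamma> s)))^2 - 1) * (k + 0)) /
     (((norm (U (\<gamma> s)))^2 + 1) * ((norm (U (\<gamma> s)))^2 + 1))) (at s)"
    by (intro DERIV_divide DERIV_diff DERIV_add dn[folded k_def] DERIV_const)
     (use nn in \<open>simp add: u_def add.commute\<close>)
   moreover have "((k - 0) * (n + 1) - (n - 1) * (k + 0)) / ((n + 1) * (n + 1)) = 2 * k / (1 + n)^2" for n :: real
    by (simp add: algebra_simps power2_eq_square)
   moreover have "2 * k = 4 * (norm u)^2 * Re (d * p)" by (simp add: k_def)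
   ultimately show ?thesis
    unfolding blend_def u_def by simp
  qed
  have dbs: "((%s. complex_of_real (blend (U (\<gamma> s)))) has_vector_derivative
    of_real (4 * (norm u)^2 * Re (d * p) / (1 + (norm u)^2)^2)) (at s)"
   by (rule has_vector_derivative_of_real[OF db])
  have "((%s. 2 * (of_real (blend (U (\<gamma> s))) * (deriv U (\<gamma> s) / U (\<gamma> s)))) has_vector_derivative
    2 * (of_real (blend u) * (d * (x * (al * u + be / u) + x^2 * (u^2 - 1 / u^2))) +
     of_real (4 * (norm u)^2 * Re (d * p) / (1 + (norm u)^2)^2) * p)) (at s)"
   using has_vector_derivative_mult_right[OF has_vector_derivative_mult[OF dbs dPs], of 2]
   by (simp add: u_def v_def p_def)
  from has_vector_derivative_add[OF dEs this] show ?thesis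
   unfolding W_def aux_energy_def aux_rate_def u_def[symmetric] v_def[symmetric] x_def[symmetric] p_def[symmetric]
   by (simp add: algebra_simps)
 qed
 have "1 + (norm (W (\<gamma> 1)))^2 <= (1 + (norm (W (\<gamma> 0)))^2) *
   exp (4 * (norm (t - c) * (48 + 24 * X1^2 + 34 * X1 * (norm al + norm be))))"
 proof (rule square_gronwall[OF main])
  fix s :: real assume s: "s \<in> {0..1}"
  show "norm (aux_rate al be d (exp (\<gamma> s)) (U (\<gamma> s)) (deriv U (\<gamma> s) / U (\<gamma> s)))
   <= norm (t - c) * (48 + 24 * X1^2 + 34 * X1 * (norm al + norm be)) * (1 + norm (W (\<gamma> s)))"
   unfolding W_def d_def[symmetric] by (rule aux_rate_bound[OF nz[OF g[OF s]] X[OF g[OF s]]])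
 qed (use X0 in auto)
 then show ?thesis by (simp add: \<gamma>_def d_def)
qed

section \<open>Solutions are meromorphic in the logarithm of the independent variable\<close>

text \<open>
  The normalisation of values at poles and removable singularities upgrades the identity theorem
  to equality at every point.
\<close>

lemma nicely_meromorphic_identity:
 assumes U: "U nicely_meromorphic_on D" and V: "V nicely_meromorphic_on D"
  and D: "open D" "connected D" and a: "a \<in> D" and eq: "\<forall>\<^sub>F t in nhds a. U t = V t" and t: "t \<in> D"
 shows "U t = V t"
proof -
 define f where "f = (%z. U z - V z)"
 have m: "f meromorphic_on D"
  unfolding f_def using U V by (intro meromorphic_intros) (auto simp: nicely_meromorphic_on_def)
 have nm: "remove_sings f nicely_meromorphic_on D" by (rule remove_sings_nicely_meromorphic[OF m])
 have near: "\<forall>\<^sub>F z in at s. remove_sings f z = f z" if "s \<in> D" for s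
  using meromorphic_on_isolated_singularity[OF meromorphic_on_subset[OF m]] that
  by (intro eventually_remove_sings_eq_at) auto
 have "\<forall>\<^sub>F z in at a. remove_sings f z = 0"
  using near[OF a] eventually_nhds_conv_at[THEN iffD1, OF eq, THEN conjunct1]
  by eventually_elim (simp add: f_def)
 then have "\<exists>\<^sub>F z in at a. remove_sings f z = 0" by (rule eventually_frequently[rotated]) simp
 then have z: "remove_sings f w = 0" if "w \<in> D" for w
  using frequently_eq_meromorphic_imp_constant[OF _ nm D a] that by blast
 have "\<forall>\<^sub>F z in at t. z \<in> D" using D t by (simp add: eventually_at_in_open')
 then have ev: "\<forall>\<^sub>F z in at t. U z = V z"
  using near[OF t] by eventually_elim (use z in \<open>simp add: f_def\<close>)
 have poles: "is_pole U t \<longleftrightarrow> is_pole V t" by (rule is_pole_cong[OF ev refl])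
 show ?thesis
 proof (cases "is_pole U t")
  case True then show ?thesis using is_pole_zero_at_nicely_mero U V poles t by metis
 next
  case False
  then have "U \<midarrow>t\<rightarrow> U t" "V \<midarrow>t\<rightarrow> V t" using U V poles t by (auto simp: nicely_meromorphic_on_def)
  moreover have "V \<midarrow>t\<rightarrow> U t" using calculation(1) tendsto_cong[OF ev] by blast
  ultimately show ?thesis using tendsto_unique[of "at t" V] by simp
 qed
qed

lemma nicely_meromorphic_locally:
 assumes "!!z. z \<in> D ==> \<exists>S V. open S & z \<in> S & V nicely_meromorphic_on S & (\<forall>s\<in>S. U s = V s)"
 shows "U nicely_meromorphic_on D"
proof -
 have *: "U meromorphic_on {z} & (is_pole U z & U z = 0 \<or> U \<midarrow>z\<rightarrow> U z)" if z: "z \<in> D" for z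
 proof -
  obtain S V where S: "open S" "z \<in> S" and V: "V nicely_meromorphic_on S" and eq: "!!s. s \<in> S ==> U s = V s"
   using assms[OF z] by blast
  have ev: "\<forall>\<^sub>F s in at z. U s = V s"
   using eventually_at_in_open'[OF S] by eventually_elim (rule eq)
  have "V meromorphic_on {z}" using V S meromorphic_on_subset by (auto simp: nicely_meromorphic_on_def)
  then have "U meromorphic_on {z}" using meromorphic_on_cong[of "{z}" U V "{z}"] ev by auto
  moreover have "is_pole U z = is_pole V z" by (rule is_pole_cong[OF ev refl])
  moreover have "U \<midarrow>z\<rightarrow> U z \<longleftrightarrow> V \<midarrow>z\<rightarrow> V z" using tendsto_cong[OF ev] eq[OF S(2)] by simp
  ultimately show ?thesis using V S eq[OF S(2)] by (auto simp: nicely_meromorphic_on_def)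
 qed
 then show ?thesis
  unfolding nicely_meromorphic_on_def using meromorphic_on_meromorphic_at by blast
qed

lemma log_solution_locally:
 assumes "!!z. z \<in> D ==> \<exists>S V. open S & z \<in> S & log_solution al be S V & (\<forall>s\<in>S. U s = V s)"
  and "\<exists>t\<in>D. U t ~= 0"
 shows "log_solution al be D U"
 unfolding log_solution_def
proof (intro conjI ballI impI)
 show "U nicely_meromorphic_on D"
 proof (rule nicely_meromorphic_locally)
  fix z assume "z \<in> D"
  then show "\<exists>S V. open S & z \<in> S & V nicely_meromorphic_on S & (\<forall>s\<in>S. U s = V s)"
   using assms(1)[of z] unfolding log_solution_def by blast
 qed
next
 fix t assume t: "t \<in> D" "U t ~= 0"
 obtain S V where S: "open S" "t \<in> S" "log_solution al be S V" "\<forall>s\<in>S. U s = V s"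
  using assms(1)[OF t(1)] by blast
 have "\<forall>\<^sub>F s in nhds t. U s = V s"
  using eventually_nhds_in_open[OF S(1,2)] by eventually_elim (use S in blast)
 moreover have "log_P3 al be V t" using S t by (auto simp: log_solution_def)
 ultimately show "log_P3 al be U t" using log_P3_cong by blast
qed (use assms in blast)

lemma log_solution_subset:
 assumes "log_solution al be D U" "S <= D" "\<exists>t\<in>S. U t ~= 0"
 shows "log_solution al be S U"
 using assms nicely_meromorphic_on_subset unfolding log_solution_def by blast

lemma bounded_energy_local_extension_small:
 fixes R K :: real and al be :: complex
 obtains r where "r > 0"
  "!!D U t0. open D ==> log_solution al be D U ==> t0 \<in> D ==> U t0 ~= 0 ==> norm t0 <= R ==>
   norm (U t0) <= 1 ==> norm (aux_energy al be (exp t0) (U t0) (deriv U t0 / U t0)) <= K ==>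
   \<exists>V. log_solution al be (ball t0 r) V & (\<forall>\<^sub>F t in nhds t0. V t = U t)"
proof -
 obtain M0 where M0: "!!x u p. exp (-R) <= norm x ==> norm x <= exp R ==> u ~= 0 ==> norm u <= 1 ==>
   norm (aux_energy al be x u p) <= K ==>
   norm (chart_coord be x u (p * u)) <= M0 \<or> norm (chart_coord (-be) x (-u) (- (p * u))) <= M0"
  by (rule aux_energy_bounds_chart[of "exp (-R)" "exp R" al be K]) auto
 define M where "M = max M0 1"
 obtain r1 where r1: "r1 > 0" "!!D U t0. open D ==> log_solution al be D U ==> t0 \<in> D ==> U t0 ~= 0 ==> norm t0 <= R ==>
   norm (U t0) <= M ==> norm (chart_coord be (exp t0) (U t0) (deriv U t0)) <= M ==>
   \<exists>V. log_solution al be (ball t0 r1) V & (\<forall>\<^sub>F t in nhds t0. V t = U t)"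
  by (rule log_solution_local_extension[where R = R and M = M and al = al and be = be]) blast
 obtain r2 where r2: "r2 > 0" "!!D U t0. open D ==> log_solution (-al) (-be) D U ==> t0 \<in> D ==> U t0 ~= 0 ==> norm t0 <= R ==>
   norm (U t0) <= M ==> norm (chart_coord (-be) (exp t0) (U t0) (deriv U t0)) <= M ==>
   \<exists>V. log_solution (-al) (-be) (ball t0 r2) V & (\<forall>\<^sub>F t in nhds t0. V t = U t)"
  by (rule log_solution_local_extension[where R = R and M = M and al = "-al" and be = "-be"]) blast
 define r where "r = min r1 r2"
 have r: "r > 0" using r1 r2 by (simp add: r_def)
 have "\<exists>V. log_solution al be (ball t0 r) V & (\<forall>\<^sub>F t in nhds t0. V t = U t)"
  if D: "open D" "log_solution al be D U" "t0 \<in> D" "U t0 ~= 0" "norm t0 <= R" "norm (U t0) <= 1"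
   and W: "norm (aux_energy al be (exp t0) (U t0) (deriv U t0 / U t0)) <= K" for D U t0
 proof -
  have shrink: "log_solution a b (ball t0 r) V"
   if "log_solution a b (ball t0 s) V" "\<forall>\<^sub>F t in nhds t0. V t = W t" "W t0 ~= 0" "r <= s" for a b s V W
  proof (rule log_solution_subset[OF that(1)])
   show "ball t0 r <= ball t0 s" using that by auto
   have "V t0 = W t0" using that(2) by (rule eventually_nhds_x_imp_x)
   then show "\<exists>t\<in>ball t0 r. V t ~= 0" using that r by (intro bexI[of _ t0]) auto
  qed
  have "\<bar>Re t0\<bar> <= R" using D(5) abs_Re_le_cmod order_trans by blast
  then have "exp (-R) <= norm (exp t0)" "norm (exp t0) <= exp R" by auto
  from M0[OF this D(4,6) W]
  consider "norm (chart_coord be (exp t0) (U t0) (deriv U t0)) <= M"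
   | "norm (chart_coord (-be) (exp t0) (- U t0) (- deriv U t0)) <= M"
   using D(4) by (auto simp: M_def le_max_iff_disj)
  moreover have UM: "norm (U t0) <= M" using D(6) unfolding M_def by linarith
  ultimately show ?thesis
  proof cases
   case 1
   then obtain V where "log_solution al be (ball t0 r1) V" "\<forall>\<^sub>F t in nhds t0. V t = U t"
    using r1(2)[OF D(1-5) UM 1] by blast
   then show ?thesis using shrink[of al be r1 V U] D(4) by (auto simp: r_def)
  next
   case 2
   have nm: "U nicely_meromorphic_on D" using D by (simp add: log_solution_def)
   obtain e where e: "e > 0" "U holomorphic_on ball t0 e"
    by (rule nicely_meromorphic_nonzero_ball[OF nm D(1,3,4)])
   have "((%t. - U t) has_field_derivative - deriv U t0) (at t0)"
    by (rule DERIV_minus[OF holomorphic_derivI[OF e(2) open_ball]]) (use e in simp)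
   then have d: "deriv (%t. - U t) t0 = - deriv U t0" by (rule DERIV_imp_deriv)
   have "\<exists>V. log_solution (-al) (-be) (ball t0 r2) V & (\<forall>\<^sub>F t in nhds t0. V t = - U t)"
    by (rule r2(2)[OF D(1) log_solution_uminus[OF D(2,1)] D(3) _ D(5)])
     (use D 2 d in \<open>auto simp: M_def\<close>)
   then obtain V where V: "log_solution (-al) (-be) (ball t0 r2) V" "\<forall>\<^sub>F t in nhds t0. V t = - U t"
    by blast
   have V': "\<forall>\<^sub>F t in nhds t0. - V t = U t" using V(2) by eventually_elim simp
   have "log_solution al be (ball t0 r2) (%t. - V t)"
    using log_solution_uminus[OF V(1)] by simp
   then show ?thesis using shrink[of al be r2 "%t. - V t" U] D(4) V' by (auto simp: r_def)
  qed
 qed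
 then show thesis using that[OF r] by blast
qed

text \<open>
  If \<open>\<bar>U t0\<bar> > 1\<close> the symmetry under inversion reduces the statement to \<open>\<bar>U t0\<bar> \<le> 1\<close>, where
  a bounded energy bounds chart coordinates.
\<close>

lemma bounded_energy_local_extension:
 fixes R K :: real and al be :: complex
 obtains r where "r > 0"
  "!!D U t0. open D ==> log_solution al be D U ==> t0 \<in> D ==> U t0 ~= 0 ==> norm t0 <= R ==>
   norm (aux_energy al be (exp t0) (U t0) (deriv U t0 / U t0)) <= K ==>
   \<exists>V. log_solution al be (ball t0 r) V & (\<forall>\<^sub>F t in nhds t0. V t = U t)"
proof -
 obtain r1 where r1: "r1 > 0" "!!D U t0. open D ==> log_solution al be D U ==> t0 \<in> D ==> U t0 ~= 0 ==> norm t0 <= R ==>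
   norm (U t0) <= 1 ==> norm (aux_energy al be (exp t0) (U t0) (deriv U t0 / U t0)) <= K ==>
   \<exists>V. log_solution al be (ball t0 r1) V & (\<forall>\<^sub>F t in nhds t0. V t = U t)"
  by (rule bounded_energy_local_extension_small[where R = R and K = K and al = al and be = be]) blast
 obtain r2 where r2: "r2 > 0" "!!D U t0. open D ==> log_solution (-be) (-al) D U ==> t0 \<in> D ==> U t0 ~= 0 ==> norm t0 <= R ==>
   norm (U t0) <= 1 ==> norm (aux_energy (-be) (-al) (exp t0) (U t0) (deriv U t0 / U t0)) <= K ==>
   \<exists>V. log_solution (-be) (-al) (ball t0 r2) V & (\<forall>\<^sub>F t in nhds t0. V t = U t)"
  by (rule bounded_energy_local_extension_small[where R = R and K = K and al = "-be" and be = "-al"]) blast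
 define r where "r = min r1 r2"
 have r: "r > 0" using r1 r2 by (simp add: r_def)
 have "\<exists>V. log_solution al be (ball t0 r) V & (\<forall>\<^sub>F t in nhds t0. V t = U t)"
  if D: "open D" "log_solution al be D U" "t0 \<in> D" "U t0 ~= 0" "norm t0 <= R"
   and W: "norm (aux_energy al be (exp t0) (U t0) (deriv U t0 / U t0)) <= K" for D U t0
 proof -
  have shrink: "log_solution a b (ball t0 r) V"
   if "log_solution a b (ball t0 s) V" "\<forall>\<^sub>F t in nhds t0. V t = W t" "W t0 ~= 0" "r <= s" for a b s V W
  proof (rule log_solution_subset[OF that(1)])
   show "ball t0 r <= ball t0 s" using that by auto
   have "V t0 = W t0" using that(2) by (rule eventually_nhds_x_imp_x)
   then show "\<exists>t\<in>ball t0 r. V t ~= 0" using that r by (intro bexI[of _ t0]) auto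
  qed
  show ?thesis
  proof (cases "norm (U t0) <= 1")
   case True
   obtain V where "log_solution al be (ball t0 r1) V" "\<forall>\<^sub>F t in nhds t0. V t = U t"
    using r1(2)[OF D True W] by blast
   then show ?thesis using shrink[of al be r1 V U] D(4) by (auto simp: r_def)
  next
   case False
   have nm: "U nicely_meromorphic_on D" using D by (simp add: log_solution_def)
   obtain e where e: "e > 0" "U holomorphic_on ball t0 e"
    by (rule nicely_meromorphic_nonzero_ball[OF nm D(1,3,4)])
   have "(U has_field_derivative deriv U t0) (at t0)"
    by (rule holomorphic_derivI[OF e(2) open_ball]) (use e in simp)
   from DERIV_inverse'[OF this D(4)]
   have d: "deriv (%t. inverse (U t)) t0 / inverse (U t0) = - (deriv U t0 / U t0)"
    using D(4) by (simp add: DERIV_imp_deriv divide_inverse)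
   have "norm (inverse (U t0)) <= 1" using False by (simp add: norm_inverse inverse_le_1_iff)
   moreover have "norm (aux_energy (-be) (-al) (exp t0) (inverse (U t0)) (deriv (%t. inverse (U t)) t0 / inverse (U t0))) <= K"
    unfolding d aux_energy_inverse[OF D(4)] by (rule W)
   ultimately obtain V where V: "log_solution (-be) (-al) (ball t0 r2) V" "\<forall>\<^sub>F t in nhds t0. V t = inverse (U t)"
    using r2(2)[OF D(1) log_solution_inverse[OF D(2,1)] D(3) _ D(5)] D(4) by auto
   have V': "\<forall>\<^sub>F t in nhds t0. inverse (V t) = U t" using V(2) by eventually_elim simp
   have "log_solution al be (ball t0 r2) (%t. inverse (V t))"
    using log_solution_inverse[OF V(1)] by simp
   then show ?thesis using shrink[of al be r2 "%t. inverse (V t)" U] D(4) V' by (auto simp: r_def)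
  qed
 qed
 then show thesis using that[OF r] by blast
qed

text \<open>
  Only countably many directions from \<open>c\<close> meet the countable set \<open>Z\<close>. With \<open>Z\<close> the zeros and poles,
  almost every point can be reached along a segment on which the energy estimate holds.
\<close>

lemma dense_visible_points:
 fixes c :: complex
 assumes Z: "countable Z" "c \<notin> Z" and O: "open S" "S ~= {}"
 obtains t where "t \<in> S" "closed_segment c t \<inter> Z = {}"
proof -
 define H where "H z = {t::complex. (\<i> * (z - c)) \<bullet> t = (\<i> * (z - c)) \<bullet> c}" for z
 have "negligible (\<Union>z\<in>Z. H z)"
 proof (rule negligible_countable_Union)
  show "countable (H ` Z)" using Z by simp
  fix A assume "A \<in> H ` Z"
  then obtain z where "z \<in> Z" "A = H z" by blast
  moreover have "\<i> * (z - c) ~= 0" using \<open>z \<in> Z\<close> Z by auto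
  ultimately show "negligible A" unfolding H_def using negligible_hyperplane by blast
 qed
 then have "~ S <= (\<Union>z\<in>Z. H z)" using open_not_negligible[OF O] negligible_subset by blast
 then obtain t where t: "t \<in> S" "!!z. z \<in> Z ==> t \<notin> H z" by blast
 have "s \<notin> Z" if seg: "s \<in> closed_segment c t" for s
 proof
  assume s: "s \<in> Z"
  obtain l where l: "s = (1 - l) *\<^sub>R c + l *\<^sub>R t" using seg unfolding in_segment by blast
  then have e: "s - c = l *\<^sub>R (t - c)" by (simp add: algebra_simps scaleR_conv_of_real)
  have l0: "l ~= 0" using e s Z by auto
  have "(\<i> * (s - c)) \<bullet> (t - c) = 0" unfolding e by (simp add: inner_complex_def algebra_simps)
  then have "t \<in> H s" by (simp add: H_def inner_diff_right)
  then show False using t s by blast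
 qed
 then show thesis using that t by blast
qed

text \<open>
  The discs of radius \<open>\<rho>\<close> around visible points cover the larger disc. Two such discs that meet also
  meet inside \<open>ball c r\<close>, where both continuations are \<open>U\<close>; discs have connected intersections, so the
  continuations agree wherever both are defined.
\<close>

lemma log_solution_enlarge_ball:
 fixes c :: complex
 assumes sol: "log_solution al be (ball c r) U" and r: "0 < r" and Uc: "U c ~= 0" and \<rho>: "\<rho> > 0"
  and ext: "!!t. t \<in> ball c r ==> (!!s. s \<in> closed_segment c t ==> U s ~= 0) ==>
    \<exists>V. log_solution al be (ball t \<rho>) V & (\<forall>\<^sub>F s in nhds t. V s = U s)"
 obtains V where "log_solution al be (ball c (r + \<rho> / 2)) V" "!!t. t \<in> ball c r ==> V t = U t"
proof -
 have nm: "U nicely_meromorphic_on ball c r" using sol by (simp add: log_solution_def)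
 define Z where "Z = {t \<in> ball c r. U t = 0}"
 have "(\<forall>x\<in>ball c r. U x = 0) \<or> (\<forall>\<^sub>\<approx>x\<in>ball c r. U x ~= 0)"
  by (rule nicely_meromorphic_imp_constant_or_avoid[OF nm]) auto
 moreover have "~ (\<forall>x\<in>ball c r. U x = 0)" using Uc r by (auto intro!: bexI[of _ c])
 ultimately have "\<forall>\<^sub>\<approx>x\<in>ball c r. U x ~= 0" by blast
 then have "{x. ~ U x ~= 0} sparse_in ball c r" by (simp add: eventually_cosparse)
 then have "countable (ball c r \<inter> {x. ~ U x ~= 0})" by (intro sparse_imp_countable) auto
 moreover have "ball c r \<inter> {x. ~ U x ~= 0} = Z" by (auto simp: Z_def)
 ultimately have Z: "countable Z" "c \<notin> Z" using Uc by (auto simp: Z_def)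
 define G where "G = {t \<in> ball c r. \<forall>s\<in>closed_segment c t. U s ~= 0}"
 have dense: "\<exists>t\<in>G. z \<in> ball t \<rho>" if z: "z \<in> ball c (r + \<rho> / 2)" for z
 proof -
  have ne: "ball c r \<inter> ball z \<rho> ~= {}"
  proof (cases "z = c")
   case False
   define d where "d = dist c z"
   have d: "d > 0" "d < r + \<rho> / 2" using z False by (auto simp: d_def)
   define w where "w = c + of_real (max 0 (d - 3 * \<rho> / 4) / d) * (z - c)"
   have "dist c w = max 0 (d - 3 * \<rho> / 4)"
    using d unfolding w_def by (simp add: dist_norm norm_mult norm_divide d_def[unfolded dist_norm] norm_minus_commute)
   moreover have "dist z w < \<rho>"
   proof -
    have "z - w = of_real (1 - max 0 (d - 3 * \<rho> / 4) / d) * (z - c)" by (simp add: w_def algebra_simps)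
    then have "dist z w = \<bar>1 - max 0 (d - 3 * \<rho> / 4) / d\<bar> * d"
     by (simp add: dist_norm norm_mult d_def norm_minus_commute del: of_real_diff of_real_divide)
    also have "... = \<bar>d - max 0 (d - 3 * \<rho> / 4)\<bar>"
    proof -
     have "\<bar>1 - q / d\<bar> * d = \<bar>(1 - q / d) * d\<bar>" for q using d(1) by (simp add: abs_mult)
     then show ?thesis using d(1) by (simp add: left_diff_distrib)
    qed
    also have "... < \<rho>" using d \<rho> by (auto simp: max_def)
    finally show ?thesis .
   qed
   moreover have "max 0 (d - 3 * \<rho> / 4) < r" using d r \<rho> by auto
   ultimately have "w \<in> ball c r \<inter> ball z \<rho>" by simp
   then show ?thesis by blast
  next
   case True
   then have "c \<in> ball c r \<inter> ball z \<rho>" using r \<rho> by simp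
   then show ?thesis by blast
  qed
  obtain t where t: "t \<in> ball c r \<inter> ball z \<rho>" "closed_segment c t \<inter> Z = {}"
   by (rule dense_visible_points[OF Z _ ne]) auto
  have "closed_segment c t <= ball c r" by (rule closed_segment_subset) (use t r in auto)
  then have "U s ~= 0" if "s \<in> closed_segment c t" for s using that t(2) unfolding Z_def by blast
  then have "t \<in> G" using t by (auto simp: G_def)
  then show ?thesis using t by (auto simp: dist_commute)
 qed
 have "\<exists>V. log_solution al be (ball t \<rho>) V & (\<forall>\<^sub>F s in nhds t. V s = U s)" if "t \<in> G" for t
  using ext[of t] that by (auto simp: G_def)
 then obtain V where V: "!!t. t \<in> G ==> log_solution al be (ball t \<rho>) (V t)"
  "!!t. t \<in> G ==> \<forall>\<^sub>F s in nhds t. V t s = U s" by metis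
 have VU: "V t z = U z" if t: "t \<in> G" and z: "z \<in> ball t \<rho>" "z \<in> ball c r" for t z
 proof (rule nicely_meromorphic_identity[where D = "ball t \<rho> \<inter> ball c r" and a = t and U = "V t" and V = U])
  show "V t nicely_meromorphic_on ball t \<rho> \<inter> ball c r"
   using V(1)[OF t] nicely_meromorphic_on_subset by (auto simp: log_solution_def)
  show "U nicely_meromorphic_on ball t \<rho> \<inter> ball c r"
   using nm nicely_meromorphic_on_subset by blast
  show "connected (ball t \<rho> \<inter> ball c r)" by (intro convex_connected convex_Int) auto
 qed (use V(2)[OF t] t z \<rho> in \<open>auto simp: G_def\<close>)
 have VV: "V t z = V t' z" if t: "t \<in> G" "t' \<in> G" and z: "z \<in> ball t \<rho>" "z \<in> ball t' \<rho>" for t t' z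
 proof -
  define m where "m = midpoint t t'"
  have "dist t t' < 2 * \<rho>" using z dist_triangle2[of t t' z] by (auto simp: dist_commute)
  then have m1: "m \<in> ball t \<rho> \<inter> ball t' \<rho>" by (auto simp: m_def dist_midpoint)
  have "m \<in> closed_segment t t'" by (simp add: m_def)
  then have m2: "m \<in> ball c r"
   using closed_segment_subset[of t "ball c r" t'] t by (auto simp: G_def)
  show ?thesis
  proof (rule nicely_meromorphic_identity[where D = "ball t \<rho> \<inter> ball t' \<rho>" and a = m and U = "V t" and V = "V t'"])
   show "V t nicely_meromorphic_on ball t \<rho> \<inter> ball t' \<rho>" "V t' nicely_meromorphic_on ball t \<rho> \<inter> ball t' \<rho>"
    using V(1)[OF t(1)] V(1)[OF t(2)] nicely_meromorphic_on_subset[OF _ Int_lower1] nicely_meromorphic_on_subset[OF _ Int_lower2]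
    unfolding log_solution_def by blast+
   show "connected (ball t \<rho> \<inter> ball t' \<rho>)" by (intro convex_connected convex_Int) auto
   have "\<forall>\<^sub>F s in nhds m. s \<in> (ball t \<rho> \<inter> ball t' \<rho>) \<inter> ball c r"
    by (rule eventually_nhds_in_open) (use m1 m2 in auto)
   then show "\<forall>\<^sub>F s in nhds m. V t s = V t' s"
    by eventually_elim (use VU t in auto)
  qed (use m1 z in auto)
 qed
 define W where "W z = V (SOME t. t \<in> G & z \<in> ball t \<rho>) z" for z
 have W: "W z = V t z" if t: "t \<in> G" "z \<in> ball t \<rho>" for t z
 proof -
  have "(SOME t. t \<in> G & z \<in> ball t \<rho>) \<in> G & z \<in> ball (SOME t. t \<in> G & z \<in> ball t \<rho>) \<rho>"
   by (rule someI) (use t in blast)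
  then show ?thesis unfolding W_def using VV t by blast
 qed
 have WU: "W t = U t" if t: "t \<in> ball c r" for t
 proof -
  have "t \<in> ball c (r + \<rho> / 2)" using t \<rho> by auto
  then obtain s where "s \<in> G" "t \<in> ball s \<rho>" using dense by blast
  then show ?thesis using W VU t by metis
 qed
 have "log_solution al be (ball c (r + \<rho> / 2)) W"
 proof (rule log_solution_locally)
  fix z assume "z \<in> ball c (r + \<rho> / 2)"
  then obtain t where t: "t \<in> G" "z \<in> ball t \<rho>" using dense by blast
  then show "\<exists>S V. open S & z \<in> S & log_solution al be S V & (\<forall>s\<in>S. W s = V s)"
   using V(1) W by (intro exI[of _ "ball t \<rho>"] exI[of _ "V t"]) auto
 next
  show "\<exists>t\<in>ball c (r + \<rho> / 2). W t ~= 0"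
   using WU[of c] Uc r \<rho> by (intro bexI[of _ c]) auto
 qed
 then show thesis using that WU by blast
qed

text \<open>
  On the target disc the energy has one bound for all continuations, hence one radius of extension
  serves for every step and finitely many enlargements suffice.
\<close>

lemma log_solution_extend_to_ball:
 assumes sol: "log_solution al be (ball c r0) U" and r0: "0 < r0" and Uc: "U c ~= 0" and Rm: "0 < Rm"
 obtains V where "log_solution al be (ball c Rm) V" "\<forall>\<^sub>F t in nhds c. V t = U t"
proof -
 define R where "R = norm c + \<bar>Rm\<bar> + r0"
 define X where "X = exp R"
 define C where "C = 4 * (R * (48 + 24 * X^2 + 34 * X * (norm al + norm be)))"
 define K where "K = (1 + (norm (aux_energy al be (exp c) (U c) (deriv U c / U c)))^2) * exp C"
 obtain \<rho> where \<rho>: "\<rho> > 0" "!!D U t0. open D ==> log_solution al be D U ==> t0 \<in> D ==> U t0 ~= 0 ==> norm t0 <= R ==>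
   norm (aux_energy al be (exp t0) (U t0) (deriv U t0 / U t0)) <= K ==>
   \<exists>V. log_solution al be (ball t0 \<rho>) V & (\<forall>\<^sub>F t in nhds t0. V t = U t)"
  by (rule bounded_energy_local_extension[where R = R and K = K and al = al and be = be]) blast
 have step: "\<exists>V'. log_solution al be (ball c (r + \<rho> / 2)) V' & (\<forall>\<^sub>F t in nhds c. V' t = U t)"
  if V: "log_solution al be (ball c r) V" "\<forall>\<^sub>F t in nhds c. V t = U t" and r: "0 < r" "r <= \<bar>Rm\<bar> + r0" for r V
 proof -
  have Vc: "V c = U c" using V(2) by (rule eventually_nhds_x_imp_x)
  have dVc: "deriv V c = deriv U c" using V(2) by (rule deriv_cong_ev) simp
  have "\<exists>V'. log_solution al be (ball t \<rho>) V' & (\<forall>\<^sub>F s in nhds t. V' s = V s)"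
   if t: "t \<in> ball c r" and nz: "!!s. s \<in> closed_segment c t ==> V s ~= 0" for t
  proof (rule \<rho>(2)[OF open_ball V(1) t])
   have sub: "closed_segment c t <= ball c r" by (rule closed_segment_subset) (use t r in auto)
   have nR: "norm s <= R" if "s \<in> ball c r" for s
    using that r norm_triangle_ineq2[of s c] by (auto simp: R_def dist_norm norm_minus_commute)
   show "norm t <= R" using nR t by blast
   show "V t ~= 0" by (rule nz) simp
   have X: "norm (exp s) <= X" if "s \<in> closed_segment c t" for s
   proof -
    have "Re s <= R" using nR[of s] sub that complex_Re_le_cmod order_trans by blast
    then show ?thesis by (simp add: X_def)
   qed
   define w where "w = norm (aux_energy al be (exp t) (V t) (deriv V t / V t))"
   have "1 + w^2 <= (1 + (norm (aux_energy al be (exp c) (V c) (deriv V c / V c)))^2) *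
     exp (4 * (norm (t - c) * (48 + 24 * X^2 + 34 * X * (norm al + norm be))))"
    unfolding w_def by (rule aux_energy_growth[OF V(1) open_ball sub nz X])
   also have "... <= K"
    unfolding K_def Vc dVc
   proof (rule mult_left_mono)
    have "norm (t - c) <= R" using t r norm_ge_zero[of c] unfolding R_def mem_ball dist_norm norm_minus_commute[of c t] by linarith
    moreover have "0 <= 48 + 24 * X^2 + 34 * X * (norm al + norm be)" by (simp add: X_def)
    ultimately show "exp (4 * (norm (t - c) * (48 + 24 * X^2 + 34 * X * (norm al + norm be)))) <= exp C"
     unfolding C_def exp_le_cancel_iff by (intro mult_left_mono mult_right_mono) auto
   qed (simp add: add_nonneg_nonneg)
   finally have "1 + w^2 <= K" .
   moreover have "w <= 1 + w^2" using zero_le_power2[of "w - 1"] zero_le_power2[of w]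
     norm_ge_zero[of "aux_energy al be (exp t) (V t) (deriv V t / V t)", folded w_def]
    by (simp add: power2_eq_square algebra_simps)
   ultimately show "norm (aux_energy al be (exp t) (V t) (deriv V t / V t)) <= K" by (simp add: w_def)
  qed
  then obtain V' where V': "log_solution al be (ball c (r + \<rho> / 2)) V'" "!!t. t \<in> ball c r ==> V' t = V t"
   using log_solution_enlarge_ball[OF V(1) r(1) _ \<rho>(1)] Vc Uc by metis
  have "\<forall>\<^sub>F t in nhds c. t \<in> ball c r" by (rule eventually_nhds_in_open) (use r in auto)
  with V(2) have "\<forall>\<^sub>F t in nhds c. V' t = U t" by eventually_elim (use V'(2) in auto)
  then show ?thesis using V'(1) by blast
 qed
 have all: "\<exists>V. log_solution al be (ball c (min (\<bar>Rm\<bar> + r0) (r0 + real n * (\<rho> / 2)))) V & (\<forall>\<^sub>F t in nhds c. V t = U t)" for n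
 proof (induction n)
  case 0
  then show ?case using sol by (intro exI[of _ U]) simp
 next
  case (Suc n)
  define r where "r = min (\<bar>Rm\<bar> + r0) (r0 + real n * (\<rho> / 2))"
  have r: "0 < r" "r <= \<bar>Rm\<bar> + r0" using r0 \<rho>(1) by (auto simp: r_def add_pos_nonneg)
  obtain V where "log_solution al be (ball c r) V" "\<forall>\<^sub>F t in nhds c. V t = U t" using Suc r_def by blast
  then obtain V' where V': "log_solution al be (ball c (r + \<rho> / 2)) V'" "\<forall>\<^sub>F t in nhds c. V' t = U t"
   using step r by blast
  have V'c: "V' c = U c" using V'(2) by (rule eventually_nhds_x_imp_x)
  have "log_solution al be (ball c (min (\<bar>Rm\<bar> + r0) (r0 + real (Suc n) * (\<rho> / 2)))) V'"
  proof (rule log_solution_subset[OF V'(1)])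
   show "ball c (min (\<bar>Rm\<bar> + r0) (r0 + real (Suc n) * (\<rho> / 2))) <= ball c (r + \<rho> / 2)"
    by (rule subset_ball) (use \<rho>(1) in \<open>auto simp: r_def min_def algebra_simps\<close>)
   show "\<exists>t\<in>ball c (min (\<bar>Rm\<bar> + r0) (r0 + real (Suc n) * (\<rho> / 2))). V' t ~= 0"
    using V'c Uc r0 \<rho>(1) by (intro bexI[of _ c]) (auto simp: add_pos_nonneg)
  qed
  then show ?case using V'(2) by blast
 qed
 obtain n :: nat where n: "\<bar>Rm\<bar> / (\<rho> / 2) <= real n" using real_arch_simple by blast
 then have "\<bar>Rm\<bar> <= real n * (\<rho> / 2)" using \<rho>(1) by (simp add: field_simps)
 then have "min (\<bar>Rm\<bar> + r0) (r0 + real n * (\<rho> / 2)) = \<bar>Rm\<bar> + r0" by simp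
 with all[of n] obtain V where V: "log_solution al be (ball c (\<bar>Rm\<bar> + r0)) V" "\<forall>\<^sub>F t in nhds c. V t = U t" by auto
 have Vc: "V c = U c" using V(2) by (rule eventually_nhds_x_imp_x)
 have "log_solution al be (ball c Rm) V"
  by (rule log_solution_subset[OF V(1)]) (use r0 Vc Uc Rm in \<open>auto intro!: bexI[of _ c]\<close>)
 then show thesis using V(2) by (rule that)
qed

text \<open>
  The Painleve property. In \<open>x\<close> itself the point 0 is a fixed singularity; in \<open>t = ln x\<close> it disappears.
\<close>

theorem log_solution_extend_entire:
 assumes sol: "log_solution al be (ball c r0) U" and r0: "0 < r0" and Uc: "U c ~= 0"
 obtains V where "log_solution al be UNIV V" "\<forall>\<^sub>F t in nhds c. V t = U t"
proof -
 have "\<exists>V. log_solution al be (ball c (real (Suc n))) V & (\<forall>\<^sub>F t in nhds c. V t = U t)" for n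
  using log_solution_extend_to_ball[OF sol r0 Uc, where Rm = "real (Suc n)"] by auto
 then obtain V where V: "!!n. log_solution al be (ball c (real (Suc n))) (V n)"
  "!!n. \<forall>\<^sub>F t in nhds c. V n t = U t" by metis
 have VV: "V n z = V m z" if z: "z \<in> ball c (real (Suc n))" "n <= m" for n m z
 proof (rule nicely_meromorphic_identity[where D = "ball c (real (Suc n))" and a = c and U = "V n" and V = "V m"])
  show "V n nicely_meromorphic_on ball c (real (Suc n))" using V(1)[of n] by (simp add: log_solution_def)
  show "V m nicely_meromorphic_on ball c (real (Suc n))"
   using V(1)[of m] z(2) by (auto simp: log_solution_def intro: nicely_meromorphic_on_subset)
  show "\<forall>\<^sub>F t in nhds c. V n t = V m t" using V(2)[of n] V(2)[of m] by eventually_elim simp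
 qed (use z in auto)
 define W where "W z = V (nat \<lceil>dist c z\<rceil>) z" for z
 have W: "W z = V n z" if "z \<in> ball c (real (Suc n))" for n z
 proof -
  have "z \<in> ball c (real (Suc (nat \<lceil>dist c z\<rceil>)))"
   using real_nat_ceiling_ge[of "dist c z"] unfolding mem_ball of_nat_Suc by linarith
  then show ?thesis unfolding W_def using VV that by (metis linorder_linear)
 qed
 have ev: "\<forall>\<^sub>F t in nhds c. W t = U t"
 proof -
  have "\<forall>\<^sub>F t in nhds c. t \<in> ball c (real (Suc 0))" by (rule eventually_nhds_in_open) auto
  with V(2)[of 0] show ?thesis by eventually_elim (use W[of _ 0] in auto)
 qed
 have "W c ~= 0" using eventually_nhds_x_imp_x[OF ev] Uc by simp
 have "log_solution al be UNIV W"
 proof (rule log_solution_locally)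
  fix z :: complex
  have "z \<in> ball c (real (Suc (nat \<lceil>dist c z\<rceil>)))"
   using real_nat_ceiling_ge[of "dist c z"] unfolding mem_ball of_nat_Suc by linarith
  then show "\<exists>S V. open S & z \<in> S & log_solution al be S V & (\<forall>s\<in>S. W s = V s)"
   using V(1) W open_ball by blast
 qed (use \<open>W c ~= 0\<close> in blast)
 then show thesis using ev by (rule that)
qed

section \<open>Primitives that vanish at infinity\<close>

definition half_line_integral :: "(real => complex) => complex" where
 "half_line_integral f = (\<integral>\<tau>. indicator {0<..} \<tau> *\<^sub>R f \<tau> \<partial>lborel)"

text \<open>
  The primitive of \<open>g\<close> that vanishes at infinity in the direction \<open>\<omega>\<close>.
\<close>

definition ray_integral :: "complex => (complex => complex) => complex => complex" where
 "ray_integral \<omega> g x = - \<omega> * half_line_integral (%\<tau>. g (x + of_real \<tau> * \<omega>))"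

lemma inverse_square_integral:
 fixes C d :: real
 assumes "0 <= C" "0 < d"
 shows "integrable lborel (%\<tau>. indicator {0<..} \<tau> *\<^sub>R (C / (d + \<tau>)^2))"
  and "(\<integral>\<tau>. indicator {0<..} \<tau> *\<^sub>R (C / (d + \<tau>)^2) \<partial>lborel) = C / d"
proof -
 let ?F = "%\<tau>. - C / (d + \<tau>)"
 have der: "DERIV ?F x :> C / (d + x)^2" if "0 < ereal x" for x
  using that assms by (auto intro!: derivative_eq_intros simp: power2_eq_square)
 have cont: "isCont (%x. C / (d + x)^2) x" if "0 < ereal x" for x
  using that assms by (intro continuous_intros) auto
 have A: "((?F \<circ> real_of_ereal) \<longlongrightarrow> - C / d) (at_right 0)"
  unfolding zero_ereal_def ereal_tendsto_simps using assms by (auto intro!: tendsto_eq_intros)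
 have "filterlim (%\<tau>. d + \<tau>) at_top at_top"
  by (rule filterlim_tendsto_add_at_top[OF tendsto_const filterlim_ident])
 then have B: "((?F \<circ> real_of_ereal) \<longlongrightarrow> 0) (at_left \<infinity>)"
  unfolding ereal_tendsto_simps by (intro real_tendsto_divide_at_top[OF tendsto_const])
 note * = interval_integral_FTC_nonneg[of 0 \<infinity> ?F "%x. C / (d + x)^2", OF _ der cont _ A B]
 have s: "einterval 0 \<infinity> = {0<..}" by (auto simp: einterval_def zero_ereal_def)
 show "integrable lborel (%\<tau>. indicator {0<..} \<tau> *\<^sub>R (C / (d + \<tau>)^2))"
  using *(1) assms unfolding set_integrable_def s by auto
 have "(LBINT x=0..\<infinity>. C / (d + x)^2) = 0 - (- C / d)" by (rule *(2)) (use assms in auto)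
 then show "(\<integral>\<tau>. indicator {0<..} \<tau> *\<^sub>R (C / (d + \<tau>)^2) \<partial>lborel) = C / d"
  using interval_integral_to_infinity_eq[of lborel 0 "%x. C / (d + x)^2"]
  by (simp add: set_lebesgue_integral_def zero_ereal_def)
qed

lemma half_line_dominated:
 assumes cont: "continuous_on {0<..} f" and b: "!!\<tau>. 0 < \<tau> ==> norm (f \<tau>) <= C / (d + \<tau>)^2"
  and Cd: "0 <= C" "0 < d"
 shows "integrable lborel (%\<tau>. indicator {0<..} \<tau> *\<^sub>R f \<tau> :: complex)"
  and "norm (half_line_integral f) <= C / d"
proof -
 show i: "integrable lborel (%\<tau>. indicator {0<..} \<tau> *\<^sub>R f \<tau> :: complex)"
 proof (rule Bochner_Integration.integrable_bound[OF inverse_square_integral(1)[OF Cd]])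
  show "(%\<tau>. indicator {0<..} \<tau> *\<^sub>R f \<tau>) \<in> borel_measurable lborel"
   using borel_measurable_continuous_on_indicator[OF _ cont] by auto
  show "AE \<tau> in lborel. norm (indicator {0<..} \<tau> *\<^sub>R f \<tau>) <= norm (indicator {0<..} \<tau> *\<^sub>R (C / (d + \<tau>)^2))"
   using b Cd by (intro AE_I2) (auto simp: indicator_def abs_of_nonneg)
 qed
 have "norm (half_line_integral f) <= (\<integral>\<tau>. indicator {0<..} \<tau> *\<^sub>R (C / (d + \<tau>)^2) \<partial>lborel)"
  unfolding half_line_integral_def
  by (rule Bochner_Integration.integral_norm_bound_integral[OF i inverse_square_integral(1)[OF Cd]])
   (use b in \<open>auto simp: indicator_def\<close>)
 then show "norm (half_line_integral f) <= C / d" unfolding inverse_square_integral(2)[OF Cd] .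
qed

text \<open>
  Cauchy's estimate turns the domination of \<open>F\<close> into one of its derivative, so that no bound on
  derivatives has to be assumed.
\<close>

lemma half_line_integral_param:
 assumes S: "open S" and hol: "!!\<tau>. 0 < \<tau> ==> F \<tau> holomorphic_on S"
  and cont: "!!z. z \<in> S ==> continuous_on {0<..} (%\<tau>. F \<tau> z)"
  and b: "!!z \<tau>. z \<in> S ==> 0 < \<tau> ==> norm (F \<tau> z) <= C / (d + \<tau>)^2"
  and Cd: "0 <= C" "0 < d" and z0: "z0 \<in> S"
 shows "((%z. half_line_integral (%\<tau>. F \<tau> z)) has_field_derivative
   half_line_integral (%\<tau>. deriv (F \<tau>) z0)) (at z0)"
  and "integrable lborel (%\<tau>. indicator {0<..} \<tau> *\<^sub>R deriv (F \<tau>) z0)"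
proof -
 obtain r0 where r0: "r0 > 0" "cball z0 r0 <= S" using S z0 open_contains_cball by blast
 define r where "r = r0 / 2"
 have r: "r > 0" using r0 by (simp add: r_def)
 have sub: "cball z r <= S" if "z \<in> ball z0 r" for z
 proof -
  have "cball z r <= cball z0 r0"
   using that unfolding cball_subset_cball_iff by (auto simp: r_def dist_commute)
  then show ?thesis using r0 by blast
 qed
 have bS: "ball z0 r <= S" using sub r by force
 have db: "norm (deriv (F \<tau>) z) <= C / (d + \<tau>)^2 / r" if \<tau>: "0 < \<tau>" and z: "z \<in> ball z0 r" for \<tau> z
 proof -
  have "norm ((deriv ^^ 1) (F \<tau>) z) <= fact 1 * (C / (d + \<tau>)^2) / r ^ 1"
  proof (rule Cauchy_inequality)
   show "F \<tau> holomorphic_on ball z r"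
    using hol[OF \<tau>] sub[OF z] by (meson ball_subset_cball holomorphic_on_subset)
   show "continuous_on (cball z r) (F \<tau>)"
    using hol[OF \<tau>] sub[OF z] by (meson continuous_on_subset holomorphic_on_imp_continuous_on)
   fix x assume "norm (z - x) = r"
   then have "x \<in> S" using sub[OF z] by (auto simp: dist_norm)
   then show "norm (F \<tau> x) <= C / (d + \<tau>)^2" using b \<tau> by blast
  qed (rule r)
  then show ?thesis by simp
 qed
 have lip: "norm (F \<tau> z - F \<tau> z0) <= C / (d + \<tau>)^2 / r * norm (z - z0)" if \<tau>: "0 < \<tau>" and z: "z \<in> ball z0 r" for \<tau> z
 proof (rule field_differentiable_bound[OF convex_ball[of z0 r]])
  fix w assume "w \<in> ball z0 r"
  then show "(F \<tau> has_field_derivative deriv (F \<tau>) w) (at w within ball z0 r)"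
   using holomorphic_derivI[OF hol[OF \<tau>] S] bS by blast
 qed (use db[OF \<tau>] z r in auto)
 have int: "integrable lborel (%\<tau>. indicator {0<..} \<tau> *\<^sub>R F \<tau> z)" if "z \<in> S" for z
  by (rule half_line_dominated(1)[OF cont[OF that] b[OF that] Cd])
 have key: "integrable lborel (%\<tau>. indicator {0<..} \<tau> *\<^sub>R deriv (F \<tau>) z0) &
   (%i. (half_line_integral (%\<tau>. F \<tau> (X i)) - half_line_integral (%\<tau>. F \<tau> z0)) / (X i - z0))
   \<longlonglongrightarrow> half_line_integral (%\<tau>. deriv (F \<tau>) z0)"
  if X: "!!i. X i \<in> ball z0 r - {z0}" and lim: "X \<longlonglongrightarrow> z0" for X
 proof -
  define s where "s i \<tau> = indicator {0<..} \<tau> *\<^sub>R ((F \<tau> (X i) - F \<tau> z0) / (X i - z0))" for i \<tau>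
  have XS: "X i \<in> S" for i using X bS by blast
  have s_eq: "s i = (%\<tau>. (indicator {0<..} \<tau> *\<^sub>R F \<tau> (X i) - indicator {0<..} \<tau> *\<^sub>R F \<tau> z0) / (X i - z0))" for i
   by (auto simp: s_def indicator_def)
  have s_int: "integrable lborel (s i)" for i
   unfolding s_eq by (intro integrable_divide Bochner_Integration.integrable_diff int XS z0)
  have s_lim: "(%i. s i \<tau>) \<longlonglongrightarrow> indicator {0<..} \<tau> *\<^sub>R deriv (F \<tau>) z0" for \<tau>
  proof (cases "0 < \<tau>")
   case True
   have "((%y. (F \<tau> y - F \<tau> z0) / (y - z0)) \<longlongrightarrow> deriv (F \<tau>) z0) (at z0)"
    using holomorphic_derivI[OF hol[OF True] S z0] by (simp add: has_field_derivative_iff)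
   moreover have "filterlim X (at z0) sequentially"
    using lim X by (auto simp: filterlim_at)
   ultimately show ?thesis using True filterlim_compose unfolding s_def by fastforce
  qed (simp add: s_def)
  have bound: "norm (s i \<tau>) <= indicator {0<..} \<tau> *\<^sub>R (C / r / (d + \<tau>)^2)" for i \<tau>
  proof (cases "0 < \<tau>")
   case True
   have "norm (X i - z0) > 0" using X[of i] by auto
   moreover have "norm (F \<tau> (X i) - F \<tau> z0) <= C / (d + \<tau>)^2 / r * norm (X i - z0)"
    using lip[OF True] X by blast
   ultimately show ?thesis using True by (simp add: s_def norm_divide divide_le_eq mult.commute)
  qed (simp add: s_def)
  have meas: "(%\<tau>. indicator {0<..} \<tau> *\<^sub>R deriv (F \<tau>) z0) \<in> borel_measurable lborel"
   by (rule borel_measurable_LIMSEQ_metric[OF borel_measurable_integrable[OF s_int] s_lim])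
  have Cr: "0 <= C / r" using Cd r by simp
  have I: "integrable lborel (%\<tau>. indicator {0<..} \<tau> *\<^sub>R deriv (F \<tau>) z0)"
   and L: "(%i. integral\<^sup>L lborel (s i)) \<longlonglongrightarrow> (\<integral>\<tau>. indicator {0<..} \<tau> *\<^sub>R deriv (F \<tau>) z0 \<partial>lborel)"
   using integrable_dominated_convergence[OF meas borel_measurable_integrable[OF s_int]
     inverse_square_integral(1)[OF Cr Cd(2)] AE_I2[OF s_lim] AE_I2[OF bound]]
    integral_dominated_convergence[OF meas borel_measurable_integrable[OF s_int]
     inverse_square_integral(1)[OF Cr Cd(2)] AE_I2[OF s_lim] AE_I2[OF bound]] by blast+
  have "integral\<^sup>L lborel (s i) = (half_line_integral (%\<tau>. F \<tau> (X i)) - half_line_integral (%\<tau>. F \<tau> z0)) / (X i - z0)" for i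
   unfolding s_eq half_line_integral_def
   by (simp add: Bochner_Integration.integral_diff[OF int[OF XS] int[OF z0]])
  with I L show ?thesis by (simp add: half_line_integral_def)
 qed
 have X0: "z0 + of_real (r / real (i + 2)) \<in> ball z0 r - {z0}" for i
 proof -
  have "0 < r / real (i + 2)" "r / real (i + 2) < r" using r by (auto simp: field_simps add_pos_nonneg)
  then show ?thesis by (simp add: dist_norm del: of_real_divide of_nat_add)
 qed
 have "(%i. r / real (i + 2)) \<longlonglongrightarrow> 0"
  using LIMSEQ_ignore_initial_segment[OF lim_const_over_n[of r], of 2] by simp
 then have "(%i. z0 + of_real (r / real (i + 2))) \<longlonglongrightarrow> z0 + of_real 0" by (intro tendsto_intros)
 then show "integrable lborel (%\<tau>. indicator {0<..} \<tau> *\<^sub>R deriv (F \<tau>) z0)"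
  using key[OF X0] by simp
 have "((%y. (half_line_integral (%\<tau>. F \<tau> y) - half_line_integral (%\<tau>. F \<tau> z0)) / (y - z0))
   \<longlongrightarrow> half_line_integral (%\<tau>. deriv (F \<tau>) z0)) (at z0 within ball z0 r)"
  unfolding tendsto_at_iff_sequentially using key by (auto simp: o_def)
 then show "((%z. half_line_integral (%\<tau>. F \<tau> z)) has_field_derivative
   half_line_integral (%\<tau>. deriv (F \<tau>) z0)) (at z0)"
  using r by (simp add: has_field_derivative_iff at_within_open[of z0 "ball z0 r"])
qed

lemma ray_integral_primitive:
 assumes G: "open G" and ray: "!!x \<tau>. x \<in> G ==> 0 <= \<tau> ==> x + of_real \<tau> * \<omega> \<in> G"
  and g: "g holomorphic_on G"
  and B: "continuous_on G B" and d: "continuous_on G d" "!!x. x \<in> G ==> 0 < d x"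
  and bd: "!!x \<tau>. x \<in> G ==> 0 <= \<tau> ==> norm (g (x + of_real \<tau> * \<omega>)) <= B x / (d x + \<tau>)^2"
  and x: "x \<in> G"
 shows "(ray_integral \<omega> g has_field_derivative g x) (at x)"
  and "norm (ray_integral \<omega> g x) <= norm \<omega> * (B x / d x)"
proof -
 have cont: "continuous_on {0<..} (%\<tau>. g (y + of_real \<tau> * \<omega>))" if "y \<in> G" for y
  by (rule continuous_on_compose2[OF holomorphic_on_imp_continuous_on[OF g]])
   (use ray[OF that] in \<open>auto intro!: continuous_intros\<close>)
 have Bpos: "0 <= B y" if "y \<in> G" for y
 proof -
  have "0 <= B y / (d y + 0)^2" using bd[OF that, of 0] norm_ge_zero order_trans by blast
  then show ?thesis using d(2)[OF that] by (simp add: zero_le_divide_iff)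
 qed
 have "norm (half_line_integral (%\<tau>. g (x + of_real \<tau> * \<omega>))) <= B x / d x"
  by (rule half_line_dominated(2)[OF cont[OF x]]) (use bd[OF x] Bpos[OF x] d(2)[OF x] in auto)
 then show "norm (ray_integral \<omega> g x) <= norm \<omega> * (B x / d x)"
  unfolding ray_integral_def norm_mult norm_minus_cancel by (rule mult_left_mono) simp
 obtain r where r: "r > 0" "cball x r <= G" using G x open_contains_cball by blast
 have cx: "compact (cball x r)" "cball x r ~= {}" using r by auto
 obtain y1 where y1: "y1 \<in> cball x r" "!!y. y \<in> cball x r ==> B y <= B y1"
  using continuous_attains_sup[OF cx continuous_on_subset[OF B r(2)]] by blast
 obtain y2 where y2: "y2 \<in> cball x r" "!!y. y \<in> cball x r ==> d y2 <= d y"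
  using continuous_attains_inf[OF cx continuous_on_subset[OF d(1) r(2)]] by blast
 define C \<delta> where "C = B y1" and "\<delta> = d y2"
 have C: "0 <= C" "0 < \<delta>" using Bpos y1 d(2) y2 r by (auto simp: C_def \<delta>_def)
 have bC: "norm (g (y + of_real \<tau> * \<omega>)) <= C / (\<delta> + \<tau>)^2" if y: "y \<in> ball x r" and \<tau>: "0 <= \<tau>" for y \<tau>
 proof -
  have yG: "y \<in> G" "y \<in> cball x r" using y r by auto
  have "norm (g (y + of_real \<tau> * \<omega>)) <= B y / (d y + \<tau>)^2" by (rule bd[OF yG(1) \<tau>])
  also have "... <= C / (\<delta> + \<tau>)^2"
   unfolding C_def \<delta>_def using y1(2)[OF yG(2)] y2(2)[OF yG(2)] Bpos[OF yG(1)] C(2) \<tau>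
   by (intro frac_le power_mono zero_less_power) (auto simp: \<delta>_def)
  finally show ?thesis .
 qed
 define F where "F \<tau> y = g (y + of_real \<tau> * \<omega>)" for \<tau> :: real and y
 have derF: "(F \<tau> has_field_derivative deriv g (y + of_real \<tau> * \<omega>)) (at y)" if "0 <= \<tau>" "y \<in> G" for \<tau> y
 proof -
  have "((%y. y + of_real \<tau> * \<omega>) has_field_derivative 1) (at y)" by (auto intro!: derivative_eq_intros)
  from DERIV_chain2[where f = g and g = "%y. y + of_real \<tau> * \<omega>", OF holomorphic_derivI[OF g G ray[OF that(2,1)]] this]
  show ?thesis unfolding F_def by simp
 qed
 have holF: "F \<tau> holomorphic_on ball x r" if "0 < \<tau>" for \<tau>
  unfolding holomorphic_on_open[OF open_ball] using derF[of \<tau>] that r ball_subset_cball by (metis less_imp_le subsetD)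
 have bF: "norm (F \<tau> z) <= C / (\<delta> + \<tau>)^2" if "z \<in> ball x r" "0 < \<tau>" for z \<tau>
  using bC that by (simp add: F_def)
 have contF: "continuous_on {0<..} (%\<tau>. F \<tau> z)" if "z \<in> ball x r" for z
  unfolding F_def by (rule cont) (use that r in auto)
 have xb: "x \<in> ball x r" using r by simp
 note P = half_line_integral_param[OF open_ball holF contF bF C xb]
 have dF: "deriv (F \<tau>) x = deriv g (x + of_real \<tau> * \<omega>)" if "0 < \<tau>" for \<tau>
  using derF[of \<tau> x] that x by (intro DERIV_imp_deriv) auto
 have ind: "indicator {0<..} \<tau> *\<^sub>R deriv (F \<tau>) x = indicator {0<..} \<tau> *\<^sub>R deriv g (x + of_real \<tau> * \<omega>)" for \<tau>
  using dF by (auto simp: indicator_def)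
 define \<Phi> where "\<Phi> \<tau> = F \<tau> x" for \<tau>
 have derP: "(\<Phi> has_vector_derivative \<omega> * deriv g (x + of_real \<tau> * \<omega>)) (at \<tau>)" if "0 <= \<tau>" for \<tau>
 proof -
  have "((%\<tau>. x + of_real \<tau> * \<omega>) has_vector_derivative \<omega>) (at \<tau>)"
   by (auto intro!: derivative_eq_intros)
  from field_vector_diff_chain_at[OF this holomorphic_derivI[OF g G ray[OF x that]]]
  show ?thesis unfolding \<Phi>_def F_def o_def .
 qed
 have "set_integrable lborel {0<..} (%\<tau>. \<omega> * deriv g (x + of_real \<tau> * \<omega>))"
  using integrable_mult_right[OF P(2), of \<omega>] unfolding ind set_integrable_def by simp
 then have si: "set_integrable lborel (einterval 0 \<infinity>) (%\<tau>. \<omega> * deriv g (x + of_real \<tau> * \<omega>))"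
  by (simp add: zero_ereal_def)
 have "(LBINT \<tau>=0..\<infinity>. \<omega> * deriv g (x + of_real \<tau> * \<omega>)) = 0 - g x"
 proof (rule interval_integral_FTC_integrable[where F = \<Phi>])
  show "(\<Phi> has_vector_derivative \<omega> * deriv g (x + of_real \<tau> * \<omega>)) (at \<tau>)" if "0 < ereal \<tau>" for \<tau>
   using derP that by simp
  show "isCont (%\<tau>. \<omega> * deriv g (x + of_real \<tau> * \<omega>)) \<tau>" if "0 < ereal \<tau>" for \<tau>
  proof -
   have "isCont (deriv g) (x + of_real \<tau> * \<omega>)"
    using holomorphic_on_imp_continuous_on[OF holomorphic_deriv[OF g G]] ray[OF x, of \<tau>] that G
    by (simp add: continuous_on_eq_continuous_at)
   moreover have "isCont (%\<tau>. x + of_real \<tau> * \<omega>) \<tau>" by (intro continuous_intros)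
   ultimately have "isCont (%\<tau>. deriv g (x + of_real \<tau> * \<omega>)) \<tau>"
    by (rule isCont_o2[rotated])
   then show ?thesis by (intro continuous_intros)
  qed
  have "isCont \<Phi> 0" using derP[of 0] has_vector_derivative_continuous by auto
  then have "(\<Phi> \<longlongrightarrow> g x) (at_right 0)"
   by (simp add: isCont_def \<Phi>_def F_def filterlim_at_split)
  then show "((\<Phi> \<circ> real_of_ereal) \<longlongrightarrow> g x) (at_right 0)"
   unfolding zero_ereal_def ereal_tendsto_simps .
  have "(\<Phi> \<longlongrightarrow> 0) at_top"
  proof (rule Lim_null_comparison)
   show "\<forall>\<^sub>F \<tau> in at_top. norm (\<Phi> \<tau>) <= C / (\<delta> + \<tau>)^2"
    using eventually_gt_at_top[of 0] by eventually_elim (use bF xb in \<open>auto simp: \<Phi>_def\<close>)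
   have "filterlim (%\<tau>. \<delta> + \<tau>) at_top at_top"
    by (rule filterlim_tendsto_add_at_top[OF tendsto_const filterlim_ident])
   then show "((%\<tau>. C / (\<delta> + \<tau>)^2) \<longlongrightarrow> 0) at_top"
    by (intro real_tendsto_divide_at_top[OF tendsto_const] filterlim_pow_at_top) auto
  qed
  then show "((\<Phi> \<circ> real_of_ereal) \<longlongrightarrow> 0) (at_left \<infinity>)"
   unfolding ereal_tendsto_simps .
 qed (use si in auto)
 then have "half_line_integral (%\<tau>. \<omega> * deriv g (x + of_real \<tau> * \<omega>)) = - g x"
  using interval_integral_to_infinity_eq[of lborel 0 "%\<tau>. \<omega> * deriv g (x + of_real \<tau> * \<omega>)"]
  unfolding set_lebesgue_integral_def zero_ereal_def half_line_integral_def by (simp del: mult_scaleR_right)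
 moreover have "half_line_integral (%\<tau>. \<omega> * deriv g (x + of_real \<tau> * \<omega>)) = \<omega> * half_line_integral (%\<tau>. deriv (F \<tau>) x)"
  unfolding half_line_integral_def ind mult_scaleR_right[symmetric]
  by (rule Bochner_Integration.integral_mult_right_zero)
 ultimately have "- \<omega> * half_line_integral (%\<tau>. deriv (F \<tau>) x) = g x" by simp
 moreover have "((%y. - \<omega> * half_line_integral (%\<tau>. F \<tau> y)) has_field_derivative
   - \<omega> * half_line_integral (%\<tau>. deriv (F \<tau>) x)) (at x)"
  by (rule DERIV_cmult[OF P(1)])
 ultimately show "(ray_integral \<omega> g has_field_derivative g x) (at x)"
  unfolding ray_integral_def F_def by simp
qed

section \<open>First-order linear equations solved from infinity\<close>

text \<open>
  The branch of the logarithm with arguments in \<open>(- \<pi> / 2, 3 * \<pi> / 2)\<close>, which is the larger sector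
  in its normal position.
\<close>

definition up_log :: "complex => complex" where
 "up_log x = Ln (x / \<i>) + \<i> * of_real (pi / 2)"

definition cut_plane :: "complex set" where
 "cut_plane = {x. x / \<i> \<notin> \<real>\<^sub>\<le>\<^sub>0}"

lemma cut_plane_iff: "x \<in> cut_plane \<longleftrightarrow> Re x ~= 0 \<or> 0 < Im x"
 by (auto simp: cut_plane_def complex_nonpos_Reals_iff)

lemma up_log:
 assumes "x \<in> cut_plane"
 shows "x ~= 0" "exp (up_log x) = x" "(up_log has_field_derivative 1 / x) (at x)"
  "Re (up_log x) = ln (norm x)" "- pi / 2 < Im (up_log x)" "Im (up_log x) < 3 * pi / 2"
proof -
 show x: "x ~= 0" using assms by (auto simp: cut_plane_def)
 have e: "exp (\<i> * of_real (pi / 2)) = \<i>" using cis_conv_exp[of "pi / 2"] cis_pi_half by simp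
 have "exp (Ln (x / \<i>)) = x / \<i>" "x / \<i> * \<i> = x" using x by (simp, simp add: complex_eq_iff)
 then show "exp (up_log x) = x" by (simp only: up_log_def exp_add e)
 have "((%x. Ln (x / \<i>) + \<i> * of_real (pi / 2)) has_field_derivative 1 / x) (at x)"
 proof -
  have "((%x. x / \<i>) has_field_derivative 1 / \<i>) (at x)"
   by (rule DERIV_cdivide[OF DERIV_ident])
  from DERIV_chain2[OF has_field_derivative_Ln this]
  have "((%x. Ln (x / \<i>)) has_field_derivative inverse (x / \<i>) * (1 / \<i>)) (at x)"
   using assms by (simp add: cut_plane_def)
  moreover have "inverse (x / \<i>) * (1 / \<i>) = 1 / x" using x by (simp add: field_simps)
  ultimately have "((%x. Ln (x / \<i>)) has_field_derivative 1 / x) (at x)" by (simp only:)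
  from DERIV_add[OF this DERIV_const] show ?thesis by simp
 qed
 then show "(up_log has_field_derivative 1 / x) (at x)" by (simp add: up_log_def[abs_def])
 show "Re (up_log x) = ln (norm x)" using x by (simp add: up_log_def norm_divide norm_mult)
 have "Im (Ln (x / \<i>)) < pi"
  using assms x by (simp add: cut_plane_def Im_Ln_less_pi)
 then show "- pi / 2 < Im (up_log x)" "Im (up_log x) < 3 * pi / 2"
  using mpi_less_Im_Ln[of "x / \<i>"] x by (auto simp: up_log_def)
qed

lemma up_log_holomorphic: "up_log holomorphic_on cut_plane"
 using up_log(3) by (meson field_differentiable_at_within field_differentiable_def holomorphic_onI)

text \<open>
  The function \<open>exp (2 * \<sigma> * x) * x powr (- a)\<close> on the cut plane, which spans the solutions of
  \<open>y' = (2 * \<sigma> - a / x) * y\<close>.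
\<close>

definition gauge_fun :: "complex => complex => complex => complex" where
 "gauge_fun \<sigma> a x = exp (2 * \<sigma> * x - a * up_log x)"

lemma gauge_fun_nonzero [simp]: "gauge_fun \<sigma> a x ~= 0"
 by (simp add: gauge_fun_def)

lemma gauge_fun_deriv:
 assumes "x \<in> cut_plane"
 shows "(gauge_fun \<sigma> a has_field_derivative (2 * \<sigma> - a / x) * gauge_fun \<sigma> a x) (at x)"
proof -
 have "((%x. exp (2 * \<sigma> * x - a * up_log x)) has_field_derivative
   exp (2 * \<sigma> * x - a * up_log x) * (2 * \<sigma> * 1 - a * (1 / x))) (at x)"
  by (intro DERIV_chain2[OF DERIV_exp] DERIV_diff DERIV_cmult up_log(3) assms DERIV_ident)
 then show ?thesis by (simp add: gauge_fun_def[abs_def] mult.commute)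
qed

lemma gauge_fun_holomorphic: "S <= cut_plane ==> gauge_fun \<sigma> a holomorphic_on S"
 using gauge_fun_deriv
 by (meson field_differentiable_at_within field_differentiable_def holomorphic_onI subsetD)

lemma log_ratio_bound:
 assumes x: "x \<in> cut_plane" "1 <= norm x" and y: "x + of_real \<tau> * \<omega> \<in> cut_plane" "1 <= norm (x + of_real \<tau> * \<omega>)"
  and \<tau>: "0 <= \<tau>"
 shows "norm (exp (a * (up_log (x + of_real \<tau> * \<omega>) - up_log x))) <= exp (norm a * (2 * pi + ln (1 + norm \<omega> * \<tau>)))"
proof -
 define y where "y = x + of_real \<tau> * \<omega>"
 define D where "D = up_log y - up_log x"
 define q where "q = 1 + norm \<omega> * \<tau>"
 have q: "1 <= q" using \<tau> by (simp add: q_def)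
 have p: "0 < norm x" "0 < norm y" using x y by (auto simp: y_def)
 have "norm y <= norm x + norm \<omega> * \<tau>"
  unfolding y_def using norm_triangle_ineq[of x "of_real \<tau> * \<omega>"] \<tau> by (simp add: norm_mult mult.commute)
 also have "... <= norm x * q"
  using mult_right_mono[OF x(2), of "norm \<omega> * \<tau>"] \<tau> by (simp add: q_def algebra_simps)
 finally have "ln (norm y) <= ln (norm x * q)" using p q by (intro ln_mono) auto
 then have 1: "ln (norm y) - ln (norm x) <= ln q" using p q by (simp add: ln_mult)
 have "norm x <= norm y + norm \<omega> * \<tau>"
  unfolding y_def using norm_triangle_ineq4[of "x + of_real \<tau> * \<omega>" "of_real \<tau> * \<omega>"] \<tau> by (simp add: norm_mult mult.commute)
 also have "... <= norm y * q"
  using mult_right_mono[OF y(2), of "norm \<omega> * \<tau>"] \<tau> by (simp add: q_def y_def algebra_simps)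
 finally have "ln (norm x) <= ln (norm y * q)" using p q by (intro ln_mono) auto
 then have 2: "ln (norm x) - ln (norm y) <= ln q" using p q by (simp add: ln_mult)
 have "\<bar>Re D\<bar> <= ln q" using 1 2 up_log(4)[OF x(1)] up_log(4)[OF y(1)] by (simp add: D_def y_def)
 moreover have "\<bar>Im D\<bar> <= 2 * pi"
  using up_log(5,6)[OF x(1)] up_log(5,6)[OF y(1)] by (simp add: D_def y_def)
 ultimately have "norm D <= ln q + 2 * pi" using cmod_le[of D] by simp
 then have "norm a * norm D <= norm a * (2 * pi + ln q)" by (intro mult_left_mono) auto
 moreover have "Re (a * D) <= norm a * norm D" using complex_Re_le_cmod[of "a * D"] by (simp add: norm_mult)
 ultimately show ?thesis by (simp add: D_def y_def q_def)
qed

lemma exp_beats_polynomial: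
 fixes W p s :: real
 assumes "0 <= W" "0 <= p"
 obtains C where "0 <= C" "!!\<tau>. 0 <= \<tau> ==>
   exp (- 2 * \<tau>) * exp (p * (s + ln (1 + W * \<tau>))) * (1 + W * \<tau>) ^ n <= C / (1 + \<tau>)^2"
proof -
 define m where "m = nat \<lceil>p\<rceil> + n"
 define C where "C = exp (p * s) * (1 + W) ^ m * (fact (m + 2) * exp 1)"
 have "exp (- 2 * \<tau>) * exp (p * (s + ln (1 + W * \<tau>))) * (1 + W * \<tau>) ^ n <= C / (1 + \<tau>)^2" if \<tau>: "0 <= \<tau>" for \<tau>
 proof -
  define q where "q = 1 + W * \<tau>"
  have q: "1 <= q" "q <= (1 + W) * (1 + \<tau>)" using \<tau> assms by (auto simp: q_def algebra_simps)
  have "exp (p * ln q) <= exp (real (nat \<lceil>p\<rceil>) * ln q)"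
   using q real_nat_ceiling_ge[of p] by (intro exp_le_cancel_iff[THEN iffD2] mult_right_mono) auto
  also have "... = q ^ nat \<lceil>p\<rceil>" using q by (simp add: exp_of_nat_mult)
  finally have "exp (p * ln q) * q ^ n <= q ^ m" using q by (simp add: m_def power_add mult_right_mono)
  also have "... <= ((1 + W) * (1 + \<tau>)) ^ m" using q by (intro power_mono) auto
  finally have 1: "exp (p * ln q) * q ^ n <= (1 + W) ^ m * (1 + \<tau>) ^ m" by (simp add: power_mult_distrib)
  have "(1 + \<tau>) ^ (m + 2) / fact (m + 2) <= exp (1 + \<tau>)"
  proof -
   have "(\<Sum>k\<in>{m + 2}. (1 + \<tau>) ^ k /\<^sub>R fact k) <= (\<Sum>k. (1 + \<tau>) ^ k /\<^sub>R fact k)"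
    using summable_exp_generic[of "1 + \<tau>"] \<tau> by (intro sum_le_suminf) auto
   then show ?thesis by (simp add: exp_def divide_inverse mult.commute)
  qed
  then have "(1 + \<tau>) ^ (m + 2) <= exp (1 + \<tau>) * fact (m + 2)"
   by (subst (asm) pos_divide_le_eq) auto
  then have 2: "(1 + \<tau>) ^ m * (1 + \<tau>)^2 <= fact (m + 2) * (exp 1 * exp \<tau>)"
   unfolding power_add exp_add by (simp only: mult_ac)
  have "exp (- 2 * \<tau>) * exp (p * (s + ln q)) * q ^ n * (1 + \<tau>)^2
    = exp (p * s) * exp (- 2 * \<tau>) * (exp (p * ln q) * q ^ n) * (1 + \<tau>)^2"
   by (simp add: exp_add distrib_left)
  also have "... <= exp (p * s) * exp (- 2 * \<tau>) * ((1 + W) ^ m * (1 + \<tau>) ^ m) * (1 + \<tau>)^2"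
   using 1 by (intro mult_right_mono mult_left_mono) auto
  also have "... = exp (p * s) * exp (- 2 * \<tau>) * (1 + W) ^ m * ((1 + \<tau>) ^ m * (1 + \<tau>)^2)" by simp
  also have "... <= exp (p * s) * exp (- 2 * \<tau>) * (1 + W) ^ m * (fact (m + 2) * (exp 1 * exp \<tau>))"
   using 2 assms by (intro mult_left_mono) auto
  also have "... = C * (exp (- 2 * \<tau>) * exp \<tau>)" by (simp add: C_def)
  also have "exp (- 2 * \<tau>) * exp \<tau> = exp (- \<tau>)" by (simp flip: exp_add)
  also have "C * exp (- \<tau>) <= C" using \<tau> assms by (intro mult_left_le) (auto simp: C_def)
  finally show ?thesis using \<tau> by (simp add: le_divide_eq q_def)
 qed
 moreover have "0 <= C" using assms by (simp add: C_def)
 ultimately show thesis by (rule that[rotated])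
qed

text \<open>
  Variation of constants with the constant fixed at infinity.
\<close>

definition gauge_inverse :: "complex => complex => complex => (complex => complex) => complex => complex" where
 "gauge_inverse \<sigma> a \<omega> g x = gauge_fun \<sigma> a x * ray_integral \<omega> (%y. g y / gauge_fun \<sigma> a y) x"

definition ray_domain :: "complex => complex set => bool" where
 "ray_domain \<omega> G \<longleftrightarrow> open G & G <= cut_plane & (\<forall>x\<in>G. 1 <= norm x) &
   (\<forall>x\<in>G. \<forall>\<tau>\<ge>0. x + of_real \<tau> * \<omega> \<in> G)"

text \<open>
  Along a ray with \<open>Re (\<sigma> * \<omega>) = 1\<close> the gauge grows like \<open>exp (2 * \<tau>)\<close>, up to powers that depend only on
  \<open>a\<close>. The estimate is uniform in the base point and leaves room for a further power \<open>n\<close>.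
\<close>

lemma gauge_ratio:
 assumes \<sigma>: "Re (\<sigma> * \<omega>) = 1"
 obtains C where "0 <= C" "!!G x \<tau>. ray_domain \<omega> G ==> x \<in> G ==> 0 <= \<tau> ==>
   norm (gauge_fun \<sigma> a x) * (1 + norm \<omega> * \<tau>) ^ n <= C / (1 + \<tau>)^2 * norm (gauge_fun \<sigma> a (x + of_real \<tau> * \<omega>))"
proof -
 obtain C where C: "0 <= C" "!!\<tau>. 0 <= \<tau> ==>
   exp (- 2 * \<tau>) * exp (norm a * (2 * pi + ln (1 + norm \<omega> * \<tau>))) * (1 + norm \<omega> * \<tau>) ^ n <= C / (1 + \<tau>)^2"
  using exp_beats_polynomial[of "norm \<omega>" "norm a" "2 * pi" n] by auto
 have "norm (gauge_fun \<sigma> a x) * (1 + norm \<omega> * \<tau>) ^ n <= C / (1 + \<tau>)^2 * norm (gauge_fun \<sigma> a (x + of_real \<tau> * \<omega>))"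
  if G: "ray_domain \<omega> G" "x \<in> G" and \<tau>: "0 <= \<tau>" for G x \<tau>
 proof -
  define y where "y = x + of_real \<tau> * \<omega>"
  have yG: "y \<in> G" using G \<tau> by (auto simp: ray_domain_def y_def)
  have cp: "x \<in> cut_plane" "y \<in> cut_plane" "1 <= norm x" "1 <= norm y" using G yG by (auto simp: ray_domain_def)
  have "gauge_fun \<sigma> a x = exp (- 2 * (of_real \<tau> * (\<sigma> * \<omega>))) * exp (a * (up_log y - up_log x)) * gauge_fun \<sigma> a y"
   by (simp add: gauge_fun_def y_def algebra_simps flip: exp_add)
  then have "norm (gauge_fun \<sigma> a x) = exp (- 2 * \<tau>) * norm (exp (a * (up_log y - up_log x))) * norm (gauge_fun \<sigma> a y)"
   using \<sigma> by (simp add: norm_mult del: norm_exp_eq_Re) (simp add: norm_exp_eq_Re)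
  also have "... <= exp (- 2 * \<tau>) * exp (norm a * (2 * pi + ln (1 + norm \<omega> * \<tau>))) * norm (gauge_fun \<sigma> a y)"
   using log_ratio_bound[of x \<tau> \<omega> a] cp \<tau> by (intro mult_right_mono mult_left_mono) (auto simp: y_def)
  finally have "norm (gauge_fun \<sigma> a x) * (1 + norm \<omega> * \<tau>) ^ n \<le>
    exp (- 2 * \<tau>) * exp (norm a * (2 * pi + ln (1 + norm \<omega> * \<tau>))) * norm (gauge_fun \<sigma> a y) * (1 + norm \<omega> * \<tau>) ^ n"
   using \<tau> by (intro mult_right_mono) auto
  also have "... = (exp (- 2 * \<tau>) * exp (norm a * (2 * pi + ln (1 + norm \<omega> * \<tau>))) * (1 + norm \<omega> * \<tau>) ^ n) * norm (gauge_fun \<sigma> a y)"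
   by simp
  also have "... <= C / (1 + \<tau>)^2 * norm (gauge_fun \<sigma> a y)" using C(2)[OF \<tau>] by (intro mult_right_mono) auto
  finally show ?thesis by (simp add: y_def)
 qed
 with C(1) show thesis by (rule that)
qed

text \<open>
  A source bounded by a multiple of \<open>w\<close> yields a solution bounded by a multiple of the same \<open>w\<close>. The weight
  \<open>w\<close> may grow polynomially along the ray, since the gauge grows exponentially.
\<close>

lemma gauge_inverse_solves:
 assumes \<sigma>: "Re (\<sigma> * \<omega>) = 1"
 obtains C where "0 < C"
  "!!G w g A x. ray_domain \<omega> G ==> continuous_on G w ==>
    (!!x \<tau>. x \<in> G ==> 0 <= \<tau> ==> w (x + of_real \<tau> * \<omega>) <= M * (1 + norm \<omega> * \<tau>) ^ n * w x) ==>
    g holomorphic_on G ==> 0 <= A ==> (!!x. x \<in> G ==> norm (g x) <= A * w x) ==> x \<in> G ==>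
    (gauge_inverse \<sigma> a \<omega> g has_field_derivative (2 * \<sigma> - a / x) * gauge_inverse \<sigma> a \<omega> g x + g x) (at x) &
    norm (gauge_inverse \<sigma> a \<omega> g x) <= C * A * w x &
    integrable lborel (%\<tau>. indicator {0<..} \<tau> *\<^sub>R (g (x + of_real \<tau> * \<omega>) / gauge_fun \<sigma> a (x + of_real \<tau> * \<omega>)))"
proof -
 obtain C0 where C0: "0 <= C0" "!!G x \<tau>. ray_domain \<omega> G ==> x \<in> G ==> 0 <= \<tau> ==>
   norm (gauge_fun \<sigma> a x) * (1 + norm \<omega> * \<tau>) ^ n <= C0 / (1 + \<tau>)^2 * norm (gauge_fun \<sigma> a (x + of_real \<tau> * \<omega>))"
  using gauge_ratio[OF \<sigma>, of a n] by auto
 define C where "C = norm \<omega> * (\<bar>M\<bar> * C0) + 1"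
 have Cpos: "0 < C" using C0(1) by (auto simp: C_def intro!: add_nonneg_pos)
 have main: "(gauge_inverse \<sigma> a \<omega> g has_field_derivative (2 * \<sigma> - a / x) * gauge_inverse \<sigma> a \<omega> g x + g x) (at x) &
    norm (gauge_inverse \<sigma> a \<omega> g x) <= C * A * w x &
    integrable lborel (%\<tau>. indicator {0<..} \<tau> *\<^sub>R (g (x + of_real \<tau> * \<omega>) / gauge_fun \<sigma> a (x + of_real \<tau> * \<omega>)))"
  if rd: "ray_domain \<omega> G" and wc: "continuous_on G w"
   and wg: "!!x \<tau>. x \<in> G ==> 0 <= \<tau> ==> w (x + of_real \<tau> * \<omega>) <= M * (1 + norm \<omega> * \<tau>) ^ n * w x"
   and g: "g holomorphic_on G" and A: "0 <= A" and gb: "!!x. x \<in> G ==> norm (g x) <= A * w x"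
   and x: "x \<in> G" for G w g A x
 proof -
  have G: "open G" "G <= cut_plane" "!!x \<tau>. x \<in> G ==> 0 <= \<tau> ==> x + of_real \<tau> * \<omega> \<in> G"
   using rd by (auto simp: ray_domain_def)
  have Aw: "0 <= A * w y" if "y \<in> G" for y using gb[OF that] norm_ge_zero order_trans by blast
  define h where "h y = g y / gauge_fun \<sigma> a y" for y
  define B where "B y = A * (\<bar>M\<bar> * w y) * C0 / norm (gauge_fun \<sigma> a y)" for y
  have hh: "h holomorphic_on G"
   unfolding h_def by (intro holomorphic_intros g gauge_fun_holomorphic G) auto
  have cg: "continuous_on G (gauge_fun \<sigma> a)"
   by (intro holomorphic_on_imp_continuous_on gauge_fun_holomorphic G)
  have hb: "norm (h (y + of_real \<tau> * \<omega>)) <= B y / (1 + \<tau>)^2" if y: "y \<in> G" and \<tau>: "0 <= \<tau>" for y \<tau>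
  proof -
   let ?y = "y + of_real \<tau> * \<omega>"
   let ?q = "(1 + norm \<omega> * \<tau>) ^ n"
   have gp: "0 < norm (gauge_fun \<sigma> a y)" "0 < norm (gauge_fun \<sigma> a ?y)" by auto
   have "norm (g ?y) <= A * w ?y" by (rule gb[OF G(3)[OF y \<tau>]])
   also have "... <= A * (M * ?q * w y)" by (rule mult_left_mono[OF wg[OF y \<tau>] A])
   also have "... = (A * w y) * M * ?q" by simp
   also have "... <= (A * w y) * \<bar>M\<bar> * ?q" using Aw[OF y] \<tau> by (intro mult_right_mono mult_left_mono) auto
   finally have "norm (g ?y) * norm (gauge_fun \<sigma> a y) <= (A * w y) * \<bar>M\<bar> * ?q * norm (gauge_fun \<sigma> a y)"
    by (rule mult_right_mono) simp
   also have "... = (A * w y) * \<bar>M\<bar> * (norm (gauge_fun \<sigma> a y) * ?q)" by simp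
   also have "... <= (A * w y) * \<bar>M\<bar> * (C0 / (1 + \<tau>)^2 * norm (gauge_fun \<sigma> a ?y))"
    using C0(2)[OF rd y \<tau>] Aw[OF y] by (intro mult_left_mono) auto
   finally have "norm (g ?y) * norm (gauge_fun \<sigma> a y) <= (A * w y) * \<bar>M\<bar> * C0 / (1 + \<tau>)^2 * norm (gauge_fun \<sigma> a ?y)"
    by simp
   then have "norm (g ?y) * norm (gauge_fun \<sigma> a y) <= (A * (\<bar>M\<bar> * w y) * C0) / (1 + \<tau>)^2 * norm (gauge_fun \<sigma> a ?y)"
    by (simp only: mult_ac)
   moreover have "n / q <= X / p / s" if "n * p <= X / s * q" "0 < p" "0 < q" "0 < s" for n p q X s :: real
    using that by (simp add: field_simps)
   moreover have "0 < (1 + \<tau>)^2" using \<tau> by simp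
   ultimately show ?thesis using gp unfolding h_def B_def norm_divide by blast
  qed
  have Bc: "continuous_on G B" unfolding B_def by (intro continuous_intros wc cg) auto
  have P: "(ray_integral \<omega> h has_field_derivative h x) (at x)"
   "norm (ray_integral \<omega> h x) <= norm \<omega> * (B x / 1)"
   by (rule ray_integral_primitive[OF G(1) _ hh Bc, where d = "%_. 1"]; use G(3) hb x in auto)+
  have J: "gauge_inverse \<sigma> a \<omega> g = (%x. gauge_fun \<sigma> a x * ray_integral \<omega> h x)"
   by (auto simp: gauge_inverse_def h_def[abs_def])
  have "(gauge_inverse \<sigma> a \<omega> g has_field_derivative
    (2 * \<sigma> - a / x) * gauge_fun \<sigma> a x * ray_integral \<omega> h x + h x * gauge_fun \<sigma> a x) (at x)"
   unfolding J using x G by (intro DERIV_mult gauge_fun_deriv P(1)) auto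
  then have "(gauge_inverse \<sigma> a \<omega> g has_field_derivative (2 * \<sigma> - a / x) * gauge_inverse \<sigma> a \<omega> g x + g x) (at x)"
   by (simp add: J h_def mult.assoc)
  moreover have "norm (gauge_inverse \<sigma> a \<omega> g x) <= C * A * w x"
  proof -
   have "norm (gauge_inverse \<sigma> a \<omega> g x) <= norm (gauge_fun \<sigma> a x) * (norm \<omega> * (B x / 1))"
    unfolding J norm_mult by (rule mult_left_mono[OF P(2)]) simp
   also have "... = norm \<omega> * (\<bar>M\<bar> * C0) * (A * w x)" by (simp add: B_def)
   also have "... <= C * (A * w x)" using Aw[OF x] by (intro mult_right_mono) (auto simp: C_def)
   finally show ?thesis by (simp add: mult.assoc)
  qed
  moreover have "integrable lborel (%\<tau>. indicator {0<..} \<tau> *\<^sub>R h (x + of_real \<tau> * \<omega>))"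
  proof (rule half_line_dominated(1))
   show "continuous_on {0<..} (%\<tau>. h (x + of_real \<tau> * \<omega>))"
    by (rule continuous_on_compose2[OF holomorphic_on_imp_continuous_on[OF hh]])
     (use G(3)[OF x] in \<open>auto intro!: continuous_intros\<close>)
   show "norm (h (x + of_real \<tau> * \<omega>)) <= B x / (1 + \<tau>)^2" if "0 < \<tau>" for \<tau>
    using hb[OF x] that by simp
   show "0 <= B x" using Aw[OF x] C0(1) unfolding B_def
    by (metis (no_types, opaque_lifting) abs_ge_zero divide_nonneg_nonneg mult.left_commute mult_nonneg_nonneg norm_ge_zero)
  qed simp
  ultimately show ?thesis unfolding h_def by blast
 qed
 show thesis
 proof (rule that[of C, OF Cpos])
  fix G w g A x
  assume p: "ray_domain \<omega> G" "continuous_on G w"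
    "!!x \<tau>. x \<in> G ==> 0 <= \<tau> ==> w (x + of_real \<tau> * \<omega>) <= M * (1 + norm \<omega> * \<tau>) ^ n * w x"
    "g holomorphic_on G" "0 <= A" "!!x. x \<in> G ==> norm (g x) <= A * w x" "x \<in> G"
  show "(gauge_inverse \<sigma> a \<omega> g has_field_derivative (2 * \<sigma> - a / x) * gauge_inverse \<sigma> a \<omega> g x + g x) (at x) &
    norm (gauge_inverse \<sigma> a \<omega> g x) <= C * A * w x &
    integrable lborel (%\<tau>. indicator {0<..} \<tau> *\<^sub>R (g (x + of_real \<tau> * \<omega>) / gauge_fun \<sigma> a (x + of_real \<tau> * \<omega>)))"
   by (rule main[OF p])
 qed
qed

lemma gauge_inverse_diff:
 assumes "integrable lborel (%\<tau>. indicator {0<..} \<tau> *\<^sub>R (f (x + of_real \<tau> * \<omega>) / gauge_fun \<sigma> a (x + of_real \<tau> * \<omega>)))"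
  "integrable lborel (%\<tau>. indicator {0<..} \<tau> *\<^sub>R (g (x + of_real \<tau> * \<omega>) / gauge_fun \<sigma> a (x + of_real \<tau> * \<omega>)))"
 shows "gauge_inverse \<sigma> a \<omega> (%y. f y - g y) x = gauge_inverse \<sigma> a \<omega> f x - gauge_inverse \<sigma> a \<omega> g x"
 unfolding gauge_inverse_def ray_integral_def half_line_integral_def
  diff_divide_distrib scaleR_diff_right Bochner_Integration.integral_diff[OF assms]
 by (simp add: algebra_simps)

text \<open>
  Such a solution is a multiple of the gauge, which is unbounded along the ray.
\<close>

lemma bounded_homogeneous_solution_zero:
 assumes \<sigma>: "Re (\<sigma> * \<omega>) = 1" and G: "ray_domain \<omega> G" "connected G"
  and y: "!!x. x \<in> G ==> (y has_field_derivative (2 * \<sigma> - a / x) * y x) (at x)"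
  and b: "!!x. x \<in> G ==> norm (y x) <= D" and x: "x \<in> G"
 shows "y x = 0"
proof -
 have G': "open G" "G <= cut_plane" "!!x \<tau>. x \<in> G ==> 0 <= \<tau> ==> x + of_real \<tau> * \<omega> \<in> G"
  using G by (auto simp: ray_domain_def)
 have "((%x. y x / gauge_fun \<sigma> a x) has_field_derivative 0) (at z)" if z: "z \<in> G" for z
 proof -
  have "z \<in> cut_plane" using z G' by blast
  from DERIV_divide[OF y[OF z] gauge_fun_deriv[OF this], of \<sigma> a] show ?thesis by simp
 qed
 then obtain c where c: "!!z. z \<in> G ==> y z / gauge_fun \<sigma> a z = c"
  using DERIV_zero_connected_constant[OF G(2) G'(1), of "{}" "%x. y x / gauge_fun \<sigma> a x"]
  by (metis (no_types, lifting) Diff_empty continuous_at_imp_continuous_on DERIV_isCont finite.emptyI)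
 obtain C where C: "0 <= C" "!!G x \<tau>. ray_domain \<omega> G ==> x \<in> G ==> 0 <= \<tau> ==>
   norm (gauge_fun \<sigma> a x) * (1 + norm \<omega> * \<tau>) ^ 0 <= C / (1 + \<tau>)^2 * norm (gauge_fun \<sigma> a (x + of_real \<tau> * \<omega>))"
  using gauge_ratio[OF \<sigma>, of a 0] by auto
 have "norm (y x) <= C / (1 + \<tau>)^2 * D" if \<tau>: "0 <= \<tau>" for \<tau>
 proof -
  have "norm (y x) = norm c * norm (gauge_fun \<sigma> a x)" using c[OF x] by (auto simp: norm_mult norm_divide field_simps)
  also have "... <= norm c * (C / (1 + \<tau>)^2 * norm (gauge_fun \<sigma> a (x + of_real \<tau> * \<omega>)))"
   using C(2)[OF G(1) x \<tau>] by (intro mult_left_mono) auto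
  also have "... = C / (1 + \<tau>)^2 * norm (y (x + of_real \<tau> * \<omega>))"
   using c[OF G'(3)[OF x \<tau>]] by (auto simp: norm_mult norm_divide field_simps)
  also have "... <= C / (1 + \<tau>)^2 * D" using b[OF G'(3)[OF x \<tau>]] C(1) by (intro mult_left_mono) auto
  finally show ?thesis .
 qed
 moreover have "((%\<tau>. C / (1 + \<tau>)^2 * D) \<longlongrightarrow> 0 * D) at_top"
  by (intro tendsto_intros real_tendsto_divide_at_top[OF tendsto_const] filterlim_pow_at_top
    filterlim_tendsto_add_at_top[OF tendsto_const] filterlim_ident) auto
 ultimately have "norm (y x) <= 0 * D"
  by (intro tendsto_lowerbound[where F = at_top and f = "%\<tau>. C / (1 + \<tau>)^2 * D"])
   (auto intro: eventually_mono[OF eventually_ge_at_top[of 0]])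
 then show ?thesis by simp
qed

section \<open>Factorisation of the linearised equation\<close>

text \<open>
  With \<open>b = exp_lo\<close> and \<open>a = exp_hi\<close>, the product \<open>(d/dx + 2 + a/x) (d/dx - 2 + b/x)\<close> is
  \<open>d\<^sup>2/dx\<^sup>2 + (1/x) d/dx - 4 - (al - be) / x\<close> up to a term of order \<open>1 / x\<^sup>2\<close>, because \<open>a + b = 1\<close> and
  \<open>2 * (b - a) = - (al - be)\<close>.
\<close>

definition exp_lo :: "complex => complex => complex" where "exp_lo al be = 1/2 - (al - be) / 4"
definition exp_hi :: "complex => complex => complex" where "exp_hi al be = 1/2 + (al - be) / 4"

text \<open>
  The part of the equation that the factorisation leaves over. Apart from the source \<open>(al + be) / x\<close> it
  is of second order in \<open>\<phi>\<close> and \<open>1 / x\<close> jointly.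
\<close>

definition remainder :: "complex => complex => complex => complex => complex" where
 "remainder al be x \<phi> = exp (2 * \<phi>) - exp (- (2 * \<phi>)) - 4 * \<phi>
   + (al * (exp \<phi> - \<phi>) + be * (exp (- \<phi>) + \<phi>)) / x - (exp_lo al be)^2 * \<phi> / x^2"

text \<open>
  The Painleve equation for \<open>\<phi> = ln u\<close>.
\<close>

definition sinh_P3 :: "complex => complex => (complex => complex) => complex => bool" where
 "sinh_P3 al be \<phi> x \<longleftrightarrow> deriv (deriv \<phi>) x + deriv \<phi> x / x =
   exp (2 * \<phi> x) - exp (- (2 * \<phi> x)) + (al * exp (\<phi> x) + be * exp (- \<phi> x)) / x"

text \<open>
  The equation as two equations of first order, one for each factor.
\<close>

definition split_system :: "complex => complex => complex set => (complex => complex) => (complex => complex) => bool" where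
 "split_system al be G \<phi> z \<longleftrightarrow> (\<forall>x\<in>G.
   (\<phi> has_field_derivative (2 * 1 - exp_lo al be / x) * \<phi> x + z x) (at x) &
   (z has_field_derivative (2 * (-1) - exp_hi al be / x) * z x + remainder al be x (\<phi> x)) (at x))"

lemma split_system_imp_sinh_P3:
 assumes s: "split_system al be G \<phi> z" and G: "open G" "0 \<notin> G" and x: "x \<in> G"
 shows "sinh_P3 al be \<phi> x"
proof -
 have x0: "x ~= 0" using G x by auto
 have d1: "(\<phi> has_field_derivative (2 * 1 - exp_lo al be / y) * \<phi> y + z y) (at y)" if "y \<in> G" for y
  using s that by (auto simp: split_system_def)
 have dz: "(z has_field_derivative (2 * (-1) - exp_hi al be / x) * z x + remainder al be x (\<phi> x)) (at x)"
  using s x by (auto simp: split_system_def)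
 have dc: "((%y. 2 * 1 - exp_lo al be / y) has_field_derivative exp_lo al be / x^2) (at x)"
  using x0 by (auto intro!: derivative_eq_intros simp: power2_eq_square)
 note d2 = DERIV_add[OF DERIV_mult[OF dc d1[OF x]] dz]
 have e: "deriv (deriv \<phi>) x = exp_lo al be / x^2 * \<phi> x + ((2 * 1 - exp_lo al be / x) * \<phi> x + z x) * (2 * 1 - exp_lo al be / x)
   + ((2 * (-1) - exp_hi al be / x) * z x + remainder al be x (\<phi> x))"
  "deriv \<phi> x = (2 * 1 - exp_lo al be / x) * \<phi> x + z x"
  using second_derivative_eqI[OF G(1) x d1 d2] by auto
 define i where "i = inverse x"
 have hi: "exp_hi al be = 1 - exp_lo al be" and m: "al - be = 2 - 4 * exp_lo al be"
  by (simp_all add: exp_lo_def exp_hi_def)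
 define p zz l E F where "p = \<phi> x" and "zz = z x" and "l = exp_lo al be" and "E = exp (\<phi> x)" and "F = exp (- \<phi> x)"
 have al: "al = be + (2 - 4 * l)" using m by (simp add: l_def algebra_simps)
 have main: "l * i^2 * p + ((2 - l * i) * p + zz) * (2 - l * i) + ((- 2 - (1 - l) * i) * zz +
   (S - 4 * p + (al * (E - p) + be * (F + p)) * i - l^2 * p * i^2)) + ((2 - l * i) * p + zz) * i =
   S + (al * E + be * F) * i" for S
  unfolding al by (simp add: algebra_simps power2_eq_square)
 show ?thesis
  using main[of "exp (2 * p) - exp (- (2 * p))"]
  unfolding sinh_P3_def e remainder_def hi
  by (simp add: divide_inverse power_inverse i_def p_def zz_def l_def E_def F_def)
qed

lemma sinh_P3_imp_split_system:
 assumes hol: "\<phi> holomorphic_on G" and G: "open G" "0 \<notin> G" and eq: "!!x. x \<in> G ==> sinh_P3 al be \<phi> x"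
 shows "split_system al be G \<phi> (%x. deriv \<phi> x - (2 * 1 - exp_lo al be / x) * \<phi> x)"
 unfolding split_system_def
proof (intro ballI conjI)
 fix x assume x: "x \<in> G"
 have x0: "x ~= 0" using G x by auto
 have d: "(\<phi> has_field_derivative deriv \<phi> x) (at x)" by (rule holomorphic_derivI[OF hol G(1) x])
 have d2: "(deriv \<phi> has_field_derivative deriv (deriv \<phi>) x) (at x)"
  by (rule holomorphic_derivI[OF holomorphic_deriv[OF hol G(1)] G(1) x])
 show "(\<phi> has_field_derivative (2 * 1 - exp_lo al be / x) * \<phi> x + (deriv \<phi> x - (2 * 1 - exp_lo al be / x) * \<phi> x)) (at x)"
  using d by simp
 have dc: "((%y. 2 * 1 - exp_lo al be / y) has_field_derivative exp_lo al be / x^2) (at x)"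
  using x0 by (auto intro!: derivative_eq_intros simp: power2_eq_square)
 define i where "i = inverse x"
 define p q l E F where "p = \<phi> x" and "q = deriv \<phi> x" and "l = exp_lo al be" and "E = exp (\<phi> x)" and "F = exp (- \<phi> x)"
 have hi: "exp_hi al be = 1 - exp_lo al be" by (simp add: exp_lo_def exp_hi_def)
 have al: "al = be + (2 - 4 * l)" by (simp add: exp_lo_def l_def field_simps)
 have dd: "deriv (deriv \<phi>) x = exp (2 * p) - exp (- (2 * p)) + (al * E + be * F) * i - q * i"
  using eq[OF x] by (simp add: sinh_P3_def p_def q_def E_def F_def i_def divide_inverse algebra_simps)
 have main: "S + (al * E + be * F) * i - q * i - (l * i^2 * p + q * (2 - l * i)) =
   (- 2 - (1 - l) * i) * (q - (2 - l * i) * p) +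
   (S - 4 * p + (al * (E - p) + be * (F + p)) * i - l^2 * p * i^2)" for S
  unfolding al by (simp add: algebra_simps power2_eq_square)
 have "deriv (deriv \<phi>) x - (exp_lo al be / x^2 * \<phi> x + deriv \<phi> x * (2 * 1 - exp_lo al be / x)) =
   (2 * (-1) - exp_hi al be / x) * (deriv \<phi> x - (2 * 1 - exp_lo al be / x) * \<phi> x) + remainder al be x (\<phi> x)"
  using main[of "exp (2 * p) - exp (- (2 * p))"]
  unfolding dd remainder_def hi
  by (simp add: divide_inverse power_inverse i_def p_def q_def l_def E_def F_def)
 then show "((%x. deriv \<phi> x - (2 * 1 - exp_lo al be / x) * \<phi> x) has_field_derivative
   (2 * (-1) - exp_hi al be / x) * (deriv \<phi> x - (2 * 1 - exp_lo al be / x) * \<phi> x) + remainder al be x (\<phi> x)) (at x)"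
  using DERIV_diff[OF d2 DERIV_mult[OF dc d]] by simp
qed

lemma norm_exp_minus_one_le:
 fixes z :: complex
 assumes "norm z <= 1"
 shows "norm (exp z - 1) <= 3 * norm z"
proof -
 have "norm (exp z - exp 0) <= 3 * norm (z - 0)"
 proof (rule field_differentiable_bound[OF convex_cball[of 0 1]])
  fix w :: complex assume "w \<in> cball 0 1"
  then have "Re w <= 1" using complex_Re_le_cmod[of w] by simp
  then have "exp (Re w) <= exp 1" by simp
  then show "norm (exp w) <= 3" using exp_le unfolding norm_exp_eq_Re by linarith
  show "(exp has_field_derivative exp w) (at w within cball 0 1)"
   by (rule DERIV_subset[OF DERIV_exp]) simp
 qed (use assms in auto)
 then show ?thesis by simp
qed

definition remainder_const :: "complex => complex => real => real" where
 "remainder_const al be K = 72 * K^2 + 3 * (norm al + norm be) * K + (norm (exp_lo al be))^2"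

text \<open>
  The derivative of the remainder in \<open>\<phi>\<close> is of order \<open>\<phi>\<close> and \<open>1 / x\<close>, so on functions of size
  \<open>K / \<bar>x\<bar>\<close> it gains one more power of \<open>1 / x\<close> than needed; this makes the iteration a contraction far out.
\<close>

lemma remainder_lipschitz:
 assumes x: "0 < norm x" "K <= norm x" and pq: "norm p <= K / norm x" "norm q <= K / norm x"
 shows "norm (remainder al be x p - remainder al be x q) <= remainder_const al be K / (norm x)^2 * norm (p - q)"
proof -
 define r where "r = K / norm x"
 have r1: "r <= 1" using x by (simp add: r_def)
 have x0: "x ~= 0" using x by auto
 define D where "D w = 2 * exp (2 * w) + 2 * exp (- (2 * w)) - 4 + (al * (exp w - 1) + be * (1 - exp (- w))) / x - (exp_lo al be)^2 / x^2" for w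
 show ?thesis
 proof (rule field_differentiable_bound[OF convex_cball[of 0 r]])
  fix w :: complex assume "w \<in> cball 0 r"
  then have w: "norm w <= r" by simp
  then have w1: "norm w <= 1" using r1 by simp
  have r0: "0 <= r" using w norm_ge_zero order_trans by blast
  have "(remainder al be x has_field_derivative D w) (at w)"
  proof -
   have 1: "((%w. exp (2 * w)) has_field_derivative exp (2 * w) * 2) (at w)"
    by (rule DERIV_chain2[OF DERIV_exp DERIV_cmult_Id])
   have 2: "((%w. exp (- (2 * w))) has_field_derivative exp (- (2 * w)) * - 2) (at w)"
    by (rule DERIV_chain2[OF DERIV_exp DERIV_minus[OF DERIV_cmult_Id]])
   have 3: "((%w. exp (- w)) has_field_derivative exp (- w) * - 1) (at w)"
    by (rule DERIV_chain2[OF DERIV_exp DERIV_minus[OF DERIV_ident]])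
   have "(remainder al be x has_field_derivative exp (2 * w) * 2 - exp (- (2 * w)) * - 2 - 4
     + (al * (exp w - 1) + be * (exp (- w) * - 1 + 1)) / x - (exp_lo al be)^2 / x^2) (at w)"
    unfolding remainder_def[abs_def] times_divide_eq_left[symmetric]
    by (rule DERIV_add DERIV_diff DERIV_cdivide DERIV_cmult DERIV_cmult_Id DERIV_exp DERIV_ident 1 2 3)+
   then show ?thesis by (rule DERIV_cong) (simp add: D_def algebra_simps)
  qed
  then show "(remainder al be x has_field_derivative D w) (at w within cball 0 r)"
   by (rule DERIV_subset) simp
  have e1: "norm (exp w - 1) <= 3 * r" "norm (exp (- w) - 1) <= 3 * r"
   using norm_exp_minus_one_le[of w] norm_exp_minus_one_le[of "- w"] w w1 by auto
  have "2 * exp (2 * w) + 2 * exp (- (2 * w)) - 4 = 2 * ((exp w - exp (- w))^2)"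
  proof -
   have "exp w * exp (- w) = 1" by (simp flip: exp_add)
   moreover have "exp (2 * w) = exp w * exp w" "exp (- (2 * w)) = exp (- w) * exp (- w)" by (simp_all flip: exp_add)
   ultimately show ?thesis by (simp add: power2_eq_square algebra_simps)
  qed
  moreover have "norm (exp w - exp (- w)) <= 6 * r"
   using norm_triangle_ineq4[of "exp w - 1" "exp (- w) - 1"] e1 by simp
  then have "norm (2 * ((exp w - exp (- w))^2)) <= 2 * (6 * r)^2"
   unfolding norm_mult norm_power by (intro mult_mono power_mono) auto
  ultimately have t1: "norm (2 * exp (2 * w) + 2 * exp (- (2 * w)) - 4) <= 72 * r^2"
   by (simp add: power_mult_distrib)
  have "norm (al * (exp w - 1) + be * (1 - exp (- w))) <= norm al * (3 * r) + norm be * (3 * r)"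
   using e1 by (intro order_trans[OF norm_triangle_ineq] add_mono) (auto simp: norm_mult norm_minus_commute intro!: mult_left_mono)
  then have t2: "norm ((al * (exp w - 1) + be * (1 - exp (- w))) / x) <= 3 * (norm al + norm be) * r / norm x"
   unfolding norm_divide using x by (intro divide_right_mono) (auto simp: algebra_simps)
  have "norm (D w) <= 72 * r^2 + 3 * (norm al + norm be) * r / norm x + (norm (exp_lo al be))^2 / (norm x)^2"
   unfolding D_def
   by (rule order_trans[OF norm_triangle_ineq4], rule add_mono, rule order_trans[OF norm_triangle_ineq], rule add_mono[OF t1 t2])
    (simp add: norm_divide norm_power)
  also have "... = remainder_const al be K / (norm x)^2"
   by (simp add: remainder_const_def r_def add_divide_distrib power2_eq_square)
  finally show "norm (D w) <= remainder_const al be K / (norm x)^2" .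
 qed (use pq in \<open>auto simp: r_def\<close>)
qed

lemma remainder_zero: "remainder al be x 0 = (al + be) / x"
 by (simp add: remainder_def)

text \<open>
  A neighbourhood of infinity in a sector of opening larger than \<open>\<pi>\<close> around the positive imaginary
  axis. Its opening tends to \<open>2 * \<pi>\<close> as \<open>k\<close> grows. It is mapped into itself by translations along
  \<open>1 + \<i> * k\<close> and \<open>- 1 + \<i> * k\<close>, and the real parts of these directions have opposite signs, so each
  exponential grows along one of them.
\<close>

definition up_region :: "real => real => complex set" where
 "up_region k \<rho> = {x. \<rho> < Im x + k * \<bar>Re x\<bar>}"

lemma up_region_open: "open (up_region k \<rho>)"
 unfolding up_region_def by (intro open_Collect_less continuous_intros)

lemma up_region_norm:
 assumes "x \<in> up_region k \<rho>" "0 < k"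
 shows "\<rho> < (1 + k) * norm x"
proof -
 have "Im x + k * \<bar>Re x\<bar> <= norm x + k * norm x"
  using abs_Im_le_cmod[of x] abs_Re_le_cmod[of x] assms by (intro add_mono mult_left_mono) auto
 then show ?thesis using assms by (simp add: up_region_def algebra_simps)
qed

lemma up_region_connected:
 assumes "0 < k"
 shows "connected (up_region k \<rho>)"
proof -
 have "k * \<bar>y\<bar> = max (k * y) (- k * y)" for y
 proof (cases "0 <= y")
  case True
  then have "0 <= k * y" using assms by simp
  then show ?thesis using True by (simp add: max_def)
 next
  case False
  then have "k * y < 0" using assms by (simp add: mult_pos_neg)
  then show ?thesis using False by (simp add: max_def)
 qed
 then have eq: "up_region k \<rho> = {x. \<rho> < Im x + k * Re x} \<union> {x. \<rho> < Im x + (- k) * Re x}"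
  by (auto simp: up_region_def max_def split: if_splits)
 have c: "convex {x::complex. \<rho> < Im x + c * Re x}" for c
 proof -
  have "{x::complex. \<rho> < Im x + c * Re x} = {x. (\<i> + of_real c) \<bullet> x > \<rho>}"
   by (auto simp: inner_complex_def add.commute)
  then show ?thesis using convex_halfspace_gt by metis
 qed
 have "\<i> * of_real (\<rho> + 1) \<in> {x. \<rho> < Im x + k * Re x} \<inter> {x. \<rho> < Im x + (- k) * Re x}" by simp
 then have "{x. \<rho> < Im x + k * Re x} \<inter> {x. \<rho> < Im x + (- k) * Re x} ~= {}" by blast
 then show ?thesis
  unfolding eq by (intro connected_Un convex_connected c)
qed

lemma up_region_ray_domain:
 assumes k: "0 < k" and \<rho>: "1 + k <= \<rho>" and \<omega>: "\<omega> = 1 + \<i> * of_real k \<or> \<omega> = - 1 + \<i> * of_real k"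
 shows "ray_domain \<omega> (up_region k \<rho>)"
 unfolding ray_domain_def
proof (intro conjI ballI allI impI)
 show "open (up_region k \<rho>)" by (rule up_region_open)
 show "up_region k \<rho> <= cut_plane" using \<rho> k by (auto simp: up_region_def cut_plane_iff)
 fix x assume x: "x \<in> up_region k \<rho>"
 have "(1 + k) * 1 < (1 + k) * norm x" using up_region_norm[OF x k] \<rho> by simp
 then show "1 <= norm x" using k by (simp add: mult_less_cancel_left)
 fix \<tau> :: real assume \<tau>: "0 <= \<tau>"
 have "\<bar>Re x\<bar> <= \<bar>Re (x + of_real \<tau> * \<omega>)\<bar> + \<tau>" using \<omega> \<tau> by auto
 then have "k * \<bar>Re x\<bar> <= k * (\<bar>Re (x + of_real \<tau> * \<omega>)\<bar> + \<tau>)" using k by (intro mult_left_mono) auto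
 then have "k * \<bar>Re x\<bar> <= k * \<bar>Re (x + of_real \<tau> * \<omega>)\<bar> + k * \<tau>" by (simp only: distrib_left)
 moreover have "Im (x + of_real \<tau> * \<omega>) = Im x + k * \<tau>" using \<omega> by auto
 ultimately show "x + of_real \<tau> * \<omega> \<in> up_region k \<rho>"
  using x unfolding up_region_def mem_Collect_eq by linarith
qed

lemma inverse_norm_weight:
 assumes "ray_domain \<omega> G" "x \<in> G" "0 <= \<tau>"
 shows "1 / norm (x + of_real \<tau> * \<omega>) <= 1 * (1 + norm \<omega> * \<tau>) ^ 1 * (1 / norm x)"
proof -
 have n: "1 <= norm x" "1 <= norm (x + of_real \<tau> * \<omega>)" using assms by (auto simp: ray_domain_def)
 have "norm x <= norm (x + of_real \<tau> * \<omega>) + norm \<omega> * \<tau>"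
  using norm_triangle_ineq4[of "x + of_real \<tau> * \<omega>" "of_real \<tau> * \<omega>"] assms by (simp add: norm_mult mult.commute)
 also have "... <= norm (x + of_real \<tau> * \<omega>) * (1 + norm \<omega> * \<tau>)"
  using mult_right_mono[OF n(2), of "norm \<omega> * \<tau>"] assms by (simp add: algebra_simps)
 finally have "norm x <= norm (x + of_real \<tau> * \<omega>) * (1 + norm \<omega> * \<tau>)" .
 moreover have "0 < norm x" "0 < norm (x + of_real \<tau> * \<omega>)" using n by linarith+
 ultimately show ?thesis by (simp add: divide_simps mult.commute)
qed

lemma gauge_inverse_cong:
 assumes "ray_domain \<omega> G" "x \<in> G" "!!y. y \<in> G ==> f y = g y"
 shows "gauge_inverse \<sigma> a \<omega> f x = gauge_inverse \<sigma> a \<omega> g x"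
proof -
 have "(%\<tau>. indicator {0<..} \<tau> *\<^sub>R (f (x + of_real \<tau> * \<omega>) / gauge_fun \<sigma> a (x + of_real \<tau> * \<omega>)))
   = (%\<tau>. indicator {0<..} \<tau> *\<^sub>R (g (x + of_real \<tau> * \<omega>) / gauge_fun \<sigma> a (x + of_real \<tau> * \<omega>)))"
  using assms by (auto simp: ray_domain_def indicator_def fun_eq_iff)
 then show ?thesis by (simp add: gauge_inverse_def ray_integral_def half_line_integral_def)
qed

definition green_inner :: "complex => complex => real => (complex => complex) => complex => complex" where
 "green_inner al be k g = gauge_inverse (-1) (exp_hi al be) (- 1 + \<i> * of_real k) g"

definition green_outer :: "complex => complex => real => (complex => complex) => complex => complex" where
 "green_outer al be k z = gauge_inverse 1 (exp_lo al be) (1 + \<i> * of_real k) z"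

lemma green_operator:
 assumes k: "0 < k"
 obtains C where "0 < C"
  "!!\<rho> g A x. 1 + k <= \<rho> ==> g holomorphic_on up_region k \<rho> ==> 0 <= A ==>
   (!!x. x \<in> up_region k \<rho> ==> norm (g x) <= A / norm x) ==> x \<in> up_region k \<rho> ==>
   (green_inner al be k g has_field_derivative
     (2 * (-1) - exp_hi al be / x) * green_inner al be k g x + g x) (at x) &
   norm (green_inner al be k g x) <= C * A / norm x"
  "!!\<rho> z A x. 1 + k <= \<rho> ==> z holomorphic_on up_region k \<rho> ==> 0 <= A ==>
   (!!x. x \<in> up_region k \<rho> ==> norm (z x) <= A / norm x) ==> x \<in> up_region k \<rho> ==>
   (green_outer al be k z has_field_derivative
     (2 * 1 - exp_lo al be / x) * green_outer al be k z x + z x) (at x) &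
   norm (green_outer al be k z x) <= C * A / norm x"
  "!!\<rho> f g A B D x. 1 + k <= \<rho> ==> f holomorphic_on up_region k \<rho> ==> g holomorphic_on up_region k \<rho> ==>
   0 <= A ==> 0 <= B ==> 0 <= D ==>
   (!!x. x \<in> up_region k \<rho> ==> norm (f x) <= A / norm x) ==>
   (!!x. x \<in> up_region k \<rho> ==> norm (g x) <= B / norm x) ==>
   (!!x. x \<in> up_region k \<rho> ==> norm (f x - g x) <= D / norm x) ==> x \<in> up_region k \<rho> ==>
   norm (green_outer al be k (green_inner al be k f) x - green_outer al be k (green_inner al be k g) x) <= C * C * D / norm x"
proof -
 define o1 o2 where "o1 = 1 + \<i> * of_real k" and "o2 = - 1 + \<i> * of_real k"
 have s1: "Re (1 * o1) = 1" and s2: "Re (- 1 * o2) = 1" by (auto simp: o1_def o2_def)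
 obtain C1 where C1: "0 < C1" "!!G w g A x. ray_domain o1 G ==> continuous_on G w ==>
    (!!x \<tau>. x \<in> G ==> 0 <= \<tau> ==> w (x + of_real \<tau> * o1) <= 1 * (1 + norm o1 * \<tau>) ^ 1 * w x) ==>
    g holomorphic_on G ==> 0 <= A ==> (!!x. x \<in> G ==> norm (g x) <= A * w x) ==> x \<in> G ==>
    (gauge_inverse 1 (exp_lo al be) o1 g has_field_derivative (2 * 1 - exp_lo al be / x) * gauge_inverse 1 (exp_lo al be) o1 g x + g x) (at x) &
    norm (gauge_inverse 1 (exp_lo al be) o1 g x) <= C1 * A * w x &
    integrable lborel (%\<tau>. indicator {0<..} \<tau> *\<^sub>R (g (x + of_real \<tau> * o1) / gauge_fun 1 (exp_lo al be) (x + of_real \<tau> * o1)))"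
  by (rule gauge_inverse_solves[OF s1, where M = 1 and n = 1 and a = "exp_lo al be"]) blast
 obtain C2 where C2: "0 < C2" "!!G w g A x. ray_domain o2 G ==> continuous_on G w ==>
    (!!x \<tau>. x \<in> G ==> 0 <= \<tau> ==> w (x + of_real \<tau> * o2) <= 1 * (1 + norm o2 * \<tau>) ^ 1 * w x) ==>
    g holomorphic_on G ==> 0 <= A ==> (!!x. x \<in> G ==> norm (g x) <= A * w x) ==> x \<in> G ==>
    (gauge_inverse (-1) (exp_hi al be) o2 g has_field_derivative (2 * (-1) - exp_hi al be / x) * gauge_inverse (-1) (exp_hi al be) o2 g x + g x) (at x) &
    norm (gauge_inverse (-1) (exp_hi al be) o2 g x) <= C2 * A * w x &
    integrable lborel (%\<tau>. indicator {0<..} \<tau> *\<^sub>R (g (x + of_real \<tau> * o2) / gauge_fun (-1) (exp_hi al be) (x + of_real \<tau> * o2)))"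
  by (rule gauge_inverse_solves[OF s2, where M = 1 and n = 1 and a = "exp_hi al be"]) blast
 define C where "C = max C1 C2"
 have C: "0 < C" "C1 <= C" "C2 <= C" using C1 by (auto simp: C_def)
 have gi: "green_inner al be k = gauge_inverse (-1) (exp_hi al be) o2"
  and go: "green_outer al be k = gauge_inverse 1 (exp_lo al be) o1"
  by (auto simp: green_inner_def green_outer_def o1_def o2_def fun_eq_iff)
 have R1: "ray_domain o1 (up_region k \<rho>)" and R2: "ray_domain o2 (up_region k \<rho>)"
  and wc: "continuous_on (up_region k \<rho>) (%x. 1 / norm x)" if "1 + k <= \<rho>" for \<rho>
 proof -
  show R: "ray_domain o1 (up_region k \<rho>)" "ray_domain o2 (up_region k \<rho>)"
   using up_region_ray_domain[OF k that] by (auto simp: o1_def o2_def)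
  have "norm x ~= 0" if "x \<in> up_region k \<rho>" for x using that R(1) by (force simp: ray_domain_def)
  then show "continuous_on (up_region k \<rho>) (%x. 1 / norm x)" by (intro continuous_intros) auto
 qed
 have I: "(green_inner al be k g has_field_derivative
     (2 * (-1) - exp_hi al be / x) * green_inner al be k g x + g x) (at x)"
   "norm (green_inner al be k g x) <= C * A / norm x"
   "integrable lborel (%\<tau>. indicator {0<..} \<tau> *\<^sub>R (g (x + of_real \<tau> * o2) / gauge_fun (-1) (exp_hi al be) (x + of_real \<tau> * o2)))"
  if h: "1 + k <= \<rho>" "g holomorphic_on up_region k \<rho>" "0 <= A"
   "!!x. x \<in> up_region k \<rho> ==> norm (g x) <= A / norm x" "x \<in> up_region k \<rho>" for \<rho> g A x
 proof -
  have b: "norm (g x) <= A * (1 / norm x)" if "x \<in> up_region k \<rho>" for x using h(4)[OF that] by simp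
  note * = C2(2)[OF R2[OF h(1)] wc[OF h(1)] inverse_norm_weight[OF R2[OF h(1)]] h(2,3) b h(5), simplified gi[symmetric]]
  have "C2 * A / norm x <= C * A / norm x" using C h(3) by (intro divide_right_mono mult_right_mono) auto
  then show "(green_inner al be k g has_field_derivative
     (2 * (-1) - exp_hi al be / x) * green_inner al be k g x + g x) (at x)"
   "norm (green_inner al be k g x) <= C * A / norm x"
   "integrable lborel (%\<tau>. indicator {0<..} \<tau> *\<^sub>R (g (x + of_real \<tau> * o2) / gauge_fun (-1) (exp_hi al be) (x + of_real \<tau> * o2)))"
   using * by auto
 qed
 have O: "(green_outer al be k g has_field_derivative
     (2 * 1 - exp_lo al be / x) * green_outer al be k g x + g x) (at x)"
   "norm (green_outer al be k g x) <= C * A / norm x"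
   "integrable lborel (%\<tau>. indicator {0<..} \<tau> *\<^sub>R (g (x + of_real \<tau> * o1) / gauge_fun 1 (exp_lo al be) (x + of_real \<tau> * o1)))"
  if h: "1 + k <= \<rho>" "g holomorphic_on up_region k \<rho>" "0 <= A"
   "!!x. x \<in> up_region k \<rho> ==> norm (g x) <= A / norm x" "x \<in> up_region k \<rho>" for \<rho> g A x
 proof -
  have b: "norm (g x) <= A * (1 / norm x)" if "x \<in> up_region k \<rho>" for x using h(4)[OF that] by simp
  note * = C1(2)[OF R1[OF h(1)] wc[OF h(1)] inverse_norm_weight[OF R1[OF h(1)]] h(2,3) b h(5), simplified go[symmetric]]
  have "C1 * A / norm x <= C * A / norm x" using C h(3) by (intro divide_right_mono mult_right_mono) auto
  then show "(green_outer al be k g has_field_derivative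
     (2 * 1 - exp_lo al be / x) * green_outer al be k g x + g x) (at x)"
   "norm (green_outer al be k g x) <= C * A / norm x"
   "integrable lborel (%\<tau>. indicator {0<..} \<tau> *\<^sub>R (g (x + of_real \<tau> * o1) / gauge_fun 1 (exp_lo al be) (x + of_real \<tau> * o1)))"
   using * by auto
 qed
 have Ihol: "green_inner al be k g holomorphic_on up_region k \<rho>"
  if h: "1 + k <= \<rho>" "g holomorphic_on up_region k \<rho>" "0 <= A"
   "!!x. x \<in> up_region k \<rho> ==> norm (g x) <= A / norm x" for \<rho> g A
  unfolding holomorphic_on_open[OF up_region_open] using I(1)[OF h] by blast
 show thesis
 proof (rule that[of C, OF C(1)])
  fix \<rho> g A x assume "1 + k <= \<rho>" "g holomorphic_on up_region k \<rho>" "0 <= A"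
   "!!x. x \<in> up_region k \<rho> ==> norm (g x) <= A / norm x" "x \<in> up_region k \<rho>"
  from I[OF this] O[OF this]
  show "(green_inner al be k g has_field_derivative
     (2 * (-1) - exp_hi al be / x) * green_inner al be k g x + g x) (at x) &
   norm (green_inner al be k g x) <= C * A / norm x"
   "(green_outer al be k g has_field_derivative
     (2 * 1 - exp_lo al be / x) * green_outer al be k g x + g x) (at x) &
   norm (green_outer al be k g x) <= C * A / norm x" by blast+
 next
  fix \<rho> f g A B D x
  assume \<rho>: "1 + k <= \<rho>" and f: "f holomorphic_on up_region k \<rho>" and g: "g holomorphic_on up_region k \<rho>"
   and A: "0 <= A" and B: "0 <= B" and D: "0 <= D"
   and fA: "!!x. x \<in> up_region k \<rho> ==> norm (f x) <= A / norm x"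
   and gB: "!!x. x \<in> up_region k \<rho> ==> norm (g x) <= B / norm x"
   and fg: "!!x. x \<in> up_region k \<rho> ==> norm (f x - g x) <= D / norm x" and x: "x \<in> up_region k \<rho>"
  define zf zg zd where "zf = green_inner al be k f" and "zg = green_inner al be k g"
   and "zd = green_inner al be k (%x. f x - g x)"
  have d: "zd y = zf y - zg y" if "y \<in> up_region k \<rho>" for y
   unfolding zf_def zg_def zd_def gi
   by (rule gauge_inverse_diff[OF I(3)[OF \<rho> f A fA that] I(3)[OF \<rho> g B gB that]])
  have dh: "(%x. f x - g x) holomorphic_on up_region k \<rho>" by (intro holomorphic_intros f g)
  have CA: "0 <= C * A" "0 <= C * B" "0 <= C * D" using C A B D by auto
  have "green_outer al be k zf x - green_outer al be k zg x = green_outer al be k (%y. zf y - zg y) x"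
   unfolding go
   by (rule gauge_inverse_diff[symmetric, OF
      O(3)[OF \<rho> Ihol[OF \<rho> f A fA] CA(1) I(2)[OF \<rho> f A fA] x, folded zf_def]
      O(3)[OF \<rho> Ihol[OF \<rho> g B gB] CA(2) I(2)[OF \<rho> g B gB] x, folded zg_def]])
  also have "... = green_outer al be k zd x"
   unfolding go by (rule gauge_inverse_cong[OF R1[OF \<rho>] x]) (simp add: d)
  also have "norm ... <= C * (C * D) / norm x"
   unfolding zd_def by (rule O(2)[OF \<rho> Ihol[OF \<rho> dh D fg] CA(3) I(2)[OF \<rho> dh D fg] x])
  finally show "norm (green_outer al be k (green_inner al be k f) x - green_outer al be k (green_inner al be k g) x) <= C * C * D / norm x"
   by (simp add: zf_def zg_def mult.assoc)
 qed
qed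

section \<open>The small solution in a large region\<close>

lemma remainder_const_nonneg: "0 <= K ==> 0 <= remainder_const al be K"
 by (simp add: remainder_const_def)

lemma remainder_bound:
 assumes x: "m <= norm x" "1 <= m" "K <= m" and K: "0 <= K" and p: "norm p <= K / norm x"
 shows "norm (remainder al be x p) <= (norm al + norm be + remainder_const al be K / m^2 * K) / norm x"
proof -
 have nx: "0 < norm x" "K <= norm x" using x by linarith+
 have Q: "0 <= remainder_const al be K" using K by (rule remainder_const_nonneg)
 have "norm (remainder al be x p - remainder al be x 0) <= remainder_const al be K / (norm x)^2 * norm (p - 0)"
  by (rule remainder_lipschitz[OF nx p]) (use K in simp)
 also have "... <= remainder_const al be K / m^2 * (K / norm x)"
  using x p Q nx K by (intro mult_mono divide_left_mono power_mono) auto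
 finally have "norm (remainder al be x p - remainder al be x 0) <= remainder_const al be K / m^2 * (K / norm x)" .
 moreover have "norm (remainder al be x 0) <= (norm al + norm be) / norm x"
  unfolding remainder_zero norm_divide by (intro divide_right_mono norm_triangle_ineq) simp
 ultimately have "norm (remainder al be x p) <= (norm al + norm be) / norm x + remainder_const al be K / m^2 * (K / norm x)"
  using norm_triangle_ineq2[of "remainder al be x p" "remainder al be x 0"] by linarith
 then show ?thesis by (simp add: add_divide_distrib)
qed

lemma remainder_difference_bound:
 assumes x: "m <= norm x" "1 <= m" "K <= m" and K: "0 <= K"
  and p: "norm p <= K / norm x" "norm q <= K / norm x" and d: "norm (p - q) <= d / norm x"
 shows "norm (remainder al be x p - remainder al be x q) <= remainder_const al be K / m^2 * d / norm x"
proof -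
 have nx: "0 < norm x" "K <= norm x" using x by linarith+
 have Q: "0 <= remainder_const al be K" using K by (rule remainder_const_nonneg)
 have "norm (remainder al be x p - remainder al be x q) <= remainder_const al be K / (norm x)^2 * norm (p - q)"
  by (rule remainder_lipschitz[OF nx p])
 also have "... <= remainder_const al be K / m^2 * (d / norm x)"
  using x d Q nx by (intro mult_mono divide_left_mono power_mono) auto
 finally show ?thesis by simp
qed

lemma remainder_holomorphic:
 assumes "\<phi> holomorphic_on G" "0 \<notin> G"
 shows "(%x. remainder al be x (\<phi> x)) holomorphic_on G"
 unfolding remainder_def using assms by (intro holomorphic_intros) auto

lemma up_region_far:
 assumes "0 < k" "(1 + k) * m <= \<rho>" "x \<in> up_region k \<rho>"
 shows "m <= norm x"
proof -
 have "(1 + k) * m < (1 + k) * norm x" using up_region_norm[OF assms(3,1)] assms(2) by linarith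
 then show ?thesis using assms(1) by (simp add: mult_less_cancel_left)
qed

lemma up_region_not_zero: "0 < \<rho> ==> 0 \<notin> up_region k \<rho>"
 by (simp add: up_region_def)

text \<open>
  The fixed point of the composition of both inverse operators with the remainder, in the class of functions
  of size \<open>K / \<bar>x\<bar>\<close>. No constant of integration is free, since each of the two exponentials is unbounded
  in this region.
\<close>

theorem small_solution_exists:
 fixes al be :: complex
 assumes k: "0 < k"
 obtains \<rho> K \<phi> where "1 + k <= \<rho>" "0 <= K" "\<phi> holomorphic_on up_region k \<rho>"
  "!!x. x \<in> up_region k \<rho> ==> sinh_P3 al be \<phi> x" "!!x. x \<in> up_region k \<rho> ==> norm (\<phi> x) <= K / norm x"
proof -
 obtain C where C: "0 < C"
  and I: "!!\<rho> g A x. 1 + k <= \<rho> ==> g holomorphic_on up_region k \<rho> ==> 0 <= A ==>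
   (!!x. x \<in> up_region k \<rho> ==> norm (g x) <= A / norm x) ==> x \<in> up_region k \<rho> ==>
   (green_inner al be k g has_field_derivative
     (2 * (-1) - exp_hi al be / x) * green_inner al be k g x + g x) (at x) &
   norm (green_inner al be k g x) <= C * A / norm x"
  and O: "!!\<rho> z A x. 1 + k <= \<rho> ==> z holomorphic_on up_region k \<rho> ==> 0 <= A ==>
   (!!x. x \<in> up_region k \<rho> ==> norm (z x) <= A / norm x) ==> x \<in> up_region k \<rho> ==>
   (green_outer al be k z has_field_derivative
     (2 * 1 - exp_lo al be / x) * green_outer al be k z x + z x) (at x) &
   norm (green_outer al be k z x) <= C * A / norm x"
  and L: "!!\<rho> f g A B D x. 1 + k <= \<rho> ==> f holomorphic_on up_region k \<rho> ==> g holomorphic_on up_region k \<rho> ==>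
   0 <= A ==> 0 <= B ==> 0 <= D ==>
   (!!x. x \<in> up_region k \<rho> ==> norm (f x) <= A / norm x) ==>
   (!!x. x \<in> up_region k \<rho> ==> norm (g x) <= B / norm x) ==>
   (!!x. x \<in> up_region k \<rho> ==> norm (f x - g x) <= D / norm x) ==> x \<in> up_region k \<rho> ==>
   norm (green_outer al be k (green_inner al be k f) x - green_outer al be k (green_inner al be k g) x) <= C * C * D / norm x"
  by (rule green_operator[OF k, of al be]) blast
 define s K Q where "s = norm al + norm be" and "K = 2 * (C * C * s)" and "Q = remainder_const al be K"
 define m where "m = 1 + K + 2 * (C * C * Q)"
 define \<rho> where "\<rho> = (1 + k) * m"
 have s0: "0 <= s" by (simp add: s_def)
 have K0: "0 <= K" using C s0 by (simp add: K_def)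
 have Q0: "0 <= Q" unfolding Q_def by (rule remainder_const_nonneg[OF K0])
 have CQ: "0 <= C * C * Q" using C Q0 by simp
 have m: "1 <= m" "K <= m" using K0 CQ by (auto simp: m_def)
 have \<rho>: "1 + k <= \<rho>" using mult_left_mono[OF m(1), of "1 + k"] k by (simp add: \<rho>_def)
 have small: "C * C * (Q / m^2) <= 1/2"
 proof -
  have "2 * (C * C * Q) <= m" using K0 by (simp add: m_def)
  also have "m <= m^2" using m(1) by (simp add: power2_eq_square)
  finally show ?thesis using m(1) by (simp add: divide_simps)
 qed
 let ?G = "up_region k \<rho>"
 have G0: "0 \<notin> ?G" by (rule up_region_not_zero) (use \<rho> k in simp)
 have far: "m <= norm x" if "x \<in> ?G" for x
  by (rule up_region_far[OF k _ that]) (simp add: \<rho>_def)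
 define A where "A = s + Q / m^2 * K"
 have A0: "0 <= A" using s0 Q0 K0 by (simp add: A_def)
 have CA: "0 <= C * A" using C A0 by simp
 have CCA: "C * (C * A) <= K"
 proof -
  have "C * (C * A) = K / 2 + C * C * (Q / m^2) * K" by (simp add: A_def K_def algebra_simps)
  also have "... <= K / 2 + 1/2 * K" by (intro add_left_mono mult_right_mono[OF small K0])
  finally show ?thesis by simp
 qed
 define M where "M = {f. f holomorphic_on ?G & (\<forall>x\<in>?G. norm (f x) <= K / norm x)}"
 define R where "R f x = remainder al be x (f x)" for f x
 define T where "T f = green_outer al be k (green_inner al be k (R f))" for f
 have Rh: "R f holomorphic_on ?G" if "f \<in> M" for f
  using that remainder_holomorphic[OF _ G0] unfolding M_def R_def[abs_def] by auto
 have RA: "norm (R f x) <= A / norm x" if "f \<in> M" "x \<in> ?G" for f x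
  unfolding R_def A_def s_def Q_def
  by (rule remainder_bound[OF far[OF that(2)] m K0]) (use that in \<open>auto simp: M_def\<close>)
 have Ih: "green_inner al be k (R f) holomorphic_on ?G" if "f \<in> M" for f
  unfolding holomorphic_on_open[OF up_region_open] using I[OF \<rho> Rh[OF that] A0 RA[OF that]] by blast
 have Ib: "norm (green_inner al be k (R f) x) <= C * A / norm x" if "f \<in> M" "x \<in> ?G" for f x
  using I[OF \<rho> Rh[OF that(1)] A0 RA[OF that(1)] that(2)] by blast
 have TD: "(T f has_field_derivative (2 * 1 - exp_lo al be / x) * T f x + green_inner al be k (R f) x) (at x)"
  and TB: "norm (T f x) <= C * (C * A) / norm x" if "f \<in> M" "x \<in> ?G" for f x
  using O[OF \<rho> Ih[OF that(1)] CA Ib[OF that(1)] that(2)] unfolding T_def by blast+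
 have TM: "T f \<in> M" if "f \<in> M" for f
  unfolding M_def
 proof (intro CollectI conjI ballI)
  show "T f holomorphic_on ?G" unfolding holomorphic_on_open[OF up_region_open] using TD[OF that] by blast
  fix x assume "x \<in> ?G"
  then have "norm (T f x) <= C * (C * A) / norm x" by (rule TB[OF that])
  also have "... <= K / norm x" using CCA by (rule divide_right_mono) simp
  finally show "norm (T f x) <= K / norm x" .
 qed
 have "\<exists>f\<in>M. \<forall>x\<in>?G. T f x = f x"
 proof (rule weighted_contraction_fixed_point[where M = M and init = "%_. 0" and T = T and P = ?G and w = "%x. 2 * K / norm x"])
  show "(%_. 0) \<in> M" using K0 by (auto simp: M_def)
 next
  fix f g x assume "f \<in> M" "g \<in> M" "x \<in> ?G"
  then have "norm (f x) <= K / norm x" "norm (g x) <= K / norm x" by (auto simp: M_def)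
  then show "norm (f x - g x) <= 2 * K / norm x" using norm_triangle_ineq4[of "f x" "g x"] by simp
 next
  fix f g :: "complex => complex" and d x
  assume f: "f \<in> M" and g: "g \<in> M" and d: "0 <= d" and le: "!!x. x \<in> ?G ==> norm (f x - g x) <= d * (2 * K / norm x)"
   and x: "x \<in> ?G"
  have RD: "norm (R f y - R g y) <= Q / m^2 * (d * (2 * K)) / norm y" if "y \<in> ?G" for y
   unfolding R_def Q_def
   by (rule remainder_difference_bound[OF far[OF that] m K0]) (use f g le[OF that] that in \<open>auto simp: M_def\<close>)
  have "norm (T f x - T g x) <= C * C * (Q / m^2 * (d * (2 * K))) / norm x"
   unfolding T_def
   by (rule L[OF \<rho> Rh[OF f] Rh[OF g] A0 A0 _ RA[OF f] RA[OF g] RD x]) (use Q0 d K0 in simp)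
  also have "... = C * C * (Q / m^2) * (d * (2 * K) / norm x)" by simp
  also have "... <= 1/2 * (d * (2 * K) / norm x)" by (rule mult_right_mono[OF small]) (use d K0 in simp)
  finally show "norm (T f x - T g x) <= d / 2 * (2 * K / norm x)" by simp
 next
  fix F :: "nat => complex => complex" and f
  assume F: "!!n. F n \<in> M" and lim: "!!n x. x \<in> ?G ==> norm (F n x - f x) <= (1/2)^n * (2 * (2 * K / norm x))"
  have "f holomorphic_on ?G"
  proof (rule holomorphic_weighted_limit[OF up_region_open _ _ lim])
   show "F n holomorphic_on ?G" for n using F by (auto simp: M_def)
   show "continuous_on ?G (%x. 2 * (2 * K / norm x))" using G0 by (intro continuous_intros) auto
  qed
  moreover have "norm (f x) <= K / norm x" if x: "x \<in> ?G" for x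
  proof -
   have "norm (f x) <= K / norm x + (1/2)^n * (2 * (2 * K / norm x))" for n
   proof -
    have "norm (F n x) <= K / norm x" using F x by (auto simp: M_def)
    then show ?thesis using lim[OF x, of n] norm_triangle_ineq2[of "f x" "F n x"] by (simp add: norm_minus_commute)
   qed
   moreover have "(%n. K / norm x + (1/2::real)^n * (2 * (2 * K / norm x))) \<longlonglongrightarrow> K / norm x + 0 * (2 * (2 * K / norm x))"
    by (intro tendsto_intros LIMSEQ_realpow_zero) auto
   ultimately show ?thesis
    by (intro LIMSEQ_le_const[where X = "%n. K / norm x + (1/2::real)^n * (2 * (2 * K / norm x))"]) auto
  qed
  ultimately show "f \<in> M" by (simp add: M_def)
 qed (use TM in blast)
 then obtain f where f: "f \<in> M" and fx: "!!x. x \<in> ?G ==> T f x = f x" by blast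
 have "split_system al be ?G f (green_inner al be k (R f))"
  unfolding split_system_def
 proof (intro ballI conjI)
  fix x assume x: "x \<in> ?G"
  have "(f has_field_derivative (2 * 1 - exp_lo al be / x) * T f x + green_inner al be k (R f) x) (at x)"
   by (rule has_field_derivative_transform_within_open[OF TD[OF f x] up_region_open x fx])
  then show "(f has_field_derivative (2 * 1 - exp_lo al be / x) * f x + green_inner al be k (R f) x) (at x)"
   by (simp only: fx[OF x])
  show "(green_inner al be k (R f) has_field_derivative
    (2 * (-1) - exp_hi al be / x) * green_inner al be k (R f) x + remainder al be x (f x)) (at x)"
   using I[OF \<rho> Rh[OF f] A0 RA[OF f] x] unfolding R_def[of f x] by blast
 qed
 then have "sinh_P3 al be f x" if "x \<in> ?G" for x
  using split_system_imp_sinh_P3[OF _ up_region_open G0 that] by blast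
 then show thesis
  using that[OF \<rho> K0, of f] f by (auto simp: M_def)
qed

lemma affine_cancel: "a * z + r - (a * w + r) = a * (z - w)" for a z r w :: complex
 by (simp add: algebra_simps)

text \<open>
  Both functions solve the same fixed point equation: the difference of a solution and of the value of the
  integral operator is a bounded solution of a homogeneous equation, hence 0. The derivative
  must be bounded for this, and Cauchy's estimate on unit discs costs the margin \<open>1 + k\<close>.
\<close>

theorem small_solution_unique:
 fixes al be :: complex
 assumes k: "0 < k" and K0: "0 <= K"
 obtains \<rho>1 where "!!\<rho> \<phi> \<psi> x. \<rho>1 <= \<rho> ==>
   \<phi> holomorphic_on up_region k \<rho> ==> \<psi> holomorphic_on up_region k \<rho> ==>
   (!!x. x \<in> up_region k \<rho> ==> sinh_P3 al be \<phi> x) ==> (!!x. x \<in> up_region k \<rho> ==> sinh_P3 al be \<psi> x) ==>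
   (!!x. x \<in> up_region k \<rho> ==> norm (\<phi> x) <= K / norm x) ==>
   (!!x. x \<in> up_region k \<rho> ==> norm (\<psi> x) <= K / norm x) ==>
   x \<in> up_region k (\<rho> + 1 + k) ==> \<phi> x = \<psi> x"
proof -
 obtain C where C: "0 < C"
  and I: "!!\<rho> g A x. 1 + k <= \<rho> ==> g holomorphic_on up_region k \<rho> ==> 0 <= A ==>
   (!!x. x \<in> up_region k \<rho> ==> norm (g x) <= A / norm x) ==> x \<in> up_region k \<rho> ==>
   (green_inner al be k g has_field_derivative
     (2 * (-1) - exp_hi al be / x) * green_inner al be k g x + g x) (at x) &
   norm (green_inner al be k g x) <= C * A / norm x"
  and O: "!!\<rho> z A x. 1 + k <= \<rho> ==> z holomorphic_on up_region k \<rho> ==> 0 <= A ==>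
   (!!x. x \<in> up_region k \<rho> ==> norm (z x) <= A / norm x) ==> x \<in> up_region k \<rho> ==>
   (green_outer al be k z has_field_derivative
     (2 * 1 - exp_lo al be / x) * green_outer al be k z x + z x) (at x) &
   norm (green_outer al be k z x) <= C * A / norm x"
  and L: "!!\<rho> f g A B D x. 1 + k <= \<rho> ==> f holomorphic_on up_region k \<rho> ==> g holomorphic_on up_region k \<rho> ==>
   0 <= A ==> 0 <= B ==> 0 <= D ==>
   (!!x. x \<in> up_region k \<rho> ==> norm (f x) <= A / norm x) ==>
   (!!x. x \<in> up_region k \<rho> ==> norm (g x) <= B / norm x) ==>
   (!!x. x \<in> up_region k \<rho> ==> norm (f x - g x) <= D / norm x) ==> x \<in> up_region k \<rho> ==>
   norm (green_outer al be k (green_inner al be k f) x - green_outer al be k (green_inner al be k g) x) <= C * C * D / norm x"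
  by (rule green_operator[OF k, of al be]) blast
 define s Q where "s = norm al + norm be" and "Q = remainder_const al be K"
 define m where "m = 1 + K + 2 * (C * C * Q)"
 have s0: "0 <= s" by (simp add: s_def)
 have Q0: "0 <= Q" unfolding Q_def by (rule remainder_const_nonneg[OF K0])
 have CQ: "0 <= C * C * Q" using C Q0 by simp
 have m: "1 <= m" "K <= m" using K0 CQ by (auto simp: m_def)
 have small: "C * C * (Q / m^2) <= 1/2"
 proof -
  have "2 * (C * C * Q) <= m" using K0 by (simp add: m_def)
  also have "m <= m^2" using m(1) by (simp add: power2_eq_square)
  finally show ?thesis using m(1) by (simp add: divide_simps)
 qed
 define A where "A = s + Q / m^2 * K"
 have A0: "0 <= A" using s0 Q0 K0 by (simp add: A_def)
 have CA: "0 <= C * A" using C A0 by simp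
 define R where "R f x = remainder al be x (f x)" for f x
 define T where "T f = green_outer al be k (green_inner al be k (R f))" for f
 have o2: "Re (- 1 * (- 1 + \<i> * of_real k)) = 1" and o1: "Re (1 * (1 + \<i> * of_real k)) = 1" by auto
 have "\<phi> x = \<psi> x"
  if \<rho>: "(1 + k) * m <= \<rho>" and hol: "\<phi> holomorphic_on up_region k \<rho>" "\<psi> holomorphic_on up_region k \<rho>"
   and eq: "!!x. x \<in> up_region k \<rho> ==> sinh_P3 al be \<phi> x" "!!x. x \<in> up_region k \<rho> ==> sinh_P3 al be \<psi> x"
   and bd: "!!x. x \<in> up_region k \<rho> ==> norm (\<phi> x) <= K / norm x" "!!x. x \<in> up_region k \<rho> ==> norm (\<psi> x) <= K / norm x"
   and x: "x \<in> up_region k (\<rho> + 1 + k)" for \<rho> \<phi> \<psi> x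
 proof -
  let ?H = "up_region k \<rho>"
  let ?G = "up_region k (\<rho> + 1 + k)"
  have "(1 + k) * 1 <= (1 + k) * m" using m(1) k by (intro mult_left_mono) auto
  then have "(1 + k) * 1 <= \<rho>" using \<rho> by (rule order_trans)
  then have r1: "1 + k <= \<rho>" by simp
  then have r2: "1 + k <= \<rho> + 1 + k" using k by simp
  have sub: "?G <= ?H" using k by (auto simp: up_region_def)
  have H0: "0 \<notin> ?H" by (rule up_region_not_zero) (use r1 k in simp)
  then have G0: "0 \<notin> ?G" using sub by blast
  have far: "m <= norm x" if "x \<in> ?H" for x by (rule up_region_far[OF k \<rho> that])
  note R1 = up_region_ray_domain[OF k r2, of "1 + \<i> * of_real k"]
  note R2 = up_region_ray_domain[OF k r2, of "- 1 + \<i> * of_real k"]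
  have near: "cball x (1/2) <= ?H" if "x \<in> ?G" for x
  proof
   fix y assume "y \<in> cball x (1/2)"
   then have n: "norm (x - y) <= 1/2" by (simp add: dist_norm)
   have "Im x - Im y <= 1/2" "\<bar>Re x\<bar> - \<bar>Re y\<bar> <= 1/2"
    using abs_Im_le_cmod[of "x - y"] abs_Re_le_cmod[of "x - y"] n by auto
   then have "Im x - Im y <= 1/2" "k * (\<bar>Re x\<bar> - \<bar>Re y\<bar>) <= k * (1/2)" using k by (auto intro: mult_left_mono)
   then show "y \<in> ?H" using that k by (simp add: up_region_def algebra_simps)
  qed
  have fixed: "R f holomorphic_on ?G & (\<forall>x\<in>?G. norm (R f x) <= A / norm x) & (\<forall>x\<in>?G. f x = T f x)"
   if f: "f holomorphic_on ?H" and fe: "!!x. x \<in> ?H ==> sinh_P3 al be f x"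
    and fb: "!!x. x \<in> ?H ==> norm (f x) <= K / norm x" for f
  proof -
   define z where "z x = deriv f x - (2 * 1 - exp_lo al be / x) * f x" for x
   have sys: "split_system al be ?H f z"
    unfolding z_def by (rule sinh_P3_imp_split_system[OF f up_region_open H0 fe])
   have fG: "f holomorphic_on ?G" using f sub by (rule holomorphic_on_subset)
   have Rh: "R f holomorphic_on ?G"
    unfolding R_def[abs_def] by (rule remainder_holomorphic[OF fG G0])
   have RA: "norm (R f x) <= A / norm x" if "x \<in> ?G" for x
    unfolding R_def A_def s_def Q_def
    by (rule remainder_bound[OF far m K0 fb]) (use that sub in auto)
   have fK: "norm (f y) <= K" if "y \<in> ?H" for y
   proof -
    have "norm (f y) <= K / norm y" by (rule fb[OF that])
    also have "... <= K / 1"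
     by (rule divide_left_mono) (use far[OF that] m K0 in auto)
    finally show ?thesis by simp
   qed
   define D where "D = K / (1/2) + (2 + norm (exp_lo al be)) * K"
   have zb: "norm (z x) <= D" if x: "x \<in> ?G" for x
   proof -
    have "norm ((deriv ^^ 1) f x) <= fact 1 * K / (1/2) ^ 1"
    proof (rule Cauchy_inequality)
     show "f holomorphic_on ball x (1/2)" using f near[OF x] by (meson ball_subset_cball holomorphic_on_subset)
     show "continuous_on (cball x (1/2)) f" using f near[OF x] by (meson continuous_on_subset holomorphic_on_imp_continuous_on)
     fix y assume "norm (x - y) = 1/2"
     then have "y \<in> ?H" using near[OF x] by (auto simp: dist_norm)
     then show "norm (f y) <= K" by (rule fK)
    qed simp
    then have 1: "norm (deriv f x) <= K / (1/2)" by simp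
    have xH: "x \<in> ?H" using x sub by blast
    have "norm (exp_lo al be / x) <= norm (exp_lo al be) / 1"
     unfolding norm_divide using far[OF xH] m by (intro divide_left_mono) auto
    then have "norm (2 * 1 - exp_lo al be / x) <= 2 + norm (exp_lo al be)"
     using norm_triangle_ineq4[of "2 * 1" "exp_lo al be / x"] by simp
    then have "norm ((2 * 1 - exp_lo al be / x) * f x) <= (2 + norm (exp_lo al be)) * K"
     unfolding norm_mult[of _ "f x"] using fK[OF xH] by (intro mult_mono) auto
    then show ?thesis unfolding z_def D_def
     using 1 norm_triangle_ineq4[of "deriv f x" "(2 * 1 - exp_lo al be / x) * f x"] by linarith
   qed
   have z_eq: "z x = green_inner al be k (R f) x" if x: "x \<in> ?G" for x
   proof -
    have "(%x. z x - green_inner al be k (R f) x) x = 0"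
    proof (rule bounded_homogeneous_solution_zero[OF o2 R2 up_region_connected[OF k] _ _ x, where a = "exp_hi al be"])
     fix y assume y: "y \<in> ?G"
     then have "(z has_field_derivative (2 * (-1) - exp_hi al be / y) * z y + R f y) (at y)"
      using sys sub by (auto simp: split_system_def R_def)
     moreover note I[OF r2 Rh A0 RA y, THEN conjunct1]
     ultimately show "((%x. z x - green_inner al be k (R f) x) has_field_derivative
       (2 * - 1 - exp_hi al be / y) * (z y - green_inner al be k (R f) y)) (at y)"
      by (rule DERIV_cong[OF DERIV_diff affine_cancel])
     have "norm (green_inner al be k (R f) y) <= C * A / norm y" using I[OF r2 Rh A0 RA y] by blast
     also have "... <= C * A / 1" using far[of y] y sub m CA by (intro divide_left_mono) auto
     finally show "norm (z y - green_inner al be k (R f) y) <= D + C * A"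
      using zb[OF y] norm_triangle_ineq4[of "z y" "green_inner al be k (R f) y"] by simp
    qed simp
    then show ?thesis by simp
   qed
   have Ih: "green_inner al be k (R f) holomorphic_on ?G"
    unfolding holomorphic_on_open[OF up_region_open] using I[OF r2 Rh A0 RA] by blast
   have Ib: "norm (green_inner al be k (R f) x) <= C * A / norm x" if "x \<in> ?G" for x
    using I[OF r2 Rh A0 RA that] by blast
   have "f x = T f x" if x: "x \<in> ?G" for x
   proof -
    have "(%x. f x - T f x) x = 0"
    proof (rule bounded_homogeneous_solution_zero[OF o1 R1 up_region_connected[OF k] _ _ x, where a = "exp_lo al be"])
     fix y assume y: "y \<in> ?G"
     then have "(f has_field_derivative (2 * 1 - exp_lo al be / y) * f y + z y) (at y)"
      using sys sub unfolding split_system_def by blast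
     then have "(f has_field_derivative (2 * 1 - exp_lo al be / y) * f y + green_inner al be k (R f) y) (at y)"
      by (simp only: z_eq[OF y])
     moreover note O[OF r2 Ih CA Ib y, THEN conjunct1, folded T_def]
     ultimately show "((%x. f x - T f x) has_field_derivative (2 * 1 - exp_lo al be / y) * (f y - T f y)) (at y)"
      by (rule DERIV_cong[OF DERIV_diff affine_cancel])
     have "norm (T f y) <= C * (C * A) / norm y" using O[OF r2 Ih CA Ib y] unfolding T_def by blast
     also have "... <= C * (C * A) / 1" using far[of y] y sub m CA C by (intro divide_left_mono) auto
     finally show "norm (f y - T f y) <= K + C * (C * A)"
      using fK[of y] y sub norm_triangle_ineq4[of "f y" "T f y"] by auto
    qed simp
    then show ?thesis by simp
   qed
   then show ?thesis using Rh RA by blast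
  qed
  note F1 = fixed[OF hol(1) eq(1) bd(1)] and F2 = fixed[OF hol(2) eq(2) bd(2)]
  have Rh: "R \<phi> holomorphic_on ?G" "R \<psi> holomorphic_on ?G" using F1 F2 by auto
  have RA: "!!x. x \<in> ?G ==> norm (R \<phi> x) <= A / norm x" "!!x. x \<in> ?G ==> norm (R \<psi> x) <= A / norm x" using F1 F2 by auto
  have step: "norm (\<phi> x - \<psi> x) <= (1/2)^n * (2 * K) / norm x" if "x \<in> ?G" for n x
   using that
  proof (induction n arbitrary: x)
   case 0
   then show ?case using bd[of x] sub norm_triangle_ineq4[of "\<phi> x" "\<psi> x"] by auto
  next
   case (Suc n)
   have RD: "norm (R \<phi> y - R \<psi> y) <= Q / m^2 * ((1/2)^n * (2 * K)) / norm y" if "y \<in> ?G" for y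
    unfolding R_def Q_def
    by (rule remainder_difference_bound[OF far m K0 bd(1) bd(2) Suc.IH[OF that]]) (use sub that in auto)
   have "norm (T \<phi> x - T \<psi> x) <= C * C * (Q / m^2 * ((1/2)^n * (2 * K))) / norm x"
    unfolding T_def by (rule L[OF r2 Rh A0 A0 _ RA RD Suc.prems]) (use Q0 K0 in simp)
   also have "... = C * C * (Q / m^2) * ((1/2)^n * (2 * K) / norm x)" by simp
   also have "... <= 1/2 * ((1/2)^n * (2 * K) / norm x)" by (rule mult_right_mono[OF small]) (use K0 in simp)
   finally show ?case using F1 F2 Suc.prems by simp
  qed
  have "(%n. (1/2::real)^n * (2 * K) / norm x) \<longlonglongrightarrow> 0 * (2 * K) / norm x"
   using G0 x by (intro tendsto_intros LIMSEQ_realpow_zero) auto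
  then have "norm (\<phi> x - \<psi> x) <= 0 * (2 * K) / norm x"
   by (rule LIMSEQ_le_const) (use step[OF x] in auto)
  then show ?thesis by simp
 qed
 then show thesis using that by blast
qed

section \<open>Inverse operators on functions of exponential decay\<close>

text \<open>
  A neighbourhood of infinity in a sector of opening less than \<open>\<pi>\<close> around the positive real axis.
  Both inverse operators integrate along the direction 1 here.
\<close>

definition right_cone :: "real => real => complex set" where
 "right_cone k \<rho> = {x. \<rho> + \<bar>Im x\<bar> < k * Re x}"

definition decaying_gauge :: "complex => complex => complex => complex" where
 "decaying_gauge al be = gauge_fun (-1) (exp_hi al be)"

definition cone_inner :: "complex => complex => (complex => complex) => complex => complex" where
 "cone_inner al be = gauge_inverse (-1) (exp_hi al be) 1"

definition cone_outer :: "complex => complex => (complex => complex) => complex => complex" where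
 "cone_outer al be = gauge_inverse 1 (exp_lo al be) 1"

lemma right_cone_open: "open (right_cone k \<rho>)"
 unfolding right_cone_def by (intro open_Collect_less continuous_intros)

lemma right_cone_connected: "connected (right_cone k \<rho>)"
proof -
 have "right_cone k \<rho> = {x. (of_real k - \<i>) \<bullet> x > \<rho>} \<inter> {x. (of_real k + \<i>) \<bullet> x > \<rho>}"
  by (auto simp: right_cone_def inner_complex_def)
 then show ?thesis by (simp only:) (intro convex_connected convex_Int convex_halfspace_gt)
qed

lemma right_cone_mono: "\<rho> <= \<rho>' ==> right_cone k \<rho>' <= right_cone k \<rho>"
 by (auto simp: right_cone_def)

lemma right_cone_far:
 assumes k: "0 < k" and m: "0 <= m" "k * m <= \<rho>" and x: "x \<in> right_cone k \<rho>"
 shows "m <= Re x" "0 < Re x" "Re x <= norm x" "norm x <= (1 + k) * Re x"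
proof -
 have a: "k * m + \<bar>Im x\<bar> < k * Re x" using x m by (simp add: right_cone_def)
 then have "k * m < k * Re x" by linarith
 then have "m < Re x" using k by simp
 then show "m <= Re x" "0 < Re x" using m by auto
 show "Re x <= norm x" by (rule complex_Re_le_cmod)
 have "\<bar>Im x\<bar> <= k * Re x" using a m k by (smt (verit) mult_nonneg_nonneg)
 then show "norm x <= (1 + k) * Re x"
  using cmod_le[of x] \<open>0 < Re x\<close> by (simp add: algebra_simps)
qed

lemma right_cone_ray_domain:
 assumes k: "0 < k" "k <= \<rho>"
 shows "ray_domain 1 (right_cone k \<rho>)"
 unfolding ray_domain_def
proof (intro conjI ballI allI impI)
 show "open (right_cone k \<rho>)" by (rule right_cone_open)
 note far = right_cone_far[OF k(1), of 1 \<rho>]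
 show "right_cone k \<rho> <= cut_plane" using far k by (force simp: cut_plane_iff)
 fix x assume x: "x \<in> right_cone k \<rho>"
 show "1 <= norm x" using far[OF _ _ x] k by simp
 fix \<tau> :: real assume "0 <= \<tau>"
 then have "0 <= k * \<tau>" using k by simp
 then show "x + of_real \<tau> * 1 \<in> right_cone k \<rho>" using x by (simp add: right_cone_def algebra_simps)
qed

lemma right_cone_subset_up_region:
 assumes "0 < k" "0 <= \<rho>"
 shows "right_cone k \<rho> <= up_region (k + 1) \<rho>"
proof
 fix x assume x: "x \<in> right_cone k \<rho>"
 have "0 < Re x" using right_cone_far[of k 0 \<rho> x] assms x by auto
 then show "x \<in> up_region (k + 1) \<rho>" using x by (simp add: right_cone_def up_region_def algebra_simps)
qed

lemma decaying_gauge_nonzero [simp]: "decaying_gauge al be x ~= 0"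
 by (simp add: decaying_gauge_def)

lemma decaying_gauge_holomorphic: "S <= cut_plane ==> decaying_gauge al be holomorphic_on S"
 unfolding decaying_gauge_def by (rule gauge_fun_holomorphic)

text \<open>
  On the cone \<open>Re x \<ge> \<bar>x\<bar> / (1 + k)\<close>; the factor 2 in the exponent of the gauge leaves one exponential
  to absorb the power of \<open>x\<close>.
\<close>

lemma decaying_gauge_exponentially_small:
 assumes k: "0 < k"
 obtains C where "0 < C" "!!\<rho> x. k <= \<rho> ==> x \<in> right_cone k \<rho> ==> norm (decaying_gauge al be x) <= C * exp (- norm x / (1 + k))"
proof -
 define a where "a = exp_hi al be"
 obtain C where C: "0 <= C" "!!\<tau>. 0 <= \<tau> ==>
   exp (- 2 * \<tau>) * exp (norm a * (2 * pi + ln (1 + (2 * (1 + k)) * \<tau>))) * (1 + (2 * (1 + k)) * \<tau>) ^ 0 <= C / (1 + \<tau>)^2"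
  by (rule exp_beats_polynomial[of "2 * (1 + k)" "norm a" "2 * pi" 0]) (use k in auto)
 have "norm (decaying_gauge al be x) <= (C + 1) * exp (- norm x / (1 + k))"
  if \<rho>: "k <= \<rho>" and x: "x \<in> right_cone k \<rho>" for \<rho> x
 proof -
  have rd: "x \<in> cut_plane" "1 <= norm x" using right_cone_ray_domain[OF k \<rho>] x by (auto simp: ray_domain_def)
  have f: "norm x <= (1 + k) * Re x" "0 < Re x" using right_cone_far[OF k, of 1 \<rho> x] \<rho> x by auto
  define \<tau> where "\<tau> = norm x / (2 * (1 + k))"
  have \<tau>: "0 <= \<tau>" "2 * (1 + k) * \<tau> = norm x" "2 * \<tau> = norm x / (1 + k)" using k by (auto simp: \<tau>_def field_simps)
  have "norm x / (1 + k) <= Re x" using f k by (subst pos_divide_le_eq) (auto simp: mult.commute)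
  then have "2 * \<tau> <= Re x" by (simp only: \<tau>(3))
  then have e1: "exp (- 2 * Re x) <= exp (- 2 * \<tau>) * exp (- 2 * \<tau>)" by (simp flip: exp_add)
  have "ln (norm x) <= ln (1 + norm x)" using rd(2) by (intro ln_mono) auto
  then have "\<bar>Re (up_log x)\<bar> <= ln (1 + norm x)" using up_log(4)[OF rd(1)] rd(2) by simp
  moreover have "\<bar>Im (up_log x)\<bar> <= 2 * pi" using up_log(5,6)[OF rd(1)] by simp
  ultimately have "norm (up_log x) <= 2 * pi + ln (1 + norm x)" using cmod_le[of "up_log x"] by linarith
  then have "norm a * norm (up_log x) <= norm a * (2 * pi + ln (1 + norm x))" by (intro mult_left_mono) auto
  moreover have "Re (- (a * up_log x)) <= norm a * norm (up_log x)"
   using complex_Re_le_cmod[of "- (a * up_log x)"] by (simp add: norm_mult)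
  ultimately have e2: "exp (Re (- (a * up_log x))) <= exp (norm a * (2 * pi + ln (1 + norm x)))" by simp
  have "decaying_gauge al be x = exp (- 2 * x) * exp (- (a * up_log x))"
   by (simp add: decaying_gauge_def gauge_fun_def a_def flip: exp_add)
  then have "norm (decaying_gauge al be x) = exp (- 2 * Re x) * exp (Re (- (a * up_log x)))"
   by (simp add: norm_mult)
  also have "... <= (exp (- 2 * \<tau>) * exp (- 2 * \<tau>)) * exp (norm a * (2 * pi + ln (1 + norm x)))"
   by (intro mult_mono e1 e2) auto
  also have "... = exp (- 2 * \<tau>) * (exp (- 2 * \<tau>) * exp (norm a * (2 * pi + ln (1 + norm x))))" by simp
  also have "... <= exp (- 2 * \<tau>) * (C + 1)"
  proof (rule mult_left_mono)
   have "exp (- 2 * \<tau>) * exp (norm a * (2 * pi + ln (1 + norm x))) <= C / (1 + \<tau>)^2"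
    using C(2)[OF \<tau>(1)] unfolding \<tau>(2) by simp
   also have "... <= C / 1" using C(1) \<tau>(1) by (intro divide_left_mono) auto
   finally show "exp (- 2 * \<tau>) * exp (norm a * (2 * pi + ln (1 + norm x))) <= C + 1" by simp
  qed simp
  finally show ?thesis using \<tau>(3) by (simp add: mult.commute)
 qed
 then show thesis by (rule that[of "C + 1", rotated]) (use C(1) in auto)
qed

lemma exp_neg_le_inverse:
 fixes r q :: real
 assumes "0 < r" "0 < q"
 shows "exp (- r / q) <= q / r"
proof -
 have "r / q < exp (r / q)" by (rule exp_gt_self)
 then show ?thesis using assms by (simp add: exp_minus field_simps)
qed

lemma decaying_gauge_ray:
 obtains C where "0 <= C" "!!G x \<tau>. ray_domain 1 G ==> x \<in> G ==> 0 <= \<tau> ==>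
   norm (decaying_gauge al be (x + of_real \<tau>)) <= C * norm (decaying_gauge al be x)"
proof -
 obtain C where C: "0 <= C" "!!G x \<tau>. ray_domain 1 G ==> x \<in> G ==> 0 <= \<tau> ==>
   norm (gauge_fun 1 (- exp_hi al be) x) * (1 + norm (1::complex) * \<tau>) ^ 0 <= C / (1 + \<tau>)^2 * norm (gauge_fun 1 (- exp_hi al be) (x + of_real \<tau> * 1))"
  by (rule gauge_ratio[of 1 1 "- exp_hi al be" 0]) auto
 have inv: "gauge_fun 1 (- exp_hi al be) x = inverse (decaying_gauge al be x)" for x
  by (simp add: decaying_gauge_def gauge_fun_def add.commute flip: exp_minus)
 have "norm (decaying_gauge al be (x + of_real \<tau>)) <= C * norm (decaying_gauge al be x)"
  if "ray_domain 1 G" "x \<in> G" and \<tau>: "0 <= \<tau>" for G x \<tau>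
 proof -
  define p q where "p = norm (decaying_gauge al be x)" and "q = norm (decaying_gauge al be (x + of_real \<tau>))"
  have pq: "0 < p" "0 < q" by (auto simp: p_def q_def)
  have "inverse p <= C / (1 + \<tau>)^2 * inverse q"
   using C(2)[OF that] by (simp add: inv norm_inverse p_def q_def)
  also have "... <= C / 1 * inverse q" using C(1) \<tau> pq by (intro mult_right_mono divide_left_mono) auto
  finally show ?thesis using pq by (simp add: p_def[symmetric] q_def[symmetric] field_simps)
 qed
 with C(1) show thesis by (rule that)
qed

text \<open>
  The source is smaller than the gauge by \<open>1 / x\<^sup>2\<close>, which makes the quotient integrable along the ray
  although the exponentials cancel.
\<close>

lemma cone_inner_solves:
 assumes k: "0 < k" "k <= \<rho>" and h: "h holomorphic_on right_cone k \<rho>" and A: "0 <= A"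
  and b: "!!x. x \<in> right_cone k \<rho> ==> norm (h x) <= A * norm (decaying_gauge al be x) / (norm x)^2"
  and x: "x \<in> right_cone k \<rho>"
 shows "(cone_inner al be h has_field_derivative (2 * (-1) - exp_hi al be / x) * cone_inner al be h x + h x) (at x)"
  and "norm (cone_inner al be h x) <= A / Re x * norm (decaying_gauge al be x)"
  and "integrable lborel (%\<tau>. indicator {0<..} \<tau> *\<^sub>R (h (x + of_real \<tau> * 1) / gauge_fun (-1) (exp_hi al be) (x + of_real \<tau> * 1)))"
  and "0 <= \<tau> ==> norm (h (x + of_real \<tau> * 1) / gauge_fun (-1) (exp_hi al be) (x + of_real \<tau> * 1)) <= A / (Re x + \<tau>)^2"
proof -
 let ?G = "right_cone k \<rho>" and ?\<mu> = "decaying_gauge al be"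
 note rd = right_cone_ray_domain[OF k]
 have sub: "?G <= cut_plane" and ray: "!!x \<tau>. x \<in> ?G ==> 0 <= \<tau> ==> x + of_real \<tau> * 1 \<in> ?G"
  using rd by (auto simp: ray_domain_def)
 have Rp: "0 < Re y" if "y \<in> ?G" for y using right_cone_far[OF k(1), of 1 \<rho> y] k that by auto
 define g where "g y = h y / ?\<mu> y" for y
 have gh: "g holomorphic_on ?G"
  unfolding g_def by (intro holomorphic_intros h decaying_gauge_holomorphic sub) auto
 have gb: "norm (g (y + of_real \<tau> * 1)) <= A / (Re y + \<tau>)^2" if y: "y \<in> ?G" and \<tau>: "0 <= \<tau>" for y \<tau>
 proof -
  let ?y = "y + of_real \<tau> * 1"
  have "norm (g ?y) <= A * norm (?\<mu> ?y) / (norm ?y)^2 / norm (?\<mu> ?y)"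
   unfolding g_def norm_divide using b[OF ray[OF y \<tau>]] by (rule divide_right_mono) simp
  also have "... = A / (norm ?y)^2" by simp
  also have "... <= A / (Re y + \<tau>)^2"
  proof (rule divide_left_mono[OF _ A])
   have "Re y + \<tau> <= norm ?y" using complex_Re_le_cmod[of ?y] by simp
   then show "(Re y + \<tau>)^2 <= (norm ?y)^2" using Rp[OF y] \<tau> by (intro power_mono) auto
   show "0 < (norm ?y)^2 * (Re y + \<tau>)^2"
    using \<open>Re y + \<tau> <= norm ?y\<close> Rp[OF y] \<tau> by (intro mult_pos_pos zero_less_power) auto
  qed
  finally show ?thesis .
 qed
 have P: "(ray_integral 1 g has_field_derivative g x) (at x)" "norm (ray_integral 1 g x) <= norm (1::complex) * (A / Re x)"
  by (rule ray_integral_primitive[OF right_cone_open ray gh, where B = "%_. A" and d = Re];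
    use gb Rp x in \<open>auto intro!: continuous_intros\<close>)+
 have J: "cone_inner al be h = (%x. ?\<mu> x * ray_integral 1 g x)"
  by (auto simp: cone_inner_def gauge_inverse_def g_def[abs_def] decaying_gauge_def)
 have "(cone_inner al be h has_field_derivative (2 * (-1) - exp_hi al be / x) * ?\<mu> x * ray_integral 1 g x + g x * ?\<mu> x) (at x)"
  unfolding J decaying_gauge_def using x sub by (intro DERIV_mult gauge_fun_deriv P(1)[unfolded decaying_gauge_def]) auto
 then show "(cone_inner al be h has_field_derivative (2 * (-1) - exp_hi al be / x) * cone_inner al be h x + h x) (at x)"
  by (rule DERIV_cong) (simp add: J g_def)
 show "norm (cone_inner al be h x) <= A / Re x * norm (?\<mu> x)"
  using mult_left_mono[OF P(2), of "norm (?\<mu> x)"] by (simp add: J norm_mult mult.commute)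
 have eq: "h (x + of_real \<tau> * 1) / gauge_fun (-1) (exp_hi al be) (x + of_real \<tau> * 1) = g (x + of_real \<tau> * 1)" for \<tau>
  by (simp add: g_def decaying_gauge_def)
 show "integrable lborel (%\<tau>. indicator {0<..} \<tau> *\<^sub>R (h (x + of_real \<tau> * 1) / gauge_fun (-1) (exp_hi al be) (x + of_real \<tau> * 1)))"
  unfolding eq
 proof (rule half_line_dominated(1)[OF _ gb[OF x] A Rp[OF x]])
  show "continuous_on {0<..} (%\<tau>. g (x + of_real \<tau> * 1))"
   by (rule continuous_on_compose2[OF holomorphic_on_imp_continuous_on[OF gh]])
    (use ray[OF x] in \<open>auto intro!: continuous_intros\<close>)
 qed simp
 show "norm (h (x + of_real \<tau> * 1) / gauge_fun (-1) (exp_hi al be) (x + of_real \<tau> * 1)) <= A / (Re x + \<tau>)^2" if "0 <= \<tau>"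
  unfolding eq by (rule gb[OF x that])
qed

text \<open>
  Here the gauge of the operator grows and the data decay, so data bounded by the decaying gauge
  lose nothing.
\<close>

lemma cone_outer_solves:
 obtains C where "0 < C"
  "!!k \<rho> z A x \<tau>. 0 < k ==> k <= \<rho> ==> z holomorphic_on right_cone k \<rho> ==> 0 <= A ==>
   (!!x. x \<in> right_cone k \<rho> ==> norm (z x) <= A * norm (decaying_gauge al be x)) ==> x \<in> right_cone k \<rho> ==>
   (cone_outer al be z has_field_derivative (2 * 1 - exp_lo al be / x) * cone_outer al be z x + z x) (at x) &
   norm (cone_outer al be z x) <= C * A * norm (decaying_gauge al be x) &
   integrable lborel (%\<tau>. indicator {0<..} \<tau> *\<^sub>R (z (x + of_real \<tau> * 1) / gauge_fun 1 (exp_lo al be) (x + of_real \<tau> * 1))) &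
   (0 <= \<tau> --> norm (z (x + of_real \<tau> * 1) / gauge_fun 1 (exp_lo al be) (x + of_real \<tau> * 1)) \<le>
    C * A * norm (decaying_gauge al be x) / norm (gauge_fun 1 (exp_lo al be) x) / (1 + \<tau>)^2)"
proof -
 let ?\<mu> = "decaying_gauge al be" and ?b = "exp_lo al be"
 obtain C0 where C0: "0 <= C0" "!!G x \<tau>. ray_domain 1 G ==> x \<in> G ==> 0 <= \<tau> ==>
   norm (?\<mu> (x + of_real \<tau>)) <= C0 * norm (?\<mu> x)" by (rule decaying_gauge_ray[of al be]) blast
 have s: "Re (1 * 1) = 1" by simp
 obtain C1 where C1: "0 < C1" "!!G w g A x. ray_domain 1 G ==> continuous_on G w ==>
    (!!x \<tau>. x \<in> G ==> 0 <= \<tau> ==> w (x + of_real \<tau> * 1) <= C0 * (1 + norm (1::complex) * \<tau>) ^ 0 * w x) ==>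
    g holomorphic_on G ==> 0 <= A ==> (!!x. x \<in> G ==> norm (g x) <= A * w x) ==> x \<in> G ==>
    (gauge_inverse 1 ?b 1 g has_field_derivative (2 * 1 - ?b / x) * gauge_inverse 1 ?b 1 g x + g x) (at x) &
    norm (gauge_inverse 1 ?b 1 g x) <= C1 * A * w x &
    integrable lborel (%\<tau>. indicator {0<..} \<tau> *\<^sub>R (g (x + of_real \<tau> * 1) / gauge_fun 1 ?b (x + of_real \<tau> * 1)))"
  by (rule gauge_inverse_solves[OF s, where M = C0 and n = 0 and a = ?b]) blast
 obtain C2 where C2: "0 <= C2" "!!G x \<tau>. ray_domain 1 G ==> x \<in> G ==> 0 <= \<tau> ==>
   norm (gauge_fun 1 ?b x) * (1 + norm (1::complex) * \<tau>) ^ 0 <= C2 / (1 + \<tau>)^2 * norm (gauge_fun 1 ?b (x + of_real \<tau> * 1))"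
  by (rule gauge_ratio[OF s, of ?b 0]) blast
 define C where "C = C1 + C0 * C2"
 have C: "0 < C" "C1 <= C" "C0 * C2 <= C" using C1(1) C0(1) C2(1) by (auto simp: C_def add_pos_nonneg)
 show thesis
 proof (rule that[of C, OF C(1)])
  fix k \<rho> z A x \<tau>
  assume k: "0 < k" "k <= \<rho>" and z: "z holomorphic_on right_cone k \<rho>" and A: "0 <= A"
   and b: "!!x. x \<in> right_cone k \<rho> ==> norm (z x) <= A * norm (?\<mu> x)" and x: "x \<in> right_cone k \<rho>"
  note rd = right_cone_ray_domain[OF k]
  have sub: "right_cone k \<rho> <= cut_plane" and ray: "!!x \<tau>. x \<in> right_cone k \<rho> ==> 0 <= \<tau> ==> x + of_real \<tau> * 1 \<in> right_cone k \<rho>"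
   using rd by (auto simp: ray_domain_def)
  have wc: "continuous_on (right_cone k \<rho>) (%x. norm (?\<mu> x))"
   by (intro continuous_intros holomorphic_on_imp_continuous_on decaying_gauge_holomorphic sub)
  have wr: "norm (?\<mu> (y + of_real t * 1)) <= C0 * (1 + norm (1::complex) * t) ^ 0 * norm (?\<mu> y)"
   if "y \<in> right_cone k \<rho>" "0 <= t" for y t using C0(2)[OF rd that] by simp
  note * = C1(2)[OF rd wc wr z A b x]
  have "C1 * A * norm (?\<mu> x) <= C * A * norm (?\<mu> x)" using C A by (intro mult_right_mono) auto
  moreover have "norm (z (x + of_real \<tau> * 1) / gauge_fun 1 ?b (x + of_real \<tau> * 1)) \<le>
    C * A * norm (?\<mu> x) / norm (gauge_fun 1 ?b x) / (1 + \<tau>)^2" if \<tau>: "0 <= \<tau>"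
  proof -
   define p q where "p = norm (gauge_fun 1 ?b x)" and "q = norm (gauge_fun 1 ?b (x + of_real \<tau> * 1))"
   have pq: "0 < p" "0 < q" by (auto simp: p_def q_def)
   have "norm (z (x + of_real \<tau> * 1)) <= A * norm (?\<mu> (x + of_real \<tau> * 1))" by (rule b[OF ray[OF x \<tau>]])
   also have "... <= A * (C0 * norm (?\<mu> x))" using C0(2)[OF rd x \<tau>] A by (intro mult_left_mono) auto
   finally have z1: "norm (z (x + of_real \<tau> * 1)) <= A * (C0 * norm (?\<mu> x))" .
   have "p <= C2 / (1 + \<tau>)^2 * q" using C2(2)[OF rd x \<tau>] by (simp add: p_def q_def)
   moreover have "0 < (1 + \<tau>)^2" using \<tau> by simp
   ultimately have "1 / q <= C2 / (1 + \<tau>)^2 / p" using pq by (simp add: field_simps)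
   then have "norm (z (x + of_real \<tau> * 1)) * (1 / q) <= A * (C0 * norm (?\<mu> x)) * (C2 / (1 + \<tau>)^2 / p)"
    using z1 pq A C0(1) by (intro mult_mono) auto
   also have "... = (C0 * C2) * (A * norm (?\<mu> x) / p / (1 + \<tau>)^2)" by (simp add: mult_ac)
   also have "... <= C * (A * norm (?\<mu> x) / p / (1 + \<tau>)^2)"
    using C A pq by (intro mult_right_mono) auto
   finally show ?thesis by (simp add: norm_divide p_def q_def)
  qed
  ultimately show "(cone_outer al be z has_field_derivative (2 * 1 - ?b / x) * cone_outer al be z x + z x) (at x) &
   norm (cone_outer al be z x) <= C * A * norm (?\<mu> x) &
   integrable lborel (%\<tau>. indicator {0<..} \<tau> *\<^sub>R (z (x + of_real \<tau> * 1) / gauge_fun 1 ?b (x + of_real \<tau> * 1))) &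
   (0 <= \<tau> --> norm (z (x + of_real \<tau> * 1) / gauge_fun 1 ?b (x + of_real \<tau> * 1)) \<le>
    C * A * norm (?\<mu> x) / norm (gauge_fun 1 ?b x) / (1 + \<tau>)^2)"
   using * unfolding cone_outer_def by (meson order_trans)
 qed
qed

text \<open>
  The integrals depend holomorphically on a parameter of the source; this is what makes the family of
  solutions holomorphic in its parameter.
\<close>

lemma gauge_inverse_param_holomorphic:
 assumes S: "open S" and rd: "ray_domain \<omega> G" and x: "x \<in> G"
  and zx: "!!c. c \<in> S ==> z c holomorphic_on G"
  and zc: "!!y. y \<in> G ==> (%c. z c y) holomorphic_on S"
  and b: "!!c \<tau>. c \<in> S ==> 0 <= \<tau> ==> norm (z c (x + of_real \<tau> * \<omega>) / gauge_fun \<sigma> a (x + of_real \<tau> * \<omega>)) <= B / (d + \<tau>)^2"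
  and Bd: "0 <= B" "0 < d"
 shows "(%c. gauge_inverse \<sigma> a \<omega> (z c) x) holomorphic_on S"
proof -
 have sub: "G <= cut_plane" and ray: "!!\<tau>. 0 <= \<tau> ==> x + of_real \<tau> * \<omega> \<in> G"
  using rd x by (auto simp: ray_domain_def)
 define F where "F \<tau> c = z c (x + of_real \<tau> * \<omega>) / gauge_fun \<sigma> a (x + of_real \<tau> * \<omega>)" for \<tau> c
 have "(%c. half_line_integral (%\<tau>. F \<tau> c)) holomorphic_on S"
  unfolding holomorphic_on_open[OF S]
 proof (intro ballI exI)
  fix c assume c: "c \<in> S"
  show "((%c. half_line_integral (%\<tau>. F \<tau> c)) has_field_derivative half_line_integral (%\<tau>. deriv (F \<tau>) c)) (at c)"
  proof (rule half_line_integral_param(1)[OF S _ _ _ Bd c])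
   show "F \<tau> holomorphic_on S" if "0 < \<tau>" for \<tau>
    unfolding F_def using ray[of \<tau>] that by (intro holomorphic_intros zc) auto
   show "continuous_on {0<..} (%\<tau>. F \<tau> c)" if "c \<in> S" for c
   proof -
    have "(%y. z c y / gauge_fun \<sigma> a y) holomorphic_on G"
     by (intro holomorphic_intros zx that gauge_fun_holomorphic sub) auto
    then show ?thesis unfolding F_def
     by (rule continuous_on_compose2[OF holomorphic_on_imp_continuous_on])
      (use ray in \<open>auto intro!: continuous_intros\<close>)
   qed
   show "norm (F \<tau> c) <= B / (d + \<tau>)^2" if "c \<in> S" "0 < \<tau>" for c \<tau>
    unfolding F_def using b[of c \<tau>] that by simp
  qed
 qed
 then show ?thesis
  unfolding gauge_inverse_def ray_integral_def F_def by (intro holomorphic_intros)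
qed

section \<open>The exponentially small perturbations\<close>

text \<open>
  The difference of the remainders at \<open>\<phi>0 + \<delta>\<close> and at \<open>\<phi>0\<close>. The inhomogeneous
  part cancels, so a decaying \<open>\<delta>\<close> gives a decaying source.
\<close>

definition cone_source :: "complex => complex => (complex => complex) => (complex => complex) => complex => complex" where
 "cone_source al be \<phi>0 \<delta> x = remainder al be x (\<phi>0 x + \<delta> x) - remainder al be x (\<phi>0 x)"

text \<open>
  The multiple \<open>c\<close> of the decaying gauge is the general solution of the first homogeneous equation; it carries
  the free parameter.
\<close>

definition cone_aux :: "complex => complex => (complex => complex) => complex => (complex => complex) => complex => complex" where
 "cone_aux al be \<phi>0 c \<delta> y = c * decaying_gauge al be y + cone_inner al be (cone_source al be \<phi>0 \<delta>) y"

definition cone_map :: "complex => complex => (complex => complex) => complex => (complex => complex) => complex => complex" where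
 "cone_map al be \<phi>0 c \<delta> = cone_outer al be (cone_aux al be \<phi>0 c \<delta>)"

definition cone_class :: "complex => complex => real => real => real => (complex => complex) set" where
 "cone_class al be k \<rho> K = {\<delta>. \<delta> holomorphic_on right_cone k \<rho> &
   (\<forall>x\<in>right_cone k \<rho>. norm (\<delta> x) <= K * norm (decaying_gauge al be x))}"

text \<open>
  The constant is fixed before \<open>k\<close>, \<open>\<rho>\<close> and the size of the class are chosen, because the size of
  the class has to dominate it.
\<close>

definition outer_const_ok :: "complex => complex => real => bool" where
 "outer_const_ok al be C \<longleftrightarrow> 0 < C & (\<forall>k \<rho> z A x \<tau>. 0 < k --> k <= \<rho> --> z holomorphic_on right_cone k \<rho> --> 0 <= A -->
   (\<forall>x\<in>right_cone k \<rho>. norm (z x) <= A * norm (decaying_gauge al be x)) --> x \<in> right_cone k \<rho> -->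
   (cone_outer al be z has_field_derivative (2 * 1 - exp_lo al be / x) * cone_outer al be z x + z x) (at x) &
   norm (cone_outer al be z x) <= C * A * norm (decaying_gauge al be x) &
   integrable lborel (%\<tau>. indicator {0<..} \<tau> *\<^sub>R (z (x + of_real \<tau> * 1) / gauge_fun 1 (exp_lo al be) (x + of_real \<tau> * 1))) &
   (0 <= \<tau> --> norm (z (x + of_real \<tau> * 1) / gauge_fun 1 (exp_lo al be) (x + of_real \<tau> * 1)) \<le>
    C * A * norm (decaying_gauge al be x) / norm (gauge_fun 1 (exp_lo al be) x) / (1 + \<tau>)^2))"

lemma affine_add: "a * p + u + (a * q + v) = a * (p + q) + (u + v)" for a p q u v :: complex
 by (simp add: algebra_simps)

lemma outer_const_exists: "\<exists>C. outer_const_ok al be C"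
 unfolding outer_const_ok_def by (rule cone_outer_solves[of al be]) (rule exI, blast)

text \<open>
  A base function \<open>\<phi>0\<close> of size \<open>K0 / \<bar>x\<bar>\<close> and perturbations bounded by \<open>K\<close> times the decaying gauge,
  on a cone so far out (at distance at least \<open>m\<close>) that the perturbed equation is a contraction.
\<close>

locale cone_setup =
 fixes al be :: complex and k \<rho> m C C4 K0 K :: real and \<phi>0 :: "complex => complex"
 assumes k: "0 < k" and \<rho>: "k * m <= \<rho>" and m1: "1 <= m"
  and C: "outer_const_ok al be C"
  and C4: "0 <= C4" "!!x. x \<in> right_cone k \<rho> ==> norm (decaying_gauge al be x) <= C4 / norm x"
  and K0: "0 <= K0" and K: "0 <= K"
  and mK: "K0 + K * C4 <= m"
  and mQ: "remainder_const al be (K0 + K * C4) * K <= m" "2 * (C * remainder_const al be (K0 + K * C4)) <= m"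
  and \<phi>0: "\<phi>0 holomorphic_on right_cone k \<rho>" "!!x. x \<in> right_cone k \<rho> ==> norm (\<phi>0 x) <= K0 / norm x"
begin

abbreviation "wedge \<equiv> right_cone k \<rho>"
abbreviation "\<mu> \<equiv> decaying_gauge al be"
abbreviation "Q \<equiv> remainder_const al be (K0 + K * C4)"
abbreviation "source \<equiv> cone_source al be \<phi>0"
abbreviation "aux \<equiv> cone_aux al be \<phi>0"
abbreviation "T \<equiv> cone_map al be \<phi>0"
abbreviation "M \<equiv> cone_class al be k \<rho> K"

lemma k\<rho>: "k <= \<rho>"
proof -
 have "k * 1 <= k * m" by (rule mult_left_mono[OF m1]) (use k in simp)
 then show ?thesis using \<rho> by simp
qed

lemma ray: "ray_domain 1 wedge"
 by (rule right_cone_ray_domain[OF k k\<rho>])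

lemma sub: "wedge <= cut_plane" and not0: "0 \<notin> wedge"
 using ray up_log(1) by (auto simp: ray_domain_def)

lemma far:
 assumes "x \<in> wedge"
 shows "m <= Re x" "0 < Re x" "m <= norm x" "0 < norm x"
 using right_cone_far[OF k _ \<rho> assms] m1 by auto

lemma Q0: "0 <= Q"
 by (intro remainder_const_nonneg) (use K0 K C4 in simp)

lemma C0: "0 < C"
 using C by (simp add: outer_const_ok_def)

lemma source_difference:
 assumes "\<delta> \<in> M" "\<eta> \<in> M" and x: "x \<in> wedge"
 shows "norm (source \<delta> x - source \<eta> x) <= Q / (norm x)^2 * norm (\<delta> x - \<eta> x)"
proof -
 have b: "norm (\<phi>0 x + \<delta> x) <= (K0 + K * C4) / norm x" if "\<delta> \<in> M" for \<delta>
 proof -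
  have "norm (\<delta> x) <= K * norm (\<mu> x)" using that x by (simp add: cone_class_def)
  also have "... <= K * (C4 / norm x)" by (rule mult_left_mono[OF C4(2)[OF x] K])
  finally show ?thesis
   using \<phi>0(2)[OF x] norm_triangle_ineq[of "\<phi>0 x" "\<delta> x"] by (simp add: add_divide_distrib)
 qed
 have "norm (remainder al be x (\<phi>0 x + \<delta> x) - remainder al be x (\<phi>0 x + \<eta> x)) \<le>
   Q / (norm x)^2 * norm ((\<phi>0 x + \<delta> x) - (\<phi>0 x + \<eta> x))"
  by (rule remainder_lipschitz) (use far[OF x] mK b assms in auto)
 then show ?thesis by (simp add: cone_source_def)
qed

lemma zero_class: "(%_. 0) \<in> M"
 using K by (simp add: cone_class_def)

lemma source_zero: "source (%_. 0) x = 0"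
 by (simp add: cone_source_def)

lemma source_holomorphic:
 assumes "\<delta> \<in> M" shows "source \<delta> holomorphic_on wedge"
proof -
 have "\<delta> holomorphic_on wedge" using assms by (simp add: cone_class_def)
 then have "(%x. \<phi>0 x + \<delta> x) holomorphic_on wedge" by (rule holomorphic_on_add[OF \<phi>0(1)])
 from holomorphic_on_diff[OF remainder_holomorphic[OF this not0] remainder_holomorphic[OF \<phi>0(1) not0]]
 show ?thesis unfolding cone_source_def .
qed

lemma source_bound:
 assumes "\<delta> \<in> M" "x \<in> wedge"
 shows "norm (source \<delta> x) <= (Q * K) * norm (\<mu> x) / (norm x)^2"
proof -
 have "norm (source \<delta> x) <= Q / (norm x)^2 * norm (\<delta> x)"
  using source_difference[OF assms(1) zero_class assms(2)] by (simp add: source_zero)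
 also have "... <= Q / (norm x)^2 * (K * norm (\<mu> x))"
  using assms Q0 by (intro mult_left_mono) (auto simp: cone_class_def)
 finally show ?thesis by simp
qed

lemma QK: "0 <= Q * K"
 using Q0 K by simp

lemma inner_props:
 assumes \<delta>: "\<delta> \<in> M" and x: "x \<in> wedge"
 shows "(cone_inner al be (source \<delta>) has_field_derivative
   (2 * (-1) - exp_hi al be / x) * cone_inner al be (source \<delta>) x + source \<delta> x) (at x)"
  and "norm (cone_inner al be (source \<delta>) x) <= Q * K / Re x * norm (\<mu> x)"
  and "integrable lborel (%\<tau>. indicator {0<..} \<tau> *\<^sub>R (source \<delta> (x + of_real \<tau> * 1) / gauge_fun (-1) (exp_hi al be) (x + of_real \<tau> * 1)))"
  and "0 <= \<tau> ==> norm (source \<delta> (x + of_real \<tau> * 1) / gauge_fun (-1) (exp_hi al be) (x + of_real \<tau> * 1)) <= Q * K / (Re x + \<tau>)^2"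
 using cone_inner_solves[OF k k\<rho> source_holomorphic[OF \<delta>] QK source_bound[OF \<delta>] x] by blast+

lemma aux_derivative:
 assumes "\<delta> \<in> M" "x \<in> wedge"
 shows "(aux c \<delta> has_field_derivative (2 * (-1) - exp_hi al be / x) * aux c \<delta> x + source \<delta> x) (at x)"
proof -
 have "(\<mu> has_field_derivative (2 * (-1) - exp_hi al be / x) * \<mu> x) (at x)"
  unfolding decaying_gauge_def using assms sub by (intro gauge_fun_deriv) auto
 from DERIV_add[OF DERIV_cmult[OF this, of c] inner_props(1)[OF assms]]
 show ?thesis unfolding cone_aux_def[abs_def] by (rule DERIV_cong) (simp add: algebra_simps)
qed

lemma aux_holomorphic: "\<delta> \<in> M ==> aux c \<delta> holomorphic_on wedge"
 unfolding holomorphic_on_open[OF right_cone_open] using aux_derivative by blast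

lemma aux_bound:
 assumes "\<delta> \<in> M" "x \<in> wedge"
 shows "norm (aux c \<delta> x) <= (norm c + 1) * norm (\<mu> x)"
proof -
 have "norm (cone_inner al be (source \<delta>) x) <= Q * K / Re x * norm (\<mu> x)"
  by (rule inner_props(2)[OF assms])
 also have "... <= 1 * norm (\<mu> x)"
 proof (rule mult_right_mono)
  show "Q * K / Re x <= 1" using mQ(1) far[OF assms(2)] by (simp add: divide_le_eq)
 qed simp
 finally show ?thesis
  unfolding cone_aux_def
  using norm_triangle_ineq[of "c * \<mu> x" "cone_inner al be (source \<delta>) x"] by (simp add: norm_mult algebra_simps)
qed

lemma outer_props:
 assumes "z holomorphic_on wedge" "0 <= A" "!!x. x \<in> wedge ==> norm (z x) <= A * norm (\<mu> x)" "x \<in> wedge"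
 shows "(cone_outer al be z has_field_derivative (2 * 1 - exp_lo al be / x) * cone_outer al be z x + z x) (at x)"
  and "norm (cone_outer al be z x) <= C * A * norm (\<mu> x)"
  and "integrable lborel (%\<tau>. indicator {0<..} \<tau> *\<^sub>R (z (x + of_real \<tau> * 1) / gauge_fun 1 (exp_lo al be) (x + of_real \<tau> * 1)))"
  and "0 <= \<tau> ==> norm (z (x + of_real \<tau> * 1) / gauge_fun 1 (exp_lo al be) (x + of_real \<tau> * 1)) \<le>
    C * A * norm (\<mu> x) / norm (gauge_fun 1 (exp_lo al be) x) / (1 + \<tau>)^2"
 using C k k\<rho> assms unfolding outer_const_ok_def by blast+

lemma c1: "0 <= norm (c::complex) + 1"
 by simp

lemma T_derivative:
 assumes "\<delta> \<in> M" "x \<in> wedge"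
 shows "(T c \<delta> has_field_derivative (2 * 1 - exp_lo al be / x) * T c \<delta> x + aux c \<delta> x) (at x)"
 unfolding cone_map_def
 by (rule outer_props(1)[OF aux_holomorphic[OF assms(1)] c1 aux_bound[OF assms(1)] assms(2)])

lemma T_bound:
 assumes "\<delta> \<in> M" "x \<in> wedge"
 shows "norm (T c \<delta> x) <= C * (norm c + 1) * norm (\<mu> x)"
 unfolding cone_map_def
 by (rule outer_props(2)[OF aux_holomorphic[OF assms(1)] c1 aux_bound[OF assms(1)] assms(2)])

lemma T_class:
 assumes "\<delta> \<in> M" "C * (norm c + 1) <= K"
 shows "T c \<delta> \<in> M"
 unfolding cone_class_def
proof (intro CollectI conjI ballI)
 show "T c \<delta> holomorphic_on wedge"
  unfolding holomorphic_on_open[OF right_cone_open] using T_derivative[OF assms(1)] by blast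
 fix x assume "x \<in> wedge"
 then show "norm (T c \<delta> x) <= K * norm (\<mu> x)"
  by (rule order_trans[OF T_bound[OF assms(1)] mult_right_mono[OF assms(2)]]) simp
qed

lemma T_contraction:
 assumes \<delta>: "\<delta> \<in> M" and \<eta>: "\<eta> \<in> M" and d: "0 <= d"
  and le: "!!x. x \<in> wedge ==> norm (\<delta> x - \<eta> x) <= d * norm (\<mu> x)" and x: "x \<in> wedge"
 shows "norm (T c \<delta> x - T c \<eta> x) <= d / 2 * norm (\<mu> x)"
proof -
 define h where "h x = source \<delta> x - source \<eta> x" for x
 have hh: "h holomorphic_on wedge"
  unfolding h_def by (intro holomorphic_intros source_holomorphic \<delta> \<eta>)
 have Qd: "0 <= Q * d" using Q0 d by simp
 have hb: "norm (h y) <= (Q * d) * norm (\<mu> y) / (norm y)^2" if "y \<in> wedge" for y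
 proof -
  have "norm (h y) <= Q / (norm y)^2 * (d * norm (\<mu> y))"
   unfolding h_def by (rule order_trans[OF source_difference[OF \<delta> \<eta> that] mult_left_mono[OF le[OF that]]]) (use Q0 in simp)
  then show ?thesis by simp
 qed
 have D: "aux c \<delta> y - aux c \<eta> y = cone_inner al be h y" if y: "y \<in> wedge" for y
 proof -
  have "cone_inner al be h y = cone_inner al be (source \<delta>) y - cone_inner al be (source \<eta>) y"
   unfolding cone_inner_def h_def[abs_def]
   by (rule gauge_inverse_diff[OF inner_props(3)[OF \<delta> y] inner_props(3)[OF \<eta> y]])
  then show ?thesis by (simp add: cone_aux_def)
 qed
 have Db: "norm (aux c \<delta> y - aux c \<eta> y) <= Q * d / m * norm (\<mu> y)" if y: "y \<in> wedge" for y
 proof -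
  have "norm (aux c \<delta> y - aux c \<eta> y) <= Q * d / Re y * norm (\<mu> y)"
   unfolding D[OF y] by (rule cone_inner_solves(2)[OF k k\<rho> hh Qd hb y])
  also have "... <= Q * d / m * norm (\<mu> y)"
   using far[OF y] m1 Qd by (intro mult_right_mono divide_left_mono) auto
  finally show ?thesis .
 qed
 have "T c \<delta> x - T c \<eta> x = cone_outer al be (%y. aux c \<delta> y - aux c \<eta> y) x"
  unfolding cone_map_def cone_outer_def
  by (rule gauge_inverse_diff[symmetric, OF
     outer_props(3)[OF aux_holomorphic[OF \<delta>] c1 aux_bound[OF \<delta>] x]
     outer_props(3)[OF aux_holomorphic[OF \<eta>] c1 aux_bound[OF \<eta>] x]])
 also have "norm ... <= C * (Q * d / m) * norm (\<mu> x)"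
  by (rule outer_props(2)[OF _ _ Db x]) (use Qd m1 in \<open>auto intro!: holomorphic_intros aux_holomorphic \<delta> \<eta>\<close>)
 also have "... <= d / 2 * norm (\<mu> x)"
 proof (rule mult_right_mono)
  have "2 * (C * Q) * d <= m * d" using mQ(2) d by (rule mult_right_mono)
  then show "C * (Q * d / m) <= d / 2" using m1 by (simp add: field_simps)
 qed simp
 finally show ?thesis .
qed

lemma T_param_holomorphic:
 assumes S: "open S" "bounded S" and \<delta>: "!!c. c \<in> S ==> \<delta> c \<in> M"
  and \<delta>c: "!!y. y \<in> wedge ==> (%c. \<delta> c y) holomorphic_on S" and x: "x \<in> wedge"
 shows "(%c. T c (\<delta> c) x) holomorphic_on S"
proof -
 obtain B where B: "!!c. c \<in> S ==> norm c <= B" using S(2) by (auto simp: bounded_iff)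
 have src: "(%c. source (\<delta> c) y) holomorphic_on S" if "y \<in> wedge" for y
  unfolding cone_source_def remainder_def using that not0
  by (intro holomorphic_intros \<delta>c[OF that]) auto
 have auxc: "(%c. aux c (\<delta> c) y) holomorphic_on S" if y: "y \<in> wedge" for y
  unfolding cone_aux_def cone_inner_def
 proof (intro holomorphic_intros)
  show "(%c. gauge_inverse (-1) (exp_hi al be) 1 (source (\<delta> c)) y) holomorphic_on S"
   by (rule gauge_inverse_param_holomorphic[OF S(1) ray y source_holomorphic[OF \<delta>] src _ QK far(2)[OF y]])
    (use inner_props(4)[OF \<delta> y] in auto)
 qed
 have b: "norm (aux c (\<delta> c) (x + of_real \<tau> * 1) / gauge_fun 1 (exp_lo al be) (x + of_real \<tau> * 1)) \<le>
   C * (B + 1) * norm (\<mu> x) / norm (gauge_fun 1 (exp_lo al be) x) / (1 + \<tau>)^2" if c: "c \<in> S" and \<tau>: "0 <= \<tau>" for c \<tau>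
 proof (rule order_trans[OF outer_props(4)[OF aux_holomorphic[OF \<delta>[OF c]] c1 aux_bound[OF \<delta>[OF c]] x \<tau>]])
  show "C * (norm c + 1) * norm (\<mu> x) / norm (gauge_fun 1 (exp_lo al be) x) / (1 + \<tau>)^2
    <= C * (B + 1) * norm (\<mu> x) / norm (gauge_fun 1 (exp_lo al be) x) / (1 + \<tau>)^2"
   using B[OF c] C0 by (intro divide_right_mono mult_right_mono mult_left_mono) auto
 qed
 show ?thesis
 proof (cases "S = {}")
  case False
  then have "0 <= B" using B norm_ge_zero order_trans by blast
  then show ?thesis
   unfolding cone_map_def cone_outer_def
   by (intro gauge_inverse_param_holomorphic[OF S(1) ray x aux_holomorphic[OF \<delta>] auxc b])
    (use C0 in auto)
 qed (simp add: holomorphic_on_def)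
qed

text \<open>
  All parameters in a disc are treated at once, by the contraction principle for functions of the pair of
  parameter and point that are holomorphic in each variable.
\<close>

lemma fixed_point_family:
 assumes Kc: "C * (norm c0 + 2) <= K"
 obtains \<delta> where "!!c. c \<in> ball c0 1 ==> \<delta> c \<in> M"
  "!!c x. c \<in> ball c0 1 ==> x \<in> wedge ==> T c (\<delta> c) x = \<delta> c x"
  "!!x. x \<in> wedge ==> (%c. \<delta> c x) holomorphic_on ball c0 1"
proof -
 let ?S = "ball c0 1"
 define \<M> where "\<M> = {f :: complex \<times> complex => complex. (\<forall>c\<in>?S. (%x. f (c, x)) \<in> M) &
   (\<forall>x\<in>wedge. (%c. f (c, x)) holomorphic_on ?S)}"
 define \<T> where "\<T> f = (%(c, x). T c (%y. f (c, y)) x)" for f :: "complex \<times> complex => complex"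
 have Kc': "C * (norm c + 1) <= K" if "c \<in> ?S" for c
 proof -
  have "norm c <= norm c0 + 1" using that norm_triangle_ineq2[of c c0] by (simp add: dist_norm norm_minus_commute)
  then have "C * (norm c + 1) <= C * (norm c0 + 2)" using C0 by (intro mult_left_mono) auto
  then show ?thesis using Kc by simp
 qed
 have "\<exists>f\<in>\<M>. \<forall>p\<in>?S \<times> wedge. \<T> f p = f p"
 proof (rule weighted_contraction_fixed_point[where M = \<M> and init = "%_. 0" and T = \<T> and P = "?S \<times> wedge"
    and w = "%p. 2 * K * norm (\<mu> (snd p))"])
  show "(%_. 0) \<in> \<M>" using zero_class by (simp add: \<M>_def)
 next
  fix f assume f: "f \<in> \<M>"
  have "(%x. \<T> f (c, x)) \<in> M" if "c \<in> ?S" for c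
   using T_class[of "%y. f (c, y)" c] f that Kc'[OF that] by (simp add: \<M>_def \<T>_def)
  moreover have "(%c. \<T> f (c, x)) holomorphic_on ?S" if "x \<in> wedge" for x
   using T_param_holomorphic[of ?S "%c y. f (c, y)" x] f that by (simp add: \<M>_def \<T>_def)
  ultimately show "\<T> f \<in> \<M>" by (simp add: \<M>_def)
 next
  fix f g p assume "f \<in> \<M>" "g \<in> \<M>" "p \<in> ?S \<times> wedge"
  then have "norm (f p) <= K * norm (\<mu> (snd p))" "norm (g p) <= K * norm (\<mu> (snd p))"
   by (auto simp: \<M>_def cone_class_def)
  then show "norm (f p - g p) <= 2 * K * norm (\<mu> (snd p))" using norm_triangle_ineq4[of "f p" "g p"] by simp
 next
  fix f g :: "complex \<times> complex => complex" and d p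
  assume f: "f \<in> \<M>" and g: "g \<in> \<M>" and d: "0 <= d"
   and le: "!!p. p \<in> ?S \<times> wedge ==> norm (f p - g p) <= d * (2 * K * norm (\<mu> (snd p)))" and p: "p \<in> ?S \<times> wedge"
  obtain c x where cx: "p = (c, x)" "c \<in> ?S" "x \<in> wedge" using p by auto
  have "norm (T c (%y. f (c, y)) x - T c (%y. g (c, y)) x) <= (d * (2 * K)) / 2 * norm (\<mu> x)"
  proof (rule T_contraction[OF _ _ _ _ cx(3)])
   show "(%y. f (c, y)) \<in> M" "(%y. g (c, y)) \<in> M" using f g cx by (auto simp: \<M>_def)
   show "norm (f (c, y) - g (c, y)) <= d * (2 * K) * norm (\<mu> y)" if "y \<in> wedge" for y
    using le[of "(c, y)"] that cx by (simp add: mult.assoc)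
  qed (use d K in simp)
  then show "norm (\<T> f p - \<T> g p) <= d / 2 * (2 * K * norm (\<mu> (snd p)))" by (simp add: \<T>_def cx)
 next
  fix F :: "nat => complex \<times> complex => complex" and f
  assume F: "!!n. F n \<in> \<M>"
   and lim: "!!n p. p \<in> ?S \<times> wedge ==> norm (F n p - f p) <= (1/2)^n * (2 * (2 * K * norm (\<mu> (snd p))))"
  have "(%x. f (c, x)) \<in> M" if c: "c \<in> ?S" for c
   unfolding cone_class_def
  proof (intro CollectI conjI ballI)
   show "(%x. f (c, x)) holomorphic_on wedge"
   proof (rule holomorphic_weighted_limit[where F = "%n x. F n (c, x)" and w = "%x. 2 * (2 * K * norm (\<mu> x))"])
    show "(%x. F n (c, x)) holomorphic_on wedge" for n using F c by (auto simp: \<M>_def cone_class_def)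
    show "continuous_on wedge (%x. 2 * (2 * K * norm (\<mu> x)))"
     by (intro continuous_intros holomorphic_on_imp_continuous_on decaying_gauge_holomorphic sub)
    show "norm (F n (c, x) - f (c, x)) <= (1/2)^n * (2 * (2 * K * norm (\<mu> x)))" if "x \<in> wedge" for n x
     using lim[of "(c, x)" n] c that by simp
   qed (rule right_cone_open)
   fix x assume x: "x \<in> wedge"
   have "norm (f (c, x)) <= K * norm (\<mu> x) + (1/2)^n * (2 * (2 * K * norm (\<mu> x)))" for n
   proof -
    have "norm (F n (c, x)) <= K * norm (\<mu> x)" using F c x by (auto simp: \<M>_def cone_class_def)
    then show ?thesis
     using lim[of "(c, x)" n] c x norm_triangle_ineq2[of "f (c, x)" "F n (c, x)"] by (simp add: norm_minus_commute)
   qed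
   moreover have "(%n. K * norm (\<mu> x) + (1/2::real)^n * (2 * (2 * K * norm (\<mu> x)))) \<longlonglongrightarrow> K * norm (\<mu> x) + 0 * (2 * (2 * K * norm (\<mu> x)))"
    by (intro tendsto_intros LIMSEQ_realpow_zero) auto
   ultimately show "norm (f (c, x)) <= K * norm (\<mu> x)"
    by (intro LIMSEQ_le_const[where X = "%n. K * norm (\<mu> x) + (1/2::real)^n * (2 * (2 * K * norm (\<mu> x)))"]) auto
  qed
  moreover have "(%c. f (c, x)) holomorphic_on ?S" if x: "x \<in> wedge" for x
  proof (rule holomorphic_weighted_limit[where F = "%n c. F n (c, x)" and w = "%_. 2 * (2 * K * norm (\<mu> x))"])
   show "(%c. F n (c, x)) holomorphic_on ?S" for n using F x by (auto simp: \<M>_def)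
   show "norm (F n (c, x) - f (c, x)) <= (1/2)^n * (2 * (2 * K * norm (\<mu> x)))" if "c \<in> ?S" for n c
    using lim[of "(c, x)" n] x that by simp
  qed auto
  ultimately show "f \<in> \<M>" by (simp add: \<M>_def)
 qed
 then obtain f where f: "f \<in> \<M>" and fx: "!!c x. c \<in> ?S ==> x \<in> wedge ==> T c (%y. f (c, y)) x = f (c, x)"
  by (auto simp: \<T>_def)
 show thesis
  by (rule that[of "%c x. f (c, x)"]) (use f fx in \<open>auto simp: \<M>_def\<close>)
qed

lemma fixed_point_unique:
 assumes \<delta>: "\<delta> \<in> M" "!!x. x \<in> wedge ==> T c \<delta> x = \<delta> x" and \<eta>: "\<eta> \<in> M" "!!x. x \<in> wedge ==> T c \<eta> x = \<eta> x"
  and x: "x \<in> wedge"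
 shows "\<delta> x = \<eta> x"
proof -
 have step: "norm (\<delta> x - \<eta> x) <= (1/2)^n * (2 * K) * norm (\<mu> x)" if "x \<in> wedge" for n x
  using that
 proof (induction n arbitrary: x)
  case 0
  then have "norm (\<delta> x) <= K * norm (\<mu> x)" "norm (\<eta> x) <= K * norm (\<mu> x)" using \<delta>(1) \<eta>(1) by (auto simp: cone_class_def)
  then show ?case using norm_triangle_ineq4[of "\<delta> x" "\<eta> x"] by simp
 next
  case (Suc n)
  have "norm (T c \<delta> x - T c \<eta> x) <= ((1/2)^n * (2 * K)) / 2 * norm (\<mu> x)"
   by (rule T_contraction[OF \<delta>(1) \<eta>(1) _ Suc.IH Suc.prems]) (use K in auto)
  then show ?case using \<delta>(2) \<eta>(2) Suc.prems by simp
 qed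
 have "(%n. (1/2::real)^n * (2 * K) * norm (\<mu> x)) \<longlonglongrightarrow> 0 * (2 * K) * norm (\<mu> x)"
  by (intro tendsto_intros LIMSEQ_realpow_zero) auto
 then have "norm (\<delta> x - \<eta> x) <= 0 * (2 * K) * norm (\<mu> x)"
  by (rule LIMSEQ_le_const) (use step[OF x] in auto)
 then show ?thesis by simp
qed

lemma fixed_point_derivative:
 assumes \<delta>: "\<delta> \<in> M" "!!x. x \<in> wedge ==> T c \<delta> x = \<delta> x" and x: "x \<in> wedge"
 shows "(\<delta> has_field_derivative (2 * 1 - exp_lo al be / x) * \<delta> x + aux c \<delta> x) (at x)"
proof -
 have "(\<delta> has_field_derivative (2 * 1 - exp_lo al be / x) * T c \<delta> x + aux c \<delta> x) (at x)"
  by (rule has_field_derivative_transform_within_open[OF T_derivative[OF \<delta>(1) x] right_cone_open x \<delta>(2)])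
 then show ?thesis by (simp only: \<delta>(2)[OF x])
qed

text \<open>
  The fixed point determines its derivative, hence the auxiliary function, hence the coefficient of
  the gauge in it.
\<close>

lemma fixed_point_parameter_unique:
 assumes \<delta>: "\<delta> \<in> M" "!!x. x \<in> wedge ==> T c \<delta> x = \<delta> x" "!!x. x \<in> wedge ==> T c' \<delta> x = \<delta> x" and x: "x \<in> wedge"
 shows "c = c'"
proof -
 have "aux c \<delta> x = aux c' \<delta> x"
  using DERIV_unique[OF fixed_point_derivative[OF \<delta>(1,2) x] fixed_point_derivative[OF \<delta>(1,3) x]] by simp
 then show ?thesis by (simp add: cone_aux_def)
qed

lemma fixed_point_solves:
 assumes base: "!!x. x \<in> wedge ==> sinh_P3 al be \<phi>0 x"
  and \<delta>: "\<delta> \<in> M" "!!x. x \<in> wedge ==> T c \<delta> x = \<delta> x" and x: "x \<in> wedge"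
 shows "sinh_P3 al be (%x. \<phi>0 x + \<delta> x) x"
proof -
 define z0 where "z0 x = deriv \<phi>0 x - (2 * 1 - exp_lo al be / x) * \<phi>0 x" for x
 have s0: "split_system al be wedge \<phi>0 z0"
  unfolding z0_def by (rule sinh_P3_imp_split_system[OF \<phi>0(1) right_cone_open not0 base])
 have "split_system al be wedge (%x. \<phi>0 x + \<delta> x) (%x. z0 x + aux c \<delta> x)"
  unfolding split_system_def
 proof (intro ballI conjI)
  fix y assume y: "y \<in> wedge"
  have 1: "(\<phi>0 has_field_derivative (2 * 1 - exp_lo al be / y) * \<phi>0 y + z0 y) (at y)"
   and 2: "(z0 has_field_derivative (2 * (-1) - exp_hi al be / y) * z0 y + remainder al be y (\<phi>0 y)) (at y)"
   using s0 y unfolding split_system_def by blast+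
  show "((%x. \<phi>0 x + \<delta> x) has_field_derivative (2 * 1 - exp_lo al be / y) * (\<phi>0 y + \<delta> y) + (z0 y + aux c \<delta> y)) (at y)"
   by (rule DERIV_cong[OF DERIV_add[OF 1 fixed_point_derivative[OF \<delta> y]] affine_add])
  have "((%x. z0 x + aux c \<delta> x) has_field_derivative
    (2 * (-1) - exp_hi al be / y) * (z0 y + aux c \<delta> y) + (remainder al be y (\<phi>0 y) + source \<delta> y)) (at y)"
   by (rule DERIV_cong[OF DERIV_add[OF 2 aux_derivative[OF \<delta>(1) y]] affine_add])
  moreover have "remainder al be y (\<phi>0 y) + source \<delta> y = remainder al be y (\<phi>0 y + \<delta> y)"
   by (simp add: cone_source_def)
  ultimately show "((%x. z0 x + aux c \<delta> x) has_field_derivative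
    (2 * (-1) - exp_hi al be / y) * (z0 y + aux c \<delta> y) + remainder al be y (\<phi>0 y + \<delta> y)) (at y)"
   by (simp only:)
 qed
 then show ?thesis by (rule split_system_imp_sinh_P3[OF _ right_cone_open not0 x])
qed

end

lemma cone_setup_exists:
 assumes k: "0 < k" and C: "outer_const_ok al be C" and K: "0 <= K0" "0 <= K"
 obtains C4 m where "0 <= C4" "1 <= m" "!!\<rho> \<phi>0. k * m <= \<rho> ==> \<phi>0 holomorphic_on right_cone k \<rho> ==>
   (!!x. x \<in> right_cone k \<rho> ==> norm (\<phi>0 x) <= K0 / norm x) ==> cone_setup al be k \<rho> m C C4 K0 K \<phi>0"
proof -
 obtain C3 where C3: "0 < C3" "!!\<rho> x. k <= \<rho> ==> x \<in> right_cone k \<rho> ==> norm (decaying_gauge al be x) <= C3 * exp (- norm x / (1 + k))"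
  by (rule decaying_gauge_exponentially_small[OF k, of al be]) blast
 define C4 where "C4 = C3 * (1 + k)"
 define Q where "Q = remainder_const al be (K0 + K * C4)"
 define m where "m = 1 + \<bar>K0 + K * C4\<bar> + \<bar>Q * K\<bar> + \<bar>2 * (C * Q)\<bar>"
 have m: "1 <= m" "K0 + K * C4 <= m" "Q * K <= m" "2 * (C * Q) <= m" by (auto simp: m_def)
 have C40: "0 <= C4" using C3 k by (simp add: C4_def)
 have "cone_setup al be k \<rho> m C C4 K0 K \<phi>0"
  if \<rho>: "k * m <= \<rho>" and \<phi>: "\<phi>0 holomorphic_on right_cone k \<rho>"
   "!!x. x \<in> right_cone k \<rho> ==> norm (\<phi>0 x) <= K0 / norm x" for \<rho> \<phi>0
 proof
  have "k * 1 <= k * m" by (rule mult_left_mono[OF m(1)]) (use k in simp)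
  then have kr: "k <= \<rho>" using \<rho> by simp
  show "norm (decaying_gauge al be x) <= C4 / norm x" if x: "x \<in> right_cone k \<rho>" for x
  proof -
   have "1 <= norm x" using right_cone_ray_domain[OF k kr] x by (simp add: ray_domain_def)
   then have "exp (- norm x / (1 + k)) <= (1 + k) / norm x" using k by (intro exp_neg_le_inverse) auto
   then have "C3 * exp (- norm x / (1 + k)) <= C3 * ((1 + k) / norm x)" using C3(1) by (intro mult_left_mono) auto
   then show ?thesis using C3(2)[OF kr x] by (simp add: C4_def)
  qed
 qed (use k \<rho> m C C40 K \<phi> in \<open>auto simp: Q_def\<close>)
 then show thesis using that[OF C40 m(1)] by blast
qed

section \<open>Calculus of asymptotic expansions\<close>

lemma eventually_at_infinity_in_sector:
 "eventually P (at_infinity_in_sector \<phi>1 \<phi>2) \<longleftrightarrow> (\<exists>R. \<forall>x\<in>sector 0 \<phi>1 \<phi>2. R <= norm x --> P x)"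
 unfolding at_infinity_in_sector_def eventually_inf_principal eventually_at_infinity by blast

lemma sector_mono: "R' <= R ==> \<phi>1' <= \<phi>1 ==> \<phi>2 <= \<phi>2' ==> sector R \<phi>1 \<phi>2 <= sector R' \<phi>1' \<phi>2'"
 unfolding sector_def by (intro subsetI) (clarsimp, metis order_le_less_trans order_less_le_trans)

text \<open>
  Discs with radius proportional to the distance from 0 stay in a slightly larger sector, which is
  what Cauchy's estimate requires.
\<close>

lemma sector_nearby:
 assumes "\<phi>1' < \<phi>1" "\<phi>2 < \<phi>2'"
 obtains c where "0 < c" "c <= 1/2" "!!x y. x \<in> sector 0 \<phi>1 \<phi>2 ==> norm (x - y) <= c * norm x ==> y \<in> sector 0 \<phi>1' \<phi>2'"
proof -
 define d where "d = min (\<phi>1 - \<phi>1') (\<phi>2' - \<phi>2)"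
 have d: "0 < d" using assms by (simp add: d_def)
 have "isCont Ln 1" by (rule continuous_at_Ln) simp
 then obtain e where e: "0 < e" "!!w. dist w 1 < e ==> dist (Ln w) (Ln 1) < d"
  using d unfolding continuous_at_eps_delta by blast
 define c where "c = min (1/2) (e/2)"
 have "y \<in> sector 0 \<phi>1' \<phi>2'" if x: "x \<in> sector 0 \<phi>1 \<phi>2" and y: "norm (x - y) <= c * norm x" for x y
 proof -
  obtain r \<theta> where r: "x = rcis r \<theta>" "0 < r" "\<phi>1 < \<theta>" "\<theta> < \<phi>2" using x by (auto simp: sector_def)
  have x0: "x ~= 0" "norm x = r" using r by (auto simp: rcis_def norm_mult)
  define w where "w = y / x"
  have "w - 1 = - (x - y) / x" using x0 by (simp add: w_def diff_divide_distrib)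
  then have "norm (w - 1) = norm (x - y) / norm x" by (simp only: norm_divide norm_minus_cancel)
  also have "... <= c" using y x0 r by (simp add: divide_le_eq)
  finally have w: "norm (w - 1) <= c" .
  then have "dist w 1 < e" using e by (simp add: dist_norm c_def)
  then have "norm (Ln w) < d" using e(2) by (simp add: dist_norm)
  then have im: "\<bar>Im (Ln w)\<bar> < d" using abs_Im_le_cmod order_le_less_trans by blast
  have w0: "w ~= 0" using w by (auto simp: c_def)
  have "w = rcis (norm w) (Im (Ln w))"
  proof -
   have "w = exp (Ln w)" using w0 by simp
   also have "... = of_real (exp (Re (Ln w))) * cis (Im (Ln w))" by (simp add: exp_eq_polar)
   also have "exp (Re (Ln w)) = norm w" using w0 exp_Ln[OF w0] norm_exp_eq_Re[of "Ln w"] by simp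
   finally show ?thesis by (simp add: rcis_def)
  qed
  then have "y = rcis (r * norm w) (\<theta> + Im (Ln w))"
  proof -
   assume w: "w = rcis (norm w) (Im (Ln w))"
   have "y = x * w" using x0 by (simp add: w_def)
   also have "... = rcis r \<theta> * rcis (norm w) (Im (Ln w))" using w r(1) by simp
   also have "... = rcis (r * norm w) (\<theta> + Im (Ln w))" by (rule rcis_mult)
   finally show ?thesis .
  qed
  moreover have "0 < r * norm w" using r w0 by simp
  moreover have "\<phi>1' < \<theta> + Im (Ln w)" "\<theta> + Im (Ln w) < \<phi>2'" using im r by (auto simp: d_def)
  ultimately show ?thesis unfolding sector_def by blast
 qed
 moreover have "0 < c" "c <= 1/2" using e by (auto simp: c_def)
 ultimately show thesis using that by blast
qed

definition decays :: "real => real => nat => (complex => complex) => bool" where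
 "decays \<theta>1 \<theta>2 N f \<longleftrightarrow> (\<forall>\<phi>1 \<phi>2. \<theta>1 < \<phi>1 & \<phi>1 < \<phi>2 & \<phi>2 < \<theta>2 -->
   f \<in> O[at_infinity_in_sector \<phi>1 \<phi>2](%x. 1 / x ^ N))"

definition far_analytic :: "real => real => (complex => complex) => bool" where
 "far_analytic \<theta>1 \<theta>2 f \<longleftrightarrow> (\<forall>\<phi>1 \<phi>2. \<theta>1 < \<phi>1 & \<phi>1 < \<phi>2 & \<phi>2 < \<theta>2 -->
   (\<forall>\<^sub>F x in at_infinity_in_sector \<phi>1 \<phi>2. f analytic_on {x}))"

lemma decays_add: "decays \<theta>1 \<theta>2 N f ==> decays \<theta>1 \<theta>2 N g ==> decays \<theta>1 \<theta>2 N (%x. f x + g x)"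
 unfolding decays_def
proof (intro allI impI)
 fix \<phi>1 \<phi>2 assume a: "\<forall>\<phi>1 \<phi>2. \<theta>1 < \<phi>1 & \<phi>1 < \<phi>2 & \<phi>2 < \<theta>2 --> f \<in> O[at_infinity_in_sector \<phi>1 \<phi>2](%x. 1 / x ^ N)"
  and b: "\<forall>\<phi>1 \<phi>2. \<theta>1 < \<phi>1 & \<phi>1 < \<phi>2 & \<phi>2 < \<theta>2 --> g \<in> O[at_infinity_in_sector \<phi>1 \<phi>2](%x. 1 / x ^ N)"
  and p: "\<theta>1 < \<phi>1 & \<phi>1 < \<phi>2 & \<phi>2 < \<theta>2"
 show "(%x. f x + g x) \<in> O[at_infinity_in_sector \<phi>1 \<phi>2](%x. 1 / x ^ N)"
  by (rule sum_in_bigo(1)[OF a[rule_format, OF p] b[rule_format, OF p]])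
qed

lemma decays_diff: "decays \<theta>1 \<theta>2 N f ==> decays \<theta>1 \<theta>2 N g ==> decays \<theta>1 \<theta>2 N (%x. f x - g x)"
 unfolding decays_def
proof (intro allI impI)
 fix \<phi>1 \<phi>2 assume a: "\<forall>\<phi>1 \<phi>2. \<theta>1 < \<phi>1 & \<phi>1 < \<phi>2 & \<phi>2 < \<theta>2 --> f \<in> O[at_infinity_in_sector \<phi>1 \<phi>2](%x. 1 / x ^ N)"
  and b: "\<forall>\<phi>1 \<phi>2. \<theta>1 < \<phi>1 & \<phi>1 < \<phi>2 & \<phi>2 < \<theta>2 --> g \<in> O[at_infinity_in_sector \<phi>1 \<phi>2](%x. 1 / x ^ N)"
  and p: "\<theta>1 < \<phi>1 & \<phi>1 < \<phi>2 & \<phi>2 < \<theta>2"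
 show "(%x. f x - g x) \<in> O[at_infinity_in_sector \<phi>1 \<phi>2](%x. 1 / x ^ N)"
  by (rule sum_in_bigo(2)[OF a[rule_format, OF p] b[rule_format, OF p]])
qed

lemma decays_mult: "decays \<theta>1 \<theta>2 M f ==> decays \<theta>1 \<theta>2 N g ==> decays \<theta>1 \<theta>2 (M + N) (%x. f x * g x)"
 unfolding decays_def
proof (intro allI impI)
 fix \<phi>1 \<phi>2 assume *: "\<forall>\<phi>1 \<phi>2. \<theta>1 < \<phi>1 & \<phi>1 < \<phi>2 & \<phi>2 < \<theta>2 --> f \<in> O[at_infinity_in_sector \<phi>1 \<phi>2](%x. 1 / x ^ M)"
  "\<forall>\<phi>1 \<phi>2. \<theta>1 < \<phi>1 & \<phi>1 < \<phi>2 & \<phi>2 < \<theta>2 --> g \<in> O[at_infinity_in_sector \<phi>1 \<phi>2](%x. 1 / x ^ N)"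
  "\<theta>1 < \<phi>1 & \<phi>1 < \<phi>2 & \<phi>2 < \<theta>2"
 then have "(%x. f x * g x) \<in> O[at_infinity_in_sector \<phi>1 \<phi>2](%x. (1 / x ^ M) * (1 / x ^ N))"
  by (intro landau_o.big.mult) auto
 then show "(%x. f x * g x) \<in> O[at_infinity_in_sector \<phi>1 \<phi>2](%x. 1 / x ^ (M + N))"
  by (simp add: power_add)
qed

lemma decays_monomial: "decays \<theta>1 \<theta>2 N (%x. c / x ^ N)"
 unfolding decays_def
proof (intro allI impI)
 fix \<phi>1 \<phi>2
 show "(%x. c / x ^ N) \<in> O[at_infinity_in_sector \<phi>1 \<phi>2](%x. 1 / x ^ N)"
  by (rule bigoI[OF always_eventually, of _ "norm c"]) (simp add: norm_divide)
qed

lemma decays_weaken: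
 assumes "decays \<theta>1 \<theta>2 N f" "M <= N"
 shows "decays \<theta>1 \<theta>2 M f"
 unfolding decays_def
proof (intro allI impI)
 fix \<phi>1 \<phi>2 assume *: "\<theta>1 < \<phi>1 & \<phi>1 < \<phi>2 & \<phi>2 < \<theta>2"
 have "\<forall>\<^sub>F x in at_infinity_in_sector \<phi>1 \<phi>2. norm (1 / x ^ N) <= 1 * norm (1 / x ^ M :: complex)"
  unfolding eventually_at_infinity_in_sector
 proof (intro exI[of _ 1] ballI impI)
  fix x :: complex assume "1 <= norm x"
  then have "norm x ^ M <= norm x ^ N" "0 < norm x ^ M"
   using assms(2) by (auto intro: power_increasing zero_less_power less_le_trans[OF zero_less_one])
  then show "norm (1 / x ^ N) <= 1 * norm (1 / x ^ M)"
   by (simp add: norm_divide norm_power frac_le)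
 qed
 then have "(%x. 1 / x ^ N) \<in> O[at_infinity_in_sector \<phi>1 \<phi>2](%x. 1 / x ^ M :: complex)"
  by (rule bigoI)
 then show "f \<in> O[at_infinity_in_sector \<phi>1 \<phi>2](%x. 1 / x ^ M)"
  using assms(1) * landau_o.big_trans unfolding decays_def by blast
qed

lemma decays_sum: "finite S ==> (!!i. i \<in> S ==> decays \<theta>1 \<theta>2 N (f i)) ==> decays \<theta>1 \<theta>2 N (%x. \<Sum>i\<in>S. f i x)"
proof (induction S rule: finite_induct)
 case empty
 then show ?case by (simp add: decays_def)
next
 case (insert i S)
 then show ?case by (simp add: decays_add)
qed

lemma decays_cong:
 assumes "!!\<phi>1 \<phi>2. \<theta>1 < \<phi>1 ==> \<phi>1 < \<phi>2 ==> \<phi>2 < \<theta>2 ==> \<forall>\<^sub>F x in at_infinity_in_sector \<phi>1 \<phi>2. f x = g x"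
 shows "decays \<theta>1 \<theta>2 N f \<longleftrightarrow> decays \<theta>1 \<theta>2 N g"
proof -
 have "f \<in> O[at_infinity_in_sector \<phi>1 \<phi>2](%x. 1 / x ^ N) \<longleftrightarrow> g \<in> O[at_infinity_in_sector \<phi>1 \<phi>2](%x. 1 / x ^ N)"
  if "\<theta>1 < \<phi>1 & \<phi>1 < \<phi>2 & \<phi>2 < \<theta>2" for \<phi>1 \<phi>2
  by (rule landau_o.big.in_cong[OF assms]) (use that in auto)
 then show ?thesis unfolding decays_def by blast
qed

lemma eventually_in_sector_far: "\<forall>\<^sub>F x in at_infinity_in_sector \<phi>1 \<phi>2. x \<in> sector 0 \<phi>1 \<phi>2 & R <= norm x"
 unfolding eventually_at_infinity_in_sector by blast

lemma decays_one_tendsto: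
 assumes "decays \<theta>1 \<theta>2 1 (%x. p x - c)" "\<theta>1 < \<phi>1" "\<phi>1 < \<phi>2" "\<phi>2 < \<theta>2"
 shows "(p \<longlongrightarrow> c) (at_infinity_in_sector \<phi>1 \<phi>2)"
proof -
 have "(%x. p x - c) \<in> O[at_infinity_in_sector \<phi>1 \<phi>2](%x. 1 / x ^ 1)" using assms unfolding decays_def by blast
 moreover have "((%x. 1 / x ^ 1 :: complex) \<longlongrightarrow> 0) (at_infinity_in_sector \<phi>1 \<phi>2)"
  unfolding at_infinity_in_sector_def power_one_right
  by (rule tendsto_mono[OF inf_le1 tendsto_inverse_0[unfolded inverse_eq_divide]])
 moreover from this have "(%x. 1 / x ^ 1 :: complex) \<in> o[at_infinity_in_sector \<phi>1 \<phi>2](%x. 1 :: complex)"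
  by (intro smalloI_tendsto) auto
 ultimately have "(%x. p x - c) \<in> o[at_infinity_in_sector \<phi>1 \<phi>2](%x. 1 :: complex)"
  by (blast intro: landau_o.big_small_trans)
 then have "((%x. p x - c) \<longlongrightarrow> 0) (at_infinity_in_sector \<phi>1 \<phi>2)" by (drule_tac smalloD_tendsto) simp
 then show ?thesis by (simp add: LIM_zero_iff)
qed

text \<open>
  Division by a factor that has a nonzero limit.
\<close>

lemma decays_cancel:
 assumes "decays \<theta>1 \<theta>2 N (%x. p x * f x)" and p: "decays \<theta>1 \<theta>2 1 (%x. p x - c)" and c: "c ~= 0"
 shows "decays \<theta>1 \<theta>2 N f"
 unfolding decays_def
proof (intro allI impI)
 fix \<phi>1 \<phi>2 assume *: "\<theta>1 < \<phi>1 & \<phi>1 < \<phi>2 & \<phi>2 < \<theta>2"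
 have t: "(p \<longlongrightarrow> c) (at_infinity_in_sector \<phi>1 \<phi>2)" using decays_one_tendsto[OF p] * by blast
 have "\<forall>\<^sub>F x in at_infinity_in_sector \<phi>1 \<phi>2. dist (p x) c < norm c / 2"
  using t c by (intro tendstoD) auto
 then have "\<forall>\<^sub>F x in at_infinity_in_sector \<phi>1 \<phi>2. norm (f x) <= (2 / norm c) * norm (p x * f x)"
 proof eventually_elim
  case (elim x)
  have "norm c <= norm (p x) + dist (p x) c" using norm_triangle_ineq2[of c "p x"] by (simp add: dist_norm norm_minus_commute)
  then have "norm c / 2 <= norm (p x)" using elim by simp
  then have "norm c / 2 * norm (f x) <= norm (p x) * norm (f x)" by (rule mult_right_mono) simp
  then show ?case using c by (simp add: norm_mult field_simps)
 qed
 then have "f \<in> O[at_infinity_in_sector \<phi>1 \<phi>2](%x. p x * f x)" by (rule bigoI)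
 then show "f \<in> O[at_infinity_in_sector \<phi>1 \<phi>2](%x. 1 / x ^ N)"
  using assms(1) * landau_o.big_trans unfolding decays_def by blast
qed

text \<open>
  Cauchy's estimate on a disc of radius proportional to \<open>\<bar>x\<bar>\<close> gains one power.
\<close>

lemma decays_deriv:
 assumes f: "far_analytic \<theta>1 \<theta>2 f" and d: "decays \<theta>1 \<theta>2 N f"
 shows "decays \<theta>1 \<theta>2 (Suc N) (deriv f)"
 unfolding decays_def
proof (intro allI impI)
 fix \<phi>1 \<phi>2 assume *: "\<theta>1 < \<phi>1 & \<phi>1 < \<phi>2 & \<phi>2 < \<theta>2"
 define \<psi>1 \<psi>2 where "\<psi>1 = (\<theta>1 + \<phi>1) / 2" and "\<psi>2 = (\<phi>2 + \<theta>2) / 2"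
 have psi: "\<theta>1 < \<psi>1" "\<psi>1 < \<phi>1" "\<phi>2 < \<psi>2" "\<psi>2 < \<theta>2" "\<psi>1 < \<psi>2" using * by (auto simp: \<psi>1_def \<psi>2_def)
 obtain c where c: "0 < c" "c <= 1/2" "!!x y. x \<in> sector 0 \<phi>1 \<phi>2 ==> norm (x - y) <= c * norm x ==> y \<in> sector 0 \<psi>1 \<psi>2"
  using sector_nearby[OF psi(2,3)] by blast
 have "f \<in> O[at_infinity_in_sector \<psi>1 \<psi>2](%x. 1 / x ^ N)" using d psi unfolding decays_def by blast
 then obtain C where C: "\<forall>\<^sub>F x in at_infinity_in_sector \<psi>1 \<psi>2. norm (f x) <= C * norm (1 / x ^ N)"
  by (rule landau_o.bigE)
 have "\<forall>\<^sub>F x in at_infinity_in_sector \<psi>1 \<psi>2. f analytic_on {x}" using f psi unfolding far_analytic_def by blast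
 then obtain R where R: "!!x. x \<in> sector 0 \<psi>1 \<psi>2 ==> R <= norm x ==> f analytic_on {x} & norm (f x) <= C * norm (1 / x ^ N)"
  using eventually_conj[OF _ C, of "%x. f analytic_on {x}"] unfolding eventually_at_infinity_in_sector by blast
 have "\<forall>\<^sub>F x in at_infinity_in_sector \<phi>1 \<phi>2. norm (deriv f x) <= (\<bar>C\<bar> * 2 ^ N / c) * norm (1 / x ^ Suc N)"
  unfolding eventually_at_infinity_in_sector
 proof (intro exI[of _ "2 * \<bar>R\<bar> + 1"] ballI impI)
  fix x assume x: "x \<in> sector 0 \<phi>1 \<phi>2" and xR: "2 * \<bar>R\<bar> + 1 <= norm x"
  have x0: "0 < norm x" using xR by auto
  have y: "f analytic_on {y}" "norm (f y) <= \<bar>C\<bar> * (2 ^ N / norm x ^ N)" if "norm (x - y) <= c * norm x" for y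
  proof -
   have "c * norm x <= 1/2 * norm x" using c by (intro mult_right_mono) auto
   then have ny: "norm x / 2 <= norm y" using that norm_triangle_ineq2[of x y] by simp
   then have "R <= norm y" using xR by auto
   then have *: "f analytic_on {y}" "norm (f y) <= C * norm (1 / y ^ N)" using R c(3)[OF x that] by auto
   show "f analytic_on {y}" by (rule *)
   have "(norm x / 2) ^ N <= norm y ^ N" using ny by (intro power_mono) auto
   then have "1 / norm y ^ N <= 1 / (norm x / 2) ^ N" using x0 by (intro divide_left_mono mult_pos_pos zero_less_power) (use ny in auto)
   then have "norm (1 / y ^ N) <= 2 ^ N / norm x ^ N" by (simp add: norm_divide norm_power power_divide)
   moreover have "norm (f y) <= \<bar>C\<bar> * norm (1 / y ^ N)"
    by (rule order_trans[OF *(2) mult_right_mono[OF abs_ge_self norm_ge_zero]])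
   ultimately show "norm (f y) <= \<bar>C\<bar> * (2 ^ N / norm x ^ N)"
    using mult_left_mono[of "norm (1 / y ^ N)" "2 ^ N / norm x ^ N" "\<bar>C\<bar>"] by linarith
  qed
  have hol: "f holomorphic_on cball x (c * norm x)"
  proof (rule analytic_imp_holomorphic)
   show "f analytic_on cball x (c * norm x)"
    unfolding analytic_on_analytic_at[of _ "cball x (c * norm x)"]
    by (intro ballI y(1)) (simp add: dist_norm)
  qed
  have "norm ((deriv ^^ 1) f x) <= fact 1 * (\<bar>C\<bar> * (2 ^ N / norm x ^ N)) / (c * norm x) ^ 1"
   by (rule Cauchy_inequality[OF holomorphic_on_subset[OF hol ball_subset_cball] holomorphic_on_imp_continuous_on[OF hol]])
    (use c x0 y(2) in auto)
  then show "norm (deriv f x) <= (\<bar>C\<bar> * 2 ^ N / c) * norm (1 / x ^ Suc N)"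
  proof -
   assume d: "norm ((deriv ^^ 1) f x) <= fact 1 * (\<bar>C\<bar> * (2 ^ N / norm x ^ N)) / (c * norm x) ^ 1"
   have "norm (1 / x ^ Suc N) = 1 / (norm x * norm x ^ N)" by (simp add: norm_divide norm_power norm_mult)
   then show ?thesis using d by (simp add: mult_ac)
  qed
 qed
 then show "deriv f \<in> O[at_infinity_in_sector \<phi>1 \<phi>2](%x. 1 / x ^ Suc N)" by (rule bigoI)
qed

definition partial_sum :: "(nat => complex) => nat => complex => complex" where
 "partial_sum F N x = (\<Sum>n\<le>N. F n / x ^ n)"

definition expands :: "real => real => nat => (complex => complex) => (nat => complex) => bool" where
 "expands \<theta>1 \<theta>2 N f F \<longleftrightarrow> decays \<theta>1 \<theta>2 (Suc N) (%x. f x - partial_sum F N x)"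

definition conv :: "(nat => complex) => (nat => complex) => nat => complex" where
 "conv F G n = (\<Sum>i\<le>n. F i * G (n - i))"

definition shift :: "(nat => complex) => nat => complex" where
 "shift F n = (case n of 0 => 0 | Suc k => F k)"

lemma partial_sum_decays: "decays \<theta>1 \<theta>2 0 (partial_sum F N)"
 unfolding partial_sum_def[abs_def] by (intro decays_sum decays_weaken[OF decays_monomial]) auto

lemma expands_bounded: "expands \<theta>1 \<theta>2 N f F ==> decays \<theta>1 \<theta>2 0 f"
 using decays_add[OF decays_weaken[of \<theta>1 \<theta>2 "Suc N" _ 0] partial_sum_decays[of \<theta>1 \<theta>2 F N]]
 unfolding expands_def by fastforce

lemma expands_self: "expands \<theta>1 \<theta>2 N (partial_sum F N) F"
 by (simp add: expands_def decays_def)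

lemma expands_leading: "expands \<theta>1 \<theta>2 N f F ==> decays \<theta>1 \<theta>2 1 (%x. f x - F 0)"
proof -
 assume e: "expands \<theta>1 \<theta>2 N f F"
 have eq: "f x - F 0 = (f x - partial_sum F N x) + (\<Sum>n\<in>{1..N}. F n / x ^ n)" for x
  unfolding partial_sum_def by (simp add: atMost_atLeast0 sum.atLeast_Suc_atMost)
 have "decays \<theta>1 \<theta>2 1 (%x. (f x - partial_sum F N x) + (\<Sum>n\<in>{1..N}. F n / x ^ n))"
 proof (intro decays_add decays_sum)
  show "decays \<theta>1 \<theta>2 1 (%x. f x - partial_sum F N x)" using e unfolding expands_def by (rule decays_weaken) simp
  show "decays \<theta>1 \<theta>2 1 (%x. F n / x ^ n)" if "n \<in> {1..N}" for n
   using that by (intro decays_weaken[OF decays_monomial]) auto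
 qed simp
 then show ?thesis unfolding eq .
qed

lemma expands_mult:
 assumes f: "expands \<theta>1 \<theta>2 N f F" and g: "expands \<theta>1 \<theta>2 N g G"
 shows "expands \<theta>1 \<theta>2 N (%x. f x * g x) (conv F G)"
proof -
 have poly: "partial_sum F N x * partial_sum G N x - partial_sum (conv F G) N x
   = (\<Sum>i\<le>N. \<Sum>j\<in>{N - i<..N}. F i * G j / x ^ (i + j))" for x
 proof -
  have "partial_sum (conv F G) N x = (\<Sum>n\<le>N. \<Sum>i\<le>n. F i * G (n - i) / x ^ n)"
   by (simp add: partial_sum_def conv_def sum_divide_distrib)
  also have "... = (\<Sum>n\<le>N. \<Sum>i\<le>n. F i * G (n - i) / x ^ (i + (n - i)))" by simp
  also have "... = (\<Sum>(i, j)\<in>{(i, j). i + j <= N}. F i * G j / x ^ (i + j))"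
   by (rule sum.triangle_reindex_eq[symmetric])
  also have "{(i, j). i + j <= N} = Sigma {..N} (%i. {..N - i})" by auto
  also have "(\<Sum>(i, j)\<in>Sigma {..N} (%i. {..N - i}). F i * G j / x ^ (i + j)) = (\<Sum>i\<le>N. \<Sum>j\<le>N - i. F i * G j / x ^ (i + j))"
   by (rule sum.Sigma[symmetric]) auto
  finally have c: "partial_sum (conv F G) N x = (\<Sum>i\<le>N. \<Sum>j\<le>N - i. F i * G j / x ^ (i + j))" .
  have "partial_sum F N x * partial_sum G N x = (\<Sum>i\<le>N. \<Sum>j\<le>N. F i * G j / x ^ (i + j))"
   unfolding partial_sum_def sum_product by (simp add: power_add)
  also have "... = (\<Sum>i\<le>N. (\<Sum>j\<le>N - i. F i * G j / x ^ (i + j)) + (\<Sum>j\<in>{N - i<..N}. F i * G j / x ^ (i + j)))"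
  proof (rule sum.cong[OF refl])
   fix i
   have "{..N} = {..N - i} \<union> {N - i<..N}" by auto
   then show "(\<Sum>j\<le>N. F i * G j / x ^ (i + j)) = (\<Sum>j\<le>N - i. F i * G j / x ^ (i + j)) + (\<Sum>j\<in>{N - i<..N}. F i * G j / x ^ (i + j))"
    by (simp only:) (rule sum.union_disjoint, auto)
  qed
  finally show ?thesis unfolding c by (simp add: sum.distrib)
 qed
 have "f x * g x - partial_sum (conv F G) N x = (f x - partial_sum F N x) * g x + partial_sum F N x * (g x - partial_sum G N x)
   + (\<Sum>i\<le>N. \<Sum>j\<in>{N - i<..N}. F i * G j / x ^ (i + j))" for x
  unfolding poly[symmetric] by (simp add: algebra_simps)
 moreover have "decays \<theta>1 \<theta>2 (Suc N) (%x. (f x - partial_sum F N x) * g x + partial_sum F N x * (g x - partial_sum G N x)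
   + (\<Sum>i\<le>N. \<Sum>j\<in>{N - i<..N}. F i * G j / x ^ (i + j)))"
 proof (intro decays_add decays_sum)
  show "decays \<theta>1 \<theta>2 (Suc N) (%x. (f x - partial_sum F N x) * g x)"
   using decays_mult[OF f[unfolded expands_def] expands_bounded[OF g]] by simp
  show "decays \<theta>1 \<theta>2 (Suc N) (%x. partial_sum F N x * (g x - partial_sum G N x))"
   using decays_mult[OF partial_sum_decays g[unfolded expands_def]] by simp
  show "decays \<theta>1 \<theta>2 (Suc N) (%x. F i * G j / x ^ (i + j))" if "i \<in> {..N}" "j \<in> {N - i<..N}" for i j
   by (rule decays_weaken[OF decays_monomial]) (use that in auto)
 qed auto
 ultimately show ?thesis by (simp add: expands_def)
qed

lemma expands_add:
 assumes "expands \<theta>1 \<theta>2 N f F" "expands \<theta>1 \<theta>2 N g G"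
 shows "expands \<theta>1 \<theta>2 N (%x. f x + g x) (%n. F n + G n)"
proof -
 have "partial_sum (%n. F n + G n) N x = partial_sum F N x + partial_sum G N x" for x
  by (simp add: partial_sum_def sum.distrib add_divide_distrib)
 then have eq: "(f x + g x) - partial_sum (%n. F n + G n) N x = (f x - partial_sum F N x) + (g x - partial_sum G N x)" for x
  by simp
 show ?thesis unfolding expands_def eq by (rule decays_add[OF assms[unfolded expands_def]])
qed

lemma expands_diff:
 assumes "expands \<theta>1 \<theta>2 N f F" "expands \<theta>1 \<theta>2 N g G"
 shows "expands \<theta>1 \<theta>2 N (%x. f x - g x) (%n. F n - G n)"
proof -
 have "partial_sum (%n. F n - G n) N x = partial_sum F N x - partial_sum G N x" for x
  by (simp add: partial_sum_def sum_subtractf diff_divide_distrib)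
 then have eq: "(f x - g x) - partial_sum (%n. F n - G n) N x = (f x - partial_sum F N x) - (g x - partial_sum G N x)" for x
  by simp
 show ?thesis unfolding expands_def eq by (rule decays_diff[OF assms[unfolded expands_def]])
qed

lemma expands_monomial:
 assumes "m <= N" shows "expands \<theta>1 \<theta>2 N (%x. c / x ^ m) (%n. if n = m then c else 0)"
proof -
 have "(\<Sum>n\<le>N. (if n = m then c else 0) / x ^ n) = c / x ^ m" for x
 proof -
  have "(\<Sum>n\<le>N. (if n = m then c else 0) / x ^ n) = (\<Sum>n\<le>N. if n = m then c / x ^ n else 0)"
   by (rule sum.cong) auto
  then show ?thesis using assms by simp
 qed
 then show ?thesis by (simp add: expands_def partial_sum_def decays_def)
qed

lemma partial_sum_shift: "partial_sum (shift F) (Suc N) x = partial_sum F N x / x"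
 unfolding partial_sum_def sum.atMost_Suc_shift by (simp add: shift_def sum_divide_distrib mult.commute)

lemma expands_shift:
 assumes "expands \<theta>1 \<theta>2 N f F"
 shows "expands \<theta>1 \<theta>2 (Suc N) (%x. f x / x) (shift F)"
proof -
 have eq: "f x / x - partial_sum (shift F) (Suc N) x = (f x - partial_sum F N x) * (1 / x ^ 1)" for x
  by (simp add: partial_sum_shift diff_divide_distrib)
 show ?thesis
  unfolding expands_def eq
  using decays_mult[OF assms[unfolded expands_def] decays_monomial[of \<theta>1 \<theta>2 1 1]] by simp
qed

lemma expands_cmult:
 assumes "expands \<theta>1 \<theta>2 N f F"
 shows "expands \<theta>1 \<theta>2 N (%x. c * f x) (%n. c * F n)"
proof -
 have "partial_sum (%n. c * F n) N x = c * partial_sum F N x" for x by (simp add: partial_sum_def sum_distrib_left)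
 then show ?thesis
  using decays_mult[OF decays_monomial[of \<theta>1 \<theta>2 0 c] assms[unfolded expands_def]]
  by (simp add: expands_def right_diff_distrib)
qed

lemma expands_deriv:
 assumes fa: "far_analytic \<theta>1 \<theta>2 f" and f: "expands \<theta>1 \<theta>2 N f F"
 shows "expands \<theta>1 \<theta>2 (Suc N) (deriv f) (shift (%n. - of_nat n * F n))"
proof -
 let ?P = "partial_sum F N"
 have dP: "(?P has_field_derivative partial_sum (%n. - of_nat n * F n) N x / x) (at x)" if "x ~= 0" for x
 proof -
  have "((%x. F n / x ^ n) has_field_derivative - of_nat n * F n / x ^ n / x) (at x)" for n
  proof (cases n)
   case (Suc m)
   have "((%x. F n / x ^ n) has_field_derivative (0 * x ^ n - F n * (of_nat n * x ^ (n - 1))) / (x ^ n * x ^ n)) (at x)"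
    using that by (intro derivative_eq_intros refl) auto
   moreover have "(0 * x ^ n - F n * (of_nat n * x ^ (n - 1))) / (x ^ n * x ^ n) = - of_nat n * F n / x ^ n / x"
    using that Suc by (simp add: field_simps)
   ultimately show ?thesis by simp
  qed simp
  then show ?thesis
   unfolding partial_sum_def[abs_def] sum_divide_distrib by (rule DERIV_sum)
 qed
 have Pa: "?P analytic_on {x}" if "x ~= 0" for x
  unfolding partial_sum_def[abs_def] using that by (intro analytic_intros) auto
 have Ra: "far_analytic \<theta>1 \<theta>2 (%x. f x - ?P x)"
  unfolding far_analytic_def
 proof (intro allI impI)
  fix \<phi>1 \<phi>2 assume "\<theta>1 < \<phi>1 & \<phi>1 < \<phi>2 & \<phi>2 < \<theta>2"
  then have "\<forall>\<^sub>F x in at_infinity_in_sector \<phi>1 \<phi>2. f analytic_on {x}" using fa unfolding far_analytic_def by blast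
  with eventually_in_sector_far[of \<phi>1 \<phi>2 1] show "\<forall>\<^sub>F x in at_infinity_in_sector \<phi>1 \<phi>2. (%x. f x - ?P x) analytic_on {x}"
   by eventually_elim (auto intro!: analytic_on_diff Pa)
 qed
 have "decays \<theta>1 \<theta>2 (Suc (Suc N)) (deriv (%x. f x - ?P x))"
  by (rule decays_deriv[OF Ra f[unfolded expands_def]])
 moreover have "\<forall>\<^sub>F x in at_infinity_in_sector \<phi>1 \<phi>2. deriv (%x. f x - ?P x) x =
   deriv f x - partial_sum (shift (%n. - of_nat n * F n)) (Suc N) x" if p: "\<theta>1 < \<phi>1" "\<phi>1 < \<phi>2" "\<phi>2 < \<theta>2" for \<phi>1 \<phi>2
 proof -
  have "\<forall>\<^sub>F x in at_infinity_in_sector \<phi>1 \<phi>2. f analytic_on {x}" using fa p unfolding far_analytic_def by blast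
  with eventually_in_sector_far[of \<phi>1 \<phi>2 1] show ?thesis
  proof eventually_elim
   case (elim x)
   then have x0: "x ~= 0" by auto
   have "(f has_field_derivative deriv f x) (at x)"
    using elim by (simp add: DERIV_deriv_iff_field_differentiable analytic_on_imp_differentiable_at)
   from DERIV_imp_deriv[OF DERIV_diff[OF this dP[OF x0]]] show ?case unfolding partial_sum_shift .
  qed
 qed
 ultimately show ?thesis unfolding expands_def by (subst (asm) decays_cong) auto
qed

section \<open>The expansion follows from its leading term\<close>

definition P3_at :: "complex => complex => (complex => complex) => complex => bool" where
 "P3_at al be u x \<longleftrightarrow> deriv (deriv u) x = 1 / u x * (deriv u x)\<^sup>2 - 1 / x * deriv u x
   + 1 / x * (al * (u x)\<^sup>2 + be) + (u x) ^ 3 - 1 / u x"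

text \<open>
  The function \<open>A\<close> whose expansion has the coefficients \<open>A n\<close>; it is defined so that
  \<open>u' = 1 + A * u\<^sup>2 + (1 - be) * u / x\<close>, and the equation of second order becomes
  \<open>A' = u * (1 - A\<^sup>2) + (al + (be - 2) * A) / x\<close>.
\<close>

definition riccati_partner :: "complex => (complex => complex) => complex => complex" where
 "riccati_partner be u x = (deriv u x - 1 - (1 - be) * u x / x) / (u x)\<^sup>2"

lemma riccati_partner_analytic:
 assumes "u analytic_on {x}" "u x ~= 0" "x ~= 0"
 shows "riccati_partner be u analytic_on {x}"
 unfolding riccati_partner_def[abs_def] using assms by (intro analytic_intros) auto

lemma riccati_partner_algebra:
 fixes x :: complex
 assumes "y ~= 0" "x ~= 0"
  and "y2 = 1 / y * p\<^sup>2 - 1 / x * p + 1 / x * (al * y\<^sup>2 + be) + y ^ 3 - 1 / y"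
 shows "((y2 - 0 - ((1 - be) * p * x - (1 - be) * y * 1) / (x * x)) * (y * y) - (p - 1 - (1 - be) * y / x) * (p * y + p * y)) / (y * y * (y * y))
  = y - y * ((p - 1 - (1 - be) * y / x) / y\<^sup>2)\<^sup>2 + (al / x + (be - 2) * ((p - 1 - (1 - be) * y / x) / y\<^sup>2 / x))"
proof -
 define i j E where "i = 1 / x" and "j = 1 / y" and "E = (p - 1) * j - (1 - be) * i"
 have ij: "i * x = 1" "j * y = 1" using assms by (auto simp: i_def j_def)
 have x: "c / x = c * i" "c / (x * x) = c * i * i" for c by (simp_all add: i_def)
 have y: "c / y\<^sup>2 = c * j * j" "c / (y * y * (y * y)) = c * j * j * j * j" "c / y = c * j" for c
  by (simp_all add: j_def power2_eq_square)
 have E: "(p - 1 - (1 - be) * y * i) * j = E"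
 proof -
  have "(p - 1 - (1 - be) * y * i) * j = (p - 1) * j - (1 - be) * i * (j * y)" by (simp add: algebra_simps)
  then show ?thesis by (simp add: ij E_def)
 qed
 have y2: "y2 * j * j = (j * p * p - i * p - j + i * be) * j * j + i * al + y"
 proof -
  have "y2 * j * j = (j * p * p - i * p - j + i * be) * j * j + i * al * (j * y) * (j * y) + y * (j * y) * (j * y)"
   unfolding assms(3) x y power2_eq_square power3_eq_cube by (simp add: algebra_simps)
  then show ?thesis by (simp add: ij)
 qed
 have "((y2 - 0 - ((1 - be) * p * x - (1 - be) * y * 1) * i * i) * (y * y) - (p - 1 - (1 - be) * y * i) * (p * y + p * y)) * j * j * j * j
   = y2 * j * j * (j * y) * (j * y) - (1 - be) * p * i * (i * x) * j * j * (j * y) * (j * y) + (1 - be) * i * i * j * (j * y) * (j * y) * (j * y)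
    - 2 * ((p - 1 - (1 - be) * y * i) * j) * p * j * j * (j * y)"
  by (simp add: algebra_simps)
 also have "... = y2 * j * j - (1 - be) * p * i * j * j + (1 - be) * i * i * j - 2 * E * p * j * j"
  unfolding ij E by simp
 also have "... = y - E * E * j + (al * i + (be - 2) * (E * j * i))"
  unfolding y2 E_def by (simp add: algebra_simps)
 also have "E * E * j = y * (E * j)\<^sup>2"
 proof -
  have "y * (E * j)\<^sup>2 = E * E * j * (j * y)" by (simp add: power2_eq_square)
  then show ?thesis by (simp add: ij)
 qed
 finally show ?thesis unfolding x y E .
qed

lemma riccati_partner_deriv:
 assumes u: "u analytic_on {x}" and u0: "u x ~= 0" and x0: "x ~= 0" and eq: "P3_at al be u x"
 shows "deriv (riccati_partner be u) x = u x - u x * (riccati_partner be u x)\<^sup>2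
   + (al / x + (be - 2) * (riccati_partner be u x / x))"
proof -
 have d1: "(u has_field_derivative deriv u x) (at x)"
  using u by (simp add: DERIV_deriv_iff_field_differentiable analytic_on_imp_differentiable_at)
 have d2: "(deriv u has_field_derivative deriv (deriv u) x) (at x)"
  using analytic_deriv[OF u] by (simp add: DERIV_deriv_iff_field_differentiable analytic_on_imp_differentiable_at)
 have xd: "((%x. x) has_field_derivative 1) (at x)" by (rule DERIV_ident)
 have n: "((%x. deriv u x - 1 - (1 - be) * u x / x) has_field_derivative
   (deriv (deriv u) x - 0 - ((1 - be) * deriv u x * x - (1 - be) * u x * 1) / (x * x))) (at x)"
  by (rule DERIV_diff[OF DERIV_diff[OF d2 DERIV_const] DERIV_divide[OF DERIV_cmult[OF d1] xd x0]])
 have "((%x. (deriv u x - 1 - (1 - be) * u x / x) / (u x * u x)) has_field_derivative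
   ((deriv (deriv u) x - 0 - ((1 - be) * deriv u x * x - (1 - be) * u x * 1) / (x * x)) * (u x * u x)
    - (deriv u x - 1 - (1 - be) * u x / x) * (deriv u x * u x + deriv u x * u x)) / (u x * u x * (u x * u x))) (at x)"
  using u0 by (intro DERIV_divide[OF n] DERIV_mult[OF d1 d1]) simp
 then have "deriv (riccati_partner be u) x =
   ((deriv (deriv u) x - 0 - ((1 - be) * deriv u x * x - (1 - be) * u x * 1) / (x * x)) * (u x * u x)
    - (deriv u x - 1 - (1 - be) * u x / x) * (deriv u x * u x + deriv u x * u x)) / (u x * u x * (u x * u x))"
  unfolding riccati_partner_def[abs_def] power2_eq_square by (rule DERIV_imp_deriv)
 then show ?thesis
  unfolding riccati_partner_def using riccati_partner_algebra[OF u0 x0 eq[unfolded P3_at_def]] by (simp only:)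
qed

lemma decays_diff_trans:
 assumes "decays \<theta>1 \<theta>2 N (%x. f x - h x)" "decays \<theta>1 \<theta>2 N (%x. g x - h x)"
 shows "decays \<theta>1 \<theta>2 N (%x. f x - g x)"
 using decays_diff[OF assms] by simp

lemma leading_const: "decays \<theta>1 \<theta>2 1 (%x. c - c)" by (simp add: decays_def)

lemma leading_add:
 assumes "decays \<theta>1 \<theta>2 1 (%x. f x - c)" "decays \<theta>1 \<theta>2 1 (%x. g x - d)"
 shows "decays \<theta>1 \<theta>2 1 (%x. (f x + g x) - (c + d))"
proof -
 have eq: "(f x + g x) - (c + d) = (f x - c) + (g x - d)" for x by simp
 show ?thesis unfolding eq by (intro decays_add assms)
qed

lemma leading_mult:
 assumes "decays \<theta>1 \<theta>2 1 (%x. f x - c)" "decays \<theta>1 \<theta>2 1 (%x. g x - d)"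
 shows "decays \<theta>1 \<theta>2 1 (%x. f x * g x - c * d)"
proof -
 have eq: "f x * g x - c * d = (f x - c) * (g x - d) + (c / x ^ 0) * (g x - d) + (d / x ^ 0) * (f x - c)" for x
  by (simp add: algebra_simps)
 have "decays \<theta>1 \<theta>2 1 (%x. (f x - c) * (g x - d))" by (rule decays_weaken[OF decays_mult[OF assms]]) simp
 moreover have "decays \<theta>1 \<theta>2 1 (%x. (c / x ^ 0) * (g x - d))" using decays_mult[OF decays_monomial[of \<theta>1 \<theta>2 0 c] assms(2)] by simp
 moreover have "decays \<theta>1 \<theta>2 1 (%x. (d / x ^ 0) * (f x - c))" using decays_mult[OF decays_monomial[of \<theta>1 \<theta>2 0 d] assms(1)] by simp
 ultimately show ?thesis unfolding eq by (intro decays_add)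
qed

lemma leading_bounded: "decays \<theta>1 \<theta>2 1 (%x. f x - c) ==> decays \<theta>1 \<theta>2 0 f"
 using decays_add[OF decays_weaken[of \<theta>1 \<theta>2 1 _ 0] decays_monomial[of \<theta>1 \<theta>2 0 c]] by fastforce

lemma conv_Suc:
 "conv F (conv G G) (n + 1) = 2 * F 0 * G 0 * G (n + 1) + F 0 * (\<Sum>l=1..n. G l * G (n + 1 - l))
   + (\<Sum>j=1..n+1. F j * (\<Sum>l=0..n+1-j. G l * G (n + 1 - j - l)))"
proof -
 have s1: "sum h {..n+1} = h 0 + sum h {1..n+1}" for h :: "nat => complex"
  by (simp add: atMost_atLeast0 sum.atLeast_Suc_atMost)
 have s2: "sum h {1..n+1} = sum h {1..n} + h (n + 1)" for h :: "nat => complex" by simp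
 have "conv G G (n + 1) = G 0 * G (n + 1) + ((\<Sum>l=1..n. G l * G (n + 1 - l)) + G (n + 1) * G 0)"
  unfolding conv_def s1 s2 by simp
 moreover have "conv F (conv G G) (n + 1) = F 0 * conv G G (n + 1) + (\<Sum>j=1..n+1. F j * conv G G (n + 1 - j))"
  by (subst conv_def) (simp only: s1 diff_zero)
 moreover have "conv G G k = (\<Sum>l=0..k. G l * G (k - l))" for k by (simp add: conv_def atMost_atLeast0)
 ultimately show ?thesis by (simp add: algebra_simps)
qed

context
 fixes al be :: complex and a A :: "nat => complex"
 assumes a4: "a 0 ^ 4 = 1"
  and A0: "A 0 = - (a 0)\<^sup>2"
  and a_rec: "!!n. 2 * a 0 * A 0 * a (n + 1) =
    (be - 1 - of_nat n) * a n
    - A 0 * (\<Sum>l=1..n. a l * a (n + 1 - l))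
    - (\<Sum>j=1..n+1. A j * (\<Sum>l=0..n+1-j. a l * a (n + 1 - j - l)))"
  and A_rec: "!!n. 2 * a 0 * A 0 * A (n + 1) =
    al * (if n = 0 then 1 else 0) + (of_nat n + be - 2) * A n
    - a 0 * (\<Sum>l=1..n. A l * A (n + 1 - l))
    - (\<Sum>j=1..n. a j * (\<Sum>l=0..n+1-j. A l * A (n + 1 - j - l)))"
begin

definition "first_rhs = (%n. shift (%n. - of_nat n * a n) n - (if n = 0 then 1 else 0) - (1 - be) * shift a n)"
definition "second_rhs = (%n. (if n = 1 then al else 0) + (be - 2) * shift A n - shift (%n. - of_nat n * A n) n)"

lemma first_equation_coeffs: "conv A (conv a a) = first_rhs"
proof
 fix n
 show "conv A (conv a a) n = first_rhs n"
 proof (cases n)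
  case 0
  have "A 0 * (a 0 * a 0) = - 1" using a4 A0 by (simp add: power2_eq_square power4_eq_xxxx mult.assoc)
  then show ?thesis using 0 by (simp add: conv_def first_rhs_def shift_def)
 next
  case (Suc k)
  have "conv A (conv a a) (k + 1) = (be - 1 - of_nat k) * a k"
   unfolding conv_Suc using a_rec[of k] by (simp add: algebra_simps)
  then show ?thesis using Suc by (simp add: first_rhs_def shift_def algebra_simps)
 qed
qed

lemma A0_square: "A 0 * A 0 = 1" using a4 A0 by (simp add: power2_eq_square power4_eq_xxxx mult.assoc)

lemma second_equation_coeffs: "(%n. conv a (conv A A) n - a n) = second_rhs"
proof
 fix n
 show "conv a (conv A A) n - a n = second_rhs n"
 proof (cases n)
  case 0
  then show ?thesis using A0_square by (simp add: conv_def second_rhs_def shift_def)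
 next
  case (Suc k)
  have "(\<Sum>j=1..k+1. a j * (\<Sum>l=0..k+1-j. A l * A (k + 1 - j - l)))
   = (\<Sum>j=1..k. a j * (\<Sum>l=0..k+1-j. A l * A (k + 1 - j - l))) + a (k + 1)"
   using A0_square by simp
  then have "conv a (conv A A) (k + 1) - a (k + 1) = al * (if k = 0 then 1 else 0) + (of_nat k + be - 2) * A k"
   unfolding conv_Suc A_rec by (simp only:) (simp add: algebra_simps)
  then show ?thesis using Suc by (simp add: second_rhs_def shift_def algebra_simps)
 qed
qed

text \<open>
  Suppose that \<open>u\<close> and its partner \<open>B\<close> are known up to \<open>1 / x ^ (N + 1)\<close>. Derivatives and divisions by \<open>x\<close>
  gain a power, so the cubic terms \<open>B * u\<^sup>2\<close> and \<open>u * B\<^sup>2 - u\<close> are known one order further. The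
  differential of the second one at the leading terms is \<open>2 * a 0 * A 0\<close> times the error of \<open>B\<close>, since
  \<open>(A 0)\<^sup>2 = 1\<close>; this improves \<open>B\<close>, and then the first one improves \<open>u\<close>.
\<close>

theorem expansion_from_leading_term:
 assumes fa: "far_analytic \<theta>1 \<theta>2 u"
  and eq: "!!\<phi>1 \<phi>2. \<theta>1 < \<phi>1 ==> \<phi>1 < \<phi>2 ==> \<phi>2 < \<theta>2 ==> \<forall>\<^sub>F x in at_infinity_in_sector \<phi>1 \<phi>2. P3_at al be u x"
  and lead: "decays \<theta>1 \<theta>2 1 (%x. u x - a 0)"
 shows "has_asymp_expansion_in_sector u a \<theta>1 \<theta>2"
proof -
 define B where "B = riccati_partner be u"
 have a00: "a 0 ~= 0" using a4 by auto
 have A00: "A 0 ~= 0" using A0_square by auto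
 have far: "\<forall>\<^sub>F x in at_infinity_in_sector \<phi>1 \<phi>2. u analytic_on {x} & u x ~= 0 & x ~= 0 & P3_at al be u x"
  if p: "\<theta>1 < \<phi>1" "\<phi>1 < \<phi>2" "\<phi>2 < \<theta>2" for \<phi>1 \<phi>2
 proof -
  have "\<forall>\<^sub>F x in at_infinity_in_sector \<phi>1 \<phi>2. u analytic_on {x}" using fa p unfolding far_analytic_def by blast
  moreover have "\<forall>\<^sub>F x in at_infinity_in_sector \<phi>1 \<phi>2. u x ~= 0"
   by (rule tendsto_imp_eventually_ne[OF decays_one_tendsto[OF lead p] a00])
  ultimately show ?thesis using eventually_in_sector_far[of \<phi>1 \<phi>2 1] eq[OF p]
   by eventually_elim auto
 qed
 have Ba: "far_analytic \<theta>1 \<theta>2 B"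
  unfolding far_analytic_def
 proof (intro allI impI)
  fix \<phi>1 \<phi>2 assume "\<theta>1 < \<phi>1 & \<phi>1 < \<phi>2 & \<phi>2 < \<theta>2"
  then have "\<forall>\<^sub>F x in at_infinity_in_sector \<phi>1 \<phi>2. u analytic_on {x} & u x ~= 0 & x ~= 0 & P3_at al be u x" using far by blast
  then show "\<forall>\<^sub>F x in at_infinity_in_sector \<phi>1 \<phi>2. B analytic_on {x}"
   unfolding B_def by eventually_elim (auto intro: riccati_partner_analytic)
 qed
 have eq1: "\<forall>\<^sub>F x in at_infinity_in_sector \<phi>1 \<phi>2. deriv u x - 1 / x ^ 0 - (1 - be) * (u x / x) = B x * (u x * u x)"
  if p: "\<theta>1 < \<phi>1" "\<phi>1 < \<phi>2" "\<phi>2 < \<theta>2" for \<phi>1 \<phi>2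
  using far[OF p] by eventually_elim (simp add: B_def riccati_partner_def power2_eq_square)
 have eq2: "\<forall>\<^sub>F x in at_infinity_in_sector \<phi>1 \<phi>2. al / x ^ 1 + (be - 2) * (B x / x) - deriv B x = u x * (B x * B x) - u x"
  if p: "\<theta>1 < \<phi>1" "\<phi>1 < \<phi>2" "\<phi>2 < \<theta>2" for \<phi>1 \<phi>2
  using far[OF p]
 proof eventually_elim
  case (elim x)
  then show ?case unfolding B_def using riccati_partner_deriv[of u x al be] by (simp add: power2_eq_square algebra_simps)
 qed
 have step: "expands \<theta>1 \<theta>2 (Suc N) u a & expands \<theta>1 \<theta>2 (Suc N) B A"
  if eu: "expands \<theta>1 \<theta>2 N u a" and eB: "expands \<theta>1 \<theta>2 N B A" for N
 proof -
  let ?P = "partial_sum a (Suc N)" and ?Q = "partial_sum A (Suc N)"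
  have lu: "decays \<theta>1 \<theta>2 1 (%x. u x - a 0)" by (rule lead)
  have lB: "decays \<theta>1 \<theta>2 1 (%x. B x - A 0)" by (rule expands_leading[OF eB])
  have lP: "decays \<theta>1 \<theta>2 1 (%x. ?P x - a 0)" by (rule expands_leading[OF expands_self])
  have lQ: "decays \<theta>1 \<theta>2 1 (%x. ?Q x - A 0)" by (rule expands_leading[OF expands_self])
  have r: "decays \<theta>1 \<theta>2 (Suc N) (%x. f x - partial_sum F (Suc N) x)" if "expands \<theta>1 \<theta>2 N f F" for f F
  proof -
   have e: "f x - partial_sum F (Suc N) x = (f x - partial_sum F N x) - F (Suc N) / x ^ Suc N" for x
    by (simp add: partial_sum_def)
   show ?thesis unfolding e by (rule decays_diff[OF that[unfolded expands_def] decays_monomial])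
  qed
  have d1: "decays \<theta>1 \<theta>2 (Suc (Suc N)) (%x. B x * (u x * u x) - ?Q x * (?P x * ?P x))"
  proof -
   have "expands \<theta>1 \<theta>2 (Suc N) (%x. deriv u x - 1 / x ^ 0 - (1 - be) * (u x / x)) first_rhs"
    unfolding first_rhs_def
    by (intro expands_diff expands_cmult expands_shift expands_deriv[OF fa] expands_monomial eu) simp
   then have "decays \<theta>1 \<theta>2 (Suc (Suc N)) (%x. (deriv u x - 1 / x ^ 0 - (1 - be) * (u x / x)) - partial_sum first_rhs (Suc N) x)"
    unfolding expands_def .
   moreover have "decays \<theta>1 \<theta>2 (Suc (Suc N)) (%x. (deriv u x - 1 / x ^ 0 - (1 - be) * (u x / x)) - partial_sum first_rhs (Suc N) x)
     = decays \<theta>1 \<theta>2 (Suc (Suc N)) (%x. B x * (u x * u x) - partial_sum first_rhs (Suc N) x)"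
    by (rule decays_cong, rule eventually_mono[OF eq1]) (assumption+, simp only:)
   ultimately have "decays \<theta>1 \<theta>2 (Suc (Suc N)) (%x. B x * (u x * u x) - partial_sum first_rhs (Suc N) x)" by simp
   moreover have "decays \<theta>1 \<theta>2 (Suc (Suc N)) (%x. ?Q x * (?P x * ?P x) - partial_sum first_rhs (Suc N) x)"
    using expands_mult[OF expands_self[of \<theta>1 \<theta>2 "Suc N" A] expands_mult[OF expands_self[of \<theta>1 \<theta>2 "Suc N" a] expands_self[of \<theta>1 \<theta>2 "Suc N" a]]]
    unfolding first_equation_coeffs expands_def .
   ultimately show ?thesis by (rule decays_diff_trans)
  qed
  have d2: "decays \<theta>1 \<theta>2 (Suc (Suc N)) (%x. (u x * (B x * B x) - u x) - (?P x * (?Q x * ?Q x) - ?P x))"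
  proof -
   have "expands \<theta>1 \<theta>2 (Suc N) (%x. al / x ^ 1 + (be - 2) * (B x / x) - deriv B x) second_rhs"
    unfolding second_rhs_def
    by (intro expands_diff expands_add expands_cmult expands_shift expands_deriv[OF Ba] expands_monomial eB) simp
   then have "decays \<theta>1 \<theta>2 (Suc (Suc N)) (%x. (al / x ^ 1 + (be - 2) * (B x / x) - deriv B x) - partial_sum second_rhs (Suc N) x)"
    unfolding expands_def .
   moreover have "decays \<theta>1 \<theta>2 (Suc (Suc N)) (%x. (al / x ^ 1 + (be - 2) * (B x / x) - deriv B x) - partial_sum second_rhs (Suc N) x)
     = decays \<theta>1 \<theta>2 (Suc (Suc N)) (%x. (u x * (B x * B x) - u x) - partial_sum second_rhs (Suc N) x)"
    by (rule decays_cong, rule eventually_mono[OF eq2]) (assumption+, simp only:)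
   ultimately have "decays \<theta>1 \<theta>2 (Suc (Suc N)) (%x. (u x * (B x * B x) - u x) - partial_sum second_rhs (Suc N) x)" by simp
   moreover have "decays \<theta>1 \<theta>2 (Suc (Suc N)) (%x. (?P x * (?Q x * ?Q x) - ?P x) - partial_sum second_rhs (Suc N) x)"
    using expands_diff[OF expands_mult[OF expands_self[of \<theta>1 \<theta>2 "Suc N" a]
      expands_mult[OF expands_self[of \<theta>1 \<theta>2 "Suc N" A] expands_self[of \<theta>1 \<theta>2 "Suc N" A]]] expands_self[of \<theta>1 \<theta>2 "Suc N" a]]
    unfolding second_equation_coeffs expands_def .
   ultimately show ?thesis by (rule decays_diff_trans)
  qed
  have s: "decays \<theta>1 \<theta>2 (Suc (Suc N)) (%x. B x - ?Q x)"
  proof (rule decays_cancel)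
   have e: "(?P x * (B x + ?Q x)) * (B x - ?Q x) = ((u x * (B x * B x) - u x) - (?P x * (?Q x * ?Q x) - ?P x)) - (u x - ?P x) * (B x * B x - A 0 * A 0)" for x
    unfolding A0_square by (simp add: algebra_simps)
   have "decays \<theta>1 \<theta>2 (Suc (Suc N)) (%x. (u x - ?P x) * (B x * B x - A 0 * A 0))"
    using decays_mult[OF r[OF eu] leading_mult[OF lB lB]] by simp
   then show "decays \<theta>1 \<theta>2 (Suc (Suc N)) (%x. (?P x * (B x + ?Q x)) * (B x - ?Q x))"
    unfolding e by (rule decays_diff[OF d2])
   show "decays \<theta>1 \<theta>2 1 (%x. ?P x * (B x + ?Q x) - a 0 * (A 0 + A 0))"
    by (intro leading_mult leading_add lP lB lQ)
   show "a 0 * (A 0 + A 0) ~= 0" using a00 A00 by (simp flip: mult_2)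
  qed
  have "decays \<theta>1 \<theta>2 (Suc (Suc N)) (%x. u x - ?P x)"
  proof (rule decays_cancel)
   have e: "(?Q x * (u x + ?P x)) * (u x - ?P x) = (B x * (u x * u x) - ?Q x * (?P x * ?P x)) - (B x - ?Q x) * (u x * u x)" for x
    by (simp add: algebra_simps)
   have "decays \<theta>1 \<theta>2 (Suc (Suc N)) (%x. (B x - ?Q x) * (u x * u x))"
    using decays_mult[OF s leading_bounded[OF leading_mult[OF lu lu]]] by simp
   then show "decays \<theta>1 \<theta>2 (Suc (Suc N)) (%x. (?Q x * (u x + ?P x)) * (u x - ?P x))"
    unfolding e by (rule decays_diff[OF d1])
   show "decays \<theta>1 \<theta>2 1 (%x. ?Q x * (u x + ?P x) - A 0 * (a 0 + a 0))"
    by (intro leading_mult leading_add lP lu lQ)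
   show "A 0 * (a 0 + a 0) ~= 0" using a00 A00 by (simp flip: mult_2)
  qed
  then show ?thesis using s by (simp add: expands_def)
 qed
 have u0: "expands \<theta>1 \<theta>2 0 u a" using lead by (simp add: expands_def partial_sum_def)
 have B0: "expands \<theta>1 \<theta>2 0 B A"
 proof -
  have "decays \<theta>1 \<theta>2 1 (%x. B x - A 0)"
  proof (rule decays_cancel)
   have "expands \<theta>1 \<theta>2 (Suc 0) (%x. deriv u x - 1 / x ^ 0 - (1 - be) * (u x / x)) first_rhs"
    unfolding first_rhs_def
    by (intro expands_diff expands_cmult expands_shift expands_deriv[OF fa] expands_monomial u0) simp
   from expands_leading[OF this] have "decays \<theta>1 \<theta>2 1 (%x. (deriv u x - 1 / x ^ 0 - (1 - be) * (u x / x)) - first_rhs 0)" .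
   moreover have "decays \<theta>1 \<theta>2 1 (%x. (deriv u x - 1 / x ^ 0 - (1 - be) * (u x / x)) - first_rhs 0)
     = decays \<theta>1 \<theta>2 1 (%x. B x * (u x * u x) - first_rhs 0)"
    by (rule decays_cong, rule eventually_mono[OF eq1]) (assumption+, simp only:)
   ultimately have 1: "decays \<theta>1 \<theta>2 1 (%x. B x * (u x * u x) - first_rhs 0)" by simp
   have 2: "decays \<theta>1 \<theta>2 1 (%x. A 0 * (u x * u x) - A 0 * (a 0 * a 0))"
    by (intro leading_mult leading_const lead)
   have "A 0 * (a 0 * a 0) = first_rhs 0" unfolding first_equation_coeffs[symmetric] by (simp add: conv_def)
   with decays_diff[OF 1 2] show "decays \<theta>1 \<theta>2 1 (%x. (u x * u x) * (B x - A 0))"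
    by (simp add: algebra_simps)
   show "decays \<theta>1 \<theta>2 1 (%x. u x * u x - a 0 * a 0)" by (intro leading_mult lead)
   show "a 0 * a 0 ~= 0" using a00 by simp
  qed
  then show ?thesis by (simp add: expands_def partial_sum_def)
 qed
 have all: "expands \<theta>1 \<theta>2 N u a & expands \<theta>1 \<theta>2 N B A" for N
  by (induction N) (use u0 B0 step in auto)
 show ?thesis
  unfolding has_asymp_expansion_in_sector_def
 proof (intro allI impI)
  fix \<phi>1 \<phi>2 N assume "\<theta>1 < \<phi>1 & \<phi>1 < \<phi>2 & \<phi>2 < \<theta>2"
  then have "(%x. u x - partial_sum a N x) \<in> O[at_infinity_in_sector \<phi>1 \<phi>2](%x. 1 / x ^ Suc N)"
   using all[of N] unfolding expands_def decays_def by blast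
  moreover have "(%x. 1 / x ^ Suc N) \<in> o[at_infinity_in_sector \<phi>1 \<phi>2](%x. 1 / x ^ N :: complex)"
  proof (rule landau_o.smallI)
   fix c :: real assume c: "0 < c"
   show "\<forall>\<^sub>F x in at_infinity_in_sector \<phi>1 \<phi>2. norm (1 / x ^ Suc N :: complex) <= c * norm (1 / x ^ N :: complex)"
    unfolding eventually_at_infinity_in_sector
   proof (intro exI[of _ "1 / c"] ballI impI)
    fix x :: complex assume "1 / c <= norm x"
    have "0 < 1 / c" using c by simp
    then have x: "0 < norm x" using \<open>1 / c <= norm x\<close> by (rule less_le_trans)
    then have "1 / norm x <= c" using \<open>1 / c <= norm x\<close> c by (simp only: pos_divide_le_eq mult.commute[of "norm x"])
    then have "1 / norm x * (1 / norm x ^ N) <= c * (1 / norm x ^ N)" by (intro mult_right_mono) auto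
    then show "norm (1 / x ^ Suc N) <= c * norm (1 / x ^ N)" by (simp add: norm_divide norm_power norm_mult)
   qed
  qed
  ultimately show "(%x. u x - (\<Sum>n\<le>N. a n / x ^ n)) \<in> o[at_infinity_in_sector \<phi>1 \<phi>2](%x. 1 / x ^ N)"
   unfolding partial_sum_def by (rule landau_o.big_small_trans)
 qed
qed

end

section \<open>Global solutions with prescribed behaviour\<close>

lemma cut_plane_open: "open cut_plane"
proof -
 have eq: "cut_plane = {x. Re x < 0} \<union> {x. 0 < Re x} \<union> {x. 0 < Im x}" by (auto simp: cut_plane_iff)
 show ?thesis unfolding eq by (intro open_Un open_Collect_less continuous_intros)
qed

lemma up_log_inj: "inj_on up_log cut_plane"
 by (rule inj_onI) (metis up_log(2))

lemma nicely_meromorphic_compose: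
 assumes V: "V nicely_meromorphic_on UNIV" and g: "g holomorphic_on D" "open D" "inj_on g D"
 shows "(%x. V (g x)) nicely_meromorphic_on D"
 unfolding nicely_meromorphic_on_def
proof (intro conjI ballI)
 have ga: "g analytic_on D" using g by (simp add: analytic_on_open)
 show "(%x. V (g x)) meromorphic_on D"
  by (rule meromorphic_on_compose[where A = UNIV]) (use V ga in \<open>auto simp: nicely_meromorphic_on_def\<close>)
 fix x assume x: "x \<in> D"
 have "isCont g x" using holomorphic_on_imp_continuous_on[OF g(1)] g(2) x by (simp add: continuous_on_eq_continuous_at)
 then have c: "g \<midarrow>x\<rightarrow> g x" by (rule isContD)
 have "\<forall>\<^sub>F y in nhds x. y \<in> D" by (rule eventually_nhds_in_open[OF g(2) x])
 then have "\<forall>\<^sub>F y in at x. y \<in> D & y ~= x" by (auto simp: eventually_at_filter elim: eventually_mono)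
 then have ne: "\<forall>\<^sub>F y in at x. g y ~= g x"
  by eventually_elim (use g(3) x in \<open>auto dest: inj_onD\<close>)
 from c ne have fl: "filterlim g (at (g x)) (at x)" by (simp add: filterlim_at)
 consider "is_pole V (g x)" "V (g x) = 0" | "V \<midarrow>g x\<rightarrow> V (g x)" using V by (auto simp: nicely_meromorphic_on_def)
 then show "is_pole (%x. V (g x)) x & V (g x) = 0 \<or> (%x. V (g x)) \<midarrow>x\<rightarrow> V (g x)"
 proof cases
  case 1
  then show ?thesis using filterlim_compose[OF _ fl] unfolding is_pole_def by blast
 next
  case 2
  then show ?thesis using filterlim_compose[OF 2 fl] by blast
 qed
qed

lemma sinh_P3_cong:
 assumes "\<forall>\<^sub>F y in nhds x. \<phi> y = \<psi> y"
 shows "sinh_P3 al be \<phi> x \<longleftrightarrow> sinh_P3 al be \<psi> x"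
proof -
 have "\<forall>\<^sub>F y in nhds x. \<forall>\<^sub>F z in nhds y. \<phi> z = \<psi> z" using assms by (simp add: eventually_eventually)
 then have "\<forall>\<^sub>F y in nhds x. deriv \<phi> y = deriv \<psi> y"
  by eventually_elim (rule deriv_cong_ev, auto)
 then have "deriv (deriv \<phi>) x = deriv (deriv \<psi>) x" by (rule deriv_cong_ev) simp
 moreover have "deriv \<phi> x = deriv \<psi> x" by (rule deriv_cong_ev[OF assms]) simp
 moreover have "\<phi> x = \<psi> x" by (rule eventually_nhds_x_imp_x[OF assms])
 ultimately show ?thesis by (simp add: sinh_P3_def)
qed

lemma sinh_P3_imp_log_P3:
 assumes S: "open S" "t \<in> S" "!!s. s \<in> S ==> exp s \<in> G" and \<phi>: "\<phi> holomorphic_on G" "open G"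
  and eq: "sinh_P3 al be \<phi> (exp t)"
 shows "log_P3 al be (%t. exp (\<phi> (exp t))) t"
proof -
 have d1: "(\<phi> has_field_derivative deriv \<phi> x) (at x)" if "x \<in> G" for x by (rule holomorphic_derivI[OF \<phi> that])
 have d2: "(deriv \<phi> has_field_derivative deriv (deriv \<phi>) x) (at x)" if "x \<in> G" for x
  by (rule holomorphic_derivI[OF holomorphic_deriv[OF \<phi>] \<phi>(2) that])
 have h: "((%s. exp (\<phi> (exp s))) has_field_derivative exp (\<phi> (exp s)) * (deriv \<phi> (exp s) * exp s)) (at s)" if "s \<in> S" for s
  by (rule DERIV_chain2[OF DERIV_exp DERIV_chain2[OF d1[OF S(3)[OF that]] DERIV_exp]])
 have d: "((%s. exp (\<phi> (exp s)) * (deriv \<phi> (exp s) * exp s)) has_field_derivative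
   exp (\<phi> (exp t)) * (deriv \<phi> (exp t) * exp t) * (deriv \<phi> (exp t) * exp t)
   + (deriv (deriv \<phi>) (exp t) * exp t * exp t + exp t * deriv \<phi> (exp t)) * exp (\<phi> (exp t))) (at t)"
  by (rule DERIV_mult[OF h[OF S(2)] DERIV_mult[OF DERIV_chain2[OF d2[OF S(3)[OF S(2)]] DERIV_exp] DERIV_exp]])
 define X Y e p q where "X = exp (\<phi> (exp t))" and "Y = exp (- \<phi> (exp t))" and "e = exp t" and "p = deriv \<phi> (exp t)" and "q = deriv (deriv \<phi>) (exp t)"
 have XY: "X * Y = 1" by (simp add: X_def Y_def exp_minus)
 have e0: "e ~= 0" by (simp add: e_def)
 have "exp (2 * \<phi> (exp t)) = X * X" "exp (- (2 * \<phi> (exp t))) = Y * Y"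
  by (simp_all add: X_def Y_def flip: exp_add)
 then have "q + p / e = X * X - Y * Y + (al * X + be * Y) / e"
  using eq unfolding sinh_P3_def X_def Y_def e_def p_def q_def by simp
 then have "(q + p / e) * e = (X * X - Y * Y + (al * X + be * Y) / e) * e" by simp
 then have main: "q * e + p = (X * X - Y * Y) * e + al * X + be * Y"
 proof -
  have z: "z / e * e = z" for z using e0 by simp
  show ?thesis using \<open>(q + p / e) * e = (X * X - Y * Y + (al * X + be * Y) / e) * e\<close> by (simp only: distrib_right z add.assoc)
 qed
 have "X * (X * (p * e) * (p * e) + (q * e * e + e * p) * X) = (X * (p * e))\<^sup>2 + e * X * X * (q * e + p)"
  by (simp add: algebra_simps power2_eq_square)
 also have "... = (X * (p * e))\<^sup>2 + e * (al * X ^ 3 + be * X * (X * Y)) + e * e * (X ^ 4 - (X * Y) * (X * Y))"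
  unfolding main by (simp add: algebra_simps power3_eq_cube power4_eq_xxxx)
 finally have "X * (X * (p * e) * (p * e) + (q * e * e + e * p) * X) = (X * (p * e))\<^sup>2 + e * (al * X ^ 3 + be * X) + e * e * (X ^ 4 - 1)"
  unfolding XY by simp
 moreover have "exp (2 * t) = e * e" by (simp add: e_def flip: exp_add)
 moreover have "deriv (deriv (%t. exp (\<phi> (exp t)))) t = X * (p * e) * (p * e) + (q * e * e + e * p) * X"
  unfolding X_def e_def p_def q_def by (rule second_derivative_eqI(1)[OF S(1,2) h d])
 moreover have "deriv (%t. exp (\<phi> (exp t))) t = X * (p * e)"
  unfolding X_def e_def p_def q_def by (rule second_derivative_eqI(2)[OF S(1,2) h d])
 moreover have "exp (\<phi> e) = X" by (simp add: X_def e_def)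
 ultimately show ?thesis
  unfolding log_P3_def by (simp only: flip: e_def)
qed

lemma branch_identity:
 assumes V: "log_solution al be UNIV V" and G: "open G" "connected G" "G <= cut_plane" and \<phi>: "\<phi> holomorphic_on G"
  and a: "a \<in> G" "\<forall>\<^sub>F x in nhds a. V (up_log x) = exp (\<phi> x)" and x: "x \<in> G"
 shows "V (up_log x) = exp (\<phi> x)"
proof -
 have V': "V nicely_meromorphic_on UNIV" using V unfolding log_solution_def by blast
 have n1: "(%x. V (up_log x)) nicely_meromorphic_on G"
  by (rule nicely_meromorphic_compose[OF V' holomorphic_on_subset[OF up_log_holomorphic G(3)] G(1) inj_on_subset[OF up_log_inj G(3)]])
 have "(%x. exp (\<phi> x)) analytic_on G" unfolding analytic_on_open[OF G(1)] by (rule holomorphic_on_exp'[OF \<phi>])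
 then have n2: "(%x. exp (\<phi> x)) nicely_meromorphic_on G" by (rule analytic_on_imp_nicely_meromorphic_on)
 show ?thesis by (rule nicely_meromorphic_identity[OF n1 n2 G(1,2) a x])
qed

text \<open>
  A solution of the equation for \<open>ln u\<close> on a region of the cut plane is, after exponentiation, the
  restriction of one global solution in logarithmic time.
\<close>

lemma branch_extends:
 assumes \<phi>: "\<phi> holomorphic_on G" and G: "open G" "connected G" "G <= cut_plane" and a: "a \<in> G"
  and eq: "!!x. x \<in> G ==> sinh_P3 al be \<phi> x"
 obtains V where "log_solution al be UNIV V" "!!x. x \<in> G ==> V (up_log x) = exp (\<phi> x)"
proof -
 define U where "U t = exp (\<phi> (exp t))" for t
 have oG: "open (exp -` G :: complex set)" by (rule open_vimage[OF G(1)]) (intro continuous_intros)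
 have acut: "a \<in> cut_plane" using a G(3) by blast
 have "up_log a \<in> exp -` G" using up_log(2)[OF acut] a by simp
 then obtain r where r: "0 < r" "ball (up_log a) r <= exp -` G" using oG open_contains_ball by blast
 let ?B = "ball (up_log a) r"
 have eB: "exp s \<in> G" if "s \<in> ?B" for s using r(2) that by auto
 have "U holomorphic_on ?B"
 proof -
  have "exp ` ?B <= G" using eB by blast
  from holomorphic_on_compose_gen[OF holomorphic_on_exp \<phi> this]
  have "(%x. \<phi> (exp x)) holomorphic_on ?B" by (simp only: o_def)
  then show ?thesis unfolding U_def[abs_def] by (rule holomorphic_on_exp')
 qed
 then have nm: "U nicely_meromorphic_on ?B" by (intro analytic_on_imp_nicely_meromorphic_on) (simp add: analytic_on_open)
 have eqB: "log_P3 al be U t" if "t \<in> ?B" for t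
  unfolding U_def[abs_def] by (rule sinh_P3_imp_log_P3[OF open_ball that eB \<phi> G(1) eq[OF eB[OF that]]])
 have "log_solution al be ?B U"
 proof -
  have "up_log a \<in> ?B" "U (up_log a) ~= 0" using r(1) by (auto simp: U_def)
  then show ?thesis unfolding log_solution_def using nm eqB by blast
 qed
 then obtain V where V: "log_solution al be UNIV V" "\<forall>\<^sub>F t in nhds (up_log a). V t = U t"
  by (rule log_solution_extend_entire[OF _ r(1)]) (auto simp: U_def)
 have "isCont up_log a" using up_log(3)[OF acut] by (rule DERIV_isCont)
 then have "filterlim up_log (nhds (up_log a)) (nhds a)" by (simp add: isCont_def tendsto_at_iff_tendsto_nhds)
 then have "\<forall>\<^sub>F x in nhds a. V (up_log x) = U (up_log x)" using V(2) by (rule eventually_compose_filterlim[rotated])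
 moreover have "\<forall>\<^sub>F x in nhds a. x \<in> G" by (rule eventually_nhds_in_open[OF G(1) a])
 ultimately have ev: "\<forall>\<^sub>F x in nhds a. V (up_log x) = exp (\<phi> x)"
 proof eventually_elim
  case (elim x)
  then have "x \<in> cut_plane" using G(3) by blast
  then show ?case using elim up_log(2) by (simp add: U_def)
 qed
 show thesis by (rule that[OF V(1)]) (rule branch_identity[OF V(1) G \<phi> a ev])
qed

text \<open>
  The global solution \<open>V\<close> is \<open>exp \<phi>\<close> on \<open>G\<close> with small \<open>\<phi>\<close>; in particular it has neither zeros
  nor poles there.
\<close>

definition small_branch :: "complex set => real => (complex => complex) => (complex => complex) => bool" where
 "small_branch G K V \<phi> \<longleftrightarrow> \<phi> holomorphic_on G & (\<forall>x\<in>G. norm (\<phi> x) <= K / norm x & V (up_log x) = exp (\<phi> x))"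

lemma up_region_cut_plane: "0 <= \<rho> ==> up_region k \<rho> <= cut_plane"
 by (auto simp: up_region_def cut_plane_iff)

lemma right_cone_cut_plane: "0 < k ==> 0 <= \<rho> ==> right_cone k \<rho> <= cut_plane"
 by (auto simp: right_cone_def cut_plane_iff)

definition upper_solution :: "complex => complex => (complex => complex) => bool" where
 "upper_solution al be V \<longleftrightarrow> log_solution al be UNIV V & (\<forall>k\<ge>1. \<exists>\<rho> K \<phi>. 1 + k <= \<rho> & 0 <= K &
   small_branch (up_region k \<rho>) K V \<phi> & (\<forall>x\<in>up_region k \<rho>. sinh_P3 al be \<phi> x))"

lemma up_region_mono: "k <= k' ==> \<rho>' <= \<rho> ==> up_region k \<rho> <= up_region k' \<rho>'"
proof
 fix x assume k: "k <= k'" "\<rho>' <= \<rho>" and x: "x \<in> up_region k \<rho>"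
 have "k * \<bar>Re x\<bar> <= k' * \<bar>Re x\<bar>" using k by (intro mult_right_mono) auto
 then show "x \<in> up_region k' \<rho>'" using x k by (simp add: up_region_def)
qed

text \<open>
  The small solution for \<open>k = 1\<close> defines \<open>V\<close>. For larger \<open>k\<close> the small solution is
  the same where both are defined, by uniqueness for \<open>k = 1\<close>, so \<open>V\<close> continues it too.
\<close>

theorem upper_solution_exists: "\<exists>V. upper_solution al be V"
proof -
 obtain \<rho>1 K1 \<phi>1 where 1: "1 + 1 <= \<rho>1" "0 <= K1" "\<phi>1 holomorphic_on up_region 1 \<rho>1"
  "!!x. x \<in> up_region 1 \<rho>1 ==> sinh_P3 al be \<phi>1 x" "!!x. x \<in> up_region 1 \<rho>1 ==> norm (\<phi>1 x) <= K1 / norm x"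
  by (rule small_solution_exists[of 1 al be]) auto
 have "\<i> * of_real (\<rho>1 + 1) \<in> up_region 1 \<rho>1" by (simp add: up_region_def)
 then obtain V where V: "log_solution al be UNIV V" "!!x. x \<in> up_region 1 \<rho>1 ==> V (up_log x) = exp (\<phi>1 x)"
  using branch_extends[OF 1(3) up_region_open up_region_connected up_region_cut_plane _ 1(4)] 1(1) by auto
 have "\<exists>\<rho> K \<phi>. 1 + k <= \<rho> & 0 <= K & small_branch (up_region k \<rho>) K V \<phi> & (\<forall>x\<in>up_region k \<rho>. sinh_P3 al be \<phi> x)"
  if k: "1 <= k" for k
 proof -
  have k0: "0 < k" using k by simp
  obtain \<rho> K \<phi> where 2: "1 + k <= \<rho>" "0 <= K" "\<phi> holomorphic_on up_region k \<rho>"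
   "!!x. x \<in> up_region k \<rho> ==> sinh_P3 al be \<phi> x" "!!x. x \<in> up_region k \<rho> ==> norm (\<phi> x) <= K / norm x"
   by (rule small_solution_exists[OF k0, of al be]) auto
  have K: "0 <= max K1 K" using 2 by simp
  obtain \<rho>u where u: "!!\<rho> \<phi> \<psi> x. \<rho>u <= \<rho> ==>
    \<phi> holomorphic_on up_region 1 \<rho> ==> \<psi> holomorphic_on up_region 1 \<rho> ==>
    (!!x. x \<in> up_region 1 \<rho> ==> sinh_P3 al be \<phi> x) ==> (!!x. x \<in> up_region 1 \<rho> ==> sinh_P3 al be \<psi> x) ==>
    (!!x. x \<in> up_region 1 \<rho> ==> norm (\<phi> x) <= max K1 K / norm x) ==>
    (!!x. x \<in> up_region 1 \<rho> ==> norm (\<psi> x) <= max K1 K / norm x) ==>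
    x \<in> up_region 1 (\<rho> + 1 + 1) ==> \<phi> x = \<psi> x"
   by (rule small_solution_unique[OF zero_less_one K, of al be]) blast
  define R where "R = max \<rho>u (max \<rho>1 \<rho>)"
  have sub: "up_region 1 R <= up_region 1 \<rho>1" "up_region 1 R <= up_region k \<rho>"
   by (rule up_region_mono; use k in \<open>simp add: R_def\<close>)+
  have agree: "\<phi>1 x = \<phi> x" if "x \<in> up_region 1 (R + 1 + 1)" for x
  proof (rule u[OF _ _ _ _ _ _ _ that])
   show "\<rho>u <= R" by (simp add: R_def)
   show "\<phi>1 holomorphic_on up_region 1 R" by (rule holomorphic_on_subset[OF 1(3) sub(1)])
   show "\<phi> holomorphic_on up_region 1 R" by (rule holomorphic_on_subset[OF 2(3) sub(2)])
   show "sinh_P3 al be \<phi>1 y" "sinh_P3 al be \<phi> y" if "y \<in> up_region 1 R" for y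
    using 1(4) 2(4) sub that by blast+
   show "norm (\<phi>1 y) <= max K1 K / norm y" if "y \<in> up_region 1 R" for y
    by (rule order_trans[OF 1(5) divide_right_mono]) (use sub that in auto)
   show "norm (\<phi> y) <= max K1 K / norm y" if "y \<in> up_region 1 R" for y
    by (rule order_trans[OF 2(5) divide_right_mono]) (use sub that in auto)
  qed
  let ?a = "\<i> * of_real (R + 3)"
  have a: "?a \<in> up_region 1 (R + 1 + 1)" by (simp add: up_region_def)
  have sub2: "up_region 1 (R + 1 + 1) <= up_region 1 R" by (rule up_region_mono) auto
  have "\<forall>\<^sub>F x in nhds ?a. x \<in> up_region 1 (R + 1 + 1)" by (rule eventually_nhds_in_open[OF up_region_open a])
  then have ev: "\<forall>\<^sub>F x in nhds ?a. V (up_log x) = exp (\<phi> x)"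
  proof eventually_elim
   case (elim x)
   then show ?case using agree[OF elim] V(2)[of x] sub(1) sub2 by auto
  qed
  have "V (up_log x) = exp (\<phi> x)" if "x \<in> up_region k \<rho>" for x
   by (rule branch_identity[OF V(1) up_region_open up_region_connected[OF k0] up_region_cut_plane 2(3) _ ev that])
    (use 2(1) k a sub sub2 in auto)
  then show ?thesis using 2 unfolding small_branch_def by blast
 qed
 then show ?thesis using V(1) unfolding upper_solution_def by blast
qed

text \<open>
  One base function for all cones; far out in each of them the values of \<open>V\<close> are near 1 and
  the principal logarithm is the small solution.
\<close>

definition base_phase :: "(complex => complex) => complex => complex" where
 "base_phase V x = Ln (V (up_log x))"

lemma Ln_exp_small: "norm z <= 1 ==> Ln (exp z) = z"
proof -
 assume "norm z <= 1"
 then have "\<bar>Im z\<bar> <= 1" using abs_Im_le_cmod order_trans by blast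
 then show ?thesis using pi_gt3 by (intro Ln_exp) auto
qed

lemma base_phase_cone:
 assumes V: "upper_solution al be V" and k: "1 <= k"
 obtains \<rho>0 K0 where "k <= \<rho>0" "0 <= K0" "base_phase V holomorphic_on right_cone k \<rho>0"
  "!!x. x \<in> right_cone k \<rho>0 ==> norm (base_phase V x) <= K0 / norm x"
  "!!x. x \<in> right_cone k \<rho>0 ==> V (up_log x) = exp (base_phase V x)"
  "!!x. x \<in> right_cone k \<rho>0 ==> sinh_P3 al be (base_phase V) x"
proof -
 have k0: "0 < k" using k by simp
 have "1 <= k + 1" using k by simp
 then obtain \<rho> K \<phi> where 1: "1 + (k + 1) <= \<rho>" "0 <= K" "small_branch (up_region (k + 1) \<rho>) K V \<phi>"
   "!!x. x \<in> up_region (k + 1) \<rho> ==> sinh_P3 al be \<phi> x"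
  using V unfolding upper_solution_def by blast
 define \<rho>0 where "\<rho>0 = max \<rho> (k * K)"
 have \<rho>0: "\<rho> <= \<rho>0" "k * K <= \<rho>0" "k <= \<rho>0" using 1(1) by (auto simp: \<rho>0_def)
 have sub: "right_cone k \<rho>0 <= up_region (k + 1) \<rho>"
  using right_cone_mono[OF \<rho>0(1), of k] right_cone_subset_up_region[OF k0, of \<rho>] 1(1) k by auto
 have b: "norm (\<phi> x) <= K / norm x" "V (up_log x) = exp (\<phi> x)" if "x \<in> right_cone k \<rho>0" for x
  using 1(3) sub that unfolding small_branch_def by auto
 have eq: "base_phase V x = \<phi> x" if x: "x \<in> right_cone k \<rho>0" for x
 proof -
  have n: "0 < Re x" "K <= Re x" "Re x <= norm x" using right_cone_far[OF k0 1(2) \<rho>0(2) x] by auto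
  then have "K / norm x <= 1" by (simp add: divide_le_eq)
  then have "norm (\<phi> x) <= 1" using b(1)[OF x] by linarith
  then show ?thesis by (simp add: base_phase_def b(2)[OF x] Ln_exp_small)
 qed
 show thesis
 proof (rule that[OF \<rho>0(3) 1(2)])
  have "\<phi> holomorphic_on right_cone k \<rho>0" using 1(3) sub unfolding small_branch_def by (auto intro: holomorphic_on_subset)
  then show "base_phase V holomorphic_on right_cone k \<rho>0" by (rule holomorphic_transform) (simp add: eq)
  fix x assume x: "x \<in> right_cone k \<rho>0"
  show "norm (base_phase V x) <= K / norm x" "V (up_log x) = exp (base_phase V x)" using b[OF x] eq[OF x] by auto
  have "\<forall>\<^sub>F y in nhds x. base_phase V y = \<phi> y"
   using eventually_nhds_in_open[OF right_cone_open x] by eventually_elim (rule eq)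
  then show "sinh_P3 al be (base_phase V) x" using sinh_P3_cong 1(4) sub x by blast
 qed
qed

lemma cone_setup_for:
 assumes C: "outer_const_ok al be C" and k: "1 <= k" and V: "upper_solution al be V" and K: "0 <= K"
 obtains \<rho>1 K0 C4 m where "k <= \<rho>1"  "0 <= K0" "0 <= C4" "!!\<rho>. \<rho>1 <= \<rho> ==> cone_setup al be k \<rho> m C C4 K0 K (base_phase V)"
  "!!x. x \<in> right_cone k \<rho>1 ==> V (up_log x) = exp (base_phase V x)"
  "!!x. x \<in> right_cone k \<rho>1 ==> sinh_P3 al be (base_phase V) x"
proof -
 have k0: "0 < k" using k by simp
 obtain \<rho>0 K0 where b: "k <= \<rho>0" "0 <= K0" "base_phase V holomorphic_on right_cone k \<rho>0"
  "!!x. x \<in> right_cone k \<rho>0 ==> norm (base_phase V x) <= K0 / norm x"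
  "!!x. x \<in> right_cone k \<rho>0 ==> V (up_log x) = exp (base_phase V x)"
  "!!x. x \<in> right_cone k \<rho>0 ==> sinh_P3 al be (base_phase V) x"
  by (rule base_phase_cone[OF V k]) blast
 obtain C4 m where s: "0 <= C4" "1 <= m" "!!\<rho> \<phi>0. k * m <= \<rho> ==> \<phi>0 holomorphic_on right_cone k \<rho> ==>
   (!!x. x \<in> right_cone k \<rho> ==> norm (\<phi>0 x) <= K0 / norm x) ==> cone_setup al be k \<rho> m C C4 K0 K \<phi>0"
  by (rule cone_setup_exists[OF k0 C b(2) K]) blast
 define \<rho>1 where "\<rho>1 = max \<rho>0 (k * m)"
 have m: "right_cone k \<rho> <= right_cone k \<rho>0" if "\<rho>1 <= \<rho>" for \<rho>
  using that by (intro right_cone_mono) (simp add: \<rho>1_def)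
 show thesis
 proof (rule that[OF _ b(2) s(1)])
  show "k <= \<rho>1" using b(1) by (simp add: \<rho>1_def)
  show "cone_setup al be k \<rho> m C C4 K0 K (base_phase V)" if "\<rho>1 <= \<rho>" for \<rho>
  proof (rule s(3))
   show "k * m <= \<rho>" using that by (simp add: \<rho>1_def)
   show "base_phase V holomorphic_on right_cone k \<rho>" by (rule holomorphic_on_subset[OF b(3) m[OF that]])
   show "norm (base_phase V x) <= K0 / norm x" if "x \<in> right_cone k \<rho>" for x
    using b(4) m[OF \<open>\<rho>1 <= \<rho>\<close>] that by blast
  qed
  show "V (up_log x) = exp (base_phase V x)" "sinh_P3 al be (base_phase V) x" if "x \<in> right_cone k \<rho>1" for x
   using b(5,6) m[OF order_refl] that by blast+
 qed
qed

text \<open>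
  The global solution with parameter \<open>c\<close>, fixed on one cone of slope 1.
\<close>

definition exp_branch :: "complex => complex => (complex => complex) => complex => (complex => complex) => bool" where
 "exp_branch al be V c W \<longleftrightarrow> log_solution al be UNIV W & (\<exists>\<rho> K \<delta>. \<delta> \<in> cone_class al be 1 \<rho> K & 0 <= K &
   (\<forall>x\<in>right_cone 1 \<rho>. cone_map al be (base_phase V) c \<delta> x = \<delta> x & W (up_log x) = exp (base_phase V x + \<delta> x)))"

lemma exp_branch_exists:
 assumes V: "upper_solution al be V"
 shows "\<exists>W. exp_branch al be V c W"
proof -
 obtain C where C: "outer_const_ok al be C" using outer_const_exists by blast
 define K where "K = C * (norm c + 2)"
 have K: "0 <= K" using C by (simp add: K_def outer_const_ok_def)
 obtain \<rho>1 K0 C4 m where s: "1 <= \<rho>1"  "0 <= K0" "0 <= C4" "!!\<rho>. \<rho>1 <= \<rho> ==> cone_setup al be 1 \<rho> m C C4 K0 K (base_phase V)"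
  "!!x. x \<in> right_cone 1 \<rho>1 ==> V (up_log x) = exp (base_phase V x)"
  "!!x. x \<in> right_cone 1 \<rho>1 ==> sinh_P3 al be (base_phase V) x"
  by (rule cone_setup_for[OF C order_refl V K]) blast
 interpret S: cone_setup al be 1 \<rho>1 m C C4 K0 K "base_phase V" by (rule s(4)[OF order_refl])
 have Kc: "C * (norm c + 2) <= K" by (simp add: K_def)
 obtain \<delta> where d: "!!c'. c' \<in> ball c 1 ==> \<delta> c' \<in> cone_class al be 1 \<rho>1 K"
  "!!c' x. c' \<in> ball c 1 ==> x \<in> right_cone 1 \<rho>1 ==> cone_map al be (base_phase V) c' (\<delta> c') x = \<delta> c' x"
  by (rule S.fixed_point_family[OF Kc]) blast
 have cc: "c \<in> ball c 1" by simp
 have hol: "(%x. base_phase V x + \<delta> c x) holomorphic_on right_cone 1 \<rho>1"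
  using d(1)[OF cc] S.\<phi>0(1) by (intro holomorphic_on_add) (auto simp: cone_class_def)
 have a: "complex_of_real (\<rho>1 + 1) \<in> right_cone 1 \<rho>1" by (simp add: right_cone_def)
 obtain W where W: "log_solution al be UNIV W" "!!x. x \<in> right_cone 1 \<rho>1 ==> W (up_log x) = exp (base_phase V x + \<delta> c x)"
 proof (rule branch_extends[OF hol right_cone_open right_cone_connected right_cone_cut_plane a])
  show "sinh_P3 al be (%x. base_phase V x + \<delta> c x) x" if "x \<in> right_cone 1 \<rho>1" for x
   by (rule S.fixed_point_solves[OF s(6) d(1)[OF cc] d(2)[OF cc] that])
 qed (use s(1) in auto)
 show ?thesis
  unfolding exp_branch_def using W d(1)[OF cc] d(2)[OF cc] K by blast
qed

lemma cone_class_subset: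
 assumes "\<delta> \<in> cone_class al be k \<rho> K" "right_cone k' \<rho>' <= right_cone k \<rho>" "K <= K'"
 shows "\<delta> \<in> cone_class al be k' \<rho>' K'"
 unfolding cone_class_def
proof (intro CollectI conjI ballI)
 show "\<delta> holomorphic_on right_cone k' \<rho>'" using assms by (auto simp: cone_class_def intro: holomorphic_on_subset)
 fix x assume "x \<in> right_cone k' \<rho>'"
 then have "norm (\<delta> x) <= K * norm (decaying_gauge al be x)" using assms by (auto simp: cone_class_def)
 also have "... <= K' * norm (decaying_gauge al be x)" using assms(3) by (rule mult_right_mono) simp
 finally show "norm (\<delta> x) <= K' * norm (decaying_gauge al be x)" .
qed

lemma right_cone_mono_slope:
 assumes "1 <= k" "0 <= \<rho>" "\<rho> <= \<rho>'"
 shows "right_cone 1 \<rho>' <= right_cone k \<rho>"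
proof
 fix x assume x: "x \<in> right_cone 1 \<rho>'"
 then have "0 <= Re x" using assms by (simp add: right_cone_def)
 then have "1 * Re x <= k * Re x" using assms by (intro mult_right_mono) auto
 then show "x \<in> right_cone k \<rho>" using x assms by (simp add: right_cone_def)
qed

text \<open>
  In a wider cone and for parameters near \<open>c0\<close> the perturbations come from one fixed point family. By
  uniqueness on a common smaller cone of slope 1 they belong to the solutions that were fixed there, so these
  inherit the estimates in the wider cone and the holomorphic dependence on the parameter.
\<close>

lemma exp_branch_local_family:
 assumes V: "upper_solution al be V" and k: "1 <= k"
 obtains \<rho> K M \<delta> where "k <= \<rho>" "0 <= K" "0 <= M"
  "!!x. x \<in> right_cone k \<rho> ==> (%c. \<delta> c x) holomorphic_on ball c0 1"
  "!!c. c \<in> ball c0 1 ==> \<delta> c holomorphic_on right_cone k \<rho>"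
  "base_phase V holomorphic_on right_cone k \<rho>"
  "!!c x. c \<in> ball c0 1 ==> x \<in> right_cone k \<rho> ==> norm (base_phase V x) + norm (\<delta> c x) <= K / norm x & K / norm x <= 1"
  "!!c x. c \<in> ball c0 1 ==> x \<in> right_cone k \<rho> ==> norm (\<delta> c x) <= M * exp (- norm x / (1 + k))"
  "!!x. x \<in> right_cone k \<rho> ==> V (up_log x) = exp (base_phase V x)"
  "!!c W x. c \<in> ball c0 1 ==> exp_branch al be V c W ==> x \<in> right_cone k \<rho> ==> W (up_log x) = exp (base_phase V x + \<delta> c x)"
proof -
 have k0: "0 < k" using k by simp
 obtain C where C: "outer_const_ok al be C" using outer_const_exists by blast
 define K where "K = C * (norm c0 + 2)"
 have K: "0 <= K" using C by (simp add: K_def outer_const_ok_def)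
 obtain \<rho>1 K0 C4 m where s: "k <= \<rho>1"  "0 <= K0" "0 <= C4" "!!\<rho>. \<rho>1 <= \<rho> ==> cone_setup al be k \<rho> m C C4 K0 K (base_phase V)"
  "!!x. x \<in> right_cone k \<rho>1 ==> V (up_log x) = exp (base_phase V x)"
  "!!x. x \<in> right_cone k \<rho>1 ==> sinh_P3 al be (base_phase V) x"
  by (rule cone_setup_for[OF C k V K]) blast
 interpret S: cone_setup al be k \<rho>1 m C C4 K0 K "base_phase V" by (rule s(4)[OF order_refl])
 have Kc: "C * (norm c0 + 2) <= K" by (simp add: K_def)
 obtain \<delta> where d: "!!c. c \<in> ball c0 1 ==> \<delta> c \<in> cone_class al be k \<rho>1 K"
  "!!c x. c \<in> ball c0 1 ==> x \<in> right_cone k \<rho>1 ==> cone_map al be (base_phase V) c (\<delta> c) x = \<delta> c x"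
  "!!x. x \<in> right_cone k \<rho>1 ==> (%c. \<delta> c x) holomorphic_on ball c0 1"
  by (rule S.fixed_point_family[OF Kc]) blast
 obtain E where E: "0 < E" "!!\<rho> x. k <= \<rho> ==> x \<in> right_cone k \<rho> ==> norm (decaying_gauge al be x) <= E * exp (- norm x / (1 + k))"
  by (rule decaying_gauge_exponentially_small[OF k0, of al be]) blast
 have \<delta>K: "norm (\<delta> c x) <= K * norm (decaying_gauge al be x)" if "c \<in> ball c0 1" "x \<in> right_cone k \<rho>1" for c x
  using d(1)[OF that(1)] that(2) by (simp add: cone_class_def)
 show thesis
 proof (rule that[OF s(1)])
  show "0 <= K0 + K * C4" using s(2,3) K by simp
  show "0 <= K * E" using K E by simp
  show "(%c. \<delta> c x) holomorphic_on ball c0 1" if "x \<in> right_cone k \<rho>1" for x by (rule d(3)[OF that])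
  show "\<delta> c holomorphic_on right_cone k \<rho>1" if "c \<in> ball c0 1" for c using d(1)[OF that] by (simp add: cone_class_def)
  show "base_phase V holomorphic_on right_cone k \<rho>1" by (rule S.\<phi>0(1))
  show "V (up_log x) = exp (base_phase V x)" if "x \<in> right_cone k \<rho>1" for x by (rule s(5)[OF that])
  show "norm (\<delta> c x) <= K * E * exp (- norm x / (1 + k))" if "c \<in> ball c0 1" "x \<in> right_cone k \<rho>1" for c x
   using order_trans[OF \<delta>K[OF that] mult_left_mono[OF E(2)[OF s(1) that(2)] K]] by (simp add: mult.assoc)
  show "norm (base_phase V x) + norm (\<delta> c x) <= (K0 + K * C4) / norm x & (K0 + K * C4) / norm x <= 1"
   if c: "c \<in> ball c0 1" and x: "x \<in> right_cone k \<rho>1" for c x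
  proof
   have "norm (\<delta> c x) <= K * (C4 / norm x)" by (rule order_trans[OF \<delta>K[OF c x] mult_left_mono[OF S.C4(2)[OF x] K]])
   then show "norm (base_phase V x) + norm (\<delta> c x) <= (K0 + K * C4) / norm x"
    using S.\<phi>0(2)[OF x] by (simp add: add_divide_distrib)
   have "0 <= m" using S.m1 by simp
   from right_cone_far[OF k0 this S.\<rho> x] have "m <= norm x" "0 < norm x" by auto
   then show "(K0 + K * C4) / norm x <= 1" using S.mK by (simp add: divide_le_eq)
  qed
  show "W (up_log x) = exp (base_phase V x + \<delta> c x)"
   if c: "c \<in> ball c0 1" and W: "exp_branch al be V c W" and x: "x \<in> right_cone k \<rho>1" for c W x
  proof -
   obtain \<rho>2 K2 \<eta> where e: "\<eta> \<in> cone_class al be 1 \<rho>2 K2" "0 <= K2"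
    "!!x. x \<in> right_cone 1 \<rho>2 ==> cone_map al be (base_phase V) c \<eta> x = \<eta> x"
    "!!x. x \<in> right_cone 1 \<rho>2 ==> W (up_log x) = exp (base_phase V x + \<eta> x)" and Wsol: "log_solution al be UNIV W"
    using W unfolding exp_branch_def by blast
   have K': "0 <= max K K2" using K by simp
   obtain \<rho>3 K0' C4' m' where s': "1 <= \<rho>3"  "0 <= K0'" "0 <= C4'"
    "!!\<rho>. \<rho>3 <= \<rho> ==> cone_setup al be 1 \<rho> m' C C4' K0' (max K K2) (base_phase V)"
    by (rule cone_setup_for[OF C order_refl V K']) blast
   define R where "R = max \<rho>1 (max \<rho>2 \<rho>3)"
   have sub: "right_cone 1 R <= right_cone k \<rho>1" "right_cone 1 R <= right_cone 1 \<rho>2"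
    by (rule right_cone_mono_slope[OF k] right_cone_mono; use s(1) k in \<open>simp add: R_def\<close>)+
   have "\<rho>3 <= R" by (simp add: R_def)
   then interpret S2: cone_setup al be 1 R m' C C4' K0' "max K K2" "base_phase V" by (rule s'(4))
   have agree: "\<delta> c y = \<eta> y" if y: "y \<in> right_cone 1 R" for y
   proof (rule S2.fixed_point_unique[OF _ _ _ _ y])
    show "\<delta> c \<in> cone_class al be 1 R (max K K2)" by (rule cone_class_subset[OF d(1)[OF c] sub(1)]) simp
    show "\<eta> \<in> cone_class al be 1 R (max K K2)" by (rule cone_class_subset[OF e(1) sub(2)]) simp
    show "cone_map al be (base_phase V) c (\<delta> c) z = \<delta> c z" if "z \<in> right_cone 1 R" for z using d(2)[OF c] sub(1) that by blast
    show "cone_map al be (base_phase V) c \<eta> z = \<eta> z" if "z \<in> right_cone 1 R" for z using e(3) sub(2) that by blast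
   qed
   let ?a = "complex_of_real (R + 1)"
   have a: "?a \<in> right_cone 1 R" by (simp add: right_cone_def)
   have ev: "\<forall>\<^sub>F y in nhds ?a. W (up_log y) = exp (base_phase V y + \<delta> c y)"
    using eventually_nhds_in_open[OF right_cone_open a]
   proof eventually_elim
    case (elim y)
    then show ?case using agree[OF elim] e(4)[of y] sub(2) by auto
   qed
   have hol: "(%x. base_phase V x + \<delta> c x) holomorphic_on right_cone k \<rho>1"
    using d(1)[OF c] S.\<phi>0(1) by (intro holomorphic_on_add) (auto simp: cone_class_def)
   show ?thesis
    by (rule branch_identity[OF Wsol right_cone_open right_cone_connected right_cone_cut_plane hol _ ev x])
     (use k s(1) a sub(1) in auto)
  qed
 qed
qed

text \<open>
  Equality of the exponentials gives equality of the perturbations, because these are small; a perturbation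
  determines its parameter.
\<close>

lemma exp_branch_distinct:
 assumes V: "upper_solution al be V" and W: "exp_branch al be V c W" "exp_branch al be V c' W'"
  and eq: "!!x. x \<in> right_cone 1 R ==> W (up_log x) = W' (up_log x)"
 shows "c = c'"
proof -
 obtain \<rho>1 K1 \<delta> where 1: "\<delta> \<in> cone_class al be 1 \<rho>1 K1" "0 <= K1"
  "!!x. x \<in> right_cone 1 \<rho>1 ==> cone_map al be (base_phase V) c \<delta> x = \<delta> x"
  "!!x. x \<in> right_cone 1 \<rho>1 ==> W (up_log x) = exp (base_phase V x + \<delta> x)"
  using W(1) unfolding exp_branch_def by blast
 obtain \<rho>2 K2 \<eta> where 2: "\<eta> \<in> cone_class al be 1 \<rho>2 K2" "0 <= K2"
  "!!x. x \<in> right_cone 1 \<rho>2 ==> cone_map al be (base_phase V) c' \<eta> x = \<eta> x"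
  "!!x. x \<in> right_cone 1 \<rho>2 ==> W' (up_log x) = exp (base_phase V x + \<eta> x)"
  using W(2) unfolding exp_branch_def by blast
 obtain C where C: "outer_const_ok al be C" using outer_const_exists by blast
 define K where "K = max K1 K2"
 have K: "0 <= K" using 1(2) by (simp add: K_def)
 obtain \<rho>3 K0 C4 m where s: "1 <= \<rho>3"  "0 <= K0" "0 <= C4"
  "!!\<rho>. \<rho>3 <= \<rho> ==> cone_setup al be 1 \<rho> m C C4 K0 K (base_phase V)"
  by (rule cone_setup_for[OF C order_refl V K]) blast
 define \<rho> where "\<rho> = max (max R \<rho>1) (max \<rho>2 \<rho>3)"
 have sub: "right_cone 1 \<rho> <= right_cone 1 R" "right_cone 1 \<rho> <= right_cone 1 \<rho>1" "right_cone 1 \<rho> <= right_cone 1 \<rho>2"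
  by (auto intro!: right_cone_mono simp: \<rho>_def)
 have "\<rho>3 <= \<rho>" by (simp add: \<rho>_def)
 then interpret S: cone_setup al be 1 \<rho> m C C4 K0 K "base_phase V" by (rule s(4))
 have dM: "\<delta> \<in> cone_class al be 1 \<rho> K" by (rule cone_class_subset[OF 1(1) sub(2)]) (simp add: K_def)
 have eM: "\<eta> \<in> cone_class al be 1 \<rho> K" by (rule cone_class_subset[OF 2(1) sub(3)]) (simp add: K_def)
 have small: "norm (f x) <= 1" if f: "f \<in> cone_class al be 1 \<rho> K" and x: "x \<in> right_cone 1 \<rho>" for f x
 proof -
  have "norm (f x) <= K * norm (decaying_gauge al be x)" using f x by (simp add: cone_class_def)
  also have "... <= K * (C4 / norm x)" by (rule mult_left_mono[OF S.C4(2)[OF x] K])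
  also have "... <= 1"
  proof -
   have "0 <= m" using S.m1 by simp
   from right_cone_far[OF zero_less_one this S.\<rho> x] have "m <= norm x" "0 < norm x" by auto
   then show ?thesis using S.mK s(2) by (simp add: divide_le_eq)
  qed
  finally show ?thesis .
 qed
 have same: "\<delta> x = \<eta> x" if x: "x \<in> right_cone 1 \<rho>" for x
 proof -
  have "exp (base_phase V x + \<delta> x) = exp (base_phase V x + \<eta> x)"
   using eq 1(4) 2(4) sub x by (metis subsetD)
  then have "exp (\<delta> x) = exp (\<eta> x)" by (simp add: exp_add)
  then show ?thesis using Ln_exp_small[OF small[OF dM x]] Ln_exp_small[OF small[OF eM x]] by metis
 qed
 let ?a = "complex_of_real (\<rho> + 1)"
 have a: "?a \<in> right_cone 1 \<rho>" by (simp add: right_cone_def)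
 have T2: "cone_map al be (base_phase V) c' \<eta> x = \<eta> x" if "x \<in> right_cone 1 \<rho>" for x using 2(3) sub(3) that by blast
 have T1: "cone_map al be (base_phase V) c \<delta> x = \<delta> x" if "x \<in> right_cone 1 \<rho>" for x using 1(3) sub(2) that by blast
 have T3: "cone_map al be (base_phase V) c' \<delta> x = \<delta> x" if x: "x \<in> right_cone 1 \<rho>" for x
 proof -
  have "norm (cone_map al be (base_phase V) c' \<delta> x - cone_map al be (base_phase V) c' \<eta> x) <= 0 / 2 * norm (decaying_gauge al be x)"
   by (rule S.T_contraction[OF dM eM order_refl _ x]) (simp add: same)
  then show ?thesis using T2[OF x] same[OF x] by simp
 qed
 show ?thesis by (rule S.fixed_point_parameter_unique[OF dM T1 T3 a])
qed

section \<open>Rotation to the sectors of the problem\<close>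

lemma sector_rotate: "x \<in> sector R \<theta>1 \<theta>2 \<longleftrightarrow> x / cis \<psi> \<in> sector R (\<theta>1 - \<psi>) (\<theta>2 - \<psi>)"
proof -
 have 1: "x / cis \<psi> \<in> sector R (\<theta>1 - \<psi>) (\<theta>2 - \<psi>)" if x: "x \<in> sector R \<theta>1 \<theta>2" for x \<theta>1 \<theta>2 \<psi>
 proof -
  obtain r \<theta> where r: "x = rcis r \<theta>" "R < r" "\<theta>1 < \<theta>" "\<theta> < \<theta>2" using x by (auto simp: sector_def)
  have "x / cis \<psi> = rcis r (\<theta> - \<psi>)" by (simp add: r(1) rcis_def cis_divide flip: times_divide_eq_right)
  moreover have "\<theta>1 - \<psi> < \<theta> - \<psi>" "\<theta> - \<psi> < \<theta>2 - \<psi>" using r by auto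
  ultimately show ?thesis using r(2) unfolding sector_def by blast
 qed
 have "x / cis \<psi> / cis (- \<psi>) = x" by (simp add: divide_divide_eq_left cis_mult)
 then show ?thesis using 1[of x \<theta>1 \<theta>2 \<psi>] 1[of "x / cis \<psi>" "\<theta>1 - \<psi>" "\<theta>2 - \<psi>" "- \<psi>"] by auto
qed

text \<open>
  The interval is the range of arguments of the cut plane: only the negative imaginary axis is excluded.
\<close>

lemma cos_or_sin_positive:
 fixes \<theta> :: real
 assumes "- pi / 2 < \<theta>" "\<theta> < 3 * pi / 2"
 shows "0 < \<bar>cos \<theta>\<bar> + max 0 (sin \<theta>)"
proof -
 consider "\<theta> < pi / 2" | "\<theta> = pi / 2" | "pi / 2 < \<theta>" by linarith
 then show ?thesis
 proof cases
  case 1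
  then have "0 < cos \<theta>" using assms by (intro cos_gt_zero_pi) auto
  then show ?thesis by (simp add: add_pos_nonneg)
 next
  case 2
  then have "sin \<theta> = 1" by (simp only: sin_pi_half)
  then show ?thesis by (simp add: add_nonneg_pos)
 next
  case 3
  then have "0 < cos (\<theta> - pi)" using assms by (intro cos_gt_zero_pi) auto
  then have "0 < \<bar>cos \<theta>\<bar>" by simp
  then show ?thesis by (simp add: add_pos_nonneg)
 qed
qed

lemma cut_plane_polar:
 assumes "x \<in> cut_plane"
 obtains \<theta> where "x = rcis (norm x) \<theta>" "- pi / 2 < \<theta>" "\<theta> < 3 * pi / 2"
proof
 have "x = exp (up_log x)" using up_log(2)[OF assms] by simp
 also have "... = of_real (exp (Re (up_log x))) * cis (Im (up_log x))" by (rule exp_eq_polar[unfolded exp_of_real])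
 also have "exp (Re (up_log x)) = norm x" using up_log(1,4)[OF assms] by simp
 finally show "x = rcis (norm x) (Im (up_log x))" by (simp add: rcis_def)
qed (use up_log(5,6)[OF assms] in auto)

lemma standard_sector:
 assumes "0 <= R"
 shows "sector R (- pi / 2) (3 * pi / 2) = {x \<in> cut_plane. R < norm x}"
proof (intro set_eqI iffI)
 fix x assume "x \<in> sector R (- pi / 2) (3 * pi / 2)"
 then obtain r \<theta> where r: "x = rcis r \<theta>" "R < r" "- pi / 2 < \<theta>" "\<theta> < 3 * pi / 2" by (auto simp: sector_def)
 have "cos \<theta> ~= 0 \<or> 0 < sin \<theta>" using cos_or_sin_positive[OF r(3,4)] by auto
 then show "x \<in> {x \<in> cut_plane. R < norm x}" using r assms by (auto simp: cut_plane_iff)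
next
 fix x assume x: "x \<in> {x \<in> cut_plane. R < norm x}"
 then obtain \<theta> where "x = rcis (norm x) \<theta>" "- pi / 2 < \<theta>" "\<theta> < 3 * pi / 2" using cut_plane_polar by blast
 then show "x \<in> sector R (- pi / 2) (3 * pi / 2)" using x unfolding sector_def by blast
qed

lemma right_half_sector:
 assumes "0 < Re x" "R < norm x"
 shows "x \<in> sector R (- pi / 2) (pi / 2)"
proof -
 have "x \<in> cut_plane" using assms by (simp add: cut_plane_iff)
 then obtain \<theta> where t: "x = rcis (norm x) \<theta>" "- pi / 2 < \<theta>" "\<theta> < 3 * pi / 2" by (rule cut_plane_polar)
 have "\<theta> < pi / 2"
 proof (rule ccontr)
  assume "~ \<theta> < pi / 2"
  then have "0 <= cos (\<theta> - pi)" using t by (intro cos_ge_zero) auto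
  then have "norm x * cos \<theta> <= 0" by (simp add: mult_nonneg_nonpos)
  moreover have "Re x = norm x * cos \<theta>" using arg_cong[OF t(1), of Re] by simp
  ultimately show False using assms by simp
 qed
 then show ?thesis using t assms unfolding sector_def by blast
qed

text \<open>
  By compactness \<open>\<bar>cos \<theta>\<bar> + max 0 (sin \<theta>)\<close> is at least some \<open>\<eta> > 0\<close> on the subsector; where the sine
  is not positive enough, \<open>k \<ge> 4 / \<eta>\<close> lets the cosine compensate.
\<close>

lemma subsector_in_up_region:
 assumes "- pi / 2 < \<phi>1" "\<phi>1 < \<phi>2" "\<phi>2 < 3 * pi / 2"
 obtains k c where "1 <= k" "0 < c" "!!x \<rho>. x \<in> sector 0 \<phi>1 \<phi>2 ==> \<rho> < c * norm x ==> x \<in> up_region k \<rho>"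
proof -
 define h :: "real => real" where "h \<theta> = \<bar>cos \<theta>\<bar> + max 0 (sin \<theta>)" for \<theta>
 have "continuous_on {\<phi>1..\<phi>2} h" unfolding h_def by (intro continuous_intros)
 then obtain t where t: "t \<in> {\<phi>1..\<phi>2}" "!!\<theta>. \<theta> \<in> {\<phi>1..\<phi>2} ==> h t <= h \<theta>"
  using continuous_attains_inf[of "{\<phi>1..\<phi>2}" h] assms by auto
 define \<eta> where "\<eta> = h t"
 have \<eta>: "0 < \<eta>" unfolding \<eta>_def h_def by (rule cos_or_sin_positive) (use t assms in auto)
 show thesis
 proof (rule that)
  show "1 <= max 1 (4 / \<eta>)" by simp
  show "0 < min 1 (\<eta> / 2)" using \<eta> by simp
  fix x \<rho> assume x: "x \<in> sector 0 \<phi>1 \<phi>2" and \<rho>: "\<rho> < min 1 (\<eta> / 2) * norm x"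
  obtain r \<theta> where r: "x = rcis r \<theta>" "0 < r" "\<phi>1 < \<theta>" "\<theta> < \<phi>2" using x by (auto simp: sector_def)
  have h: "\<eta> <= \<bar>cos \<theta>\<bar> + max 0 (sin \<theta>)" using t(2)[of \<theta>] r by (simp add: \<eta>_def h_def)
  have le: "min 1 (\<eta> / 2) <= sin \<theta> + max 1 (4 / \<eta>) * \<bar>cos \<theta>\<bar>"
  proof (cases "\<eta> / 2 <= sin \<theta>")
   case True
   have "0 <= max 1 (4 / \<eta>) * \<bar>cos \<theta>\<bar>" by simp
   then show ?thesis using True by linarith
  next
   case False
   then have "\<eta> / 2 <= \<bar>cos \<theta>\<bar>" using h \<eta> by (auto simp: max_def split: if_splits)
   then have "(4 / \<eta>) * (\<eta> / 2) <= max 1 (4 / \<eta>) * \<bar>cos \<theta>\<bar>" using \<eta> by (intro mult_mono) auto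
   then have "2 <= max 1 (4 / \<eta>) * \<bar>cos \<theta>\<bar>" using \<eta> by simp
   then show ?thesis using sin_ge_minus_one[of \<theta>] by linarith
  qed
  have "\<rho> < min 1 (\<eta> / 2) * r" using \<rho> r by simp
  also have "... <= (sin \<theta> + max 1 (4 / \<eta>) * \<bar>cos \<theta>\<bar>) * r" using le r(2) by (intro mult_right_mono) auto
  also have "... = Im x + max 1 (4 / \<eta>) * \<bar>Re x\<bar>" using r(2) by (simp add: r(1) abs_mult algebra_simps)
  finally show "x \<in> up_region (max 1 (4 / \<eta>)) \<rho>" by (simp add: up_region_def)
 qed
qed

lemma subsector_in_right_cone:
 assumes "- pi / 2 < \<phi>1" "\<phi>1 < \<phi>2" "\<phi>2 < pi / 2"
 obtains k where "1 <= k" "!!x \<rho>. x \<in> sector 0 \<phi>1 \<phi>2 ==> \<rho> < norm x ==> x \<in> right_cone k \<rho>"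
proof -
 have "continuous_on {\<phi>1..\<phi>2} (cos :: real => real)" by (intro continuous_intros)
 then obtain t where t: "t \<in> {\<phi>1..\<phi>2}" "!!\<theta>. \<theta> \<in> {\<phi>1..\<phi>2} ==> cos t <= cos \<theta>"
  using continuous_attains_inf[of "{\<phi>1..\<phi>2}" "cos :: real => real"] assms by auto
 define \<eta> where "\<eta> = cos t"
 have \<eta>: "0 < \<eta>" "\<eta> <= 1" unfolding \<eta>_def using t assms by (auto intro!: cos_gt_zero_pi)
 show thesis
 proof (rule that)
  show "1 <= 2 / \<eta>" using \<eta> by (simp add: le_divide_eq)
  fix x \<rho> assume x: "x \<in> sector 0 \<phi>1 \<phi>2" and \<rho>: "\<rho> < norm x"
  obtain r \<theta> where r: "x = rcis r \<theta>" "0 < r" "\<phi>1 < \<theta>" "\<theta> < \<phi>2" using x by (auto simp: sector_def)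
  have "(2 / \<eta>) * \<eta> <= (2 / \<eta>) * cos \<theta>" using t(2)[of \<theta>] r \<eta> by (intro mult_left_mono) (auto simp: \<eta>_def)
  then have "2 <= (2 / \<eta>) * cos \<theta>" using \<eta> by simp
  then have "r * 2 <= r * ((2 / \<eta>) * cos \<theta>)" using r(2) by (intro mult_left_mono) auto
  moreover have "r * \<bar>sin \<theta>\<bar> <= r * 1" using r(2) by (intro mult_left_mono) auto
  moreover have "\<rho> < r" using \<rho> r by simp
  ultimately have "\<rho> + r * \<bar>sin \<theta>\<bar> < r * ((2 / \<eta>) * cos \<theta>)" by linarith
  then show "x \<in> right_cone (2 / \<eta>) \<rho>" using r(2) by (simp add: right_cone_def r(1) abs_mult mult.left_commute)
 qed
qed

lemma eventually_rotated_up_region: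
 assumes "\<psi> - pi / 2 < \<phi>1" "\<phi>1 < \<phi>2" "\<phi>2 < \<psi> + 3 * pi / 2"
 obtains k where "1 <= k" "!!\<rho>. \<forall>\<^sub>F x in at_infinity_in_sector \<phi>1 \<phi>2. x / cis \<psi> \<in> up_region k \<rho>"
proof -
 have "- pi / 2 < \<phi>1 - \<psi>" "\<phi>1 - \<psi> < \<phi>2 - \<psi>" "\<phi>2 - \<psi> < 3 * pi / 2" using assms by auto
 then obtain k c where k: "1 <= k" "0 < c" "!!x \<rho>. x \<in> sector 0 (\<phi>1 - \<psi>) (\<phi>2 - \<psi>) ==> \<rho> < c * norm x ==> x \<in> up_region k \<rho>"
  by (rule subsector_in_up_region) blast
 have "\<forall>\<^sub>F x in at_infinity_in_sector \<phi>1 \<phi>2. x / cis \<psi> \<in> up_region k \<rho>" for \<rho>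
  using eventually_in_sector_far[of \<phi>1 \<phi>2 "(\<bar>\<rho>\<bar> + 1) / c"]
 proof eventually_elim
  case (elim x)
  then have "(\<bar>\<rho>\<bar> + 1) / c * c <= norm x * c" using k(2) by (intro mult_right_mono) auto
  then have "\<rho> < c * norm (x / cis \<psi>)" using k(2) by (simp add: norm_divide mult.commute)
  then show ?case using elim sector_rotate[of x 0 \<phi>1 \<phi>2 \<psi>] k(3) by blast
 qed
 then show thesis using that k(1) by blast
qed

lemma eventually_rotated_right_cone:
 assumes "\<psi> - pi / 2 < \<phi>1" "\<phi>1 < \<phi>2" "\<phi>2 < \<psi> + pi / 2"
 obtains k where "1 <= k" "!!\<rho>. \<forall>\<^sub>F x in at_infinity_in_sector \<phi>1 \<phi>2. x / cis \<psi> \<in> right_cone k \<rho>"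
proof -
 have "- pi / 2 < \<phi>1 - \<psi>" "\<phi>1 - \<psi> < \<phi>2 - \<psi>" "\<phi>2 - \<psi> < pi / 2" using assms by auto
 then obtain k where k: "1 <= k" "!!x \<rho>. x \<in> sector 0 (\<phi>1 - \<psi>) (\<phi>2 - \<psi>) ==> \<rho> < norm x ==> x \<in> right_cone k \<rho>"
  by (rule subsector_in_right_cone) blast
 have "\<forall>\<^sub>F x in at_infinity_in_sector \<phi>1 \<phi>2. x / cis \<psi> \<in> right_cone k \<rho>" for \<rho>
  using eventually_in_sector_far[of \<phi>1 \<phi>2 "\<bar>\<rho>\<bar> + 1"]
 proof eventually_elim
  case (elim x)
  then have "\<rho> < norm (x / cis \<psi>)" using abs_ge_self[of \<rho>] by (simp add: norm_divide)
  then show ?case using elim sector_rotate[of x 0 \<phi>1 \<phi>2 \<psi>] k(2) by blast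
 qed
 then show thesis using that k(1) by blast
qed

lemma sin_cos_lower:
 fixes t :: real
 assumes "- pi / 2 < t" "t <= - pi / 4"
 shows "sin t + \<bar>cos t\<bar> <= 0"
proof -
 have "0 <= cos t" using assms by (intro cos_ge_zero) auto
 moreover have "cos t = sin (pi / 2 - - t)" using cos_sin_eq[of "- t"] by simp
 moreover have "sin (pi / 2 - - t) <= sin (- t)" using assms by (intro sin_monotone_2pi_le) auto
 ultimately show ?thesis by simp
qed

text \<open>
  For \<open>k = 1\<close> the region lies in a proper subsector, so an expansion that holds in proper subsectors
  controls a solution on all of it.
\<close>

lemma up_region_in_sector:
 assumes "0 <= \<rho>" "x \<in> up_region 1 \<rho>"
 shows "x \<in> sector 0 (- pi / 4) (5 * pi / 4)"
proof -
 have x: "\<rho> < Im x + \<bar>Re x\<bar>" using assms by (simp add: up_region_def)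
 have "x \<in> cut_plane" using up_region_cut_plane assms by blast
 then obtain \<theta> where t: "x = rcis (norm x) \<theta>" "- pi / 2 < \<theta>" "\<theta> < 3 * pi / 2" by (rule cut_plane_polar)
 have x0: "0 < norm x" using x assms(1) by auto
 have "Re x = norm x * cos \<theta>" "Im x = norm x * sin \<theta>" using arg_cong[OF t(1), of Re] arg_cong[OF t(1), of Im] by auto
 then have "0 < norm x * (sin \<theta> + \<bar>cos \<theta>\<bar>)" using x assms(1) by (simp add: distrib_left abs_mult)
 then have p: "0 < sin \<theta> + \<bar>cos \<theta>\<bar>" using x0 by (simp add: zero_less_mult_iff)
 have "- pi / 4 < \<theta>" using sin_cos_lower[OF t(2)] p by linarith
 moreover have "\<theta> < 5 * pi / 4"
 proof (rule ccontr)
  assume "~ \<theta> < 5 * pi / 4"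
  then have "sin (pi - \<theta>) + \<bar>cos (pi - \<theta>)\<bar> <= 0" using t by (intro sin_cos_lower) auto
  then show False using p by simp
 qed
 ultimately show ?thesis using t(1) x0 unfolding sector_def by blast
qed

lemma rotated_sector:
 assumes "0 <= R"
 shows "sector R (\<psi> - pi / 2) (\<psi> + 3 * pi / 2) = {x. x / cis \<psi> \<in> cut_plane & R < norm x}"
proof (rule set_eqI)
 fix x
 have "\<psi> - pi / 2 - \<psi> = - pi / 2" "\<psi> + 3 * pi / 2 - \<psi> = 3 * pi / 2" by auto
 then show "x \<in> sector R (\<psi> - pi / 2) (\<psi> + 3 * pi / 2) \<longleftrightarrow> x \<in> {x. x / cis \<psi> \<in> cut_plane & R < norm x}"
  using sector_rotate[of x R "\<psi> - pi / 2" "\<psi> + 3 * pi / 2" \<psi>] standard_sector[OF assms] by (simp add: norm_divide)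
qed

lemma rotated_cut_plane_open: "open {x. x / cis \<psi> \<in> cut_plane}"
proof -
 have "open ((%x. x / cis \<psi>) -` cut_plane)" by (rule open_vimage[OF cut_plane_open]) (intro continuous_intros, simp)
 then show ?thesis by (simp add: vimage_def)
qed

lemma rotated_sector_open: "0 <= R ==> open (sector R (\<psi> - pi / 2) (\<psi> + 3 * pi / 2))"
proof -
 assume R: "0 <= R"
 have "open ({x. x / cis \<psi> \<in> cut_plane} \<inter> {x. R < norm x})"
  by (intro open_Int rotated_cut_plane_open open_Collect_less continuous_intros)
 then show ?thesis by (simp add: rotated_sector[OF R] Collect_conj_eq)
qed

lemma sector_connected:
 assumes R: "0 < R"
 shows "connected (sector R \<theta>1 \<theta>2)"
proof -
 let ?T = "{t. Re t > ln R} \<inter> ({t. Im t > \<theta>1} \<inter> {t. Im t < \<theta>2})"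
 have "exp ` ?T = sector R \<theta>1 \<theta>2"
 proof (intro set_eqI iffI)
  fix x assume "x \<in> exp ` ?T"
  then obtain t where t: "x = exp t" "ln R < Re t" "\<theta>1 < Im t" "Im t < \<theta>2" by auto
  have "x = rcis (exp (Re t)) (Im t)" by (simp add: t(1) rcis_def exp_eq_polar[of t] exp_of_real)
  moreover have "R < exp (Re t)" using t(2) R by (metis exp_less_mono exp_ln)
  ultimately show "x \<in> sector R \<theta>1 \<theta>2" using t unfolding sector_def by blast
 next
  fix x assume "x \<in> sector R \<theta>1 \<theta>2"
  then obtain r \<theta> where r: "x = rcis r \<theta>" "R < r" "\<theta>1 < \<theta>" "\<theta> < \<theta>2" by (auto simp: sector_def)
  have r0: "0 < r" using R r by simp
  have "exp (Complex (ln r) \<theta>) = of_real (exp (ln r)) * cis \<theta>" using exp_eq_polar[of "Complex (ln r) \<theta>"] by (simp add: exp_of_real)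
  then have "x = exp (Complex (ln r) \<theta>)" using r0 by (simp add: r(1) rcis_def)
  moreover have "Complex (ln r) \<theta> \<in> ?T" using r R r0 by simp
  ultimately show "x \<in> exp ` ?T" by (rule image_eqI)
 qed
 moreover have "connected ?T"
  by (intro convex_connected convex_Int convex_halfspace_Re_gt convex_halfspace_Im_gt convex_halfspace_Im_lt)
 ultimately show ?thesis using connected_continuous_image[of ?T exp] by (simp add: continuous_on_exp)
qed

text \<open>
  The passage from the normal position back to the given one, and from \<open>ln x\<close> to \<open>x\<close>.
\<close>

definition pull :: "complex => real => (complex => complex) => complex => complex" where
 "pull a0 \<psi> V x = a0 * V (up_log (x / cis \<psi>))"

lemma rotated_log_deriv:
 assumes "x / cis \<psi> \<in> cut_plane"
 shows "((%x. up_log (x / cis \<psi>)) has_field_derivative 1 / x) (at x)"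
proof -
 have "((%x. x / cis \<psi>) has_field_derivative 1 / cis \<psi>) (at x)" by (rule DERIV_cdivide[OF DERIV_ident])
 from DERIV_chain2[OF up_log(3)[OF assms] this] show ?thesis by simp
qed

lemma pull_algebra:
 fixes a0 z al be x v p q :: complex
 assumes a4: "a0 ^ 4 = 1" and az: "a0\<^sup>2 = z\<^sup>2" and z0: "z ~= 0" and x0: "x ~= 0" and v0: "v ~= 0"
  and eq: "v * q = p\<^sup>2 + (x / z) * (al * a0 * z * v ^ 3 + be * z / a0 * v) + (x / z) * (x / z) * (v ^ 4 - 1)"
 shows "a0 * ((q * (1 / x)) * (1 / x) + (0 * x - 1 * 1) / (x * x) * p) =
   1 / (a0 * v) * (a0 * (p * (1 / x)))\<^sup>2 - 1 / x * (a0 * (p * (1 / x))) + 1 / x * (al * (a0 * v)\<^sup>2 + be) + (a0 * v) ^ 3 - 1 / (a0 * v)"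
proof -
 have a0: "a0 ~= 0" using a4 by auto
 define i w b y where "i = 1 / x" and "w = 1 / v" and "b = 1 / a0" and "y = 1 / z"
 have inv: "x * i = 1" "v * w = 1" "a0 * b = 1" "z * y = 1" using a0 x0 v0 z0 by (auto simp: i_def w_def b_def y_def)
 have a4': "a0 * a0 * (a0 * a0) = 1" using a4 by (simp add: power4_eq_xxxx mult.assoc)
 have zz: "z * z = a0 * a0" using az by (simp add: power2_eq_square)
 have "y * y = (y * y) * (a0 * a0 * (z * z))" by (simp add: zz a4')
 also have "... = (z * y) * (z * y) * (a0 * a0)" by simp
 finally have yy: "y * y = a0 * a0" by (simp add: inv)
 have "b = b * (a0 * a0 * (a0 * a0))" by (simp add: a4')
 also have "... = (a0 * b) * (a0 * a0 * a0)" by simp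
 finally have b: "b = a0 * a0 * a0" by (simp add: inv)
 have d: "c / x = c * i" "c / v = c * w" "c / a0 = c * b" "c / z = c * y" "c / (a0 * v) = c * b * w" "c / (x * x) = c * i * i" for c
  by (simp_all add: i_def w_def b_def y_def)
 have "q = (v * w) * q" by (simp add: inv)
 also have "... = w * (v * q)" by simp
 finally have q: "q = w * (p\<^sup>2 + (x * y) * (al * a0 * z * v ^ 3 + be * z * b * v) + (x * y) * (x * y) * (v ^ 4 - 1))"
  unfolding eq d .
 have "a0 * q * i * i = a0 * w * p * p * i * i + (al * a0 * a0 * v * v + be * (a0 * b)) * i * ((x * i) * (z * y) * (v * w))
   + a0 * (y * y) * ((x * i) * (x * i)) * (v * v * v * (v * w) - w)"
  unfolding q by (simp add: algebra_simps power2_eq_square power3_eq_cube power4_eq_xxxx)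
 then have q': "a0 * q * i * i = a0 * w * p * p * i * i + (al * a0 * a0 * v * v + be) * i + a0 * (a0 * a0) * (v * v * v - w)"
  unfolding inv yy by simp
 have "b * w * (a0 * (p * i)) * (a0 * (p * i)) = (a0 * b) * (a0 * w * p * p * i * i)" by simp
 then have s: "b * w * (a0 * (p * i)) * (a0 * (p * i)) = a0 * w * p * p * i * i" unfolding inv by simp
 have "a0 * (q * i * i - i * i * p) = b * w * (a0 * (p * i)) * (a0 * (p * i)) - i * (a0 * (p * i)) + i * (al * (a0 * v) * (a0 * v) + be) + (a0 * v) * (a0 * v) * (a0 * v) - b * w"
  unfolding s using q' by (simp add: b algebra_simps)
 then show ?thesis unfolding d by (simp add: power2_eq_square power3_eq_cube mult.assoc)
qed

lemma pull_solves:
 assumes V: "log_solution (al * a0 * cis \<psi>) (be * cis \<psi> / a0) UNIV V"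
  and a4: "a0 ^ 4 = 1" and az: "a0\<^sup>2 = (cis \<psi>)\<^sup>2" and x: "x / cis \<psi> \<in> cut_plane" and nz: "V (up_log (x / cis \<psi>)) ~= 0"
 shows "pull a0 \<psi> V analytic_on {x}" "P3_at al be (pull a0 \<psi> V) x"
proof -
 define g where "g x = up_log (x / cis \<psi>)" for x
 have Vn: "V nicely_meromorphic_on UNIV" and Veq: "log_P3 (al * a0 * cis \<psi>) (be * cis \<psi> / a0) V (g x)"
  using V nz unfolding log_solution_def g_def by auto
 obtain r where r: "0 < r" "V holomorphic_on ball (g x) r"
  by (rule nicely_meromorphic_nonzero_ball[OF Vn open_UNIV UNIV_I nz]) (auto simp: g_def)
 have gd: "(g has_field_derivative 1 / y) (at y)" if "y / cis \<psi> \<in> cut_plane" for y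
  unfolding g_def[abs_def] by (rule rotated_log_deriv[OF that])
 define S where "S = {y. y / cis \<psi> \<in> cut_plane} \<inter> g -` ball (g x) r"
 have "continuous_on {y. y / cis \<psi> \<in> cut_plane} g"
  by (rule continuous_at_imp_continuous_on) (use gd DERIV_isCont in blast)
 then have oS: "open S" unfolding S_def by (rule continuous_open_preimage[OF _ rotated_cut_plane_open open_ball])
 have xS: "x \<in> S" using x r by (simp add: S_def)
 have d1: "(V has_field_derivative deriv V t) (at t)" if "t \<in> ball (g x) r" for t by (rule holomorphic_derivI[OF r(2) open_ball that])
 have d2: "(deriv V has_field_derivative deriv (deriv V) t) (at t)" if "t \<in> ball (g x) r" for t
  by (rule holomorphic_derivI[OF holomorphic_deriv[OF r(2) open_ball] open_ball that])
 have u: "pull a0 \<psi> V = (%y. a0 * V (g y))" by (simp add: pull_def g_def fun_eq_iff)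
 have h: "(pull a0 \<psi> V has_field_derivative a0 * (deriv V (g y) * (1 / y))) (at y)" if "y \<in> S" for y
  unfolding u using that by (intro DERIV_cmult DERIV_chain2[OF d1 gd]) (auto simp: S_def)
 have x0: "x ~= 0" using up_log(1)[OF x] by auto
 have gx: "g x \<in> ball (g x) r" using r by simp
 have dd: "((%y. a0 * (deriv V (g y) * (1 / y))) has_field_derivative
   a0 * ((deriv (deriv V) (g x) * (1 / x)) * (1 / x) + (0 * x - 1 * 1) / (x * x) * deriv V (g x))) (at x)"
  by (rule DERIV_cmult[OF DERIV_mult[OF DERIV_chain2[OF d2[OF gx] gd[OF x]] DERIV_divide[OF DERIV_const DERIV_ident x0]]])
 have "pull a0 \<psi> V holomorphic_on S"
  unfolding holomorphic_on_open[OF oS] using h by blast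
 then show "pull a0 \<psi> V analytic_on {x}" unfolding analytic_at using oS xS by blast
 have e: "exp (g x) = x / cis \<psi>" "exp (2 * g x) = (x / cis \<psi>) * (x / cis \<psi>)"
 proof -
  show 1: "exp (g x) = x / cis \<psi>" unfolding g_def by (rule up_log(2)[OF x])
  show "exp (2 * g x) = (x / cis \<psi>) * (x / cis \<psi>)" unfolding mult_2 exp_add 1 ..
 qed
 have "V (g x) * deriv (deriv V) (g x) = (deriv V (g x))\<^sup>2 + (x / cis \<psi>) * (al * a0 * cis \<psi> * V (g x) ^ 3 + be * cis \<psi> / a0 * V (g x)) + (x / cis \<psi>) * (x / cis \<psi>) * (V (g x) ^ 4 - 1)"
  using Veq unfolding log_P3_def e .
 note alg = pull_algebra[OF a4 az cis_neq_zero x0 nz[folded g_def] this]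
 have D: "deriv (deriv (pull a0 \<psi> V)) x = a0 * ((deriv (deriv V) (g x) * (1 / x)) * (1 / x) + (0 * x - 1 * 1) / (x * x) * deriv V (g x))"
  "deriv (pull a0 \<psi> V) x = a0 * (deriv V (g x) * (1 / x))" "pull a0 \<psi> V x = a0 * V (g x)"
  by (rule second_derivative_eqI(1)[OF oS xS h dd], assumption, rule second_derivative_eqI(2)[OF oS xS h dd], assumption, simp add: u)
 show "P3_at al be (pull a0 \<psi> V) x" unfolding P3_at_def D by (rule alg)
qed

lemma pull_nicely_meromorphic:
 assumes V: "log_solution al' be' UNIV V"
 shows "pull a0 \<psi> V nicely_meromorphic_on {x. x / cis \<psi> \<in> cut_plane}"
proof -
 let ?D = "{x. x / cis \<psi> \<in> cut_plane}"
 have Vn: "V nicely_meromorphic_on UNIV" using V unfolding log_solution_def by blast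
 have hol: "(%x. up_log (x / cis \<psi>)) holomorphic_on ?D"
  unfolding holomorphic_on_open[OF rotated_cut_plane_open] using rotated_log_deriv by blast
 have inj: "inj_on (%x. up_log (x / cis \<psi>)) ?D"
 proof (rule inj_onI)
  fix x y assume xy: "x \<in> ?D" "y \<in> ?D" "up_log (x / cis \<psi>) = up_log (y / cis \<psi>)"
  have "x / cis \<psi> = y / cis \<psi>" by (rule inj_onD[OF up_log_inj xy(3)]) (use xy in auto)
  then show "x = y" by simp
 qed
 have "(%x. a0 * V (up_log (x / cis \<psi>))) nicely_meromorphic_on ?D"
  by (rule nicely_meromorphic_on_cmult_left[OF nicely_meromorphic_compose[OF Vn hol rotated_cut_plane_open inj]])
 then show ?thesis by (simp add: pull_def[abs_def])
qed

lemma pull_solution_on: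
 assumes V: "log_solution (al * a0 * cis \<psi>) (be * cis \<psi> / a0) UNIV V"
  and a4: "a0 ^ 4 = 1" and az: "a0\<^sup>2 = (cis \<psi>)\<^sup>2"
  and S: "!!x. x \<in> S ==> x / cis \<psi> \<in> cut_plane" and y: "y \<in> S" "V (up_log (y / cis \<psi>)) ~= 0"
 shows "painleve3_solution_on al be S (pull a0 \<psi> V)"
 unfolding painleve3_solution_on_def
proof (intro conjI ballI impI)
 show "pull a0 \<psi> V nicely_meromorphic_on S"
  by (rule nicely_meromorphic_on_subset[OF pull_nicely_meromorphic[OF V]]) (use S in blast)
 have a0: "a0 ~= 0" using a4 by auto
 then show "\<exists>x\<in>S. pull a0 \<psi> V x ~= 0" using y by (intro bexI[of _ y]) (auto simp: pull_def)
 fix x assume x: "x \<in> S" and "~ is_pole (pull a0 \<psi> V) x & pull a0 \<psi> V x ~= 0"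
 then have "V (up_log (x / cis \<psi>)) ~= 0" by (auto simp: pull_def)
 from pull_solves(2)[OF V a4 az S[OF x] this, unfolded P3_at_def]
 show "deriv (deriv (pull a0 \<psi> V)) x = 1 / pull a0 \<psi> V x * (deriv (pull a0 \<psi> V) x)\<^sup>2 - 1 / x * deriv (pull a0 \<psi> V) x
   + 1 / x * (al * (pull a0 \<psi> V x)\<^sup>2 + be) + (pull a0 \<psi> V x) ^ 3 - 1 / pull a0 \<psi> V x" .
qed

lemma log_phase_algebra:
 fixes a0 z al be x w p q :: complex
 assumes a4: "a0 ^ 4 = 1" and az: "a0\<^sup>2 = z\<^sup>2" and z0: "z ~= 0" and y0: "y ~= 0" and w0: "w ~= 0"
  and eq: "q = 1 / w * p\<^sup>2 - 1 / (z * y) * p + 1 / (z * y) * (al * w\<^sup>2 + be) + w ^ 3 - 1 / w"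
 shows "(z * (q * z) * w - z * p * (p * z)) / (w * w) + z * p / w / y = (w / a0) * (w / a0) - (a0 / w) * (a0 / w)
   + (al * a0 * z * (w / a0) + be * z / a0 * (a0 / w)) / y"
proof -
 have a0: "a0 ~= 0" using a4 by auto
 define j i b where "j = 1 / w" and "i = 1 / (z * y)" and "b = 1 / a0"
 have inv: "w * j = 1" "a0 * b = 1" using a0 w0 by (auto simp: j_def b_def)
 have a4': "a0 * a0 * (a0 * a0) = 1" using a4 by (simp add: power4_eq_xxxx mult.assoc)
 have zz: "z * z = a0 * a0" using az by (simp add: power2_eq_square)
 have "b * b = (b * b) * (a0 * a0 * (a0 * a0))" by (simp add: a4')
 also have "... = (a0 * b) * (a0 * b) * (a0 * a0)" by simp
 finally have bb: "b * b = z * z" by (simp add: inv zz)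
 have d: "c / w = c * j" "c / (w * w) = c * j * j" "c / a0 = c * b" "c / y = c * (z * i)" "c / (z * y) = c * i" for c
  using z0 by (simp_all add: j_def i_def b_def)
 have "(z * (q * z) * w - z * p * (p * z)) * j * j + z * p * j * (z * i) = z * z * (q * j * (w * j) - p * p * j * j + p * i * j)"
  by (simp add: algebra_simps)
 also have "q * j * (w * j) = q * j" by (simp add: inv)
 also have "q * j = p * p * j * j - i * p * j + i * (al * w * (w * j) + be * j) + w * w * (w * j) - j * j"
  unfolding eq d by (simp add: algebra_simps power2_eq_square power3_eq_cube)
 also have "z * z * (p * p * j * j - i * p * j + i * (al * w * (w * j) + be * j) + w * w * (w * j) - j * j - p * p * j * j + p * i * j)
   = (z * z) * w * w - (z * z) * j * j + (al * z * w + be * z * j) * (z * i)"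
  unfolding inv by (simp add: algebra_simps)
 also have "... = (b * b) * w * w - (a0 * a0) * j * j + (al * (a0 * b) * z * w + be * z * (a0 * b) * j) * (z * i)"
  unfolding inv bb zz by simp
 finally show ?thesis unfolding d by (simp add: mult_ac)
qed

text \<open>
  The converse transformation, for a given solution \<open>v\<close> whose values are near \<open>a0\<close>.
\<close>

lemma log_phase_solves:
 assumes a4: "a0 ^ 4 = 1" and az: "a0\<^sup>2 = z\<^sup>2" and z0: "z ~= 0"
  and S: "open S" "0 \<notin> S" and v: "!!s. s \<in> S ==> v analytic_on {z * s}"
  and cut: "!!s. s \<in> S ==> v (z * s) / a0 \<notin> \<real>\<^sub>\<le>\<^sub>0" and y: "y \<in> S" and eq: "P3_at al be v (z * y)"
 shows "sinh_P3 (al * a0 * z) (be * z / a0) (%s. Ln (v (z * s) / a0)) y"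
proof -
 have a0: "a0 ~= 0" using a4 by auto
 have nz: "v (z * s) ~= 0" if "s \<in> S" for s using cut[OF that] by auto
 have d1: "(v has_field_derivative deriv v (z * s)) (at (z * s))" if "s \<in> S" for s
  using v[OF that] by (simp add: DERIV_deriv_iff_field_differentiable analytic_on_imp_differentiable_at)
 have d2: "(deriv v has_field_derivative deriv (deriv v) (z * s)) (at (z * s))" if "s \<in> S" for s
  using analytic_deriv[OF v[OF that]] by (simp add: DERIV_deriv_iff_field_differentiable analytic_on_imp_differentiable_at)
 have m: "((*) z has_field_derivative z) (at s)" for s by (rule DERIV_cmult_Id)
 have h: "((%s. Ln (v (z * s) / a0)) has_field_derivative z * deriv v (z * s) / v (z * s)) (at s)" if s: "s \<in> S" for s
 proof (rule DERIV_cong)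
  show "((%s. Ln (v (z * s) / a0)) has_field_derivative inverse (v (z * s) / a0) * (deriv v (z * s) * z / a0)) (at s)"
   by (rule DERIV_chain2[OF has_field_derivative_Ln[OF cut[OF s]] DERIV_cdivide[OF DERIV_chain2[OF d1[OF s] m]]])
  show "inverse (v (z * s) / a0) * (deriv v (z * s) * z / a0) = z * deriv v (z * s) / v (z * s)"
   using a0 nz[OF s] by simp
 qed
 have dd: "((%s. z * deriv v (z * s) / v (z * s)) has_field_derivative
   (z * (deriv (deriv v) (z * y) * z) * v (z * y) - z * deriv v (z * y) * (deriv v (z * y) * z)) / (v (z * y) * v (z * y))) (at y)"
  by (rule DERIV_divide[OF DERIV_cmult[OF DERIV_chain2[OF d2[OF y] m]] DERIV_chain2[OF d1[OF y] m] nz[OF y]])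
 have y0: "y ~= 0" using S y by auto
 have E: "exp (Ln (v (z * y) / a0)) = v (z * y) / a0" "exp (- Ln (v (z * y) / a0)) = a0 / v (z * y)"
  using nz[OF y] a0 by (simp_all add: exp_minus)
 have E2: "exp (2 * L) = exp L * exp L" "exp (- (2 * L)) = exp (- L) * exp (- L)" for L :: complex
 proof -
  show "exp (2 * L) = exp L * exp L" unfolding mult_2 exp_add ..
  have "- (2 * L) = - L + - L" by simp
  then show "exp (- (2 * L)) = exp (- L) * exp (- L)" by (simp only: exp_add)
 qed
 have D: "deriv (deriv (%s. Ln (v (z * s) / a0))) y =
   (z * (deriv (deriv v) (z * y) * z) * v (z * y) - z * deriv v (z * y) * (deriv v (z * y) * z)) / (v (z * y) * v (z * y))"
  "deriv (%s. Ln (v (z * s) / a0)) y = z * deriv v (z * y) / v (z * y)"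
  by (rule second_derivative_eqI(1)[OF S(1) y h dd], assumption, rule second_derivative_eqI(2)[OF S(1) y h dd], assumption)
 show ?thesis
  unfolding sinh_P3_def D E2 E
  by (rule log_phase_algebra[OF a4 az z0 y0 nz[OF y] eq[unfolded P3_at_def]])
qed

section \<open>Expansion, uniqueness and the one-parameter family\<close>

lemma norm_one_if_square_cis: "c\<^sup>2 = (cis \<psi>)\<^sup>2 ==> norm c = 1"
proof -
 assume "c\<^sup>2 = (cis \<psi>)\<^sup>2"
 then have "(norm c)\<^sup>2 = 1\<^sup>2" by (simp flip: norm_power) (simp add: norm_power)
 then show ?thesis by (rule power2_eq_imp_eq) auto
qed

lemma pull_expansion:
 fixes al be :: complex and a A :: "nat => complex"
 assumes a4: "a 0 ^ 4 = 1"
  and A0: "A 0 = - (a 0)\<^sup>2"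
  and a_rec: "!!n. 2 * a 0 * A 0 * a (n + 1) =
    (be - 1 - of_nat n) * a n
    - A 0 * (\<Sum>l=1..n. a l * a (n + 1 - l))
    - (\<Sum>j=1..n+1. A j * (\<Sum>l=0..n+1-j. a l * a (n + 1 - j - l)))"
  and A_rec: "!!n. 2 * a 0 * A 0 * A (n + 1) =
    al * (if n = 0 then 1 else 0) + (of_nat n + be - 2) * A n
    - a 0 * (\<Sum>l=1..n. A l * A (n + 1 - l))
    - (\<Sum>j=1..n. a j * (\<Sum>l=0..n+1-j. A l * A (n + 1 - j - l)))"
  and az: "(a 0)\<^sup>2 = (cis \<psi>)\<^sup>2"
  and V: "log_solution (al * a 0 * cis \<psi>) (be * cis \<psi> / a 0) UNIV V"
  and br: "!!\<phi>1 \<phi>2. \<theta>1 < \<phi>1 ==> \<phi>1 < \<phi>2 ==> \<phi>2 < \<theta>2 ==> \<exists>G K \<phi>. G <= cut_plane & 0 <= K & small_branch G K V \<phi> &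
    (\<forall>\<^sub>F x in at_infinity_in_sector \<phi>1 \<phi>2. x / cis \<psi> \<in> G)"
 shows "has_asymp_expansion_in_sector (pull (a 0) \<psi> V) a \<theta>1 \<theta>2"
proof -
 have n1: "norm (a 0) = 1" by (rule norm_one_if_square_cis[OF az])
 have ev: "\<exists>K. \<forall>\<^sub>F x in at_infinity_in_sector \<phi>1 \<phi>2. pull (a 0) \<psi> V analytic_on {x} & P3_at al be (pull (a 0) \<psi> V) x &
   norm (pull (a 0) \<psi> V x - a 0) <= K * norm (1 / x ^ 1)"
  if p: "\<theta>1 < \<phi>1" "\<phi>1 < \<phi>2" "\<phi>2 < \<theta>2" for \<phi>1 \<phi>2
 proof -
  obtain G K \<phi> where G: "G <= cut_plane" "0 <= K" "small_branch G K V \<phi>" "\<forall>\<^sub>F x in at_infinity_in_sector \<phi>1 \<phi>2. x / cis \<psi> \<in> G"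
   using br[OF p] by blast
  have "\<forall>\<^sub>F x in at_infinity_in_sector \<phi>1 \<phi>2. pull (a 0) \<psi> V analytic_on {x} & P3_at al be (pull (a 0) \<psi> V) x &
   norm (pull (a 0) \<psi> V x - a 0) <= 3 * K * norm (1 / x ^ 1)"
   using G(4) eventually_in_sector_far[of \<phi>1 \<phi>2 "K + 1"]
  proof eventually_elim
   case (elim x)
   let ?y = "x / cis \<psi>"
   have y: "?y \<in> cut_plane" using elim G(1) by blast
   have b: "norm (\<phi> ?y) <= K / norm ?y" "V (up_log ?y) = exp (\<phi> ?y)" using G(3) elim unfolding small_branch_def by auto
   have nz: "V (up_log ?y) ~= 0" by (simp add: b(2))
   have nx: "norm ?y = norm x" by (simp add: norm_divide)
   have "K / norm x <= 1" using elim G(2) by (simp add: divide_le_eq)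
   moreover have "norm (\<phi> ?y) <= K / norm x" using b(1) unfolding nx .
   ultimately have "norm (\<phi> ?y) <= 1" by linarith
   then have "norm (exp (\<phi> ?y) - 1) <= 3 * norm (\<phi> ?y)" by (rule norm_exp_minus_one_le)
   also have "... <= 3 * (K / norm x)" using b(1) unfolding nx by simp
   finally have e: "norm (exp (\<phi> ?y) - 1) <= 3 * (K / norm x)" .
   have "pull (a 0) \<psi> V x - a 0 = a 0 * (exp (\<phi> ?y) - 1)" by (simp add: pull_def b(2) right_diff_distrib)
   then have "norm (pull (a 0) \<psi> V x - a 0) <= 3 * K * norm (1 / x ^ 1)" using e n1 by (simp add: norm_mult norm_divide)
   then show ?case using pull_solves[OF V a4 az y nz] by blast
  qed
  then show ?thesis by blast
 qed
 show ?thesis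
 proof (rule expansion_from_leading_term[OF a4 A0 a_rec A_rec])
  show "far_analytic \<theta>1 \<theta>2 (pull (a 0) \<psi> V)"
   unfolding far_analytic_def
  proof (intro allI impI)
   fix \<phi>1 \<phi>2 assume "\<theta>1 < \<phi>1 & \<phi>1 < \<phi>2 & \<phi>2 < \<theta>2"
   then obtain K where "\<forall>\<^sub>F x in at_infinity_in_sector \<phi>1 \<phi>2. pull (a 0) \<psi> V analytic_on {x} & P3_at al be (pull (a 0) \<psi> V) x &
     norm (pull (a 0) \<psi> V x - a 0) <= K * norm (1 / x ^ 1)" using ev by blast
   then show "\<forall>\<^sub>F x in at_infinity_in_sector \<phi>1 \<phi>2. pull (a 0) \<psi> V analytic_on {x}" by (rule eventually_mono) blast
  qed
  show "\<forall>\<^sub>F x in at_infinity_in_sector \<phi>1 \<phi>2. P3_at al be (pull (a 0) \<psi> V) x" if p: "\<theta>1 < \<phi>1" "\<phi>1 < \<phi>2" "\<phi>2 < \<theta>2" for \<phi>1 \<phi>2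
  proof -
   obtain K where "\<forall>\<^sub>F x in at_infinity_in_sector \<phi>1 \<phi>2. pull (a 0) \<psi> V analytic_on {x} & P3_at al be (pull (a 0) \<psi> V) x &
     norm (pull (a 0) \<psi> V x - a 0) <= K * norm (1 / x ^ 1)" using ev[OF p] by blast
   then show ?thesis by (rule eventually_mono) blast
  qed
  show "decays \<theta>1 \<theta>2 1 (%x. pull (a 0) \<psi> V x - a 0)"
   unfolding decays_def
  proof (intro allI impI)
   fix \<phi>1 \<phi>2 assume "\<theta>1 < \<phi>1 & \<phi>1 < \<phi>2 & \<phi>2 < \<theta>2"
   then obtain K where "\<forall>\<^sub>F x in at_infinity_in_sector \<phi>1 \<phi>2. pull (a 0) \<psi> V analytic_on {x} & P3_at al be (pull (a 0) \<psi> V) x &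
     norm (pull (a 0) \<psi> V x - a 0) <= K * norm (1 / x ^ 1)" using ev by blast
   then have "\<forall>\<^sub>F x in at_infinity_in_sector \<phi>1 \<phi>2. norm (pull (a 0) \<psi> V x - a 0) <= K * norm (1 / x ^ 1)" by (rule eventually_mono) blast
   then show "(%x. pull (a 0) \<psi> V x - a 0) \<in> O[at_infinity_in_sector \<phi>1 \<phi>2](%x. 1 / x ^ 1)" by (rule bigoI)
  qed
 qed
qed

text \<open>
  The terms of the expansion up to order 1 bound \<open>ln (v / a 0)\<close> by a multiple of \<open>1 / \<bar>x\<bar>\<close> far out in the
  sector, so it is the small solution there.
\<close>

lemma pull_unique:
 assumes R: "0 < R" and a4: "a 0 ^ 4 = 1" and az: "(a 0)\<^sup>2 = (cis \<psi>)\<^sup>2"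
  and V: "upper_solution (al * a 0 * cis \<psi>) (be * cis \<psi> / a 0) V"
  and v: "painleve3_solution_on al be (sector R (\<psi> - pi / 2) (\<psi> + 3 * pi / 2)) v"
  and ex: "has_asymp_expansion_in_sector v a (\<psi> - pi / 2) (\<psi> + 3 * pi / 2)"
  and x: "x \<in> sector R (\<psi> - pi / 2) (\<psi> + 3 * pi / 2)"
 shows "v x = pull (a 0) \<psi> V x"
proof -
 define \<Omega> where "\<Omega> = sector R (\<psi> - pi / 2) (\<psi> + 3 * pi / 2)"
 define z where "z = cis \<psi>"
 have z0: "z ~= 0" "norm z = 1" by (auto simp: z_def)
 have n1: "norm (a 0) = 1" by (rule norm_one_if_square_cis[OF az])
 then have a0: "a 0 ~= 0" by auto
 have R0: "0 <= R" using R by simp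
 have \<Omega>: "open \<Omega>" "connected \<Omega>" unfolding \<Omega>_def using rotated_sector_open[OF R0] sector_connected[OF R] by auto
 have \<Omega>_iff: "w \<in> \<Omega> \<longleftrightarrow> w / z \<in> cut_plane & R < norm w" for w
  unfolding \<Omega>_def rotated_sector[OF R0] z_def by blast
 have vn: "v nicely_meromorphic_on \<Omega>" and veq: "!!w. w \<in> \<Omega> ==> ~ is_pole v w ==> v w ~= 0 ==> P3_at al be v w"
  using v unfolding painleve3_solution_on_def \<Omega>_def P3_at_def by blast+
 have Vsol: "log_solution (al * a 0 * z) (be * z / a 0) UNIV V" using V unfolding upper_solution_def z_def by blast
 (* the smallest sector that contains the rotated region up_region 1 *)
 define \<phi>1 \<phi>2 where "\<phi>1 = \<psi> - pi / 4" and "\<phi>2 = \<psi> + 5 * pi / 4"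
 have "\<psi> - pi / 2 < \<phi>1 & \<phi>1 < \<phi>2 & \<phi>2 < \<psi> + 3 * pi / 2" using pi_gt_zero by (auto simp: \<phi>1_def \<phi>2_def)
 then have "(%x. v x - (\<Sum>n\<le>1. a n / x ^ n)) \<in> o[at_infinity_in_sector \<phi>1 \<phi>2](%x. 1 / x ^ 1)"
  using ex unfolding has_asymp_expansion_in_sector_def by blast
 from landau_o.smallD[OF this zero_less_one] obtain R1
  where R1: "!!x. x \<in> sector 0 \<phi>1 \<phi>2 ==> R1 <= norm x ==> norm (v x - (\<Sum>n\<le>1. a n / x ^ n)) <= 1 * norm (1 / x ^ 1)"
  unfolding eventually_at_infinity_in_sector by blast
 define K1 where "K1 = 1 + norm (a 1)"
 have K1: "0 < K1" by (simp add: K1_def add_pos_nonneg)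
 have near: "norm (v x - a 0) <= K1 / norm x" if "x \<in> sector 0 \<phi>1 \<phi>2" "R1 <= norm x" for x
 proof -
  have "v x - a 0 = (v x - (\<Sum>n\<le>1. a n / x ^ n)) + a 1 / x" by simp
  then have "norm (v x - a 0) <= norm (v x - (\<Sum>n\<le>1. a n / x ^ n)) + norm (a 1 / x)" by (simp only: norm_triangle_ineq)
  also have "... <= 1 * norm (1 / x ^ 1) + norm (a 1 / x)" using R1[OF that] by (rule add_right_mono)
  also have "... = K1 / norm x" by (simp add: K1_def norm_divide add_divide_distrib)
  finally show ?thesis .
 qed
 obtain \<rho>2 K2 \<theta> where 2: "1 + 1 <= \<rho>2" "0 <= K2" "small_branch (up_region 1 \<rho>2) K2 V \<theta>"
   "!!x. x \<in> up_region 1 \<rho>2 ==> sinh_P3 (al * a 0 * z) (be * z / a 0) \<theta> x"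
  using V order_refl[of "1::real"] unfolding upper_solution_def z_def by blast
 have Km: "0 <= max (2 * K1) K2" using K1 by simp
 obtain \<rho>u where u: "!!\<rho> \<phi> \<xi> x. \<rho>u <= \<rho> ==>
    \<phi> holomorphic_on up_region 1 \<rho> ==> \<xi> holomorphic_on up_region 1 \<rho> ==>
    (!!x. x \<in> up_region 1 \<rho> ==> sinh_P3 (al * a 0 * z) (be * z / a 0) \<phi> x) ==>
    (!!x. x \<in> up_region 1 \<rho> ==> sinh_P3 (al * a 0 * z) (be * z / a 0) \<xi> x) ==>
    (!!x. x \<in> up_region 1 \<rho> ==> norm (\<phi> x) <= max (2 * K1) K2 / norm x) ==>
    (!!x. x \<in> up_region 1 \<rho> ==> norm (\<xi> x) <= max (2 * K1) K2 / norm x) ==>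
    x \<in> up_region 1 (\<rho> + 1 + 1) ==> \<phi> x = \<xi> x"
  by (rule small_solution_unique[OF zero_less_one Km, of "al * a 0 * z" "be * z / a 0"]) blast
 define M where "M = max (max R R1) (4 * K1) + 1"
 define \<rho> where "\<rho> = max (max \<rho>u \<rho>2) (2 * M)"
 have \<rho>: "\<rho>u <= \<rho>" "\<rho>2 <= \<rho>" "(1 + 1) * M <= \<rho>" "0 < \<rho>" using 2(1) by (auto simp: \<rho>_def)
 let ?G = "up_region 1 \<rho>"
 have sub: "?G <= up_region 1 \<rho>2" by (rule up_region_mono) (use \<rho> in auto)
 have G0: "0 \<notin> ?G" by (rule up_region_not_zero[OF \<rho>(4)])
 have far: "M <= norm y" if "y \<in> ?G" for y by (rule up_region_far[OF zero_less_one \<rho>(3) that])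
 have nzy: "norm (z * y) = norm y" for y by (simp add: norm_mult z0)
 have zyz: "z * y / z = y" for y using z0 by simp
 have Gsec: "z * y \<in> sector 0 \<phi>1 \<phi>2" if "y \<in> ?G" for y
 proof -
  have y: "y \<in> sector 0 (- pi / 4) (5 * pi / 4)" by (rule up_region_in_sector[OF _ that]) (use \<rho>(4) in simp)
  have e: "\<phi>1 - \<psi> = - pi / 4" "\<phi>2 - \<psi> = 5 * pi / 4" by (auto simp: \<phi>1_def \<phi>2_def)
  have "z * y / cis \<psi> \<in> sector 0 (\<phi>1 - \<psi>) (\<phi>2 - \<psi>)"
   unfolding e z_def[symmetric] zyz by (rule y)
  then show ?thesis by (subst sector_rotate[of _ _ _ _ \<psi>])
 qed
 have G\<Omega>: "z * y \<in> \<Omega>" if "y \<in> ?G" for y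
 proof -
  have "y \<in> cut_plane" using up_region_cut_plane[of \<rho> 1] \<rho>(4) that by auto
  moreover have "R < norm y" using far[OF that] by (auto simp: M_def)
  ultimately show ?thesis unfolding \<Omega>_iff zyz nzy by blast
 qed
 have q: "norm (v (z * y) / a 0 - 1) <= K1 / norm y" "norm (v (z * y) / a 0 - 1) < 1 / 2" if y: "y \<in> ?G" for y
 proof -
  have "R1 <= norm (z * y)" using far[OF y] unfolding nzy by (auto simp: M_def)
  from near[OF Gsec[OF y] this] have 1: "norm (v (z * y) - a 0) <= K1 / norm y" unfolding nzy .
  have "v (z * y) / a 0 - 1 = (v (z * y) - a 0) / a 0" using a0 by (simp add: diff_divide_distrib)
  then show 2: "norm (v (z * y) / a 0 - 1) <= K1 / norm y" using 1 by (simp add: norm_divide n1)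
  have "4 * K1 < norm y" using far[OF y] by (auto simp: M_def)
  then have "K1 / norm y < 1 / 2" using K1 by (simp add: divide_less_eq)
  then show "norm (v (z * y) / a 0 - 1) < 1 / 2" using 2 by linarith
 qed
 have cut: "v (z * y) / a 0 \<notin> \<real>\<^sub>\<le>\<^sub>0" if y: "y \<in> ?G" for y
 proof -
  have "\<bar>Re (v (z * y) / a 0 - 1)\<bar> < 1 / 2" by (rule le_less_trans[OF abs_Re_le_cmod q(2)[OF y]])
  then have "- Re (v (z * y) / a 0 - 1) < 1 / 2" unfolding abs_less_iff by blast
  then have "0 < Re (v (z * y) / a 0)" by simp
  then show ?thesis by (simp add: complex_nonpos_Reals_iff)
 qed
 have nz: "v (z * y) ~= 0" if "y \<in> ?G" for y using cut[OF that] by auto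
 have van: "v analytic_on {z * y}" if y: "y \<in> ?G" for y
 proof -
  obtain r where "0 < r" "v holomorphic_on ball (z * y) r"
   by (rule nicely_meromorphic_nonzero_ball[OF vn \<Omega>(1) G\<Omega>[OF y] nz[OF y]]) blast
  then show ?thesis unfolding analytic_at by (intro exI[of _ "ball (z * y) r"]) auto
 qed
 have P3: "P3_at al be v (z * y)" if y: "y \<in> ?G" for y
  by (rule veq[OF G\<Omega>[OF y] analytic_at_imp_no_pole[OF van[OF y]] nz[OF y]])
 define \<phi> where "\<phi> = (%s. Ln (v (z * s) / a 0))"
 have hol: "\<phi> holomorphic_on ?G"
  unfolding holomorphic_on_open[OF up_region_open] \<phi>_def
 proof (intro ballI exI)
  fix s assume s: "s \<in> ?G"
  have dv: "(v has_field_derivative deriv v (z * s)) (at (z * s))"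
   using van[OF s] by (simp add: DERIV_deriv_iff_field_differentiable analytic_on_imp_differentiable_at)
  show "((%s. Ln (v (z * s) / a 0)) has_field_derivative inverse (v (z * s) / a 0) * (deriv v (z * s) * z / a 0)) (at s)"
   by (rule DERIV_chain2[OF has_field_derivative_Ln[OF cut[OF s]] DERIV_cdivide[OF DERIV_chain2[OF dv DERIV_cmult_Id]]])
 qed
 have sinh: "sinh_P3 (al * a 0 * z) (be * z / a 0) \<phi> y" if y: "y \<in> ?G" for y
  unfolding \<phi>_def by (rule log_phase_solves[OF a4 az[folded z_def] z0(1) up_region_open G0 van cut y P3[OF y]])
 have bound: "norm (\<phi> y) <= max (2 * K1) K2 / norm y" if y: "y \<in> ?G" for y
 proof -
  have "norm (\<phi> y) <= 2 * norm (v (z * y) / a 0 - 1)" using norm_Ln_le[OF q(2)[OF y]] by (simp add: \<phi>_def)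
  also have "... <= 2 * (K1 / norm y)" using q(1)[OF y] by simp
  also have "... = 2 * K1 / norm y" by simp
  also have "... <= max (2 * K1) K2 / norm y" by (intro divide_right_mono) auto
  finally show ?thesis .
 qed
 have agree: "\<phi> y = \<theta> y" if y: "y \<in> up_region 1 (\<rho> + 1 + 1)" for y
 proof (rule u[OF \<rho>(1) hol _ sinh _ bound _ y])
  show "\<theta> holomorphic_on ?G" using 2(3) sub unfolding small_branch_def by (auto intro: holomorphic_on_subset)
  show "sinh_P3 (al * a 0 * z) (be * z / a 0) \<theta> w" if "w \<in> ?G" for w using 2(4) sub that by blast
  show "norm (\<theta> w) <= max (2 * K1) K2 / norm w" if w: "w \<in> ?G" for w
  proof -
   have "norm (\<theta> w) <= K2 / norm w" using 2(3) sub w unfolding small_branch_def by blast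
   also have "... <= max (2 * K1) K2 / norm w" by (intro divide_right_mono) auto
   finally show ?thesis .
  qed
 qed
 have eq: "v (z * y) = pull (a 0) \<psi> V (z * y)" if y: "y \<in> up_region 1 (\<rho> + 1 + 1)" for y
 proof -
  have yG: "y \<in> ?G" using y up_region_mono[of 1 1 \<rho> "\<rho> + 1 + 1"] by auto
  have "v (z * y) / a 0 = exp (\<phi> y)" using nz[OF yG] a0 by (simp add: \<phi>_def)
  also have "... = V (up_log y)" using agree[OF y] 2(3) sub yG unfolding small_branch_def by auto
  finally show ?thesis using a0 zyz[of y] by (simp add: pull_def field_simps flip: z_def)
 qed
 let ?b = "z * (\<i> * of_real (\<rho> + 3))"
 have b1: "\<i> * of_real (\<rho> + 3) \<in> up_region 1 (\<rho> + 1 + 1)" by (simp add: up_region_def)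
 then have "\<i> * of_real (\<rho> + 3) \<in> ?G" using up_region_mono[of 1 1 \<rho> "\<rho> + 1 + 1"] by auto
 then have b: "?b \<in> \<Omega>" by (rule G\<Omega>)
 have "open ((%w. w / z) -` up_region 1 (\<rho> + 1 + 1))"
  by (rule open_vimage[OF up_region_open]) (use z0 in \<open>intro continuous_intros, simp\<close>)
 moreover have "?b \<in> (%w. w / z) -` up_region 1 (\<rho> + 1 + 1)" using b1 zyz by (simp only: vimage_eq)
 ultimately have "\<forall>\<^sub>F w in nhds ?b. w \<in> (%w. w / z) -` up_region 1 (\<rho> + 1 + 1)" by (rule eventually_nhds_in_open)
 then have ev: "\<forall>\<^sub>F w in nhds ?b. v w = pull (a 0) \<psi> V w"
 proof eventually_elim
  case (elim w)
  then show ?case using eq[of "w / z"] z0 by simp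
 qed
 have pn: "pull (a 0) \<psi> V nicely_meromorphic_on \<Omega>"
  by (rule nicely_meromorphic_on_subset[OF pull_nicely_meromorphic[OF Vsol]]) (auto simp: \<Omega>_iff z_def)
 show ?thesis by (rule nicely_meromorphic_identity[OF vn pn \<Omega> b ev]) (use x in \<open>simp add: \<Omega>_def\<close>)
qed

lemma exp_branch_close:
 assumes V: "upper_solution al be V" and k: "1 <= k" and W: "exp_branch al be V c W"
 obtains \<rho> C where "0 <= C" "!!x. x \<in> right_cone k \<rho> ==> norm (W (up_log x) - V (up_log x)) <= C * exp (- norm x / (1 + k))"
proof -
 obtain \<rho> K M \<delta> where f: "0 <= M"
  "!!c' x. c' \<in> ball c 1 ==> x \<in> right_cone k \<rho> ==> norm (base_phase V x) + norm (\<delta> c' x) <= K / norm x & K / norm x <= 1"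
  "!!c' x. c' \<in> ball c 1 ==> x \<in> right_cone k \<rho> ==> norm (\<delta> c' x) <= M * exp (- norm x / (1 + k))"
  "!!x. x \<in> right_cone k \<rho> ==> V (up_log x) = exp (base_phase V x)"
  "!!c' W x. c' \<in> ball c 1 ==> exp_branch al be V c' W ==> x \<in> right_cone k \<rho> ==> W (up_log x) = exp (base_phase V x + \<delta> c' x)"
  by (rule exp_branch_local_family[OF V k, of c]) blast
 have cc: "c \<in> ball c 1" by simp
 have "norm (W (up_log x) - V (up_log x)) <= 12 * M * exp (- norm x / (1 + k))" if x: "x \<in> right_cone k \<rho>" for x
 proof -
  have s: "norm (base_phase V x) + norm (\<delta> c x) <= 1" using f(2)[OF cc x] by linarith
  then have b1: "norm (base_phase V x) <= 1" "norm (\<delta> c x) <= 1"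
   using norm_ge_zero[of "base_phase V x"] norm_ge_zero[of "\<delta> c x"] by linarith+
  have "norm (exp (base_phase V x)) <= norm (exp (base_phase V x) - 1) + norm (1 :: complex)"
   using norm_triangle_ineq[of "exp (base_phase V x) - 1" 1] by simp
  then have e4: "norm (exp (base_phase V x)) <= 4" using norm_exp_minus_one_le[OF b1(1)] b1(1) by simp
  have e3: "norm (exp (\<delta> c x) - 1) <= 3 * (M * exp (- norm x / (1 + k)))"
   using norm_exp_minus_one_le[OF b1(2)] f(3)[OF cc x] by linarith
  have "W (up_log x) - V (up_log x) = exp (base_phase V x) * (exp (\<delta> c x) - 1)"
   unfolding f(5)[OF cc W x] f(4)[OF x] exp_add by (simp add: right_diff_distrib)
  then have "norm (W (up_log x) - V (up_log x)) = norm (exp (base_phase V x)) * norm (exp (\<delta> c x) - 1)" by (simp only: norm_mult)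
  also have "... <= 4 * (3 * (M * exp (- norm x / (1 + k))))" by (rule mult_mono[OF e4 e3]) auto
  also have "... = 12 * M * exp (- norm x / (1 + k))" by simp
  finally show ?thesis .
 qed
 then show thesis using that[of "12 * M" \<rho>] f(1) by simp
qed

lemma exp_branch_small:
 assumes V: "upper_solution al be V" and k: "1 <= k" and W: "exp_branch al be V c W"
 obtains \<rho> K \<phi> where "0 <= \<rho>" "0 <= K" "small_branch (right_cone k \<rho>) K W \<phi>"
proof -
 obtain \<rho> K M \<delta> where f: "k <= \<rho>" "0 <= K"
  "!!c'. c' \<in> ball c 1 ==> \<delta> c' holomorphic_on right_cone k \<rho>" "base_phase V holomorphic_on right_cone k \<rho>"
  "!!c' x. c' \<in> ball c 1 ==> x \<in> right_cone k \<rho> ==> norm (base_phase V x) + norm (\<delta> c' x) <= K / norm x & K / norm x <= 1"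
  "!!c' W x. c' \<in> ball c 1 ==> exp_branch al be V c' W ==> x \<in> right_cone k \<rho> ==> W (up_log x) = exp (base_phase V x + \<delta> c' x)"
  by (rule exp_branch_local_family[OF V k, of c]) blast
 have cc: "c \<in> ball c 1" by simp
 have "small_branch (right_cone k \<rho>) K W (%x. base_phase V x + \<delta> c x)"
  unfolding small_branch_def
 proof (intro conjI ballI)
  show "(%x. base_phase V x + \<delta> c x) holomorphic_on right_cone k \<rho>" by (rule holomorphic_on_add[OF f(4) f(3)[OF cc]])
  fix x assume x: "x \<in> right_cone k \<rho>"
  show "norm (base_phase V x + \<delta> c x) <= K / norm x"
   by (rule order_trans[OF norm_triangle_ineq]) (use f(5)[OF cc x] in blast)
  show "W (up_log x) = exp (base_phase V x + \<delta> c x)" by (rule f(6)[OF cc W x])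
 qed
 then show thesis using that f(1,2) k by (meson order_trans zero_le_one)
qed

lemma exp_branch_holomorphic_parameter:
 assumes V: "upper_solution al be V" and k: "1 <= k" and W: "!!c. exp_branch al be V c (W c)"
 obtains \<rho> where "!!x. x \<in> right_cone k \<rho> ==> (%c. W c (up_log x)) holomorphic_on ball c0 1"
proof -
 obtain \<rho> K M \<delta> where f: "!!x. x \<in> right_cone k \<rho> ==> (%c. \<delta> c x) holomorphic_on ball c0 1"
  "!!c W x. c \<in> ball c0 1 ==> exp_branch al be V c W ==> x \<in> right_cone k \<rho> ==> W (up_log x) = exp (base_phase V x + \<delta> c x)"
  by (rule exp_branch_local_family[OF V k, of c0]) blast
 show thesis
 proof (rule that)
  fix x assume x: "x \<in> right_cone k \<rho>"
  have "(%c. exp (base_phase V x + \<delta> c x)) holomorphic_on ball c0 1"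
   by (intro holomorphic_on_exp' holomorphic_on_add holomorphic_on_const f(1)[OF x])
  then show "(%c. W c (up_log x)) holomorphic_on ball c0 1"
   by (rule holomorphic_transform) (simp add: f(2)[OF _ W x])
 qed
qed

theorem theorem1:
  fixes \<alpha> \<beta> x\<^sub>0 :: complex and m k :: nat and a A :: "nat \<Rightarrow> complex"
  assumes m: "m \<in> {0, 1, 2, 3}" and k: "k \<in> {0, 1}" and x0: "x\<^sub>0 \<noteq> 0"
    and a0: "a 0 = exp (of_nat m * of_real pi * \<i> / 2)"
    and A0: "A 0 = - (a 0)\<^sup>2"
    and a_rec: "\<And>n. 2 * a 0 * A 0 * a (n + 1) =
        (\<beta> - 1 - of_nat n) * a n
        - A 0 * (\<Sum>l=1..n. a l * a (n + 1 - l))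
        - (\<Sum>j=1..n+1. A j * (\<Sum>l=0..n+1-j. a l * a (n + 1 - j - l)))"
    and A_rec: "\<And>n. 2 * a 0 * A 0 * A (n + 1) =
        \<alpha> * (if n = 0 then 1 else 0) + (of_nat n + \<beta> - 2) * A n
        - a 0 * (\<Sum>l=1..n. A l * A (n + 1 - l))
        - (\<Sum>j=1..n. a j * (\<Sum>l=0..n+1-j. A l * A (n + 1 - j - l)))"
  shows
    "(\<exists>U. one_parameter_family_in_sector U (norm x\<^sub>0) (sector_start m k) (S_end m k) \<and>
        (\<forall>c. painleve3_solution_on \<alpha> \<beta> (sector (norm x\<^sub>0) (sector_start m k) (S_end m k)) (U c) \<and>
             has_asymp_expansion_in_sector (U c) a (sector_start m k) (S_end m k)))
     \<and>
     (\<exists>u. painleve3_solution_on \<alpha> \<beta> (sector (norm x\<^sub>0) (sector_start m k) (Omega_end m k)) u \<and>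
          has_asymp_expansion_in_sector u a (sector_start m k) (Omega_end m k) \<and>
          (\<forall>v. painleve3_solution_on \<alpha> \<beta> (sector (norm x\<^sub>0) (sector_start m k) (Omega_end m k)) v \<and>
               has_asymp_expansion_in_sector v a (sector_start m k) (Omega_end m k) \<longrightarrow>
               (\<forall>x\<in>sector (norm x\<^sub>0) (sector_start m k) (Omega_end m k). v x = u x)))"
proof -
 (* the direction of the middle of the sector of opening pi *)
 define \<psi> where "\<psi> = sector_start m k + pi / 2"
 define R where "R = norm x\<^sub>0"
 have R: "0 < R" "0 <= R" using x0 by (auto simp: R_def)
 have start: "sector_start m k = \<psi> - pi / 2" by (simp add: \<psi>_def)
 have S_end: "S_end m k = \<psi> + pi / 2" by (simp add: \<psi>_def S_end_def sector_start_def algebra_simps)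
 have Omega_end: "Omega_end m k = \<psi> + 3 * pi / 2" by (simp add: \<psi>_def Omega_end_def sector_start_def algebra_simps)
 have sq: "(a 0)\<^sup>2 = (- 1) ^ m"
 proof -
  have "a 0 = cis (real m * pi / 2)" unfolding a0 cis_conv_exp by (simp add: mult_ac)
  then have "(a 0)\<^sup>2 = cis (real m * pi / 2 + real m * pi / 2)" by (simp only: power2_eq_square cis_mult)
  also have "... = cis (real m * pi)" by (simp only: field_sum_of_halves)
  also have "... = cis pi ^ m" by (rule Complex.DeMoivre[symmetric])
  finally show ?thesis by simp
 qed
 have a4: "a 0 ^ 4 = 1"
 proof -
  have "a 0 ^ 4 = ((a 0)\<^sup>2)\<^sup>2" by (simp flip: power_mult)
  also have "... = 1" unfolding sq by (simp flip: power_mult)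
  finally show ?thesis .
 qed
 have az: "(a 0)\<^sup>2 = (cis \<psi>)\<^sup>2"
 proof (cases "m \<in> {0, 2}")
  case True
  then have "\<psi> = real k * pi" by (simp add: \<psi>_def sector_start_def)
  then have "cis \<psi> = cis pi ^ k" by (simp only: Complex.DeMoivre)
  then have "(cis \<psi>)\<^sup>2 = 1" by (simp flip: power_mult)
  moreover have "(- 1 :: complex) ^ m = 1" using True by auto
  ultimately show ?thesis by (simp add: sq)
 next
  case False
  then have "\<psi> = real k * pi + pi / 2" by (simp add: \<psi>_def sector_start_def)
  then have "cis \<psi> = cis pi ^ k * \<i>" by (simp only: Complex.DeMoivre cis_mult[symmetric] cis_pi_half)
  then have "(cis \<psi>)\<^sup>2 = - 1" by (simp add: power_mult_distrib flip: power_mult)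
  moreover have "(- 1 :: complex) ^ m = - 1" using False m by auto
  ultimately show ?thesis by (simp add: sq)
 qed
 have a00: "a 0 ~= 0" using a4 by auto
 define z where "z = cis \<psi>"
 have zyz: "z * y / cis \<psi> = y" "norm (z * y) = norm y" "norm (y / cis \<psi>) = norm y" for y
  by (auto simp: z_def norm_mult norm_divide)
 define \<Omega> where "\<Omega> = sector R (\<psi> - pi / 2) (\<psi> + 3 * pi / 2)"
 define S where "S = sector R (\<psi> - pi / 2) (\<psi> + pi / 2)"
 have \<Omega>cut: "x / cis \<psi> \<in> cut_plane" if "x \<in> \<Omega>" for x using that unfolding \<Omega>_def rotated_sector[OF R(2)] by blast
 have "S <= \<Omega>" unfolding S_def \<Omega>_def by (rule sector_mono) auto
 then have Scut: "x / cis \<psi> \<in> cut_plane" if "x \<in> S" for x using \<Omega>cut that by blast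
 have inS: "z * y \<in> S" if "0 < Re y" "R < norm y" for y
 proof -
  have "\<psi> - pi / 2 - \<psi> = - pi / 2" "\<psi> + pi / 2 - \<psi> = pi / 2" by auto
  then show ?thesis unfolding S_def
   using sector_rotate[of "z * y" R "\<psi> - pi / 2" "\<psi> + pi / 2" \<psi>] right_half_sector[OF that] zyz(1)[of y] by simp
 qed
 obtain V where V: "upper_solution (\<alpha> * a 0 * cis \<psi>) (\<beta> * cis \<psi> / a 0) V" using upper_solution_exists by blast
 have Vsol: "log_solution (\<alpha> * a 0 * cis \<psi>) (\<beta> * cis \<psi> / a 0) UNIV V" using V unfolding upper_solution_def by blast
 have Vreg: "\<exists>\<rho> K \<phi>. 1 + k <= \<rho> & 0 <= K & small_branch (up_region k \<rho>) K V \<phi>" if "1 <= k" for k :: real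
  using V that unfolding upper_solution_def by blast
 have part2: "painleve3_solution_on \<alpha> \<beta> \<Omega> (pull (a 0) \<psi> V)"
  "has_asymp_expansion_in_sector (pull (a 0) \<psi> V) a (\<psi> - pi / 2) (\<psi> + 3 * pi / 2)"
 proof -
  obtain \<rho> K \<phi> where r: "1 + 1 <= \<rho>" "small_branch (up_region 1 \<rho>) K V \<phi>" using Vreg[of 1] by auto
  define y where "y = \<i> * complex_of_real (max \<rho> R + 1)"
  have "y \<in> up_region 1 \<rho>" by (auto simp: y_def up_region_def)
  then have nz: "V (up_log (z * y / cis \<psi>)) ~= 0" using r(2) unfolding small_branch_def zyz by auto
  have "R < norm y" using R by (simp add: y_def norm_mult)
  moreover have "y \<in> cut_plane" using r(1) by (simp add: y_def cut_plane_iff)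
  ultimately have y: "z * y \<in> \<Omega>" unfolding \<Omega>_def rotated_sector[OF R(2)] by (simp add: zyz)
  show "painleve3_solution_on \<alpha> \<beta> \<Omega> (pull (a 0) \<psi> V)" by (rule pull_solution_on[OF Vsol a4 az \<Omega>cut y nz])
  show "has_asymp_expansion_in_sector (pull (a 0) \<psi> V) a (\<psi> - pi / 2) (\<psi> + 3 * pi / 2)"
  proof (rule pull_expansion[OF a4 A0 a_rec A_rec az Vsol])
   fix \<phi>1 \<phi>2 assume p: "\<psi> - pi / 2 < \<phi>1" "\<phi>1 < \<phi>2" "\<phi>2 < \<psi> + 3 * pi / 2"
   obtain k where k: "1 <= k" "!!\<rho>. \<forall>\<^sub>F x in at_infinity_in_sector \<phi>1 \<phi>2. x / cis \<psi> \<in> up_region k \<rho>"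
    by (rule eventually_rotated_up_region[OF p]) blast
   obtain \<rho> K \<phi> where r: "1 + k <= \<rho>" "0 <= K" "small_branch (up_region k \<rho>) K V \<phi>" using Vreg[OF k(1)] by blast
   have "up_region k \<rho> <= cut_plane" by (rule up_region_cut_plane) (use k(1) r(1) in simp)
   then show "\<exists>G K \<phi>. G <= cut_plane & 0 <= K & small_branch G K V \<phi> & (\<forall>\<^sub>F x in at_infinity_in_sector \<phi>1 \<phi>2. x / cis \<psi> \<in> G)"
    using r k(2) by blast
  qed
 qed
 have part2u: "v x = pull (a 0) \<psi> V x" if "painleve3_solution_on \<alpha> \<beta> \<Omega> v" "has_asymp_expansion_in_sector v a (\<psi> - pi / 2) (\<psi> + 3 * pi / 2)" "x \<in> \<Omega>" for v x
  by (rule pull_unique[of R a \<psi> \<alpha> \<beta> V v x, OF R(1) a4 az V that[unfolded \<Omega>_def]])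
 (* one solution for every value of the parameter, chosen on the cone of slope 1 *)
 obtain W where W: "!!c. exp_branch (\<alpha> * a 0 * cis \<psi>) (\<beta> * cis \<psi> / a 0) V c (W c)"
  using exp_branch_exists[OF V] by metis
 have Wsol: "log_solution (\<alpha> * a 0 * cis \<psi>) (\<beta> * cis \<psi> / a 0) UNIV (W c)" for c using W unfolding exp_branch_def by blast
 define U where "U c = pull (a 0) \<psi> (W c)" for c
 have part1: "painleve3_solution_on \<alpha> \<beta> S (U c)" "has_asymp_expansion_in_sector (U c) a (\<psi> - pi / 2) (\<psi> + pi / 2)" for c
 proof -
  obtain \<rho> K \<phi> where r: "0 <= \<rho>" "small_branch (right_cone 1 \<rho>) K (W c) \<phi>" by (rule exp_branch_small[OF V order_refl W]) blast
  define y where "y = complex_of_real (max \<rho> R + 1)"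
  have "y \<in> right_cone 1 \<rho>" by (auto simp: y_def right_cone_def)
  then have nz: "W c (up_log (z * y / cis \<psi>)) ~= 0" using r(2) unfolding small_branch_def zyz by auto
  have y: "z * y \<in> S" by (rule inS) (use R r(1) in \<open>auto simp: y_def simp del: of_real_add\<close>)
  show "painleve3_solution_on \<alpha> \<beta> S (U c)" unfolding U_def by (rule pull_solution_on[OF Wsol a4 az Scut y nz])
  show "has_asymp_expansion_in_sector (U c) a (\<psi> - pi / 2) (\<psi> + pi / 2)"
   unfolding U_def
  proof (rule pull_expansion[OF a4 A0 a_rec A_rec az Wsol])
   fix \<phi>1 \<phi>2 assume p: "\<psi> - pi / 2 < \<phi>1" "\<phi>1 < \<phi>2" "\<phi>2 < \<psi> + pi / 2"
   obtain k where k: "1 <= k" "!!\<rho>. \<forall>\<^sub>F x in at_infinity_in_sector \<phi>1 \<phi>2. x / cis \<psi> \<in> right_cone k \<rho>"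
    by (rule eventually_rotated_right_cone[OF p]) blast
   obtain \<rho> K \<phi> where r: "0 <= \<rho>" "0 <= K" "small_branch (right_cone k \<rho>) K (W c) \<phi>" by (rule exp_branch_small[OF V k(1) W]) blast
   have "right_cone k \<rho> <= cut_plane" by (rule right_cone_cut_plane) (use k(1) r(1) in auto)
   then show "\<exists>G K \<phi>. G <= cut_plane & 0 <= K & small_branch G K (W c) \<phi> & (\<forall>\<^sub>F x in at_infinity_in_sector \<phi>1 \<phi>2. x / cis \<psi> \<in> G)"
    using r k(2) by blast
  qed
 qed
 have family: "one_parameter_family_in_sector U R (\<psi> - pi / 2) (\<psi> + pi / 2)"
  unfolding one_parameter_family_in_sector_def
 proof (intro conjI allI impI)
  fix c c' :: complex assume cc: "c ~= c'"
  show "\<exists>x\<in>sector R (\<psi> - pi / 2) (\<psi> + pi / 2). U c x ~= U c' x"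
  proof (rule ccontr)
   assume "~ ?thesis"
   then have same: "U c x = U c' x" if "x \<in> S" for x using that unfolding S_def by blast
   have "c = c'"
   proof (rule exp_branch_distinct[OF V W W])
    fix y assume y: "y \<in> right_cone 1 R"
    then have y2: "0 < Re y" "R < Re y" using R by (auto simp: right_cone_def)
    then have "R < norm y" using complex_Re_le_cmod[of y] by linarith
    from same[OF inS[OF y2(1) this]] show "W c (up_log y) = W c' (up_log y)"
     using a00 by (simp add: U_def pull_def zyz)
   qed
   then show False using cc by simp
  qed
 next
  fix \<phi>1 \<phi>2 c0 assume p: "\<psi> - pi / 2 < \<phi>1 & \<phi>1 < \<phi>2 & \<phi>2 < \<psi> + pi / 2"
  obtain k where k: "1 <= k" "!!\<rho>. \<forall>\<^sub>F x in at_infinity_in_sector \<phi>1 \<phi>2. x / cis \<psi> \<in> right_cone k \<rho>"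
   by (rule eventually_rotated_right_cone[of \<psi> \<phi>1 \<phi>2]) (use p in auto)
  obtain \<rho> where r: "!!x. x \<in> right_cone k \<rho> ==> (%c. W c (up_log x)) holomorphic_on ball c0 1"
   by (rule exp_branch_holomorphic_parameter[OF V k(1) W, of c0]) blast
  have "\<forall>\<^sub>F x in at_infinity_in_sector \<phi>1 \<phi>2. (%c. U c x) holomorphic_on ball c0 1"
   using k(2)[of \<rho>] by (rule eventually_mono) (auto simp: U_def pull_def intro!: holomorphic_on_mult r)
  then show "\<exists>\<delta>>0. \<forall>\<^sub>F x in at_infinity_in_sector \<phi>1 \<phi>2. (%c. U c x) holomorphic_on ball c0 \<delta>"
   by (intro exI[of _ 1]) simp
 next
  fix \<phi>1 \<phi>2 c c' assume p: "\<psi> - pi / 2 < \<phi>1 & \<phi>1 < \<phi>2 & \<phi>2 < \<psi> + pi / 2"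
  obtain k where k: "1 <= k" "!!\<rho>. \<forall>\<^sub>F x in at_infinity_in_sector \<phi>1 \<phi>2. x / cis \<psi> \<in> right_cone k \<rho>"
   by (rule eventually_rotated_right_cone[of \<psi> \<phi>1 \<phi>2]) (use p in auto)
  obtain \<rho> C where 1: "!!x. x \<in> right_cone k \<rho> ==> norm (W c (up_log x) - V (up_log x)) <= C * exp (- norm x / (1 + k))"
   by (rule exp_branch_close[OF V k(1) W]) blast
  obtain \<rho>' C' where 2: "!!x. x \<in> right_cone k \<rho>' ==> norm (W c' (up_log x) - V (up_log x)) <= C' * exp (- norm x / (1 + k))"
   by (rule exp_branch_close[OF V k(1) W]) blast
  define \<kappa> where "\<kappa> = 1 / (1 + k)"
  have \<kappa>: "0 < \<kappa>" "- t / (1 + k) = - \<kappa> * t" for t using k(1) by (auto simp: \<kappa>_def)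
  have n1: "norm (a 0) = 1" by (rule norm_one_if_square_cis[OF az])
  have "\<forall>\<^sub>F x in at_infinity_in_sector \<phi>1 \<phi>2. norm (U c x - U c' x) <= (C + C') * norm (of_real (exp (- \<kappa> * norm x)) :: complex)"
   using k(2)[of \<rho>] k(2)[of \<rho>']
  proof eventually_elim
   case (elim x)
   let ?y = "x / cis \<psi>"
   have "U c x - U c' x = a 0 * ((W c (up_log ?y) - V (up_log ?y)) - (W c' (up_log ?y) - V (up_log ?y)))"
    by (simp add: U_def pull_def right_diff_distrib)
   then have "norm (U c x - U c' x) = norm ((W c (up_log ?y) - V (up_log ?y)) - (W c' (up_log ?y) - V (up_log ?y)))"
    by (simp only: norm_mult n1 mult_1)
   also have "... <= norm (W c (up_log ?y) - V (up_log ?y)) + norm (W c' (up_log ?y) - V (up_log ?y))" by (rule norm_triangle_ineq4)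
   also have "... <= C * exp (- norm ?y / (1 + k)) + C' * exp (- norm ?y / (1 + k))" by (rule add_mono[OF 1 2]) (use elim in auto)
   finally show ?case unfolding zyz \<kappa>(2) by (simp add: distrib_right)
  qed
  then have "(%x. U c x - U c' x) \<in> O[at_infinity_in_sector \<phi>1 \<phi>2](%x. of_real (exp (- \<kappa> * norm x)))" by (rule bigoI)
  then show "\<exists>\<kappa>>0. (%x. U c x - U c' x) \<in> O[at_infinity_in_sector \<phi>1 \<phi>2](%x. of_real (exp (- \<kappa> * norm x)))"
   using \<kappa>(1) by blast
 qed
 show ?thesis
  unfolding start S_end Omega_end R_def[symmetric] using family part1 part2 part2u unfolding S_def \<Omega>_def by blast
qed

end
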